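(* Assume that $\|r\|_{L^\infty}$ and $\|\mathcal L_{\mu,\Sigma} r\|_{L^\infty}$ are finite. Let $V$ be the continuous-time value function and, for each $\Delta t>0$, let $\tilde V$ be the solution of the discrete-time Bellman equation $$\tilde V(s) = r(s)\Delta t + e^{-\beta\Delta t}\,\mathbb E[\tilde V(s_{\Delta t})\mid s_0=s].$$ Then, as $\Delta t\to 0$, $$\|V-\tilde V\|_{L^\infty} \le \frac{\tfrac12\left(\|\mathcal L_{\mu,\Sigma} r\|_{L^\infty}+\beta\|r\|_{L^\infty}\right)}{\beta}\,\Delta t + o(\Delta t).$$
   Context: Setting: $\beta>0$; $r:\mathbb R^d\to\mathbb R$ is a bounded reward function; $\mu:\mathbb R^d\to\mathbb R^d$ and $\sigma:\mathbb R^d\to\mathbb R^{d\times d}$ are Lipschitz continuous; $\Sigma=\sigma\sigma^\top$; the state $s_t\in\mathbb R^d$ is the strong solution of the SDE $ds_t=\mu(s_t)\,dt+\sigma(s_t)\,dB_t$ with $B$ a $d$-dimensional Brownian motion. The value function is $V(s)=\mathbb E\left[\int_0^\infty e^{-\beta t}r(s_t)\,dt\mid s_0=s\right]$. The operator is $\mathcal L_{\mu,\Sigma}f=\mu\cdot\nabla f+\frac12\Sigma:\nabla^2 f$, where $\Sigma:\nabla^2=\sum_{i,j}\Sigma_{ij}\partial_{s_i}\partial_{s_j}$. The solution of the Bellman equation is $\tilde V(s)=\mathbb E\left[\sum_{j=0}^\infty e^{-\beta\Delta t j}r(s_{j\Delta t})\Delta t\mid s_0=s\right]$. $\|f\|_{L^\infty}=\sup_s|f(s)|$.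 *)

theory Defs
  imports "HOL-Probability.Probability"
begin

subsection \<open>The operator and the sup norm\<close>

definition partial_deriv :: "'d::finite \<Rightarrow> (real^'d \<Rightarrow> real) \<Rightarrow> real^'d \<Rightarrow> real" where
  "partial_deriv i f x = frechet_derivative f (at x) (axis i 1)"

definition C1_fun :: "(real^'d::finite \<Rightarrow> real) \<Rightarrow> bool" where
  "C1_fun f \<longleftrightarrow> (\<forall>x. f differentiable (at x)) \<and> (\<forall>i. continuous_on UNIV (partial_deriv i f))"

definition C2_fun :: "(real^'d::finite \<Rightarrow> real) \<Rightarrow> bool" where
  "C2_fun f \<longleftrightarrow> C1_fun f \<and> (\<forall>i. C1_fun (partial_deriv i f))"

definition generator ::
  "(real^'d::finite \<Rightarrow> real^'d) \<Rightarrow> (real^'d \<Rightarrow> real^'d^'d) \<Rightarrow> (real^'d \<Rightarrow> real) \<Rightarrow> real^'d \<Rightarrow> real"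
where
  "generator \<mu> S f x =
     (\<Sum>i\<in>UNIV. \<mu> x $ i * partial_deriv i f x)
     + 1 / 2 * (\<Sum>i\<in>UNIV. \<Sum>j\<in>UNIV. S x $ i $ j * partial_deriv i (partial_deriv j f) x)"

text \<open>The supremum over all points (not an essential supremum); it is extended-real valued, so
  that finiteness is a genuine condition.\<close>

definition Linf_norm :: "('a \<Rightarrow> real) \<Rightarrow> ereal" where
  "Linf_norm f = (SUP x. ereal \<bar>f x\<bar>)"


subsection \<open>Brownian motion and the Ito integral\<close>

definition brownian_motion ::
  "'w measure \<Rightarrow> (real \<Rightarrow> 'w \<Rightarrow> real^'d::finite) \<Rightarrow> bool"
where
  "brownian_motion M B \<longleftrightarrow>
     prob_space M \<and>
     (\<forall>t\<ge>0. B t \<in> borel_measurable M) \<and>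
     (AE \<omega> in M. B 0 \<omega> = 0) \<and>
     (AE \<omega> in M. continuous_on {0..} (\<lambda>t. B t \<omega>)) \<and>
     (\<forall>s t. 0 \<le> s \<longrightarrow> s < t \<longrightarrow>
        distributed M lborel (\<lambda>\<omega>. B t \<omega> - B s \<omega>)
          (\<lambda>x. ennreal (\<Prod>i\<in>UNIV. normal_density 0 (sqrt (t - s)) (x $ i)))) \<and>
     (\<forall>(\<tau> :: nat \<Rightarrow> real) n. 0 \<le> \<tau> 0 \<longrightarrow> mono \<tau> \<longrightarrow>
        prob_space.indep_vars M (\<lambda>_. borel) (\<lambda>k \<omega>. B (\<tau> (Suc k)) \<omega> - B (\<tau> k) \<omega>) {..<n})"

text \<open>The filtration generated by \<open>B\<close>, augmented by the null sets of \<open>M\<close>.\<close>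

definition brownian_filtration ::
  "'w measure \<Rightarrow> (real \<Rightarrow> 'w \<Rightarrow> real^'d::finite) \<Rightarrow> real \<Rightarrow> 'w measure"
where
  "brownian_filtration M B t =
     sigma (space M)
       ({B u -` A \<inter> space M | u A. 0 \<le> u \<and> u \<le> t \<and> A \<in> sets borel} \<union> null_sets M)"

text \<open>A simple process on \<open>[0, T]\<close> is given by a partition \<open>\<tau> 0 \<le> \<dots> \<le> \<tau> n\<close> of \<open>[0, T]\<close> and bounded
  coefficients \<open>\<xi> k\<close>, measurable at time \<open>\<tau> k\<close>; its value on \<open>(\<tau> k, \<tau> (k + 1)]\<close> is \<open>\<xi> k\<close>.\<close>

definition simple_process_data ::
  "'w measure \<Rightarrow> (real \<Rightarrow> 'w measure) \<Rightarrow> real \<Rightarrow> nat \<Rightarrow> (nat \<Rightarrow> real) \<Rightarrow>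
    (nat \<Rightarrow> 'w \<Rightarrow> real^'d^'d::finite) \<Rightarrow> bool"
where
  "simple_process_data M F T n \<tau> \<xi> \<longleftrightarrow>
     \<tau> 0 = 0 \<and> \<tau> n = T \<and>
     (\<forall>k<n. \<tau> k \<le> \<tau> (Suc k) \<and> \<xi> k \<in> borel_measurable (F (\<tau> k)) \<and> bounded (\<xi> k ` space M))"

definition simple_process ::
  "nat \<Rightarrow> (nat \<Rightarrow> real) \<Rightarrow> (nat \<Rightarrow> 'w \<Rightarrow> real^'d^'d::finite) \<Rightarrow> real \<Rightarrow> 'w \<Rightarrow> real^'d^'d"
where
  "simple_process n \<tau> \<xi> u \<omega> = (\<Sum>k<n. indicator {\<tau> k<..\<tau> (Suc k)} u *\<^sub>R \<xi> k \<omega>)"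

definition simple_integral ::
  "(real \<Rightarrow> 'w \<Rightarrow> real^'d) \<Rightarrow> nat \<Rightarrow> (nat \<Rightarrow> real) \<Rightarrow>
    (nat \<Rightarrow> 'w \<Rightarrow> real^'d^'d::finite) \<Rightarrow> 'w \<Rightarrow> real^'d"
where
  "simple_integral B n \<tau> \<xi> \<omega> = (\<Sum>k<n. \<xi> k \<omega> *v (B (\<tau> (Suc k)) \<omega> - B (\<tau> k) \<omega>))"

definition vanishes_in_prob :: "'w measure \<Rightarrow> (nat \<Rightarrow> 'w \<Rightarrow> ennreal) \<Rightarrow> bool" where
  "vanishes_in_prob M Z \<longleftrightarrow>
     (\<forall>\<epsilon>>0. (\<lambda>m. measure M {\<omega> \<in> space M. ennreal \<epsilon> < Z m \<omega>}) \<longlonglongrightarrow> 0)"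

definition progressive_on ::
  "(real \<Rightarrow> 'w measure) \<Rightarrow> real \<Rightarrow> (real \<Rightarrow> 'w \<Rightarrow> 'b::topological_space) \<Rightarrow> bool"
where
  "progressive_on F T H \<longleftrightarrow>
     (\<forall>t\<in>{0..T}. (\<lambda>(u, \<omega>). H u \<omega>) \<in> borel_measurable (restrict_space borel {0..t} \<Otimes>\<^sub>M F t))"

text \<open>\<open>has_ito_integral M B T H I\<close> says that the random variable \<open>I\<close> is a version of the Ito
  integral \<open>\<integral>\<^sub>0\<^sup>T H\<^sub>u dB\<^sub>u\<close> of a progressive matrix-valued process with almost surely square-integrable
  paths: simple processes converge to \<open>H\<close> in \<open>L\<^sup>2([0, T])\<close>, in probability, and their integrals
  converge to \<open>I\<close> in probability. Such an \<open>I\<close> exists and is unique up to a null set. The norm on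
  matrices is the Frobenius norm.\<close>

definition has_ito_integral ::
  "'w measure \<Rightarrow> (real \<Rightarrow> 'w \<Rightarrow> real^'d) \<Rightarrow> real \<Rightarrow>
    (real \<Rightarrow> 'w \<Rightarrow> real^'d^'d::finite) \<Rightarrow> ('w \<Rightarrow> real^'d) \<Rightarrow> bool"
where
  "has_ito_integral M B T H I \<longleftrightarrow>
     progressive_on (brownian_filtration M B) T H \<and>
     (AE \<omega> in M. (\<integral>\<^sup>+u\<in>{0..T}. ennreal ((norm (H u \<omega>))\<^sup>2) \<partial>lborel) < \<infinity>) \<and>
     I \<in> borel_measurable M \<and>
     (\<exists>(N :: nat \<Rightarrow> nat) (\<tau> :: nat \<Rightarrow> nat \<Rightarrow> real) (\<xi> :: nat \<Rightarrow> nat \<Rightarrow> 'w \<Rightarrow> real^'d^'d).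
        (\<forall>m. simple_process_data M (brownian_filtration M B) T (N m) (\<tau> m) (\<xi> m)) \<and>
        vanishes_in_prob M (\<lambda>m \<omega>. \<integral>\<^sup>+u\<in>{0..T}.
          ennreal ((norm (simple_process (N m) (\<tau> m) (\<xi> m) u \<omega> - H u \<omega>))\<^sup>2) \<partial>lborel) \<and>
        vanishes_in_prob M (\<lambda>m \<omega>.
          ennreal (norm (simple_integral B (N m) (\<tau> m) (\<xi> m) \<omega> - I \<omega>))))"


subsection \<open>Strong solutions and the two value functions\<close>

text \<open>The integral equation is required almost surely for each \<open>t\<close>. As the paths of \<open>X\<close> are
  continuous, this is the same as requiring it almost surely for all \<open>t\<close> simultaneously with the
  continuous version of the stochastic integral.\<close>

definition strong_solution ::
  "'w measure \<Rightarrow> (real \<Rightarrow> 'w \<Rightarrow> real^'d) \<Rightarrow> (real^'d \<Rightarrow> real^'d) \<Rightarrow> (real^'d \<Rightarrow> real^'d^'d::finite) \<Rightarrow>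
    real^'d \<Rightarrow> (real \<Rightarrow> 'w \<Rightarrow> real^'d) \<Rightarrow> bool"
where
  "strong_solution M B \<mu> \<sigma> s X \<longleftrightarrow>
     (\<forall>t\<ge>0. X t \<in> borel_measurable (brownian_filtration M B t)) \<and>
     (\<forall>\<omega>\<in>space M. continuous_on {0..} (\<lambda>t. X t \<omega>)) \<and>
     (AE \<omega> in M. X 0 \<omega> = s) \<and>
     (\<forall>t\<ge>0. \<exists>I. has_ito_integral M B t (\<lambda>u \<omega>. \<sigma> (X u \<omega>)) I \<and>
        (AE \<omega> in M. X t \<omega> = s + (LINT u:{0..t}|lborel. \<mu> (X u \<omega>)) + I \<omega>))"

text \<open>In the next two definitions \<open>X s\<close> is the state process started at \<open>s\<close>, so that the expectation
  conditional on the initial state being \<open>s\<close> is the plain expectation of a functional of \<open>X s\<close>.\<close>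

definition value_fun ::
  "'w measure \<Rightarrow> (real^'d \<Rightarrow> real \<Rightarrow> 'w \<Rightarrow> real^'d::finite) \<Rightarrow> real \<Rightarrow> (real^'d \<Rightarrow> real) \<Rightarrow>
    real^'d \<Rightarrow> real"
where
  "value_fun M X \<beta> r s =
     (\<integral>\<omega>. (LINT t:{0..}|lborel. exp (- \<beta> * t) * r (X s t \<omega>)) \<partial>M)"

text \<open>The solution of the Bellman equation is sought among the bounded Borel functions, where it is
  unique: the right-hand side is a contraction there.\<close>

definition bellman_solution ::
  "'w measure \<Rightarrow> (real^'d \<Rightarrow> real \<Rightarrow> 'w \<Rightarrow> real^'d::finite) \<Rightarrow> real \<Rightarrow> (real^'d \<Rightarrow> real) \<Rightarrow> real \<Rightarrow>
    (real^'d \<Rightarrow> real) \<Rightarrow> bool"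
where
  "bellman_solution M X \<beta> r \<Delta> W \<longleftrightarrow>
     W \<in> borel_measurable borel \<and> bounded (range W) \<and>
     (\<forall>s. W s = r s * \<Delta> + exp (- \<beta> * \<Delta>) * (\<integral>\<omega>. W (X s \<Delta> \<omega>) \<partial>M))"

end

theory Submission
  imports Defs
begin

text \<open>
  Write \<open>P\<^sub>t f(s) = E f(s\<^sub>t)\<close>. By the Markov property \<open>V(s)\<close> is the discounted reward over \<open>[0, \<Delta>t)\<close> plus
  \<open>e\<^sup>-\<^sup>\<beta>\<^sup>\<Delta>\<^sup>t E V(s\<^sub>\<Delta>\<^sub>t)\<close>, so \<open>V\<close> satisfies the Bellman equation up to the error
  \<open>\<integral>\<^sub>0\<^sup>\<Delta>\<^sup>t (e\<^sup>-\<^sup>\<beta>\<^sup>t P\<^sub>t r - r) dt\<close>, which is at most \<open>(G + \<beta> \<rho>) \<Delta>t\<^sup>2 / 2\<close> once \<open>\<bar>P\<^sub>t r - r\<bar> \<le> G t\<close> is known,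
  where \<open>\<rho>\<close> and \<open>G\<close> are the sup norms of \<open>r\<close> and of its generator. As the Bellman operator is a contraction
  with factor \<open>e\<^sup>-\<^sup>\<beta>\<^sup>\<Delta>\<^sup>t\<close>, the error of \<open>V\<close> is this bound divided by \<open>1 - e\<^sup>-\<^sup>\<beta>\<^sup>\<Delta>\<^sup>t\<close>.

  Both the Markov property and the bound on \<open>P\<^sub>t r - r\<close> come from the Euler scheme, which converges to the
  strong solution in probability: an Euler path is a Markov chain by construction, and its one-step
  operator is compared with the generator by Taylor's formula, so that Ito's formula is not needed.
  The only stochastic calculus is an Ito inequality for the definition of the integral by limits in
  probability, localised by decreasing families of adapted events in place of stopping times.
\<close>

subsection \<open>Gaussian increments\<close>

text \<open>The first obstacle is the starting point. The solutions \<open>X s\<close> are given one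
  \<open>s\<close> at a time, with no information on how they vary with \<open>s\<close>, whereas
  conditioning at time \<Delta>t restarts the motion from a random state. For the Euler chain this
  dependence is explicit: its iterated transition operators map Lipschitz functions to Lipschitz
  functions with a constant uniform in the mesh, and this survives the limit. Convergence in
  probability suffices because it is tested only on bounded Lipschitz functions, so second moments
  of the error are taken only on events where the solution has stayed in a ball. The second obstacle
  is that \<open>r\<close> and its generator are bounded while the derivatives of \<open>r\<close>
  and the coefficients may grow, so the Taylor error of one Euler step is not uniform in the start.
  It is uniform for functions constant outside a ball, where fourth moments beat the linear growth
  of the coefficients. Passing from these to \<open>r\<close> gives an upper bound only, which is
  then applied to \<open>-r\<close> as well. The factor 1/2 is the integral of \<open>t\<close> over
  the unit interval; dividing by \<open>1 - exp (- \<beta> * \<Delta>)\<close>, which is \<beta>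
  \<Delta> to first order, leaves one power of \<Delta>.\<close>

definition gauss :: "real \<Rightarrow> (real^'d::finite) measure" where
  "gauss h = density lborel (\<lambda>x. ennreal (\<Prod>i\<in>UNIV. normal_density 0 (sqrt h) (x $ i)))"

lemma sets_gauss [measurable_cong]: "sets (gauss h) = sets borel"
  by (simp add: gauss_def)

lemma space_gauss [simp]: "space (gauss h) = UNIV"
  by (simp add: gauss_def)

lemma prod_Basis_vec:
  fixes F :: "real^'d::finite \<Rightarrow> 'a::comm_monoid_mult"
  shows "(\<Prod>b\<in>Basis. F b) = (\<Prod>i\<in>UNIV. F (axis i 1))"
proof -
  have B: "(Basis :: (real^'d) set) = range (\<lambda>i. axis i 1)"
    by (auto simp: Basis_vec_def)
  show ?thesis
    unfolding B by (subst prod.reindex) (auto simp: inj_on_def axis_eq_axis)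
qed

text \<open>Density and integrand both factor over the coordinates, and Lebesgue measure is a
  product along the basis. With nonnegative integrals the factorisation holds before anything is
  known to be integrable.\<close>

lemma nn_integral_gauss_prod:
  fixes g :: "'d::finite \<Rightarrow> real \<Rightarrow> real"
  assumes [measurable]: "\<And>i. g i \<in> borel_measurable borel" and nn: "\<And>i x. 0 \<le> g i x"
    and h: "0 < h"
  shows "(\<integral>\<^sup>+y. ennreal (\<Prod>i\<in>UNIV. g i (y $ i)) \<partial>(gauss h)) =
     (\<Prod>i\<in>UNIV. \<integral>\<^sup>+x. ennreal (normal_density 0 (sqrt h) x * g i x) \<partial>lborel)"
proof -
  let ?n = "normal_density 0 (sqrt h)"
  have "(\<integral>\<^sup>+y. ennreal (\<Prod>i\<in>UNIV. g i (y $ i)) \<partial>(gauss h)) =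
      (\<integral>\<^sup>+y. (\<Prod>i\<in>UNIV. ennreal (?n (y $ i) * g i (y $ i))) \<partial>(lborel :: (real^'d) measure))"
    unfolding gauss_def
    by (subst nn_integral_density)
      (auto simp: prod_ennreal ennreal_mult'[symmetric] prod_nonneg nn prod.distrib intro!: nn_integral_cong)
  also have "\<dots> = (\<integral>\<^sup>+y. (\<Prod>b\<in>Basis. ennreal (?n (y \<bullet> b) * g (axis_index b) (y \<bullet> b))) \<partial>(lborel :: (real^'d) measure))"
    unfolding prod_Basis_vec by (simp add: cart_eq_inner_axis[symmetric])
  also have "\<dots> = (\<Prod>b\<in>(Basis::(real^'d) set). \<integral>\<^sup>+x. ennreal (?n x * g (axis_index b) x) \<partial>lborel)"
    by (subst nn_integral_lborel_prod) auto
  also have "\<dots> = (\<Prod>i\<in>UNIV. \<integral>\<^sup>+x. ennreal (?n x * g i x) \<partial>lborel)"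
    unfolding prod_Basis_vec by simp
  finally show ?thesis .
qed

lemma prob_space_gauss:
  assumes h: "0 < h"
  shows "prob_space (gauss h :: (real^'d::finite) measure)"
proof
  have "(\<integral>\<^sup>+x. ennreal (normal_density 0 (sqrt h) x * 1) \<partial>lborel) = 1"
    using prob_space.emeasure_space_1[OF prob_space_normal_density[of "sqrt h" 0]] h
    by (simp add: emeasure_density)
  then have "(\<integral>\<^sup>+y. ennreal (\<Prod>i\<in>UNIV. 1) \<partial>(gauss h :: (real^'d) measure)) = 1"
    using nn_integral_gauss_prod[of "\<lambda>(i::'d) x. 1", OF _ _ h] by simp
  then show "emeasure (gauss h) (space (gauss h :: (real^'d) measure)) = 1"
    by simp
qed

text \<open>The value is \<open>h^k\<close> times the double factorial of \<open>2 * k - 1\<close>.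
  All coordinates other than \<open>l\<close> contribute total mass one.\<close>

lemma nn_integral_gauss_component:
  fixes l :: "'d::finite"
  assumes h: "0 < h"
  shows "(\<integral>\<^sup>+y. ennreal ((y $ l)^(2 * k)) \<partial>(gauss h)) = ennreal (fact (2 * k) / ((2 / h)^k * fact k))"
proof -
  let ?g = "\<lambda>i x. if i = l then x^(2*k) else (1::real)"
  have one: "(\<integral>\<^sup>+x. ennreal (normal_density 0 (sqrt h) x) \<partial>lborel) = 1"
    using prob_space.emeasure_space_1[OF prob_space_normal_density[of "sqrt h" 0]] h
    by (simp add: emeasure_density)
  have mom: "(\<integral>\<^sup>+x. ennreal (normal_density 0 (sqrt h) x * x^(2*k)) \<partial>lborel) = ennreal (fact (2 * k) / ((2 / h)^k * fact k))"
    using normal_moment_even[of "sqrt h" 0 k] h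
    by (subst nn_integral_eq_integral) (auto simp: has_bochner_integral_iff normal_density_nonneg)
  have p: "(\<Prod>i\<in>UNIV. ?g i (y $ i)) = (y $ l)^(2*k)" for y :: "real^'d"
    using prod.delta[of UNIV l "\<lambda>i. (y $ i)^(2*k)"] by (simp add: if_distrib cong: if_cong)
  have "(\<integral>\<^sup>+y. ennreal ((y $ l)^(2 * k)) \<partial>(gauss h)) =
     (\<Prod>i\<in>UNIV. \<integral>\<^sup>+x. ennreal (normal_density 0 (sqrt h) x * ?g i x) \<partial>lborel)"
    unfolding p[symmetric] by (rule nn_integral_gauss_prod) (use h in auto)
  also have "\<dots> = (\<Prod>i\<in>UNIV. if i = l then ennreal (fact (2 * k) / ((2 / h)^k * fact k)) else 1)"
    by (intro prod.cong) (auto simp: mom one)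
  also have "\<dots> = ennreal (fact (2 * k) / ((2 / h)^k * fact k))"
    by (simp add: prod.delta)
  finally show ?thesis .
qed

lemma gauss_second_moment:
  assumes h: "0 < h"
  shows "has_bochner_integral (gauss h) (\<lambda>y. (y $ l)^2) h"
    and "has_bochner_integral (gauss h) (\<lambda>y. (y $ l)^4) (3 * h^2)"
  using nn_integral_gauss_component[OF h, of l 1] nn_integral_gauss_component[OF h, of l 2] h
  by (auto intro!: has_bochner_integral_nn_integral simp: fact_numeral field_simps power2_eq_square)

text \<open>The density depends on each coordinate only through its square. This symmetry yields the
  vanishing moments without computing any integral.\<close>

lemma distr_gauss_reflect:
  fixes l :: "'d::finite"
  shows "distr (gauss h) borel (\<lambda>y. y - (2 * y $ l) *\<^sub>R axis l 1) = (gauss h :: (real^'d) measure)"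
proof -
  let ?T = "\<lambda>y::real^'d. y - (2 * y $ l) *\<^sub>R axis l 1"
  let ?f = "\<lambda>x::real^'d. ennreal (\<Prod>i\<in>UNIV. normal_density 0 (sqrt h) (x $ i))"
  \<comment> \<open>The reflection is a diagonal map with entries 1 and a single -1, so its Jacobian
    has absolute value 1 and Lebesgue measure is preserved.\<close>
  define c where "c b = (if b = (axis l 1 :: real^'d) then -1 else (1::real))" for b
  have T: "(\<Sum>j\<in>Basis. (c j * (x \<bullet> j)) *\<^sub>R j) = ?T x" for x :: "real^'d"
  proof -
    have "axis l 1 \<in> (Basis :: (real^'d) set)"
      by (auto simp: Basis_vec_def)
    moreover have "(\<Sum>j\<in>Basis. (c j * (x \<bullet> j)) *\<^sub>R j) =
       (\<Sum>j\<in>Basis. (x \<bullet> j) *\<^sub>R j - (if j = axis l 1 then (2 * (x \<bullet> j)) *\<^sub>R j else 0))"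
      by (rule sum.cong) (auto simp: c_def algebra_simps scaleR_2[symmetric])
    ultimately show ?thesis
      by (simp add: sum_subtractf euclidean_representation sum.delta inner_axis)
  qed
  have c1: "c j \<noteq> 0" "\<bar>c j\<bar> = 1" for j by (auto simp: c_def)
  have [measurable]: "?T \<in> borel_measurable borel"
    by (intro borel_measurable_continuous_onI continuous_intros)
  have "lborel = density (distr lborel borel ?T) (\<lambda>_. 1)"
    using lborel_affine_euclidean[of c 0] by (simp add: T c1)
  then have L: "distr lborel borel ?T = lborel"
    by (simp add: density_1)
  have inv: "?f (?T x) = ?f x" for x
  proof -
    have "normal_density 0 (sqrt h) (?T x $ i) = normal_density 0 (sqrt h) (x $ i)" for i
      by (cases "i = l") (auto simp: normal_density_def axis_def)
    then show ?thesis by simp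
  qed
  have "gauss h = density (distr lborel borel ?T) ?f"
    by (simp add: L gauss_def)
  also have "\<dots> = distr (density lborel (\<lambda>x. ?f (?T x))) borel ?T"
    by (rule density_distr) auto
  also have "\<dots> = distr (gauss h) borel ?T"
    by (simp only: inv gauss_def)
  finally show ?thesis ..
qed

text \<open>In both cases the reflection of coordinate \<open>l\<close> changes the sign of the
  integrand, so the integral equals its own negative.\<close>

lemma gauss_first_moment:
  assumes h: "0 < h"
  shows "has_bochner_integral (gauss h) (\<lambda>y. y $ l) 0"
    and "l \<noteq> m \<Longrightarrow> has_bochner_integral (gauss h) (\<lambda>y. y $ l * y $ m) 0"
proof -
  interpret prob_space "gauss h :: (real^'a) measure" by (rule prob_space_gauss[OF h])
  let ?T = "\<lambda>y::real^'a. y - (2 * y $ l) *\<^sub>R axis l 1"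
  have [measurable]: "?T \<in> borel_measurable borel"
    by (intro borel_measurable_continuous_onI continuous_intros)
  have i2: "integrable (gauss h) (\<lambda>y::real^'a. (y $ i)^2)" for i
    using gauss_second_moment(1)[OF h, of i] by (simp add: has_bochner_integral_iff)
  have i1: "integrable (gauss h) (\<lambda>y::real^'a. y $ i)" for i
    by (rule square_integrable_imp_integrable[OF _ i2]) auto
  have "(\<integral>y. y $ l \<partial>gauss h) = (\<integral>y. ?T y $ l \<partial>gauss h)"
    by (subst distr_gauss_reflect[of h l, symmetric], subst integral_distr) auto
  also have "\<dots> = - (\<integral>y. y $ l \<partial>gauss h)"
    by simp
  finally show "has_bochner_integral (gauss h) (\<lambda>y. y $ l) 0"
    using i1 by (simp add: has_bochner_integral_iff)
  assume lm: "l \<noteq> m"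
  have i12: "integrable (gauss h) (\<lambda>y::real^'a. y $ l * y $ m)"
  proof (rule Bochner_Integration.integrable_bound)
    show "integrable (gauss h) (\<lambda>y::real^'a. (y $ l)^2 + (y $ m)^2)"
      by (intro Bochner_Integration.integrable_add i2)
    have "\<bar>a * b\<bar> \<le> a^2 + b^2" for a b :: real
    proof -
      have "2 * (\<bar>a\<bar> * \<bar>b\<bar>) \<le> a^2 + b^2" "0 \<le> \<bar>a\<bar> * \<bar>b\<bar>"
        using sum_squares_bound[of "\<bar>a\<bar>" "\<bar>b\<bar>"] by auto
      then show ?thesis unfolding abs_mult by linarith
    qed
    then show "AE y in gauss h. norm (y $ l * y $ m) \<le> norm ((y $ l)^2 + (y $ m)^2)"
      by auto
  qed auto
  have "(\<integral>y. y $ l * y $ m \<partial>gauss h) = (\<integral>y. ?T y $ l * ?T y $ m \<partial>gauss h)"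
    by (subst distr_gauss_reflect[of h l, symmetric], subst integral_distr) auto
  also have "\<dots> = - (\<integral>y. y $ l * y $ m \<partial>gauss h)"
    using lm by (simp add: axis_def)
  finally show "has_bochner_integral (gauss h) (\<lambda>y. y $ l * y $ m) 0"
    using i12 by (simp add: has_bochner_integral_iff)
qed

lemma gauss_covariance:
  assumes h: "0 < h"
  shows "has_bochner_integral (gauss h) (\<lambda>y. y $ l * y $ m) (if l = m then h else 0)"
  using gauss_first_moment(2)[OF h, of l m] gauss_second_moment(1)[OF h, of l]
  by (auto simp: power2_eq_square)

lemma gauss_const:
  fixes c :: real
  assumes h: "0 < h"
  shows "has_bochner_integral (gauss h :: (real^'d::finite) measure) (\<lambda>y. c) c"
proof -
  interpret G: prob_space "gauss h :: (real^'d) measure" by (rule prob_space_gauss[OF h])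
  show ?thesis by (simp add: has_bochner_integral_iff G.prob_space[unfolded space_gauss])
qed

subsection \<open>The Brownian filtration\<close>

locale brownian =
  fixes M :: "'w measure" and B :: "real \<Rightarrow> 'w \<Rightarrow> real^'d::finite"
  assumes brownian: "brownian_motion M B"

sublocale brownian \<subseteq> prob_space M
  using brownian by (simp add: brownian_motion_def)

context brownian
begin

abbreviation F :: "real \<Rightarrow> 'w measure" where
  "F \<equiv> brownian_filtration M B"

lemma measurable_B [measurable]: "0 \<le> t \<Longrightarrow> B t \<in> borel_measurable M"
  using brownian by (simp add: brownian_motion_def)

lemma B_0: "AE \<omega> in M. B 0 \<omega> = 0"
  using brownian by (simp add: brownian_motion_def)

lemma distr_increment:
  assumes "0 \<le> s" "s < t"
  shows "distr M borel (\<lambda>\<omega>. B t \<omega> - B s \<omega>) = gauss (t - s)"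
proof -
  have "distributed M lborel (\<lambda>\<omega>. B t \<omega> - B s \<omega>)
          (\<lambda>x. ennreal (\<Prod>i\<in>UNIV. normal_density 0 (sqrt (t - s)) (x $ i)))"
    using brownian assms by (simp add: brownian_motion_def)
  from distributed_distr_eq_density[OF this] show ?thesis
    by (simp add: gauss_def cong: distr_cong)
qed

lemma indep_increments:
  assumes "0 \<le> \<tau> 0" "mono \<tau>"
  shows "indep_vars (\<lambda>_. borel) (\<lambda>k \<omega>. B (\<tau> (Suc k)) \<omega> - B (\<tau> k) \<omega>) {..<n}"
  using brownian assms by (simp add: brownian_motion_def)

section \<open>Independence of an increment from the past\<close>

definition gens :: "real \<Rightarrow> 'w set set" where
  "gens t = {B u -` A \<inter> space M | u A. 0 \<le> u \<and> u \<le> t \<and> A \<in> sets borel} \<union> null_sets M"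

lemma gens_sub: "gens t \<subseteq> sets M"
  using measurable_sets[OF measurable_B] by (auto simp: gens_def)

lemma gens_Pow: "gens t \<subseteq> Pow (space M)"
  using gens_sub sets.sets_into_space by blast

lemma space_F [simp]: "space (F t) = space M"
  by (simp add: brownian_filtration_def space_measure_of_conv)

lemma sets_F: "sets (F t) = sigma_sets (space M) (gens t)"
  using gens_Pow[of t] by (simp add: brownian_filtration_def gens_def)

lemma subalgebra_F: "subalgebra M (F t)"
  using gens_sub by (simp add: subalgebra_def sets_F sets.sigma_sets_subset)

lemma subalgebra_F_mono:
  assumes "s \<le> t"
  shows "subalgebra (F t) (F s)"
proof -
  have "gens s \<subseteq> gens t"
    using assms unfolding gens_def by (blast intro: order_trans)
  then show ?thesis
    by (simp add: subalgebra_def sets_F sigma_sets_subseteq)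
qed

lemma measurable_F: "f \<in> measurable (F t) N \<Longrightarrow> f \<in> measurable M N"
  using measurable_from_subalg[OF subalgebra_F] .

lemma measurable_F_mono: "f \<in> measurable (F s) N \<Longrightarrow> s \<le> t \<Longrightarrow> f \<in> measurable (F t) N"
  using measurable_from_subalg[OF subalgebra_F_mono] by blast

lemma sets_F_sub: "A \<in> sets (F t) \<Longrightarrow> A \<in> sets M"
  using subalgebra_F by (auto simp: subalgebra_def)

lemma sets_F_mono: "A \<in> sets (F s) \<Longrightarrow> s \<le> t \<Longrightarrow> A \<in> sets (F t)"
  using subalgebra_F_mono by (auto simp: subalgebra_def)

lemma B_measurable_F: "0 \<le> u \<Longrightarrow> u \<le> t \<Longrightarrow> B u \<in> borel_measurable (F t)"
  by (rule measurableI) (auto simp: sets_F gens_def intro!: sigma_sets.Basic)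

text \<open>The family \<open>gens\<close> is not intersection stable in general; finite-dimensional
  events are, and they are what a pi-lambda argument needs. Null sets are adjoined because the
  filtration is augmented.\<close>

definition cylinders :: "real \<Rightarrow> 'w set set" where
  "cylinders t = {{\<omega> \<in> space M. \<forall>i<n. B (\<tau> i) \<omega> \<in> A i} | (n::nat) \<tau> A.
     (\<forall>i<n. 0 \<le> \<tau> i \<and> \<tau> i \<le> t \<and> A i \<in> sets borel)} \<union> null_sets M"

lemma cylindersI:
  fixes n :: nat
  assumes "\<And>i. i < n \<Longrightarrow> 0 \<le> \<tau> i \<and> \<tau> i \<le> t \<and> A i \<in> sets borel"
  shows "{\<omega> \<in> space M. \<forall>i<n. B (\<tau> i) \<omega> \<in> A i} \<in> cylinders t"
  unfolding cylinders_def using assms by blast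

lemma cylinders_sub: "cylinders t \<subseteq> sets M"
proof
  fix x assume x: "x \<in> cylinders t"
  show "x \<in> sets M"
  proof (cases "x \<in> null_sets M")
    case False
    then obtain n \<tau> A where x: "x = {\<omega> \<in> space M. \<forall>i<n. B (\<tau> i) \<omega> \<in> A i}"
      and *: "\<forall>i<(n::nat). 0 \<le> \<tau> i \<and> \<tau> i \<le> t \<and> A i \<in> sets borel"
      using x unfolding cylinders_def by blast
    have "{\<omega> \<in> space M. \<forall>i\<in>{..<n}. B (\<tau> i) \<omega> \<in> A i} \<in> sets M"
    proof (rule sets.sets_Collect_finite_All)
      fix i assume "i \<in> {..<n}"
      then have "B (\<tau> i) -` A i \<inter> space M \<in> sets M"
        using * by (intro measurable_sets[OF measurable_B]) auto
      then show "{\<omega> \<in> space M. B (\<tau> i) \<omega> \<in> A i} \<in> sets M"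
        by (simp add: vimage_def Int_def conj_commute)
    qed simp
    also have "{\<omega> \<in> space M. \<forall>i\<in>{..<n}. B (\<tau> i) \<omega> \<in> A i} = x"
      unfolding x by auto
    finally show ?thesis .
  qed auto
qed

lemma Int_stable_cylinders: "Int_stable (cylinders t)"
proof (rule Int_stableI)
  fix a b assume a: "a \<in> cylinders t" and b: "b \<in> cylinders t"
  show "a \<inter> b \<in> cylinders t"
  proof (cases "a \<in> null_sets M \<or> b \<in> null_sets M")
    case True
    then have "a \<inter> b \<in> null_sets M"
      using a b cylinders_sub null_set_Int1 null_set_Int2 by blast
    then show ?thesis by (simp add: cylinders_def)
  next
    case False
    then obtain n \<tau> A m \<sigma> D
      where *: "a = {\<omega> \<in> space M. \<forall>i<n. B (\<tau> i) \<omega> \<in> A i}"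
        "\<forall>i<(n::nat). 0 \<le> \<tau> i \<and> \<tau> i \<le> t \<and> A i \<in> sets borel"
        "b = {\<omega> \<in> space M. \<forall>i<m. B (\<sigma> i) \<omega> \<in> D i}"
        "\<forall>i<(m::nat). 0 \<le> \<sigma> i \<and> \<sigma> i \<le> t \<and> D i \<in> sets borel"
      using a b unfolding cylinders_def by blast
    \<comment> \<open>The two finite families of times are concatenated; times may repeat and need
      not be sorted.\<close>
    let ?\<tau> = "\<lambda>i. if i < n then \<tau> i else \<sigma> (i - n)" and ?A = "\<lambda>i. if i < n then A i else D (i - n)"
    have split: "(\<forall>i<n+m. P i) \<longleftrightarrow> (\<forall>i<n. P i) \<and> (\<forall>i<m. P (n + i))" for P
    proof (intro iffI allI conjI impI)
      fix i assume "(\<forall>i<n. P i) \<and> (\<forall>i<m. P (n + i))" "i < n + m"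
      moreover have "n + (i - n) = i" "i - n < m" if "\<not> i < n" using that \<open>i < n + m\<close> by auto
      ultimately show "P i" by (cases "i < n") metis+
    qed auto
    have "a \<inter> b = {\<omega> \<in> space M. \<forall>i<n+m. B (?\<tau> i) \<omega> \<in> ?A i}"
      unfolding split * by auto
    moreover have "\<forall>i<n+m. 0 \<le> ?\<tau> i \<and> ?\<tau> i \<le> t \<and> ?A i \<in> sets borel"
      unfolding split using * by auto
    ultimately show ?thesis
      using cylindersI[of "n + m" ?\<tau> t ?A] by simp
  qed
qed

lemma gens_sub_cylinders: "gens t \<subseteq> cylinders t"
proof
  fix x assume x: "x \<in> gens t"
  show "x \<in> cylinders t"
  proof (cases "x \<in> null_sets M")
    case False
    then obtain u A where "x = B u -` A \<inter> space M" "0 \<le> u" "u \<le> t" "A \<in> sets borel"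
      using x by (auto simp: gens_def)
    then show ?thesis
      using cylindersI[of 1 "\<lambda>_. u" t "\<lambda>_. A"] by (simp add: vimage_def Int_def conj_commute)
  qed (simp add: cylinders_def)
qed

text \<open>The values of \<open>B\<close> at finitely many times up to \<open>t\<close> are partial
  sums of increments along the sorted grid of these times, and the increment from \<open>t\<close>
  to \<open>v\<close> is the next one in that grid.\<close>

lemma cylinder_indep:
  assumes t: "0 \<le> t" "t < v" and D: "D \<in> sets borel" and C0: "C \<in> cylinders t"
  shows "prob (C \<inter> ((\<lambda>\<omega>. B v \<omega> - B t \<omega>) -` D \<inter> space M)) =
      prob C * prob ((\<lambda>\<omega>. B v \<omega> - B t \<omega>) -` D \<inter> space M)"
proof (cases "C \<in> null_sets M")
  case True
  have "(\<lambda>\<omega>. B v \<omega> - B t \<omega>) -` D \<inter> space M \<in> sets M"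
    using t D by (intro measurable_sets[OF _ D]) auto
  with True have "C \<inter> ((\<lambda>\<omega>. B v \<omega> - B t \<omega>) -` D \<inter> space M) \<in> null_sets M"
    by (rule null_set_Int2)
  with True show ?thesis by (simp add: measure_eq_0_null_sets)
next
  case False
  then obtain n \<tau> A where C: "C = {\<omega> \<in> space M. \<forall>i<n. B (\<tau> i) \<omega> \<in> A i}"
    and *: "\<forall>i<(n::nat). 0 \<le> \<tau> i \<and> \<tau> i \<le> t \<and> A i \<in> sets borel"
    using C0 unfolding cylinders_def by blast
  \<comment> \<open>The point 0 lets partial sums of increments recover the values of
    \<open>B\<close>; the point \<open>t\<close> makes the last increment before \<open>v\<close>
    start exactly at \<open>t\<close>.\<close>
  define S where "S = insert 0 (insert t (\<tau> ` {..<n}))"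
  define L where "L = sorted_list_of_set S"
  define K where "K = length L - 1"
  have fS: "finite S" by (simp add: S_def)
  have setL: "set L = S" and sL: "sorted L" using fS by (auto simp: L_def)
  have S0: "0 \<le> x" "x \<le> t" if "x \<in> S" for x using that * t by (auto simp: S_def)
  have len: "length L = Suc K"
    using setL by (cases L) (auto simp: K_def S_def)
  \<comment> \<open>Staying at \<open>v\<close> after the last grid point makes \<open>ts\<close>
    monotone on all natural numbers, as \<open>indep_increments\<close> asks, and makes increment
    number \<open>K\<close> the one from \<open>t\<close> to \<open>v\<close>.\<close>
  define ts where "ts k = (if k \<le> K then L ! k else v)" for k
  have idx: "\<exists>j\<le>K. ts j = x" if "x \<in> S" for x
    using that unfolding setL[symmetric] in_set_conv_nth len ts_def by auto
  have tsS: "ts k \<in> S" if "k \<le> K" for k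
    using that len nth_mem[of k L] by (simp add: ts_def setL)
  have mono_ts: "mono ts"
  proof (rule monoI)
    fix i j :: nat assume "i \<le> j"
    then show "ts i \<le> ts j"
      using sorted_nth_mono[OF sL, of i j] len S0(2)[OF tsS, of i] t by (auto simp: ts_def)
  qed
  have ts0: "ts 0 = 0"
  proof -
    obtain j where "ts j = 0" using idx[of 0] by (auto simp: S_def)
    then show ?thesis
      using monoD[OF mono_ts, of 0 j] S0(1)[OF tsS[of 0]] by simp
  qed
  have tsK: "ts K = t"
  proof -
    obtain j where "j \<le> K" "ts j = t" using idx[of t] by (auto simp: S_def)
    then show ?thesis
      using monoD[OF mono_ts, of j K] S0(2)[OF tsS[of K]] by simp
  qed
  have tsv: "ts (Suc K) = v" by (simp add: ts_def)
  have ts_nonneg: "0 \<le> ts k" for k using monoD[OF mono_ts, of 0 k] ts0 by simp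
  let ?d = "\<lambda>k \<omega>. B (ts (Suc k)) \<omega> - B (ts k) \<omega>"
  have d_meas [measurable]: "?d k \<in> borel_measurable M" for k
    using ts_nonneg by (intro borel_measurable_diff measurable_B) auto
  have ind: "indep_vars (\<lambda>_. borel) ?d {..<Suc K}"
    using mono_ts ts0 by (intro indep_increments) auto
  define j where "j i = (SOME j. j \<le> K \<and> ts j = \<tau> i)" for i
  have j: "j i \<le> K" "ts (j i) = \<tau> i" if "i < n" for i
    using someI_ex[of "\<lambda>j. j \<le> K \<and> ts j = \<tau> i"] idx[of "\<tau> i"] that
    by (auto simp: j_def S_def)
  \<comment> \<open>This is the event \<open>C\<close> rewritten in terms of increments: the partial
    sum up to \<open>j i\<close> is the value at time \<open>\<tau> i\<close>.\<close>
  define E where "E = {f \<in> space (PiM {..<K} (\<lambda>_. borel :: (real^'d) measure)). \<forall>i\<in>{..<n}. (\<Sum>k<j i. f k) \<in> A i}"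
  have E: "E \<in> sets (PiM {..<K} (\<lambda>_. borel))"
    unfolding E_def
  proof (rule sets.sets_Collect_finite_All)
    fix i assume i: "i \<in> {..<n}"
    then have "(\<lambda>f. \<Sum>k<j i. f k) \<in> borel_measurable (PiM {..<K} (\<lambda>_. borel :: (real^'d) measure))"
      using j[of i] by (intro borel_measurable_sum measurable_component_singleton) auto
    then have "(\<lambda>f. \<Sum>k<j i. f k) -` A i \<inter> space (PiM {..<K} (\<lambda>_. borel :: (real^'d) measure)) \<in> sets (PiM {..<K} (\<lambda>_. borel))"
      by (rule measurable_sets) (use * i in auto)
    then show "{f \<in> space (PiM {..<K} (\<lambda>_. borel :: (real^'d) measure)). (\<Sum>k<j i. f k) \<in> A i} \<in> sets (PiM {..<K} (\<lambda>_. borel))"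
      by (simp only: vimage_def Int_def conj_commute mem_Collect_eq)
  qed auto
  let ?X = "\<lambda>\<omega>. restrict (\<lambda>k. ?d k \<omega>) {..<K}" and ?Y = "\<lambda>\<omega>. restrict (\<lambda>k. ?d k \<omega>) {K}"
  have iv: "indep_var (PiM {..<K} (\<lambda>_. borel)) ?X (PiM {K} (\<lambda>_. borel)) ?Y"
    by (rule indep_var_restrict[OF ind]) auto
  define G where "G = {f \<in> space (PiM {K} (\<lambda>_. borel :: (real^'d) measure)). f K \<in> D}"
  have G: "G \<in> sets (PiM {K} (\<lambda>_. borel))"
    unfolding G_def by (rule sets_Collect_single) (use D in auto)
  \<comment> \<open>The two descriptions agree only almost surely, since \<open>B 0 = 0\<close>
    holds only almost surely.\<close>
  have e: "AE \<omega> in M. (\<omega> \<in> C \<longleftrightarrow> \<omega> \<in> ?X -` E \<inter> space M)"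
    using B_0
  proof eventually_elim
    case (elim \<omega>)
    have tel: "(\<Sum>k<j. ?d k \<omega>) = B (ts j) \<omega>" for j
      using sum_lessThan_telescope[of "\<lambda>k. B (ts k) \<omega>" j] elim ts0 by simp
    have "(\<Sum>k<j i. ?X \<omega> k) = B (\<tau> i) \<omega>" if "i < n" for i
      using tel[of "j i"] j[OF that] by (subst sum.cong[OF refl, of _ _ "\<lambda>k. ?d k \<omega>"]) auto
    then show ?case by (auto simp: C E_def space_PiM)
  qed
  let ?D = "(\<lambda>\<omega>. B v \<omega> - B t \<omega>) -` D \<inter> space M"
  have Xm: "?X -` E \<inter> space M \<in> sets M"
    using E by (intro measurable_sets[OF _ E] measurable_restrict) auto
  have Cm: "C \<in> sets M"
    using C0 cylinders_sub by blast
  have Dm: "?D \<in> sets M"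
    using t D by (intro measurable_sets[OF _ D]) auto
  have "prob (C \<inter> ?D) = prob ((?X -` E \<inter> space M) \<inter> ?D)"
    using e Cm Xm Dm by (intro finite_measure_eq_AE) auto
  also have "\<dots> = prob ((\<lambda>\<omega>. (?X \<omega>, ?Y \<omega>)) -` (E \<times> G) \<inter> space M)"
    by (rule arg_cong[where f=prob]) (auto simp: tsK tsv G_def space_PiM)
  also have "\<dots> = prob (?X -` E \<inter> space M) * prob (?Y -` G \<inter> space M)"
    by (rule indep_varD[OF iv E G])
  also have "?Y -` G \<inter> space M = ?D"
    by (auto simp: tsK tsv G_def space_PiM)
  also have "prob (?X -` E \<inter> space M) = prob C"
    using e Cm Xm by (intro finite_measure_eq_AE) auto
  finally show ?thesis .
qed

text \<open>Independence of two intersection-stable families passes to the generated sigma-algebras,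
  and the cylinders contain the generators of \<open>F t\<close>.\<close>

lemma indep_set_increment:
  assumes t: "0 \<le> t" "t < v"
  shows "indep_set (sets (F t)) {(\<lambda>\<omega>. B v \<omega> - B t \<omega>) -` A \<inter> space M | A. A \<in> sets borel}"
    (is "indep_set _ ?D")
proof -
  have dm [measurable]: "(\<lambda>\<omega>. B v \<omega> - B t \<omega>) \<in> borel_measurable M"
    using t by auto
  have Dsub: "?D \<subseteq> sets M"
    using measurable_sets[OF dm] by auto
  have stD: "Int_stable ?D"
  proof (rule Int_stableI)
    fix a b assume "a \<in> ?D" "b \<in> ?D"
    then obtain A1 A2 where *: "A1 \<in> sets borel" "A2 \<in> sets borel"
      "a = (\<lambda>\<omega>. B v \<omega> - B t \<omega>) -` A1 \<inter> space M" "b = (\<lambda>\<omega>. B v \<omega> - B t \<omega>) -` A2 \<inter> space M"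
      by auto
    have "a \<inter> b = (\<lambda>\<omega>. B v \<omega> - B t \<omega>) -` (A1 \<inter> A2) \<inter> space M" "A1 \<inter> A2 \<in> sets borel"
      using * by auto
    then show "a \<inter> b \<in> ?D" by blast
  qed
  have "indep_set (cylinders t) ?D"
    using cylinders_sub Dsub cylinder_indep[OF t] by (intro indep_setI) auto
  then have ind: "indep_set (sigma_sets (space M) (cylinders t)) (sigma_sets (space M) ?D)"
    using Int_stable_cylinders stD by (rule indep_set_sigma_sets)
  have sub: "sets (F t) \<subseteq> sigma_sets (space M) (cylinders t)"
    unfolding sets_F by (rule sigma_sets_subseteq[OF gens_sub_cylinders])
  show ?thesis
  proof (rule indep_setI)
    show "sets (F t) \<subseteq> events" using sets_F_sub by blast
    show "?D \<subseteq> events" by (rule Dsub)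
    fix a b assume "a \<in> sets (F t)" "b \<in> ?D"
    then show "prob (a \<inter> b) = prob a * prob b"
      using sub by (intro indep_setD[OF ind]) (blast, blast intro: sigma_sets.Basic)
  qed
qed

text \<open>The product form of the joint law is what allows Fubini to integrate out one Gaussian
  increment with the past held fixed; this is the Markov property of the Euler chain in
  disguise.\<close>

lemma distr_pair_increment:
  assumes t: "0 \<le> t" "t < v" and Y: "Y \<in> measurable (F t) N"
  shows "distr M (N \<Otimes>\<^sub>M borel) (\<lambda>\<omega>. (Y \<omega>, B v \<omega> - B t \<omega>)) = distr M N Y \<Otimes>\<^sub>M gauss (v - t)"
proof -
  have dm [measurable]: "(\<lambda>\<omega>. B v \<omega> - B t \<omega>) \<in> borel_measurable M"
    using t by auto
  have Ym [measurable]: "Y \<in> measurable M N"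
    by (rule measurable_F[OF Y])
  interpret Y: prob_space "distr M N Y"
    by (rule prob_space_distr[OF Ym])
  interpret G: prob_space "gauss (v - t) :: (real^'d) measure"
    using t by (intro prob_space_gauss) simp
  have "distr M N Y \<Otimes>\<^sub>M gauss (v - t) = distr M (N \<Otimes>\<^sub>M borel) (\<lambda>\<omega>. (Y \<omega>, B v \<omega> - B t \<omega>))"
  proof (rule pair_measure_eqI)
    show "sigma_finite_measure (distr M N Y)" "sigma_finite_measure (gauss (v - t) :: (real^'d) measure)"
      by unfold_locales
    show "sets (distr M N Y \<Otimes>\<^sub>M gauss (v - t)) = sets (distr M (N \<Otimes>\<^sub>M borel) (\<lambda>\<omega>. (Y \<omega>, B v \<omega> - B t \<omega>)))"
      by (simp cong: sets_pair_measure_cong add: sets_gauss)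
    fix A D assume "A \<in> sets (distr M N Y)" "D \<in> sets (gauss (v - t) :: (real^'d) measure)"
    then have A: "A \<in> sets N" and D: "D \<in> sets borel" by (auto simp: sets_gauss)
    let ?A = "Y -` A \<inter> space M" and ?B = "(\<lambda>\<omega>. B v \<omega> - B t \<omega>) -` D \<inter> space M"
    have Am: "?A \<in> sets (F t)" using measurable_sets[OF Y A] by simp
    have "prob (?A \<inter> ?B) = prob ?A * prob ?B"
      using Am D by (intro indep_setD[OF indep_set_increment[OF t]]) blast+
    then have "emeasure M (?A \<inter> ?B) = emeasure M ?A * emeasure M ?B"
      by (simp add: emeasure_eq_measure ennreal_mult)
    moreover have "?A \<inter> ?B = (\<lambda>\<omega>. (Y \<omega>, B v \<omega> - B t \<omega>)) -` (A \<times> D) \<inter> space M"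
      by auto
    ultimately show "emeasure (distr M N Y) A * emeasure (gauss (v - t)) D =
        emeasure (distr M (N \<Otimes>\<^sub>M borel) (\<lambda>\<omega>. (Y \<omega>, B v \<omega> - B t \<omega>))) (A \<times> D)"
      using A D by (simp add: distr_increment[OF t, symmetric] emeasure_distr)
  qed
  then show ?thesis ..
qed

lemma indep_var_increment:
  fixes Y :: "'w \<Rightarrow> real" and g :: "real^'d \<Rightarrow> real"
  assumes t: "0 \<le> t" "t < v" and Y: "Y \<in> borel_measurable (F t)" and g: "g \<in> borel_measurable borel"
  shows "indep_var borel Y borel (\<lambda>\<omega>. g (B v \<omega> - B t \<omega>))"
  unfolding indep_var_def
proof (subst indep_vars_def2, intro conjI ballI)
  have dm [measurable]: "(\<lambda>\<omega>. B v \<omega> - B t \<omega>) \<in> borel_measurable M"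
    using t by auto
  note [measurable] = g measurable_F[OF Y]
  show "random_variable (case i of True \<Rightarrow> borel | False \<Rightarrow> borel)
          (case i of True \<Rightarrow> Y | False \<Rightarrow> \<lambda>\<omega>. g (B v \<omega> - B t \<omega>))" for i
    by (cases i) auto
  have "indep_set {Y -` A \<inter> space M | A. A \<in> sets borel} {(\<lambda>\<omega>. g (B v \<omega> - B t \<omega>)) -` A \<inter> space M | A. A \<in> sets borel}"
  proof (rule indep_setI)
    show "{Y -` A \<inter> space M | A. A \<in> sets borel} \<subseteq> events"
      "{(\<lambda>\<omega>. g (B v \<omega> - B t \<omega>)) -` A \<inter> space M | A. A \<in> sets borel} \<subseteq> events"
      by auto
    fix a b assume "a \<in> {Y -` A \<inter> space M | A. A \<in> sets borel}"
      "b \<in> {(\<lambda>\<omega>. g (B v \<omega> - B t \<omega>)) -` A \<inter> space M | A. A \<in> sets borel}"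
    then obtain A1 A2 where *: "A1 \<in> sets borel" "A2 \<in> sets borel"
      "a = Y -` A1 \<inter> space M" "b = (\<lambda>\<omega>. g (B v \<omega> - B t \<omega>)) -` A2 \<inter> space M" by auto
    have "a \<in> sets (F t)"
      using measurable_sets[OF Y *(1)] * by simp
    moreover have "b = (\<lambda>\<omega>. B v \<omega> - B t \<omega>) -` (g -` A2 \<inter> space borel) \<inter> space M"
      using * by auto
    moreover have "g -` A2 \<inter> space borel \<in> sets borel"
      by (rule measurable_sets[OF g *(2)])
    ultimately show "prob (a \<inter> b) = prob a * prob b"
      by (intro indep_setD[OF indep_set_increment[OF t]]) blast+
  qed
  then show "indep_sets (\<lambda>i. {(case i of True \<Rightarrow> Y | False \<Rightarrow> \<lambda>\<omega>. g (B v \<omega> - B t \<omega>)) -` A \<inter> space M |A.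
            A \<in> sets (case i of True \<Rightarrow> borel | False \<Rightarrow> borel)}) UNIV"
    unfolding indep_set_def by (rule indep_sets_mono_sets) (auto split: bool.split)
qed

text \<open>Factorisation of expectations takes the place of conditioning on \<open>F t\<close> in
  the isometry below.\<close>

lemma has_bochner_integral_increment_mult:
  fixes Y :: "'w \<Rightarrow> real" and g :: "real^'d \<Rightarrow> real"
  assumes t: "0 \<le> t" "t < v" and Y: "Y \<in> borel_measurable (F t)" "integrable M Y"
    and g: "has_bochner_integral (gauss (v - t)) g c"
  shows "has_bochner_integral M (\<lambda>\<omega>. Y \<omega> * g (B v \<omega> - B t \<omega>)) (expectation Y * c)"
proof -
  have gm [measurable]: "g \<in> borel_measurable borel"
    using has_bochner_integral_iff[THEN iffD1, OF g] by (auto dest!: borel_measurable_integrable simp: sets_gauss cong: measurable_cong_sets)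
  have dm [measurable]: "(\<lambda>\<omega>. B v \<omega> - B t \<omega>) \<in> borel_measurable M"
    using t by auto
  have ig: "integrable M (\<lambda>\<omega>. g (B v \<omega> - B t \<omega>))" "expectation (\<lambda>\<omega>. g (B v \<omega> - B t \<omega>)) = c"
    using g unfolding distr_increment[OF t, symmetric] has_bochner_integral_iff
    by (auto simp: integrable_distr_eq integral_distr)
  note iv = indep_var_increment[OF t Y(1) gm]
  show ?thesis
    using indep_var_integrable[OF iv Y(2) ig(1)] indep_var_lebesgue_integral[OF iv Y(2) ig(1)] ig
    by (simp add: has_bochner_integral_iff)
qed

end

subsection \<open>Discrete stochastic integrals\<close>

lemma norm_vec_sq:
  fixes x :: "real^'d::finite"
  shows "(norm x)\<^sup>2 = (\<Sum>i\<in>UNIV. (x $ i)\<^sup>2)"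
  unfolding power2_norm_eq_inner inner_vec_def by (simp add: power2_eq_square)

text \<open>The expansion is sorted by monomials in \<open>v\<close>, so that every summand is a
  quantity known in the past times a polynomial in the increment whose mean is known.\<close>

lemma norm_add_matrix_vector_sq:
  fixes a v :: "real^'d::finite" and Z :: "real^'d^'d"
  shows "(norm (a + Z *v v))\<^sup>2 = (norm a)\<^sup>2 + (\<Sum>l\<in>UNIV. (2 * (\<Sum>i\<in>UNIV. a $ i * Z $ i $ l)) * v $ l)
     + (\<Sum>l\<in>UNIV. \<Sum>m\<in>UNIV. (\<Sum>i\<in>UNIV. Z $ i $ l * Z $ i $ m) * (v $ l * v $ m))"
proof -
  let ?w = "\<lambda>i. \<Sum>l\<in>UNIV. Z $ i $ l * v $ l"
  have "(norm (a + Z *v v))\<^sup>2 = (\<Sum>i\<in>UNIV. (a $ i)\<^sup>2 + 2 * (a $ i * ?w i) + ?w i * ?w i)"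
    unfolding norm_vec_sq by (intro sum.cong refl) (simp add: matrix_vector_mult_def power2_eq_square algebra_simps)
  also have "\<dots> = (norm a)\<^sup>2 + (\<Sum>i\<in>UNIV. 2 * (a $ i * ?w i)) + (\<Sum>i\<in>UNIV. ?w i * ?w i)"
    by (simp add: sum.distrib norm_vec_sq)
  also have "(\<Sum>i\<in>UNIV. 2 * (a $ i * ?w i)) = (\<Sum>l\<in>UNIV. (2 * (\<Sum>i\<in>UNIV. a $ i * Z $ i $ l)) * v $ l)"
    unfolding sum_distrib_left sum_distrib_right by (subst sum.swap) (simp add: mult_ac)
  also have "(\<Sum>i\<in>UNIV. ?w i * ?w i) =
      (\<Sum>l\<in>UNIV. \<Sum>m\<in>UNIV. (\<Sum>i\<in>UNIV. Z $ i $ l * Z $ i $ m) * (v $ l * v $ m))"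
  proof -
    have "(\<Sum>i\<in>UNIV. ?w i * ?w i) = (\<Sum>i\<in>UNIV. \<Sum>l\<in>UNIV. \<Sum>m\<in>UNIV. Z $ i $ l * Z $ i $ m * (v $ l * v $ m))"
      by (simp add: sum_product mult_ac)
    also have "\<dots> = (\<Sum>l\<in>UNIV. \<Sum>i\<in>UNIV. \<Sum>m\<in>UNIV. Z $ i $ l * Z $ i $ m * (v $ l * v $ m))"
      by (rule sum.swap)
    also have "\<dots> = (\<Sum>l\<in>UNIV. \<Sum>m\<in>UNIV. \<Sum>i\<in>UNIV. Z $ i $ l * Z $ i $ m * (v $ l * v $ m))"
      by (intro sum.cong refl sum.swap)
    finally show ?thesis by (simp add: sum_distrib_right)
  qed
  finally show ?thesis .
qed

lemma norm_matrix_sq: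
  fixes Z :: "real^'d::finite^'e::finite"
  shows "(norm Z)\<^sup>2 = (\<Sum>l\<in>UNIV. \<Sum>i\<in>UNIV. Z $ i $ l * Z $ i $ l)"
  by (subst sum.swap) (simp add: power2_norm_eq_inner inner_vec_def)

lemma norm_matrix_vector_le:
  fixes A :: "real^'n::finite^'m::finite"
  shows "norm (A *v x) \<le> norm A * norm x"
proof (rule power2_le_imp_le)
  have "(norm (A *v x))\<^sup>2 = (\<Sum>i\<in>UNIV. (inner (A $ i) x)\<^sup>2)"
    unfolding norm_vec_sq by (simp add: inner_vec_def matrix_vector_mult_def)
  also have "\<dots> \<le> (\<Sum>i\<in>UNIV. inner (A $ i) (A $ i) * inner x x)"
    by (intro sum_mono Cauchy_Schwarz_ineq)
  also have "\<dots> = (norm A * norm x)\<^sup>2"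
    by (simp add: power_mult_distrib power2_norm_eq_inner inner_vec_def sum_distrib_right)
  finally show "(norm (A *v x))\<^sup>2 \<le> (norm A * norm x)\<^sup>2" .
qed simp

lemma borel_measurable_vec_nth [measurable]: "(\<lambda>x. x $ i) \<in> borel_measurable (borel :: ('a::real_normed_vector^'n) measure)"
  by (intro borel_measurable_continuous_onI continuous_intros)

lemma borel_measurable_matrix_vector_mult [measurable]:
  fixes f :: "'a \<Rightarrow> real^'n::finite^'m::finite"
  assumes "f \<in> borel_measurable M" "g \<in> borel_measurable M"
  shows "(\<lambda>x. f x *v g x) \<in> borel_measurable M"
proof (rule borel_measurable_continuous_Pair[OF assms])
  show "continuous_on UNIV (\<lambda>x. fst x *v snd x :: real^'m)" for x :: "(real^'n^'m) \<times> real^'n"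
    unfolding matrix_vector_mult_def by (intro continuous_intros)
qed

context brownian
begin

text \<open>The linear terms have mean zero, and among the quadratic ones only \<open>l = m\<close>
  survives, leaving the Frobenius norm. The bound on \<open>Z\<close> makes the products with the
  merely square-integrable \<open>a\<close> integrable.\<close>

lemma has_bochner_integral_step:
  fixes a :: "'w \<Rightarrow> real^'d" and Z :: "'w \<Rightarrow> real^'d^'d"
  assumes t: "0 \<le> t" "t < v"
    and a: "a \<in> borel_measurable (F t)" "integrable M (\<lambda>\<omega>. (norm (a \<omega>))\<^sup>2)"
    and Z: "Z \<in> borel_measurable (F t)" "\<And>\<omega>. \<omega> \<in> space M \<Longrightarrow> norm (Z \<omega>) \<le> c"
  shows "has_bochner_integral M (\<lambda>\<omega>. (norm (a \<omega> + Z \<omega> *v (B v \<omega> - B t \<omega>)))\<^sup>2)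
      (expectation (\<lambda>\<omega>. (norm (a \<omega>))\<^sup>2) + (v - t) * expectation (\<lambda>\<omega>. (norm (Z \<omega>))\<^sup>2))"
proof -
  have h: "0 < v - t" using t by simp
  note [measurable] = a(1) Z(1) measurable_F[OF a(1)] measurable_F[OF Z(1)]
  let ?v = "\<lambda>\<omega>. B v \<omega> - B t \<omega>"
  have Zb: "\<bar>Z \<omega> $ i $ l\<bar> \<le> c" if "\<omega> \<in> space M" for \<omega> i l
    using Z(2)[OF that] Finite_Cartesian_Product.norm_nth_le[of "Z \<omega>" i] component_le_norm_cart[of "Z \<omega> $ i" l] by simp
  have ai: "integrable M (\<lambda>\<omega>. a \<omega> $ i)" for i
  proof (rule square_integrable_imp_integrable)
    show "integrable M (\<lambda>\<omega>. (a \<omega> $ i)\<^sup>2)"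
    proof (rule Bochner_Integration.integrable_bound[OF a(2)])
      show "AE x in M. norm ((a x $ i)\<^sup>2) \<le> norm ((norm (a x))\<^sup>2)"
        using component_le_norm_cart[of "a _" i] by (intro AE_I2) (simp add: abs_le_square_iff[symmetric])
    qed simp
  qed simp
  have aZi: "integrable M (\<lambda>\<omega>. a \<omega> $ i * Z \<omega> $ i $ l)" for i l
  proof (rule Bochner_Integration.integrable_bound)
    show "integrable M (\<lambda>\<omega>. c * \<bar>a \<omega> $ i\<bar>)"
      using ai by (intro integrable_mult_right integrable_abs)
    show "AE \<omega> in M. norm (a \<omega> $ i * Z \<omega> $ i $ l) \<le> norm (c * \<bar>a \<omega> $ i\<bar>)"
    proof (intro AE_I2)
      fix \<omega> assume "\<omega> \<in> space M"
      from Zb[OF this, of i l] show "norm (a \<omega> $ i * Z \<omega> $ i $ l) \<le> norm (c * \<bar>a \<omega> $ i\<bar>)"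
        using mult_left_mono[of "\<bar>Z \<omega> $ i $ l\<bar>" c "\<bar>a \<omega> $ i\<bar>"] by (simp add: abs_mult mult.commute)
    qed
  qed simp
  have ZZi: "integrable M (\<lambda>\<omega>. Z \<omega> $ i $ l * Z \<omega> $ i $ m)" for i l m
  proof (rule integrable_const_bound)
    show "AE \<omega> in M. norm (Z \<omega> $ i $ l * Z \<omega> $ i $ m) \<le> c * c"
    proof (intro AE_I2)
      fix \<omega> assume \<omega>: "\<omega> \<in> space M"
      have "0 \<le> c" using Zb[OF \<omega>, of i l] by linarith
      then show "norm (Z \<omega> $ i $ l * Z \<omega> $ i $ m) \<le> c * c"
        using mult_mono[OF Zb[OF \<omega>, of i l] Zb[OF \<omega>, of i m]] by (simp add: abs_mult)
    qed
  qed simp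
  have 1: "has_bochner_integral M (\<lambda>\<omega>. \<Sum>l\<in>UNIV. (2 * (\<Sum>i\<in>UNIV. a \<omega> $ i * Z \<omega> $ i $ l)) * ?v \<omega> $ l)
     (\<Sum>l\<in>(UNIV::'d set). expectation (\<lambda>\<omega>. 2 * (\<Sum>i\<in>UNIV. a \<omega> $ i * Z \<omega> $ i $ l)) * 0)"
    using aZi
    by (intro has_bochner_integral_sum has_bochner_integral_increment_mult[OF t, where g="\<lambda>y. y $ _"] gauss_first_moment(1)[OF h]) auto
  have 2: "has_bochner_integral M (\<lambda>\<omega>. \<Sum>l\<in>UNIV. \<Sum>m\<in>UNIV. (\<Sum>i\<in>UNIV. Z \<omega> $ i $ l * Z \<omega> $ i $ m) * (?v \<omega> $ l * ?v \<omega> $ m))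
     (\<Sum>l\<in>(UNIV::'d set). \<Sum>m\<in>UNIV. expectation (\<lambda>\<omega>. \<Sum>i\<in>UNIV. Z \<omega> $ i $ l * Z \<omega> $ i $ m) * (if l = m then v - t else 0))"
  proof (intro has_bochner_integral_sum)
    fix l m :: 'd
    show "has_bochner_integral M (\<lambda>\<omega>. (\<Sum>i\<in>UNIV. Z \<omega> $ i $ l * Z \<omega> $ i $ m) * (?v \<omega> $ l * ?v \<omega> $ m))
       (expectation (\<lambda>\<omega>. \<Sum>i\<in>UNIV. Z \<omega> $ i $ l * Z \<omega> $ i $ m) * (if l = m then v - t else 0))"
      using ZZi by (intro has_bochner_integral_increment_mult[OF t, where g="\<lambda>y. y $ l * y $ m"] gauss_covariance[OF h]) auto
  qed
  have "(\<Sum>l\<in>(UNIV::'d set). \<Sum>m\<in>UNIV. expectation (\<lambda>\<omega>. \<Sum>i\<in>UNIV. Z \<omega> $ i $ l * Z \<omega> $ i $ m) * (if l = m then v - t else 0))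
     = (v - t) * expectation (\<lambda>\<omega>. (norm (Z \<omega>))\<^sup>2)"
    using ZZi by (simp add: norm_matrix_sq sum_distrib_left sum_distrib_right mult.commute if_distrib cong: if_cong)
  moreover have "has_bochner_integral M (\<lambda>\<omega>. (norm (a \<omega>))\<^sup>2) (expectation (\<lambda>\<omega>. (norm (a \<omega>))\<^sup>2))"
    using a(2) by (simp add: has_bochner_integral_iff)
  ultimately show ?thesis
    using has_bochner_integral_add[OF has_bochner_integral_add[OF _ 1] 2]
    by (simp add: norm_add_matrix_vector_sq)
qed

text \<open>The partial sum up to \<open>p n\<close> is itself adapted and square integrable, so it
  can play the role of \<open>a\<close> in the one-step identity.\<close>

lemma discrete_isometry:
  fixes Z :: "nat \<Rightarrow> 'w \<Rightarrow> real^'d^'d"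
  assumes p0: "0 \<le> p 0" and p: "\<And>k. k < N \<Longrightarrow> p k < p (Suc k)"
    and Z: "\<And>k. k < N \<Longrightarrow> Z k \<in> borel_measurable (F (p k))"
      "\<And>k \<omega>. k < N \<Longrightarrow> \<omega> \<in> space M \<Longrightarrow> norm (Z k \<omega>) \<le> c k"
  shows "has_bochner_integral M (\<lambda>\<omega>. (norm (\<Sum>k<N. Z k \<omega> *v (B (p (Suc k)) \<omega> - B (p k) \<omega>)))\<^sup>2)
    (\<Sum>k<N. (p (Suc k) - p k) * expectation (\<lambda>\<omega>. (norm (Z k \<omega>))\<^sup>2))"
proof -
  let ?S = "\<lambda>n \<omega>. \<Sum>k<n. Z k \<omega> *v (B (p (Suc k)) \<omega> - B (p k) \<omega>)"
  have p0': "0 \<le> p k" if "k \<le> N" for k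
    using that by (induction k) (use p0 p in \<open>auto simp: less_eq_Suc_le intro: order_trans less_imp_le\<close>)
  have "n \<le> N \<Longrightarrow> ?S n \<in> borel_measurable (F (p n)) \<and>
     has_bochner_integral M (\<lambda>\<omega>. (norm (?S n \<omega>))\<^sup>2)
       (\<Sum>k<n. (p (Suc k) - p k) * expectation (\<lambda>\<omega>. (norm (Z k \<omega>))\<^sup>2))" for n
  proof (induction n)
    case 0
    then show ?case by (simp add: has_bochner_integral_zero)
  next
    case (Suc n)
    then have n: "n < N" and IH: "?S n \<in> borel_measurable (F (p n))"
      "has_bochner_integral M (\<lambda>\<omega>. (norm (?S n \<omega>))\<^sup>2)
         (\<Sum>k<n. (p (Suc k) - p k) * expectation (\<lambda>\<omega>. (norm (Z k \<omega>))\<^sup>2))"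
      by auto
    have le: "p n \<le> p (Suc n)" using p[OF n] by simp
    note [measurable] = measurable_F_mono[OF IH(1) le] measurable_F_mono[OF Z(1)[OF n] le]
       B_measurable_F[of "p n" "p (Suc n)", OF p0' le] B_measurable_F[of "p (Suc n)" "p (Suc n)", OF p0' order_refl]
    have "?S (Suc n) \<in> borel_measurable (F (p (Suc n)))"
      using n by simp
    moreover have "has_bochner_integral M (\<lambda>\<omega>. (norm (?S n \<omega> + Z n \<omega> *v (B (p (Suc n)) \<omega> - B (p n) \<omega>)))\<^sup>2)
      (expectation (\<lambda>\<omega>. (norm (?S n \<omega>))\<^sup>2) + (p (Suc n) - p n) * expectation (\<lambda>\<omega>. (norm (Z n \<omega>))\<^sup>2))"
      using p0'[of n] p[OF n] n IH Z[OF n] by (intro has_bochner_integral_step[where c="c n"]) (auto simp: has_bochner_integral_iff)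
    ultimately show ?case
      using IH(2) by (simp add: has_bochner_integral_iff)
  qed
  then show ?thesis by blast
qed

end

subsection \<open>Refining simple processes\<close>

text \<open>Freezing time at the last point of a grid strictly before \<open>t\<close> gives
  countably many measurable pieces, which converge by left continuity. Left limits are the right
  hypothesis here, because indicators of stopping families are only left continuous. Negative times
  are folded to 0.\<close>

lemma borel_measurable_pair_left_limit:
  fixes f :: "real \<Rightarrow> 'a \<Rightarrow> 'b::metric_space"
  assumes f: "\<And>t. 0 \<le> t \<Longrightarrow> f t \<in> borel_measurable M"
    and lim: "\<And>t x. 0 < t \<Longrightarrow> x \<in> space M \<Longrightarrow> ((\<lambda>s. f s x) \<longlongrightarrow> f t x) (at_left t)"
  shows "(\<lambda>(t, x). f (max 0 t) x) \<in> borel_measurable (borel \<Otimes>\<^sub>M M)"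
proof -
  \<comment> \<open>Ceiling minus one, rather than floor, keeps the grid point strictly below
    \<open>t\<close>, so that the filter \<open>at_left t\<close> applies.\<close>
  define k where "k n t = \<lceil>t * real (Suc n)\<rceil> - 1" for n and t :: real
  define q where "q n t = max 0 (real_of_int (k n t) / real (Suc n))" for n t
  have q0: "q n t = 0" if "t \<le> 0" for n t
  proof -
    have "t * real (Suc n) \<le> 0" using that by (simp add: mult_nonpos_nonneg)
    then have "real_of_int (k n t) \<le> 0" unfolding k_def by linarith
    then have "real_of_int (k n t) / real (Suc n) \<le> 0" by (simp add: divide_nonpos_pos)
    then show ?thesis by (simp add: q_def max_absorb1)
  qed
  have q: "t - 1 / real (Suc n) \<le> q n t" "q n t < t" if "0 < t" for n t
  proof -
    have "t * real (Suc n) - 1 \<le> real_of_int (k n t)" "real_of_int (k n t) < t * real (Suc n)"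
      unfolding k_def by linarith+
    moreover have "t - 1 / real (Suc n) = (t * real (Suc n) - 1) / real (Suc n)"
      by (simp add: field_simps)
    ultimately have "t - 1 / real (Suc n) \<le> real_of_int (k n t) / real (Suc n)" "real_of_int (k n t) / real (Suc n) < t"
      by (simp_all add: divide_right_mono pos_divide_less_eq del: of_nat_Suc)
    then show "t - 1 / real (Suc n) \<le> q n t" "q n t < t"
      using that by (auto simp: q_def)
  qed
  have ql: "filterlim (\<lambda>n. q n t) (at_left t) sequentially" if "0 < t" for t
  proof (rule tendsto_imp_filterlim_at_left)
    show "(\<lambda>n. q n t) \<longlonglongrightarrow> t"
    proof (rule tendsto_sandwich)
      show "(\<lambda>n. t - 1 / real (Suc n)) \<longlonglongrightarrow> t"
        using tendsto_diff[OF tendsto_const LIMSEQ_inverse_real_of_nat, of t] by (simp add: inverse_eq_divide)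
    qed (use q[OF that] in \<open>auto intro!: always_eventually less_imp_le\<close>)
    show "\<forall>\<^sub>F n in sequentially. q n t < t" using q(2)[OF that] by simp
  qed
  show ?thesis
  proof (rule borel_measurable_LIMSEQ_metric)
    fix n
    have 1: "(\<lambda>z. f (max 0 (real_of_int i / real (Suc n))) (snd z)) \<in> borel_measurable (borel \<Otimes>\<^sub>M M)" for i
      by (rule measurable_compose[OF measurable_snd f]) simp
    have 2: "(\<lambda>z. k n (fst z)) \<in> measurable (borel \<Otimes>\<^sub>M M) (count_space UNIV)"
      unfolding k_def by measurable
    show "(\<lambda>z. f (q n (fst z)) (snd z)) \<in> borel_measurable (borel \<Otimes>\<^sub>M M)"
      unfolding q_def by (rule measurable_compose_countable[OF 1 2])
  next
    fix z assume "z \<in> space (borel \<Otimes>\<^sub>M M :: (real \<times> 'a) measure)"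
    then have z: "snd z \<in> space M" by (auto simp: space_pair_measure)
    show "(\<lambda>n. f (q n (fst z)) (snd z)) \<longlonglongrightarrow> (case z of (t, x) \<Rightarrow> f (max 0 t) x)"
    proof (cases "fst z > 0")
      case True
      from filterlim_compose[OF lim[OF True z] ql[OF True]] show ?thesis
        using True by (simp add: case_prod_beta)
    qed (simp add: q0 case_prod_beta)
  qed
qed

text \<open>Borel-Cantelli: choose \<open>r k\<close> so that level \<open>2^-k\<close> is exceeded
  with probability below \<open>2^-k\<close>. The requirement \<open>r k \<ge> k\<close> already
  sends \<open>r\<close> to infinity, which is all that later compositions use.\<close>

lemma vanishes_in_prob_subseq_AE:
  assumes "prob_space M" and Z: "vanishes_in_prob M Z" and [measurable]: "\<And>m. Z m \<in> borel_measurable M"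
  shows "\<exists>r. filterlim r at_top sequentially \<and> (AE \<omega> in M. (\<lambda>k. Z (r k) \<omega>) \<longlonglongrightarrow> (0::ennreal))"
proof -
  interpret prob_space M by fact
  let ?A = "\<lambda>m k. {\<omega> \<in> space M. ennreal ((1/2)^k) < Z m \<omega>}"
  have "\<exists>m\<ge>k. measure M (?A m k) < (1/2)^k" for k :: nat
  proof -
    have "(\<lambda>m. measure M (?A m k)) \<longlonglongrightarrow> 0"
      using Z by (simp add: vanishes_in_prob_def)
    then have "\<forall>\<^sub>F m in sequentially. measure M (?A m k) < (1/2)^k"
      by (rule order_tendstoD) simp
    then have "\<forall>\<^sub>F m in sequentially. m \<ge> k \<and> measure M (?A m k) < (1/2)^k"
      using eventually_ge_at_top by (rule eventually_conj[rotated])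
    then show ?thesis
      using eventually_happens by fastforce
  qed
  then obtain r where r: "\<And>k. r k \<ge> k" "\<And>k. measure M (?A (r k) k) < (1/2)^k" by metis
  have "AE \<omega> in M. \<forall>\<^sub>F k in sequentially. \<omega> \<in> space M - ?A (r k) k"
  proof (rule borel_cantelli_AE1)
    show "summable (\<lambda>k. measure M (?A (r k) k))"
      by (rule summable_comparison_test[OF _ summable_geometric[of "1/2"]]) (use r(2) in \<open>auto intro!: exI less_imp_le\<close>)
  qed (auto simp: less_top[symmetric])
  then have "AE \<omega> in M. (\<lambda>k. Z (r k) \<omega>) \<longlonglongrightarrow> 0"
  proof eventually_elim
    case (elim \<omega>)
    have "(\<lambda>k. ennreal ((1/2)^k)) \<longlonglongrightarrow> ennreal 0"
      by (intro tendsto_ennrealI LIMSEQ_realpow_zero) auto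
    then have l: "(\<lambda>k. ennreal ((1/2)^k)) \<longlonglongrightarrow> 0" by simp
    show ?case
      by (rule tendsto_sandwich[OF _ _ tendsto_const l]) (use elim in \<open>auto elim!: eventually_mono simp: not_less\<close>)
  qed
  moreover have "filterlim r at_top sequentially"
    by (rule filterlim_at_top_mono[OF filterlim_ident]) (use r(1) in auto)
  ultimately show ?thesis by blast
qed

text \<open>Removing repetitions makes consecutive points strictly ordered; an increment has a
  Gaussian density only over a positive time span.\<close>

lemma finite_grid_enumeration:
  fixes S :: "real set"
  assumes S: "finite S" "S \<subseteq> {0..T}" "0 \<in> S" "T \<in> S"
  shows "\<exists>(p :: nat \<Rightarrow> real) N. p 0 = 0 \<and> p N = T \<and> (\<forall>i j. i < j \<longrightarrow> j \<le> N \<longrightarrow> p i < p j) \<and> p ` {..N} = S"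
proof -
  define L where "L = sorted_list_of_set S"
  define N where "N = length L - 1"
  have setL: "set L = S" using S(1) by (simp add: L_def)
  have len: "length L = Suc N" using setL S(3) by (cases L) (auto simp: N_def)
  have lt: "L ! i < L ! j" if "i < j" "j \<le> N" for i j
    using sorted_wrt_nth_less[OF strict_sorted_list_of_set[of S], of i j] that len by (simp add: L_def)
  have img: "(!) L ` {..N} = S"
    unfolding setL[symmetric] set_conv_nth len by (auto simp: less_Suc_eq_le)
  obtain i where i: "i \<le> N" "L ! i = 0" using img S(3) by (auto simp: image_iff)
  obtain j where j: "j \<le> N" "L ! j = T" using img S(4) by (auto simp: image_iff)
  have "L ! 0 \<in> S" "L ! N \<in> S" using img by auto
  then have "0 \<le> L ! 0" "L ! N \<le> T" using S(2) by auto
  then have "L ! 0 = 0" "L ! N = T"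
    using lt[of 0 i] lt[of j N] i j by (cases "i = 0"; cases "j = N"; force)+
  then show ?thesis using lt img by blast
qed

section \<open>Simple processes on a common refinement\<close>

context brownian
begin

text \<open>This is \<open>simple_process_data\<close> without boundedness of the coefficients: the
  Euler coefficients \<open>\<sigma> (E h s j \<omega>)\<close> are unbounded, and they are to be
  compared with the bounded simple processes of the Ito integral.\<close>

definition step_data :: "real \<Rightarrow> nat \<Rightarrow> (nat \<Rightarrow> real) \<Rightarrow> (nat \<Rightarrow> 'w \<Rightarrow> real^'d^'d) \<Rightarrow> bool" where
  "step_data T n \<tau> \<xi> \<longleftrightarrow> \<tau> 0 = 0 \<and> \<tau> n = T \<and> (\<forall>k<n. \<tau> k \<le> \<tau> (Suc k) \<and> \<xi> k \<in> borel_measurable (F (\<tau> k)))"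

lemma step_data_mono: "step_data T n \<tau> \<xi> \<Longrightarrow> i \<le> j \<Longrightarrow> j \<le> n \<Longrightarrow> \<tau> i \<le> \<tau> j"
proof (induction j)
  case (Suc j)
  then show ?case by (cases "i = Suc j") (auto simp: step_data_def less_eq_Suc_le intro: order_trans)
qed simp

lemma step_data_bounds: "step_data T n \<tau> \<xi> \<Longrightarrow> k \<le> n \<Longrightarrow> 0 \<le> \<tau> k \<and> \<tau> k \<le> T"
  using step_data_mono[of T n \<tau> \<xi> 0 k] step_data_mono[of T n \<tau> \<xi> k n] by (auto simp: step_data_def)

lemma simple_process_measurable_pair:
  assumes "step_data T n \<tau> \<xi>"
  shows "(\<lambda>(u, \<omega>). simple_process n \<tau> \<xi> u \<omega>) \<in> borel_measurable (borel \<Otimes>\<^sub>M M)"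
  unfolding simple_process_def case_prod_beta
proof (intro borel_measurable_sum borel_measurable_scaleR)
  fix k assume k: "k \<in> {..<n}"
  show "(\<lambda>z. \<xi> k (snd z)) \<in> borel_measurable (borel \<Otimes>\<^sub>M M)"
    using assms k by (intro measurable_compose[OF measurable_snd] measurable_F[where t="\<tau> k"]) (auto simp: step_data_def)
qed measurable

end

text \<open>Two simple processes with different partitions are subtracted by interpreting this
  locale twice with the same \<open>p\<close>. The original points may repeat; those of
  \<open>p\<close> do not.\<close>

locale step_grid = brownian M B for M :: "'w measure" and B :: "real \<Rightarrow> 'w \<Rightarrow> real^'d::finite" +
  fixes T :: real and n :: nat and \<tau> :: "nat \<Rightarrow> real" and \<xi> :: "nat \<Rightarrow> 'w \<Rightarrow> real^'d^'d"
    and p :: "nat \<Rightarrow> real" and N :: nat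
  assumes step: "step_data T n \<tau> \<xi>"
    and p: "p 0 = 0" "p N = T" "\<And>i j. i < j \<Longrightarrow> j \<le> N \<Longrightarrow> p i < p j"
    and refines: "\<And>k. k \<le> n \<Longrightarrow> \<tau> k \<in> p ` {..N}"
begin

lemma p_less_iff: "i \<le> N \<Longrightarrow> j \<le> N \<Longrightarrow> p i < p j \<longleftrightarrow> i < j"
  using p(3)[of i j] p(3)[of j i] by (cases i j rule: linorder_cases) auto

text \<open>No partition point lies strictly inside a cell of the refining grid.\<close>

lemma tau_less_iff:
  assumes "k \<le> n" "j < N" "p j < u" "u \<le> p (Suc j)"
  shows "\<tau> k < u \<longleftrightarrow> \<tau> k \<le> p j" "u \<le> \<tau> k \<longleftrightarrow> p (Suc j) \<le> \<tau> k"
proof -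
  obtain a where a: "a \<le> N" "\<tau> k = p a" using refines[OF assms(1)] by auto
  have "p a \<le> p j" if "a \<le> j" using p_less_iff[of j a] that assms(2) a by auto
  moreover have "p (Suc j) \<le> p a" if "\<not> a \<le> j" using p_less_iff[of a "Suc j"] that assms(2) a by auto
  ultimately show "\<tau> k < u \<longleftrightarrow> \<tau> k \<le> p j" "u \<le> \<tau> k \<longleftrightarrow> p (Suc j) \<le> \<tau> k"
    using assms(3,4) a by (cases "a \<le> j"; force)+
qed

lemma simple_process_const:
  assumes "j < N" "p j < u" "u \<le> p (Suc j)"
  shows "simple_process n \<tau> \<xi> u \<omega> = simple_process n \<tau> \<xi> (p (Suc j)) \<omega>"
  unfolding simple_process_def
proof (intro sum.cong refl)
  fix k assume "k \<in> {..<n}"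
  then have "k \<le> n" "Suc k \<le> n" by auto
  from tau_less_iff[OF this(1) assms] tau_less_iff[OF this(2) assms]
    tau_less_iff[OF this(1), of j "p (Suc j)"] tau_less_iff[OF this(2), of j "p (Suc j)"]
  show "indicator {\<tau> k<..\<tau> (Suc k)} u *\<^sub>R \<xi> k \<omega> = indicator {\<tau> k<..\<tau> (Suc k)} (p (Suc j)) *\<^sub>R \<xi> k \<omega>"
    using assms by (auto simp: indicator_def)
qed

text \<open>Read at its right end, the value on a cell is already known at the left end: a
  coefficient active there starts at some \<open>\<tau> k\<close> below \<open>p (Suc j)\<close>,
  hence at or before \<open>p j\<close>.\<close>

lemma simple_process_adapted:
  assumes j: "j < N"
  shows "simple_process n \<tau> \<xi> (p (Suc j)) \<in> borel_measurable (F (p j))"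
proof -
  have "(\<lambda>\<omega>. indicator {\<tau> k<..\<tau> (Suc k)} (p (Suc j)) *\<^sub>R \<xi> k \<omega>) \<in> borel_measurable (F (p j))" if k: "k < n" for k
  proof (cases "\<tau> k < p (Suc j)")
    case True
    then have "\<tau> k \<le> p j"
      using tau_less_iff(1)[of k j "p (Suc j)"] k j p_less_iff[of j "Suc j"] by auto
    then have "\<xi> k \<in> borel_measurable (F (p j))"
      using measurable_F_mono[of "\<xi> k" "\<tau> k" borel "p j"] step k by (auto simp: step_data_def)
    then show ?thesis by simp
  qed (simp add: indicator_def)
  then have "(\<lambda>\<omega>. \<Sum>k<n. indicator {\<tau> k<..\<tau> (Suc k)} (p (Suc j)) *\<^sub>R \<xi> k \<omega>) \<in> borel_measurable (F (p j))"
    by (intro borel_measurable_sum) auto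
  then show ?thesis by (simp add: simple_process_def[abs_def])
qed

text \<open>The increments over the cells inside \<open>(\<tau> k, \<tau> (Suc k)]\<close>
  telescope, so refinement does not change the integral.\<close>

lemma simple_integral_grid:
  "simple_integral B n \<tau> \<xi> \<omega> =
    (\<Sum>j<N. simple_process n \<tau> \<xi> (p (Suc j)) \<omega> *v (B (p (Suc j)) \<omega> - B (p j) \<omega>))"
proof -
  let ?d = "\<lambda>j. B (p (Suc j)) \<omega> - B (p j) \<omega>"
  have tel: "(\<Sum>j<N. indicator {\<tau> k<..\<tau> (Suc k)} (p (Suc j)) *\<^sub>R ?d j) = B (\<tau> (Suc k)) \<omega> - B (\<tau> k) \<omega>"
    if k: "k < n" for k
  proof -
    obtain a where a: "a \<le> N" "\<tau> k = p a" using refines[of k] k by auto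
    obtain b where b: "b \<le> N" "\<tau> (Suc k) = p b" using refines[of "Suc k"] k by auto
    have ab: "a \<le> b" using step k a b p_less_iff[of b a] by (force simp: step_data_def)
    have "(\<Sum>j<N. indicator {\<tau> k<..\<tau> (Suc k)} (p (Suc j)) *\<^sub>R ?d j) = (\<Sum>j<N. if j \<in> {a..<b} then ?d j else 0)"
    proof (intro sum.cong refl)
      fix j assume "j \<in> {..<N}"
      then have "p a < p (Suc j) \<longleftrightarrow> a \<le> j" "p (Suc j) \<le> p b \<longleftrightarrow> j < b"
        using p_less_iff[of a "Suc j"] p_less_iff[of b "Suc j"] a b by auto
      then show "indicator {\<tau> k<..\<tau> (Suc k)} (p (Suc j)) *\<^sub>R ?d j = (if j \<in> {a..<b} then ?d j else 0)"
        by (auto simp: a b indicator_def)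
    qed
    also have "\<dots> = (\<Sum>j\<in>{..<N} \<inter> {a..<b}. ?d j)"
      by (subst sum.inter_restrict) auto
    also have "{..<N} \<inter> {a..<b} = {a..<b}" using b by auto
    also have "(\<Sum>j=a..<b. ?d j) = B (p b) \<omega> - B (p a) \<omega>"
      by (rule sum_Suc_diff'[OF ab])
    finally show ?thesis by (simp add: a b)
  qed
  have add: "(\<Sum>i\<in>I. f i) *v x = (\<Sum>i\<in>I. f i *v x)" if "finite I" for I and f :: "nat \<Rightarrow> real^'d^'d" and x
    using that by (induction I) (auto simp: matrix_vector_mult_add_rdistrib)
  have add2: "A *v (\<Sum>i\<in>I. f i) = (\<Sum>i\<in>I. A *v f i)" if "finite I" for I and f :: "nat \<Rightarrow> real^'d" and A :: "real^'d^'d"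
    using that by (induction I) (auto simp: matrix_vector_right_distrib)
  have "(\<Sum>j<N. simple_process n \<tau> \<xi> (p (Suc j)) \<omega> *v ?d j) =
      (\<Sum>j<N. \<Sum>k<n. \<xi> k \<omega> *v (indicator {\<tau> k<..\<tau> (Suc k)} (p (Suc j)) *\<^sub>R ?d j))"
    unfolding simple_process_def by (simp add: add scaleR_matrix_vector_assoc[symmetric] matrix_vector_mult_scaleR)
  also have "\<dots> = (\<Sum>k<n. \<Sum>j<N. \<xi> k \<omega> *v (indicator {\<tau> k<..\<tau> (Suc k)} (p (Suc j)) *\<^sub>R ?d j))"
    by (rule sum.swap)
  also have "\<dots> = (\<Sum>k<n. \<xi> k \<omega> *v (B (\<tau> (Suc k)) \<omega> - B (\<tau> k) \<omega>))"
    by (intro sum.cong refl) (simp only: add2[OF finite_lessThan, symmetric] tel lessThan_iff)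
  finally show ?thesis by (simp add: simple_integral_def)
qed

end

section \<open>The isometry up to a predictable stopping\<close>

context brownian
begin

text \<open>Replace \<open>z\<close> by the coefficient that is set to zero once \<open>A k\<close>
  fails or the accumulated energy \<open>Q\<close> exceeds \<open>c\<close>. The truncated
  coefficients are bounded, so the isometry applies to them, and on the event in the indicator
  nothing has been truncated.\<close>

lemma truncated_isometry:
  fixes z :: "nat \<Rightarrow> 'w \<Rightarrow> real^'d^'d"
  assumes p0: "0 \<le> p 0" and p: "\<And>k. k < N \<Longrightarrow> p k < p (Suc k)"
    and z: "\<And>k. k < N \<Longrightarrow> z k \<in> borel_measurable (F (p k))"
    and A: "\<And>k. k < N \<Longrightarrow> A k \<in> sets (F (p k))"
    and c: "0 < c"
  defines "Q \<equiv> \<lambda>n \<omega>. \<Sum>k<n. if \<omega> \<in> A k then (p (Suc k) - p k) * (norm (z k \<omega>))\<^sup>2 else 0"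
  shows "(\<integral>\<^sup>+\<omega>. indicator {\<omega> \<in> space M. (\<forall>k<N. \<omega> \<in> A k) \<and> Q N \<omega> \<le> c} \<omega> *
      ennreal ((norm (\<Sum>k<N. z k \<omega> *v (B (p (Suc k)) \<omega> - B (p k) \<omega>)))\<^sup>2) \<partial>M)
    \<le> (\<integral>\<^sup>+\<omega>. min (ennreal c) (ennreal (Q N \<omega>)) \<partial>M)"
proof -
  let ?d = "\<lambda>k. p (Suc k) - p k" and ?B = "\<lambda>k \<omega>. B (p (Suc k)) \<omega> - B (p k) \<omega>"
  have mono_p: "p i \<le> p j" if "i \<le> j" "j \<le> N" for i j
    using that
  proof (induction j)
    case (Suc j)
    then show ?case using p[of j] by (cases "i = Suc j") auto
  qed simp
  \<comment> \<open>Using \<open>Q (Suc k)\<close>, the energy including the current cell, is still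
    adapted, because \<open>z k\<close> is known at \<open>p k\<close>; it keeps the total energy of
    \<open>Z\<close> at most \<open>c\<close>.\<close>
  define Z where "Z k \<omega> = (if \<omega> \<in> A k \<and> Q (Suc k) \<omega> \<le> c then z k \<omega> else 0)" for k \<omega>
  have Q_mono: "Q i \<omega> \<le> Q j \<omega>" if "i \<le> j" "j \<le> N" for i j \<omega>
    unfolding Q_def using that p by (intro sum_mono2) (auto intro!: mult_nonneg_nonneg simp: less_imp_le)
  have Q0: "0 \<le> Q i \<omega>" if "i \<le> N" for i \<omega> using Q_mono[of 0 i \<omega>] that by (simp add: Q_def)
  have Q_meas: "Q n \<in> borel_measurable (F (p k))" if "n \<le> Suc k" "k < N" for n k
    unfolding Q_def
  proof (intro borel_measurable_sum)
    fix i assume "i \<in> {..<n}"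
    then have i: "i < N" "p i \<le> p k" using that mono_p[of i k] by auto
    note [measurable] = measurable_F_mono[OF z[OF i(1)] i(2)] sets_F_mono[OF A[OF i(1)] i(2)]
    show "(\<lambda>\<omega>. if \<omega> \<in> A i then ?d i * (norm (z i \<omega>))\<^sup>2 else 0) \<in> borel_measurable (F (p k))"
      by measurable
  qed
  have Z_meas: "Z k \<in> borel_measurable (F (p k))" if "k < N" for k
  proof -
    note [measurable] = z[OF that] A[OF that] Q_meas[OF order_refl that]
    show ?thesis unfolding Z_def[abs_def] by measurable
  qed
  \<comment> \<open>A coefficient that survives contributes at most \<open>c\<close> to
    \<open>Q\<close> over its own cell, which bounds its norm by the cell length.\<close>
  have Z_bound: "norm (Z k \<omega>) \<le> sqrt (c / ?d k)" if k: "k < N" for k \<omega>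
  proof (cases "\<omega> \<in> A k \<and> Q (Suc k) \<omega> \<le> c")
    case True
    have "Q (Suc k) \<omega> = Q k \<omega> + ?d k * (norm (z k \<omega>))\<^sup>2" using True by (simp add: Q_def)
    then have "?d k * (norm (z k \<omega>))\<^sup>2 \<le> c" using True Q0[of k \<omega>] k by simp
    then have "(norm (z k \<omega>))\<^sup>2 \<le> c / ?d k" using p[OF k] by (simp add: field_simps)
    then show ?thesis using True by (simp add: Z_def real_le_rsqrt)
  next
    case False
    then show ?thesis using p[OF k] c by (simp only: Z_def) (simp add: less_imp_le)
  qed
  note Zm [measurable] = measurable_F[OF Z_meas]
  have iso: "has_bochner_integral M (\<lambda>\<omega>. (norm (\<Sum>k<N. Z k \<omega> *v ?B k \<omega>))\<^sup>2)
      (\<Sum>k<N. ?d k * expectation (\<lambda>\<omega>. (norm (Z k \<omega>))\<^sup>2))"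
    by (rule discrete_isometry[OF p0 p Z_meas Z_bound])
  have Zint: "integrable M (\<lambda>\<omega>. (norm (Z k \<omega>))\<^sup>2)" if "k < N" for k
  proof (rule integrable_const_bound)
    show "AE \<omega> in M. norm ((norm (Z k \<omega>))\<^sup>2) \<le> (sqrt (c / ?d k))\<^sup>2"
      using Z_bound[OF that] by (intro AE_I2) (simp add: power_mono)
  qed (use that in measurable)
  \<comment> \<open>If the last coefficient survives, the energy is at most the current
    \<open>Q\<close>, itself at most \<open>c\<close>; otherwise the last term vanishes and
    \<open>Q\<close> can only have grown.\<close>
  have bound: "(\<Sum>k<n. ?d k * (norm (Z k \<omega>))\<^sup>2) \<le> min c (Q n \<omega>)" if "n \<le> N" for n \<omega>
    using that
  proof (induction n)
    case (Suc n)
    then have n: "n < N" by simp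
    show ?case
    proof (cases "\<omega> \<in> A n \<and> Q (Suc n) \<omega> \<le> c")
      case True
      then have "(\<Sum>k<Suc n. ?d k * (norm (Z k \<omega>))\<^sup>2) \<le> Q (Suc n) \<omega>"
        using Suc by (simp add: Q_def Z_def)
      with True show ?thesis by simp
    next
      case False
      then have "Z n \<omega> = 0" by (auto simp: Z_def)
      then show ?thesis using Suc Q_mono[of n "Suc n" \<omega>] by simp
    qed
  qed (use c in \<open>simp add: Q_def\<close>)
  have "(\<integral>\<^sup>+\<omega>. indicator {\<omega> \<in> space M. (\<forall>k<N. \<omega> \<in> A k) \<and> Q N \<omega> \<le> c} \<omega> *
      ennreal ((norm (\<Sum>k<N. z k \<omega> *v ?B k \<omega>))\<^sup>2) \<partial>M)
    \<le> (\<integral>\<^sup>+\<omega>. ennreal ((norm (\<Sum>k<N. Z k \<omega> *v ?B k \<omega>))\<^sup>2) \<partial>M)"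
  proof (intro nn_integral_mono)
    fix \<omega> assume "\<omega> \<in> space M"
    show "indicator {\<omega> \<in> space M. (\<forall>k<N. \<omega> \<in> A k) \<and> Q N \<omega> \<le> c} \<omega> *
        ennreal ((norm (\<Sum>k<N. z k \<omega> *v ?B k \<omega>))\<^sup>2) \<le> ennreal ((norm (\<Sum>k<N. Z k \<omega> *v ?B k \<omega>))\<^sup>2)"
    proof (cases "(\<forall>k<N. \<omega> \<in> A k) \<and> Q N \<omega> \<le> c")
      case True
      then have "Z k \<omega> = z k \<omega>" if "k < N" for k
        using that Q_mono[of "Suc k" N \<omega>] by (auto simp: Z_def)
      then show ?thesis by (simp add: indicator_def)
    qed (auto simp: indicator_def)
  qed
  also have "\<dots> = ennreal (\<Sum>k<N. ?d k * expectation (\<lambda>\<omega>. (norm (Z k \<omega>))\<^sup>2))"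
    using iso by (subst nn_integral_eq_integral) (auto simp: has_bochner_integral_iff)
  also have "(\<Sum>k<N. ?d k * expectation (\<lambda>\<omega>. (norm (Z k \<omega>))\<^sup>2)) = expectation (\<lambda>\<omega>. \<Sum>k<N. ?d k * (norm (Z k \<omega>))\<^sup>2)"
    using Zint by (subst Bochner_Integration.integral_sum) auto
  also have "ennreal \<dots> = (\<integral>\<^sup>+\<omega>. ennreal (\<Sum>k<N. ?d k * (norm (Z k \<omega>))\<^sup>2) \<partial>M)"
    using Zint p by (intro nn_integral_eq_integral[symmetric]) (auto intro!: sum_nonneg simp: less_imp_le)
  also have "\<dots> \<le> (\<integral>\<^sup>+\<omega>. min (ennreal c) (ennreal (Q N \<omega>)) \<partial>M)"
    using bound[OF order_refl] by (intro nn_integral_mono) (auto simp: ennreal_leI)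
  finally show ?thesis .
qed

text \<open>On a grid the stopping event is tested at the left end \<open>p k\<close> of a cell,
  while the time integral would test it at \<open>u\<close>. A mesh of at most \<delta> puts
  \<open>A (p k)\<close> inside \<open>A (max 0 (u - \<delta>))\<close>; the delay \<delta> is
  removed later by letting it tend to zero.\<close>

lemma simple_integral_truncated_bound:
  assumes T: "0 \<le> T" and \<xi>: "step_data T n \<tau> \<xi>" and \<eta>: "step_data T n' \<tau>' \<eta>"
    and A: "\<And>u. 0 \<le> u \<Longrightarrow> A u \<in> sets (F u)" and A_anti: "\<And>u v. 0 \<le> u \<Longrightarrow> u \<le> v \<Longrightarrow> A v \<subseteq> A u"
    and c: "0 < c" and \<delta>: "0 < \<delta>"
  defines "W \<equiv> \<lambda>\<omega>. \<integral>\<^sup>+u. indicator {0..T} u * indicator (A (max 0 (u - \<delta>))) \<omega> *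
      ennreal ((norm (simple_process n \<tau> \<xi> u \<omega> - simple_process n' \<tau>' \<eta> u \<omega>))\<^sup>2) \<partial>lborel"
  shows "(\<integral>\<^sup>+\<omega>. indicator {\<omega> \<in> A T. W \<omega> \<le> ennreal c} \<omega> *
        ennreal ((norm (simple_integral B n \<tau> \<xi> \<omega> - simple_integral B n' \<tau>' \<eta> \<omega>))\<^sup>2) \<partial>M)
     \<le> (\<integral>\<^sup>+\<omega>. min (ennreal c) (W \<omega>) \<partial>M)"
proof -
  \<comment> \<open>The grid refines both partitions, and the multiples of \<delta> bound its
    mesh.\<close>
  define S where "S = \<tau> ` {..n} \<union> \<tau>' ` {..n'} \<union> (\<lambda>i. min T (real i * \<delta>)) ` {..nat \<lceil>T / \<delta>\<rceil>}"
  have S: "finite S" "S \<subseteq> {0..T}" "0 \<in> S" "T \<in> S"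
  proof -
    show "finite S" by (simp add: S_def)
    show "S \<subseteq> {0..T}"
      using step_data_bounds[OF \<xi>] step_data_bounds[OF \<eta>] T \<delta> by (auto simp: S_def)
    have "0 = \<tau> 0" "T = \<tau> n" using \<xi> by (auto simp: step_data_def)
    then show "0 \<in> S" "T \<in> S" unfolding S_def by blast+
  qed
  from finite_grid_enumeration[OF S] obtain p :: "nat \<Rightarrow> real" and N where
    "p 0 = 0 \<and> p N = T \<and> (\<forall>i j. i < j \<longrightarrow> j \<le> N \<longrightarrow> p i < p j) \<and> p ` {..N} = S"
    by (elim exE)
  then have p: "p 0 = 0" "p N = T" "\<And>i j. i < j \<Longrightarrow> j \<le> N \<Longrightarrow> p i < p j" "p ` {..N} = S"
    by simp_all
  interpret g1: step_grid M B T n \<tau> \<xi> p N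
    using \<xi> p by unfold_locales (auto simp: S_def)
  interpret g2: step_grid M B T n' \<tau>' \<eta> p N
    using \<eta> p by unfold_locales (auto simp: S_def)
  have p_nonneg: "0 \<le> p k" "p k \<le> T" if "k \<le> N" for k
    using that p(4) S(2) by auto
  \<comment> \<open>The largest multiple of \<delta> strictly below \<open>u\<close> is a grid
    point, so the left end of the cell of \<open>u\<close> is no smaller.\<close>
  have mesh: "u - \<delta> \<le> p k" if k: "k < N" and u: "p k < u" "u \<le> p (Suc k)" for k u
  proof -
    have u0: "0 < u" "u \<le> T" using u p_nonneg[of k] p_nonneg[of "Suc k"] k by auto
    define i where "i = nat (\<lceil>u / \<delta>\<rceil> - 1)"
    have "0 < u / \<delta>" using u0 \<delta> by simp
    then have "1 \<le> \<lceil>u / \<delta>\<rceil>" by linarith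
    then have ir: "real i = real_of_int \<lceil>u / \<delta>\<rceil> - 1" by (simp add: i_def)
    then have "u / \<delta> - 1 \<le> real i" "real i < u / \<delta>" by linarith+
    then have i: "u - \<delta> \<le> real i * \<delta>" "real i * \<delta> < u" using \<delta> by (simp_all add: field_simps)
    have "\<lceil>u / \<delta>\<rceil> \<le> \<lceil>T / \<delta>\<rceil>" using u0 \<delta> by (intro ceiling_mono divide_right_mono) auto
    then have "i \<le> nat \<lceil>T / \<delta>\<rceil>" unfolding i_def by linarith
    moreover have "min T (real i * \<delta>) = real i * \<delta>" using i(2) u0 by simp
    ultimately have "real i * \<delta> \<in> S" by (force simp: S_def)
    then obtain a where a: "a \<le> N" "p a = real i * \<delta>" using p(4) by auto
    have "a < Suc k" using g1.p_less_iff[of a "Suc k"] a i u k by auto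
    then have "p a \<le> p k" using g1.p_less_iff[of k a] a k by auto
    then show ?thesis using a i by simp
  qed
  let ?X = "\<lambda>u \<omega>. simple_process n \<tau> \<xi> u \<omega> - simple_process n' \<tau>' \<eta> u \<omega>"
  let ?Q = "\<lambda>\<omega>. \<Sum>k<N. if \<omega> \<in> A (p k) then (p (Suc k) - p k) * (norm (?X (p (Suc k)) \<omega>))\<^sup>2 else 0"
  \<comment> \<open>The discrete energy is the integral of a step function dominated by the
    integrand of \<open>W\<close>; at each \<open>u\<close> at most one cell contributes.\<close>
  have QW: "ennreal (?Q \<omega>) \<le> W \<omega>" for \<omega>
  proof -
    let ?f = "\<lambda>k. if \<omega> \<in> A (p k) then ennreal ((norm (?X (p (Suc k)) \<omega>))\<^sup>2) else 0"
    have "ennreal (?Q \<omega>) = (\<Sum>k<N. ?f k * ennreal (p (Suc k) - p k))"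
      using p(3) by (subst sum_ennreal[symmetric])
        (auto intro!: mult_nonneg_nonneg sum.cong simp: less_imp_le ennreal_mult mult.commute)
    also have "\<dots> = (\<Sum>k<N. \<integral>\<^sup>+u. ?f k * indicator {p k<..p (Suc k)} u \<partial>lborel)"
      using p(3) by (intro sum.cong refl) (subst nn_integral_cmult_indicator, auto simp: less_imp_le)
    also have "\<dots> = (\<integral>\<^sup>+u. (\<Sum>k<N. ?f k * indicator {p k<..p (Suc k)} u) \<partial>lborel)"
      by (intro nn_integral_sum[symmetric]) measurable
    also have "\<dots> \<le> W \<omega>"
      unfolding W_def
    proof (intro nn_integral_mono)
      fix u
      show "(\<Sum>k<N. ?f k * indicator {p k<..p (Suc k)} u) \<le> indicator {0..T} u * indicator (A (max 0 (u - \<delta>))) \<omega> *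
          ennreal ((norm (?X u \<omega>))\<^sup>2)"
      proof (cases "\<exists>K<N. u \<in> {p K<..p (Suc K)}")
        case True
        then obtain K where K: "K < N" "p K < u" "u \<le> p (Suc K)" by auto
        have "indicator {p k<..p (Suc k)} u = (if k = K then 1 else 0 :: ennreal)" if "k < N" for k
        proof (cases "k = K")
          case False
          then have "k < K \<and> p (Suc k) \<le> p K \<or> K < k \<and> p (Suc K) \<le> p k"
            using that K g1.p_less_iff[of K "Suc k"] g1.p_less_iff[of k "Suc K"] by (cases k K rule: linorder_cases) auto
          then show ?thesis using K False by (auto simp: indicator_def)
        qed (use K in auto)
        then have "(\<Sum>k<N. ?f k * indicator {p k<..p (Suc k)} u) = (\<Sum>k<N. if k = K then ?f k else 0)"
          by (intro sum.cong) auto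
        also have "\<dots> = ?f K" using K by simp
        also have "\<dots> \<le> indicator {0..T} u * indicator (A (max 0 (u - \<delta>))) \<omega> * ennreal ((norm (?X u \<omega>))\<^sup>2)"
        proof (cases "\<omega> \<in> A (p K)")
          case True
          have "max 0 (u - \<delta>) \<le> p K" using mesh[OF K] p_nonneg[of K] K by auto
          then have "\<omega> \<in> A (max 0 (u - \<delta>))" using A_anti[of "max 0 (u - \<delta>)" "p K"] True by auto
          moreover have "u \<in> {0..T}" using K p_nonneg[of K] p_nonneg[of "Suc K"] by auto
          ultimately show ?thesis
            using True K by (simp add: g1.simple_process_const[OF K] g2.simple_process_const[OF K])
        qed simp
        finally show ?thesis .
      next
        case False
        then have "(\<Sum>k<N. ?f k * indicator {p k<..p (Suc k)} u) = 0"
          by (intro sum.neutral) (auto simp: indicator_def)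
        then show ?thesis by simp
      qed
    qed
    finally show ?thesis .
  qed
  have SI: "simple_integral B n \<tau> \<xi> \<omega> - simple_integral B n' \<tau>' \<eta> \<omega> =
     (\<Sum>k<N. ?X (p (Suc k)) \<omega> *v (B (p (Suc k)) \<omega> - B (p k) \<omega>))" for \<omega>
    by (simp add: g1.simple_integral_grid g2.simple_integral_grid matrix_vector_mult_diff_rdistrib sum_subtractf)
  have "(\<integral>\<^sup>+\<omega>. indicator {\<omega> \<in> A T. W \<omega> \<le> ennreal c} \<omega> *
        ennreal ((norm (simple_integral B n \<tau> \<xi> \<omega> - simple_integral B n' \<tau>' \<eta> \<omega>))\<^sup>2) \<partial>M) \<le>
     (\<integral>\<^sup>+\<omega>. indicator {\<omega> \<in> space M. (\<forall>k<N. \<omega> \<in> A (p k)) \<and> ?Q \<omega> \<le> c} \<omega> *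
      ennreal ((norm (\<Sum>k<N. ?X (p (Suc k)) \<omega> *v (B (p (Suc k)) \<omega> - B (p k) \<omega>)))\<^sup>2) \<partial>M)"
  proof (unfold SI, intro nn_integral_mono mult_right_mono)
    fix \<omega> assume "\<omega> \<in> space M"
    have "\<omega> \<in> A (p k)" if "\<omega> \<in> A T" "k < N" for k
      using A_anti[of "p k" T] p_nonneg[of k] that by auto
    moreover have "?Q \<omega> \<le> c" if "W \<omega> \<le> ennreal c"
      using order_trans[OF QW that] c by (simp add: ennreal_le_iff)
    ultimately show "indicator {\<omega> \<in> A T. W \<omega> \<le> ennreal c} \<omega> \<le> (indicator {\<omega> \<in> space M. (\<forall>k<N. \<omega> \<in> A (p k)) \<and> ?Q \<omega> \<le> c} \<omega> :: ennreal)"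
      using \<open>\<omega> \<in> space M\<close> by (auto simp: indicator_def)
  qed simp
  also have "\<dots> \<le> (\<integral>\<^sup>+\<omega>. min (ennreal c) (ennreal (?Q \<omega>)) \<partial>M)"
  proof (rule truncated_isometry[OF _ _ _ _ c])
    show "0 \<le> p 0" using p by simp
    fix k assume k: "k < N"
    show "p k < p (Suc k)" using p(3)[of k "Suc k"] k by simp
    show "?X (p (Suc k)) \<in> borel_measurable (F (p k))"
      using g1.simple_process_adapted[OF k] g2.simple_process_adapted[OF k] by simp
    show "A (p k) \<in> sets (F (p k))" using A p_nonneg[of k] k by simp
  qed
  also have "\<dots> \<le> (\<integral>\<^sup>+\<omega>. min (ennreal c) (W \<omega>) \<partial>M)"
    using QW by (intro nn_integral_mono min.mono) auto
  finally show ?thesis .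
qed

end

subsection \<open>A localised Ito inequality\<close>

lemma borel_measurable_nn_integral_lborel_fst:
  fixes g :: "real \<Rightarrow> 'a \<Rightarrow> ennreal"
  assumes "(\<lambda>(u, \<omega>). g u \<omega>) \<in> borel_measurable (borel \<Otimes>\<^sub>M M)"
  shows "(\<lambda>\<omega>. \<integral>\<^sup>+u. g u \<omega> \<partial>lborel) \<in> borel_measurable M"
proof (rule lborel.borel_measurable_nn_integral)
  have "(\<lambda>(\<omega>, u). (u, \<omega>)) \<in> measurable (M \<Otimes>\<^sub>M lborel) (borel \<Otimes>\<^sub>M M)"
    by measurable
  from measurable_compose[OF this assms]
  show "case_prod (\<lambda>\<omega> u. g u \<omega>) \<in> borel_measurable (M \<Otimes>\<^sub>M lborel)"
    by (simp add: case_prod_beta)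
qed

lemma pair_section_measurable:
  fixes f :: "real \<Rightarrow> 'a \<Rightarrow> ennreal"
  assumes "(\<lambda>(u, \<omega>). f u \<omega>) \<in> borel_measurable (borel \<Otimes>\<^sub>M M)" "\<omega> \<in> space M"
  shows "(\<lambda>u. f u \<omega>) \<in> borel_measurable borel"
proof -
  have "(\<lambda>u. (u, \<omega>)) \<in> measurable borel (borel \<Otimes>\<^sub>M M)" using assms(2) by measurable
  from measurable_compose[OF this assms(1)] show ?thesis by simp
qed

lemma norm_diff_sq_le:
  fixes a b c :: "'a::real_normed_vector"
  shows "(norm (a - c))\<^sup>2 \<le> 2 * (norm (a - b))\<^sup>2 + 2 * (norm (b - c))\<^sup>2"
proof -
  have "norm (a - c) \<le> norm (a - b) + norm (b - c)"
    using norm_triangle_ineq[of "a - b" "b - c"] by simp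
  then have "(norm (a - c))\<^sup>2 \<le> (norm (a - b) + norm (b - c))\<^sup>2"
    by (intro power_mono) auto
  also have "\<dots> \<le> 2 * (norm (a - b))\<^sup>2 + 2 * (norm (b - c))\<^sup>2"
    using sum_squares_bound[of "norm (a - b)" "norm (b - c)"] by (simp add: power2_sum)
  finally show ?thesis .
qed

context brownian
begin

text \<open>Progressive measurability speaks only of times in \<open>{0..T}\<close>; clamping the
  time turns it into joint measurability on the whole line.\<close>

lemma progressive_measurable_pair:
  assumes T: "0 \<le> T" and H: "progressive_on F T H"
  shows "(\<lambda>(u, \<omega>). H (max 0 (min u T)) \<omega>) \<in> borel_measurable (borel \<Otimes>\<^sub>M M)"
proof -
  have [measurable]: "(\<lambda>\<omega>. \<omega>) \<in> measurable M (F T)"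
    by (rule measurable_F[where t=T]) simp
  have 1: "(\<lambda>(u, \<omega>). (max 0 (min u T), \<omega>)) \<in> measurable (borel \<Otimes>\<^sub>M M) (restrict_space borel {0..T} \<Otimes>\<^sub>M F T)"
    unfolding case_prod_beta using T
    by (intro measurable_Pair measurable_restrict_space2) (auto intro: measurable_compose[OF measurable_snd])
  have 2: "(\<lambda>(u, \<omega>). H u \<omega>) \<in> borel_measurable (restrict_space borel {0..T} \<Otimes>\<^sub>M F T)"
    using H T by (auto simp: progressive_on_def)
  from measurable_compose[OF 1 2] show ?thesis
    by (simp add: case_prod_beta)
qed

text \<open>\<open>A u\<close> is the event that some (predictable) stopping has not yet occurred at time \<open>u\<close>; these
  families replace stopping times, so that no stopped stochastic integral has to be defined.\<close>

definition stopping_family :: "(real \<Rightarrow> 'w set) \<Rightarrow> bool" where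
  "stopping_family A \<longleftrightarrow>
     (\<forall>u\<ge>0. A u \<in> sets (F u)) \<and> (\<forall>u v. 0 \<le> u \<longrightarrow> u \<le> v \<longrightarrow> A v \<subseteq> A u) \<and>
     (\<forall>u>0. \<forall>\<omega>\<in>space M. \<omega> \<notin> A u \<longrightarrow> (\<exists>v. 0 \<le> v \<and> v < u \<and> \<omega> \<notin> A v))"

lemma stopping_familyD:
  assumes "stopping_family A"
  shows "0 \<le> u \<Longrightarrow> A u \<in> sets (F u)" and "0 \<le> u \<Longrightarrow> u \<le> v \<Longrightarrow> A v \<subseteq> A u"
    and "0 < u \<Longrightarrow> \<omega> \<in> space M \<Longrightarrow> \<omega> \<notin> A u \<Longrightarrow> \<exists>v. 0 \<le> v \<and> v < u \<and> \<omega> \<notin> A v"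
  using assms by (auto simp: stopping_family_def)

text \<open>Each path of the indicator is eventually constant from the left, by monotonicity on the
  event and by the left-closure clause of \<open>stopping_family\<close> off it. The second claim
  later removes the delay \<delta>.\<close>

lemma stopping_indicator_measurable_pair:
  assumes sf: "stopping_family A"
  shows "(\<lambda>(u, \<omega>). indicator (A (max 0 u)) \<omega> :: real) \<in> borel_measurable (borel \<Otimes>\<^sub>M M)"
    and "\<And>u \<omega>. 0 < u \<Longrightarrow> \<omega> \<in> space M \<Longrightarrow> \<forall>\<^sub>F s in at_left u. indicator (A (max 0 s)) \<omega> = (indicator (A u) \<omega> :: real)"
proof -
  note A = stopping_familyD(1)[OF sf] and A_anti = stopping_familyD(2)[OF sf] and A_left = stopping_familyD(3)[OF sf]
  show ev: "\<forall>\<^sub>F s in at_left u. indicator (A (max 0 s)) \<omega> = (indicator (A u) \<omega> :: real)"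
    if u: "0 < u" and \<omega>: "\<omega> \<in> space M" for u \<omega>
  proof (cases "\<omega> \<in> A u")
    case True
    then have "\<omega> \<in> A (max 0 s)" if "s < u" for s
      using A_anti[of "max 0 s" u] u that by auto
    then have "\<forall>s\<in>{u-1<..<u}. indicator (A (max 0 s)) \<omega> = (indicator (A u) \<omega> :: real)"
      using True by simp
    then show ?thesis by (auto intro: eventually_at_leftI[of "u - 1"])
  next
    case False
    then obtain v where v: "0 \<le> v" "v < u" "\<omega> \<notin> A v" using A_left u \<omega> by blast
    then have "\<omega> \<notin> A (max 0 s)" if "v < s" for s
      using A_anti[of v "max 0 s"] that by auto
    then have "indicator (A (max 0 s)) \<omega> = (indicator (A u) \<omega> :: real)" if "s \<in> {v<..<u}" for s
      using False that by simp
    then show ?thesis using v by (intro eventually_at_leftI[of v]) auto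
  qed
  have "(\<lambda>(u, \<omega>). indicator (A (max 0 (max 0 u))) \<omega> :: real) \<in> borel_measurable (borel \<Otimes>\<^sub>M M)"
  proof (rule borel_measurable_pair_left_limit)
    show "indicator (A (max 0 t)) \<in> borel_measurable M" for t
      using sets_F_sub[OF A, of "max 0 t"] by simp
    show "((\<lambda>s. indicator (A (max 0 s)) x) \<longlongrightarrow> (indicator (A (max 0 t)) x :: real)) (at_left t)"
      if "0 < t" "x \<in> space M" for t x
      using ev[OF that] that by (intro tendsto_eventually) (simp add: max_def)
  qed
  then show "(\<lambda>(u, \<omega>). indicator (A (max 0 u)) \<omega> :: real) \<in> borel_measurable (borel \<Otimes>\<^sub>M M)"
    by simp
qed

lemma simple_integral_measurable:
  assumes "step_data T n \<tau> \<xi>"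
  shows "simple_integral B n \<tau> \<xi> \<in> borel_measurable M"
  unfolding simple_integral_def[abs_def]
proof (intro borel_measurable_sum borel_measurable_matrix_vector_mult borel_measurable_diff)
  fix k assume "k \<in> {..<n}"
  then show "\<xi> k \<in> borel_measurable M" "B (\<tau> (Suc k)) \<in> borel_measurable M" "B (\<tau> k) \<in> borel_measurable M"
    using assms step_data_bounds[OF assms, of k] step_data_bounds[OF assms, of "Suc k"]
    by (auto intro: measurable_F simp: step_data_def)
qed

text \<open>Two successive extractions of subsequences turn both convergences in probability into
  almost sure ones along the same approximants.\<close>

lemma has_ito_integral_approx:
  assumes T: "0 \<le> T" and H: "has_ito_integral M B T H I"
  obtains N :: "nat \<Rightarrow> nat" and \<tau> and \<xi>
  where "\<forall>m. step_data T (N m) (\<tau> m) (\<xi> m)"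
    and "AE \<omega> in M. (\<lambda>m. \<integral>\<^sup>+u\<in>{0..T}. ennreal ((norm (simple_process (N m) (\<tau> m) (\<xi> m) u \<omega> - H u \<omega>))\<^sup>2) \<partial>lborel) \<longlonglongrightarrow> 0"
    and "AE \<omega> in M. (\<lambda>m. simple_integral B (N m) (\<tau> m) (\<xi> m) \<omega>) \<longlonglongrightarrow> I \<omega>"
proof -
  obtain N \<tau> \<xi> where sp: "\<And>m. simple_process_data M F T (N m) (\<tau> m) (\<xi> m)"
    and V: "vanishes_in_prob M (\<lambda>m \<omega>. \<integral>\<^sup>+u\<in>{0..T}. ennreal ((norm (simple_process (N m) (\<tau> m) (\<xi> m) u \<omega> - H u \<omega>))\<^sup>2) \<partial>lborel)"
    and D: "vanishes_in_prob M (\<lambda>m \<omega>. ennreal (norm (simple_integral B (N m) (\<tau> m) (\<xi> m) \<omega> - I \<omega>)))"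
    using H unfolding has_ito_integral_def by auto
  have step: "step_data T (N m) (\<tau> m) (\<xi> m)" for m
    using sp[of m] by (auto simp: simple_process_data_def step_data_def)
  have I [measurable]: "I \<in> borel_measurable M" and prog: "progressive_on F T H"
    using H by (auto simp: has_ito_integral_def)
  let ?V = "\<lambda>m \<omega>. \<integral>\<^sup>+u\<in>{0..T}. ennreal ((norm (simple_process (N m) (\<tau> m) (\<xi> m) u \<omega> - H u \<omega>))\<^sup>2) \<partial>lborel"
  let ?D = "\<lambda>m \<omega>. ennreal (norm (simple_integral B (N m) (\<tau> m) (\<xi> m) \<omega> - I \<omega>))"
  have V_meas: "?V m \<in> borel_measurable M" for m
  proof -
    note [measurable] = simple_process_measurable_pair[OF step] progressive_measurable_pair[OF T prog]
    have "(\<lambda>\<omega>. \<integral>\<^sup>+u. ennreal ((norm (simple_process (N m) (\<tau> m) (\<xi> m) u \<omega> - H (max 0 (min u T)) \<omega>))\<^sup>2) * indicator {0..T} u \<partial>lborel)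
      \<in> borel_measurable M"
      by (rule borel_measurable_nn_integral_lborel_fst) measurable
    also have "(\<lambda>\<omega>. \<integral>\<^sup>+u. ennreal ((norm (simple_process (N m) (\<tau> m) (\<xi> m) u \<omega> - H (max 0 (min u T)) \<omega>))\<^sup>2) * indicator {0..T} u \<partial>lborel) = ?V m"
      by (intro ext nn_integral_cong) (auto simp: indicator_def)
    finally show ?thesis .
  qed
  have D_meas: "?D m \<in> borel_measurable M" for m
    using simple_integral_measurable[OF step[of m]] by measurable
  obtain r where r: "filterlim r at_top sequentially" "AE \<omega> in M. (\<lambda>k. ?V (r k) \<omega>) \<longlonglongrightarrow> 0"
    using vanishes_in_prob_subseq_AE[OF prob_space_axioms V V_meas] by auto
  have "vanishes_in_prob M (\<lambda>m. ?D (r m))"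
    using D unfolding vanishes_in_prob_def by (auto intro: filterlim_compose[OF _ r(1)])
  then obtain q where q: "filterlim q at_top sequentially" "AE \<omega> in M. (\<lambda>k. ?D (r (q k)) \<omega>) \<longlonglongrightarrow> 0"
    using vanishes_in_prob_subseq_AE[OF prob_space_axioms _ D_meas] by auto
  show ?thesis
  proof (rule that)
    show "\<forall>m. step_data T (N (r (q m))) (\<tau> (r (q m))) (\<xi> (r (q m)))" by (simp add: step)
    show "AE \<omega> in M. (\<lambda>m. ?V (r (q m)) \<omega>) \<longlonglongrightarrow> 0"
      using r(2) by eventually_elim (rule filterlim_compose[OF _ q(1)])
    show "AE \<omega> in M. (\<lambda>m. simple_integral B (N (r (q m))) (\<tau> (r (q m))) (\<xi> (r (q m))) \<omega>) \<longlonglongrightarrow> I \<omega>"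
      using q(2)
    proof eventually_elim
      case (elim \<omega>)
      have "(\<lambda>k. enn2real (?D (r (q k)) \<omega>)) \<longlonglongrightarrow> enn2real 0"
        using elim by (intro tendsto_enn2real) auto
      then show ?case by (simp add: LIM_zero_iff tendsto_norm_zero_iff)
    qed
  qed
qed

text \<open>The truncated bound for simple integrals is carried to the limit at a fixed level
  \<open>c\<close>, where the right side is dominated by the constant \<open>c\<close>; then
  \<open>c\<close> is sent to infinity. Fatou's lemma serves on the left both times. The factor 2 is
  the price of inserting \<open>H\<close> between the approximant and \<eta>; the Gronwall argument
  tolerates it.\<close>

lemma has_ito_integral_bound:
  assumes T: "0 \<le> T" and H: "has_ito_integral M B T H I" and \<eta>: "step_data T n \<sigma> \<eta>"
    and sf: "stopping_family A"
  shows "(\<integral>\<^sup>+\<omega>. indicator (A T) \<omega> * ennreal ((norm (I \<omega> - simple_integral B n \<sigma> \<eta> \<omega>))\<^sup>2) \<partial>M)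
    \<le> (\<integral>\<^sup>+\<omega>. 2 * (\<integral>\<^sup>+u. indicator {0..T} u * indicator (A u) \<omega> *
           ennreal ((norm (H u \<omega> - simple_process n \<sigma> \<eta> u \<omega>))\<^sup>2) \<partial>lborel) \<partial>M)"
proof -
  note A = stopping_familyD(1)[OF sf] and A_anti = stopping_familyD(2)[OF sf]
  obtain N :: "nat \<Rightarrow> nat" and \<tau> \<xi> where step': "\<forall>m. step_data T (N m) (\<tau> m) (\<xi> m)"
    and V: "AE \<omega> in M. (\<lambda>m. \<integral>\<^sup>+u\<in>{0..T}. ennreal ((norm (simple_process (N m) (\<tau> m) (\<xi> m) u \<omega> - H u \<omega>))\<^sup>2) \<partial>lborel) \<longlonglongrightarrow> 0"
    and S: "AE \<omega> in M. (\<lambda>m. simple_integral B (N m) (\<tau> m) (\<xi> m) \<omega>) \<longlonglongrightarrow> I \<omega>"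
    by (rule has_ito_integral_approx[OF T H]) (rule that)
  from step' have step: "step_data T (N m) (\<tau> m) (\<xi> m)" for m by blast
  have I [measurable]: "I \<in> borel_measurable M" and prog: "progressive_on F T H"
    and H2: "AE \<omega> in M. (\<integral>\<^sup>+u\<in>{0..T}. ennreal ((norm (H u \<omega>))\<^sup>2) \<partial>lborel) < \<infinity>"
    using H by (auto simp: has_ito_integral_def)
  let ?H = "\<lambda>u \<omega>. H (max 0 (min u T)) \<omega>"
  let ?\<eta> = "simple_process n \<sigma> \<eta>" and ?\<xi> = "\<lambda>m. simple_process (N m) (\<tau> m) (\<xi> m)"
  let ?J = "\<lambda>\<delta> u \<omega>. indicator (A (max 0 (u - \<delta>))) \<omega> :: ennreal"
  note H_meas [measurable] = progressive_measurable_pair[OF T prog]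
  note sp_meas [measurable] = simple_process_measurable_pair[OF step] simple_process_measurable_pair[OF \<eta>]
  note SI_meas [measurable] = simple_integral_measurable[OF step] simple_integral_measurable[OF \<eta>]
  note ind = stopping_indicator_measurable_pair[OF sf]
  have J_meas [measurable]: "(\<lambda>(u, \<omega>). ?J \<delta> u \<omega>) \<in> borel_measurable (borel \<Otimes>\<^sub>M M)" for \<delta>
  proof -
    have "(\<lambda>(u, \<omega>). (u - \<delta>, \<omega>)) \<in> measurable (borel \<Otimes>\<^sub>M M) (borel \<Otimes>\<^sub>M M)" by measurable
    from measurable_compose[OF this ind(1)]
    have "(\<lambda>z. ennreal (indicator (A (max 0 (fst z - \<delta>))) (snd z))) \<in> borel_measurable (borel \<Otimes>\<^sub>M M)"
      by (simp add: case_prod_beta)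
    then show ?thesis by (simp add: ennreal_indicator case_prod_beta)
  qed
  define R where "R u \<omega> = indicator {0..T} u * ennreal ((norm (?H u \<omega> - ?\<eta> u \<omega>))\<^sup>2)" for u \<omega>
  have R_meas [measurable]: "(\<lambda>(u, \<omega>). R u \<omega>) \<in> borel_measurable (borel \<Otimes>\<^sub>M M)"
    unfolding R_def by measurable
  define V' where "V' m \<omega> = (\<integral>\<^sup>+u. indicator {0..T} u * ennreal ((norm (?\<xi> m u \<omega> - ?H u \<omega>))\<^sup>2) \<partial>lborel)" for m \<omega>
  have V'_eq: "V' m \<omega> = (\<integral>\<^sup>+u\<in>{0..T}. ennreal ((norm (?\<xi> m u \<omega> - H u \<omega>))\<^sup>2) \<partial>lborel)" for m \<omega>
    unfolding V'_def by (intro nn_integral_cong) (auto simp: indicator_def)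
  \<comment> \<open>\<open>W m\<close> majorises the energy of approximant minus \<eta>, with a
    delay that shrinks as the approximants improve, so a single limit in \<open>m\<close> removes
    both errors.\<close>
  define W where "W m \<omega> = 2 * (\<integral>\<^sup>+u. ?J (inverse (Suc m)) u \<omega> * R u \<omega> \<partial>lborel) + 2 * V' m \<omega>" for m \<omega>
  define Q where "Q \<omega> = (\<integral>\<^sup>+u. ?J 0 u \<omega> * R u \<omega> \<partial>lborel)" for \<omega>
  have W_meas [measurable]: "W m \<in> borel_measurable M" for m
    unfolding W_def[abs_def] V'_def
    by (intro borel_measurable_add borel_measurable_times borel_measurable_const borel_measurable_nn_integral_lborel_fst) measurable
  have Q_meas [measurable]: "Q \<in> borel_measurable M"
    unfolding Q_def[abs_def] by (intro borel_measurable_nn_integral_lborel_fst) measurable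
  have AT [measurable]: "A T \<in> sets M" using sets_F_sub[OF A[OF T]] .
  let ?S = "\<lambda>m \<omega>. simple_integral B (N m) (\<tau> m) (\<xi> m) \<omega> - simple_integral B n \<sigma> \<eta> \<omega>"
  define G where "G c m \<omega> = indicator {\<omega> \<in> A T. W m \<omega> \<le> ennreal c} \<omega> * ennreal ((norm (?S m \<omega>))\<^sup>2)" for c m \<omega>
  have trunc: "(\<integral>\<^sup>+\<omega>. G c m \<omega> \<partial>M) \<le> (\<integral>\<^sup>+\<omega>. min (ennreal c) (W m \<omega>) \<partial>M)" if c: "0 < c" for c m
  proof -
    let ?W = "\<lambda>\<omega>. \<integral>\<^sup>+u. indicator {0..T} u * ?J (inverse (Suc m)) u \<omega> * ennreal ((norm (?\<xi> m u \<omega> - ?\<eta> u \<omega>))\<^sup>2) \<partial>lborel"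
    have le: "?W \<omega> \<le> W m \<omega>" if \<omega>: "\<omega> \<in> space M" for \<omega>
    proof -
      have [measurable]: "(\<lambda>u. ?J (inverse (Suc m)) u \<omega> * R u \<omega>) \<in> borel_measurable borel"
        by (rule pair_section_measurable[OF _ \<omega>]) measurable
      have [measurable]: "(\<lambda>u. indicator {0..T} u * ennreal ((norm (?\<xi> m u \<omega> - ?H u \<omega>))\<^sup>2)) \<in> borel_measurable borel"
        by (rule pair_section_measurable[OF _ \<omega>]) measurable
      have "?W \<omega> \<le> (\<integral>\<^sup>+u. 2 * (?J (inverse (Suc m)) u \<omega> * R u \<omega>) + 2 * (indicator {0..T} u * ennreal ((norm (?\<xi> m u \<omega> - ?H u \<omega>))\<^sup>2)) \<partial>lborel)"
      proof (intro nn_integral_mono)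
        fix u
        have "ennreal ((norm (?\<xi> m u \<omega> - ?\<eta> u \<omega>))\<^sup>2) \<le> 2 * ennreal ((norm (?H u \<omega> - ?\<eta> u \<omega>))\<^sup>2) + 2 * ennreal ((norm (?\<xi> m u \<omega> - ?H u \<omega>))\<^sup>2)"
        proof -
          have "ennreal ((norm (?\<xi> m u \<omega> - ?\<eta> u \<omega>))\<^sup>2) \<le> ennreal (2 * (norm (?H u \<omega> - ?\<eta> u \<omega>))\<^sup>2 + 2 * (norm (?\<xi> m u \<omega> - ?H u \<omega>))\<^sup>2)"
            using norm_diff_sq_le[of "?\<xi> m u \<omega>" "?\<eta> u \<omega>" "?H u \<omega>"] by (intro ennreal_leI) simp
          then show ?thesis by (simp add: ennreal_plus ennreal_mult)
        qed
        then show "indicator {0..T} u * ?J (inverse (Suc m)) u \<omega> * ennreal ((norm (?\<xi> m u \<omega> - ?\<eta> u \<omega>))\<^sup>2)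
           \<le> 2 * (?J (inverse (Suc m)) u \<omega> * R u \<omega>) + 2 * (indicator {0..T} u * ennreal ((norm (?\<xi> m u \<omega> - ?H u \<omega>))\<^sup>2))"
          by (auto simp: R_def indicator_def)
      qed
      also have "\<dots> = W m \<omega>"
      proof -
        have "(\<integral>\<^sup>+u. 2 * f u + 2 * g u \<partial>lborel) = 2 * (\<integral>\<^sup>+u. f u \<partial>lborel) + 2 * (\<integral>\<^sup>+u. g u \<partial>lborel)"
          if "f \<in> borel_measurable borel" "g \<in> borel_measurable borel" for f g :: "real \<Rightarrow> ennreal"
          using that by (simp add: nn_integral_add nn_integral_cmult)
        then show ?thesis unfolding W_def V'_def by this measurable
      qed
      finally show ?thesis .
    qed
    have "(\<integral>\<^sup>+\<omega>. G c m \<omega> \<partial>M) \<le> (\<integral>\<^sup>+\<omega>. indicator {\<omega> \<in> A T. ?W \<omega> \<le> ennreal c} \<omega> * ennreal ((norm (?S m \<omega>))\<^sup>2) \<partial>M)"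
      unfolding G_def using le by (intro nn_integral_mono mult_right_mono) (auto simp: indicator_def intro: order_trans)
    also have "\<dots> \<le> (\<integral>\<^sup>+\<omega>. min (ennreal c) (?W \<omega>) \<partial>M)"
      using T step \<eta> A A_anti c by (intro simple_integral_truncated_bound) auto
    also have "\<dots> \<le> (\<integral>\<^sup>+\<omega>. min (ennreal c) (W m \<omega>) \<partial>M)"
      using le by (intro nn_integral_mono min.mono) auto
    finally show ?thesis .
  qed
  have lim: "AE \<omega> in M. Q \<omega> < \<infinity> \<and> (\<lambda>m. W m \<omega>) \<longlonglongrightarrow> 2 * Q \<omega>"
    using V H2 AE_space
  proof eventually_elim
    case (elim \<omega>)
    have Rm: "(\<lambda>u. R u \<omega>) \<in> borel_measurable borel"
      by (rule pair_section_measurable[OF R_meas elim(3)])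
    have JRm: "(\<lambda>u. ?J \<delta> u \<omega> * R u \<omega>) \<in> borel_measurable borel" for \<delta>
      by (rule pair_section_measurable[OF _ elim(3)]) measurable
    \<comment> \<open>The coefficients of \<eta> need not be bounded in \<omega>, but along a fixed
      \<omega> they are finitely many; hence the energy in \<open>R\<close> is finite almost
      surely.\<close>
    define C where "C = (\<Sum>k<n. norm (\<eta> k \<omega>))"
    have C: "norm (?\<eta> u \<omega>) \<le> C" for u
      unfolding C_def simple_process_def
      by (rule sum_norm_le) (auto simp: indicator_def)
    have "(\<integral>\<^sup>+u. R u \<omega> \<partial>lborel) \<le> (\<integral>\<^sup>+u. 2 * (ennreal ((norm (H u \<omega>))\<^sup>2) * indicator {0..T} u) + ennreal (2 * C\<^sup>2) * indicator {0..T} u \<partial>lborel)"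
    proof (intro nn_integral_mono)
      fix u
      have "(norm (H u \<omega> - ?\<eta> u \<omega>))\<^sup>2 \<le> 2 * (norm (H u \<omega>))\<^sup>2 + 2 * C\<^sup>2"
        using norm_diff_sq_le[of "H u \<omega>" "?\<eta> u \<omega>" 0] power_mono[OF C[of u], of 2] by simp
      then have "ennreal ((norm (H u \<omega> - ?\<eta> u \<omega>))\<^sup>2) \<le> ennreal (2 * (norm (H u \<omega>))\<^sup>2 + 2 * C\<^sup>2)"
        by (rule ennreal_leI)
      then show "R u \<omega> \<le> 2 * (ennreal ((norm (H u \<omega>))\<^sup>2) * indicator {0..T} u) + ennreal (2 * C\<^sup>2) * indicator {0..T} u"
        by (auto simp: R_def indicator_def ennreal_plus ennreal_mult)
    qed
    also have "\<dots> = 2 * (\<integral>\<^sup>+u\<in>{0..T}. ennreal ((norm (H u \<omega>))\<^sup>2) \<partial>lborel) + ennreal (2 * C\<^sup>2) * T"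
    proof -
      have "(\<lambda>u. ennreal ((norm (?H u \<omega>))\<^sup>2) * indicator {0..T} u) \<in> borel_measurable borel"
        by (rule pair_section_measurable[OF _ elim(3)]) measurable
      also have "(\<lambda>u. ennreal ((norm (?H u \<omega>))\<^sup>2) * indicator {0..T} u) = (\<lambda>u. ennreal ((norm (H u \<omega>))\<^sup>2) * indicator {0..T} u)"
        by (auto simp: indicator_def)
      finally show ?thesis using T
        by (subst nn_integral_add) (auto simp: nn_integral_cmult nn_integral_cmult_indicator)
    qed
    also have "\<dots> < \<infinity>"
      using elim(2) by (auto simp: ennreal_mult_less_top ennreal_add_less_top)
    finally have Rfin: "(\<integral>\<^sup>+u. R u \<omega> \<partial>lborel) < \<infinity>" .
    have "Q \<omega> \<le> (\<integral>\<^sup>+u. R u \<omega> \<partial>lborel)"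
      unfolding Q_def by (intro nn_integral_mono) (auto simp: indicator_def)
    then have Qfin: "Q \<omega> < \<infinity>" using Rfin by simp
    have "(\<lambda>m. \<integral>\<^sup>+u. ?J (inverse (Suc m)) u \<omega> * R u \<omega> \<partial>lborel) \<longlonglongrightarrow> Q \<omega>"
      unfolding Q_def
    proof (rule nn_integral_dominated_convergence[where w="\<lambda>u. R u \<omega>"])
      show "AE u in lborel. (\<lambda>m. ?J (inverse (Suc m)) u \<omega> * R u \<omega>) \<longlonglongrightarrow> ?J 0 u \<omega> * R u \<omega>"
        using AE_lborel_singleton[of 0]
      proof eventually_elim
        case (elim u)
        show ?case
        proof (cases "0 < u")
          case True
          have "filterlim (\<lambda>m. u - inverse (real (Suc m))) (at_left u) sequentially"
          proof (rule tendsto_imp_filterlim_at_left)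
            show "(\<lambda>n. u - inverse (real (Suc n))) \<longlonglongrightarrow> u"
              using tendsto_diff[OF tendsto_const LIMSEQ_inverse_real_of_nat, of u] by simp
          qed (auto intro!: always_eventually)
          from filterlim_iff[THEN iffD1, rule_format, OF this ind(2)[OF True \<open>\<omega> \<in> space M\<close>]]
          have "\<forall>\<^sub>F m in sequentially. ?J (inverse (Suc m)) u \<omega> * R u \<omega> = ?J 0 u \<omega> * R u \<omega>"
            by (rule eventually_mono) (use True in \<open>auto simp: indicator_def split: if_splits\<close>)
          then show ?thesis by (rule tendsto_eventually)
        next
          case False
          then have "R u \<omega> = 0" using elim by (simp add: R_def)
          then show ?thesis by simp
        qed
      qed
    qed (use Rm JRm JRm[of 0] Rfin in \<open>auto simp: indicator_def\<close>)
    then have "(\<lambda>m. W m \<omega>) \<longlonglongrightarrow> 2 * Q \<omega> + 2 * 0"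
      unfolding W_def using elim(1) by (intro tendsto_add ennreal_tendsto_cmult) (auto simp: V'_eq)
    then show ?case using Qfin by simp
  qed
  let ?E = "\<lambda>\<omega>. ennreal ((norm (I \<omega> - simple_integral B n \<sigma> \<eta> \<omega>))\<^sup>2)"
  \<comment> \<open>The strict inequality \<open>2 * Q \<omega> < ennreal c\<close> forces
    \<open>W m \<omega> \<le> ennreal c\<close> for large \<open>m\<close>, so the truncation
    indicator in \<open>G\<close> is eventually 1.\<close>
  have step_c: "(\<integral>\<^sup>+\<omega>. indicator {\<omega> \<in> A T. 2 * Q \<omega> < ennreal c} \<omega> * ?E \<omega> \<partial>M) \<le> (\<integral>\<^sup>+\<omega>. 2 * Q \<omega> \<partial>M)" if c: "0 < c" for c
  proof -
    have "(\<integral>\<^sup>+\<omega>. indicator {\<omega> \<in> A T. 2 * Q \<omega> < ennreal c} \<omega> * ?E \<omega> \<partial>M) \<le> (\<integral>\<^sup>+\<omega>. liminf (\<lambda>m. G c m \<omega>) \<partial>M)"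
    proof (rule nn_integral_mono_AE)
      show "AE \<omega> in M. indicator {\<omega> \<in> A T. 2 * Q \<omega> < ennreal c} \<omega> * ?E \<omega> \<le> liminf (\<lambda>m. G c m \<omega>)"
        using lim S
      proof eventually_elim
        case (elim \<omega>)
        show ?case
        proof (cases "\<omega> \<in> A T \<and> 2 * Q \<omega> < ennreal c")
          case True
          have "\<forall>\<^sub>F m in sequentially. W m \<omega> < ennreal c"
            using elim True by (intro order_tendstoD) auto
          then have ev: "\<forall>\<^sub>F m in sequentially. ennreal ((norm (?S m \<omega>))\<^sup>2) = G c m \<omega>"
            by (rule eventually_mono) (use True in \<open>auto simp: G_def\<close>)
          have "(\<lambda>m. ennreal ((norm (?S m \<omega>))\<^sup>2)) \<longlonglongrightarrow> ?E \<omega>"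
            using elim by (intro tendsto_ennrealI tendsto_intros) auto
          then have "(\<lambda>m. G c m \<omega>) \<longlonglongrightarrow> ?E \<omega>"
            using ev by (simp cong: filterlim_cong add: tendsto_cong)
          then have "liminf (\<lambda>m. G c m \<omega>) = ?E \<omega>"
            by (intro lim_imp_Liminf) auto
          then show ?thesis using True by simp
        qed (auto simp: indicator_def)
      qed
    qed
    also have "\<dots> \<le> liminf (\<lambda>m. \<integral>\<^sup>+\<omega>. G c m \<omega> \<partial>M)"
      unfolding G_def by (intro nn_integral_liminf) measurable
    also have "\<dots> \<le> liminf (\<lambda>m. \<integral>\<^sup>+\<omega>. min (ennreal c) (W m \<omega>) \<partial>M)"
      using trunc[OF c] by (intro Liminf_mono always_eventually) auto
    also have "\<dots> = (\<integral>\<^sup>+\<omega>. min (ennreal c) (2 * Q \<omega>) \<partial>M)"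
    proof (rule lim_imp_Liminf)
      show "(\<lambda>m. \<integral>\<^sup>+\<omega>. min (ennreal c) (W m \<omega>) \<partial>M) \<longlonglongrightarrow> (\<integral>\<^sup>+\<omega>. min (ennreal c) (2 * Q \<omega>) \<partial>M)"
      proof (rule nn_integral_dominated_convergence[where w="\<lambda>_. ennreal c"])
        show "AE \<omega> in M. (\<lambda>m. min (ennreal c) (W m \<omega>)) \<longlonglongrightarrow> min (ennreal c) (2 * Q \<omega>)"
          using lim by eventually_elim (intro tendsto_min tendsto_const, simp)
      qed (auto simp: emeasure_space_1)
    qed simp
    also have "\<dots> \<le> (\<integral>\<^sup>+\<omega>. 2 * Q \<omega> \<partial>M)"
      by (intro nn_integral_mono) simp
    finally show ?thesis .
  qed
  \<comment> \<open>Since \<open>Q\<close> is finite almost surely, almost every point lies below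
    some level \<open>Suc k\<close>, and the level bound \<open>step_c\<close> does not depend on
    the level.\<close>
  have "(\<integral>\<^sup>+\<omega>. indicator (A T) \<omega> * ?E \<omega> \<partial>M) \<le> (\<integral>\<^sup>+\<omega>. liminf (\<lambda>k. indicator {\<omega> \<in> A T. 2 * Q \<omega> < ennreal (Suc k)} \<omega> * ?E \<omega>) \<partial>M)"
  proof (rule nn_integral_mono_AE)
    show "AE \<omega> in M. indicator (A T) \<omega> * ?E \<omega> \<le> liminf (\<lambda>k. indicator {\<omega> \<in> A T. 2 * Q \<omega> < ennreal (Suc k)} \<omega> * ?E \<omega>)"
      using lim
    proof eventually_elim
      case (elim \<omega>)
      then have "2 * Q \<omega> < \<infinity>" by (simp add: ennreal_mult_less_top)
      then obtain b where b: "2 * Q \<omega> = ennreal b" "0 \<le> b" by (cases "2 * Q \<omega>") auto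
      obtain k0 where k0: "b < real k0" using reals_Archimedean2 by blast
      have "\<forall>\<^sub>F k in sequentially. indicator (A T) \<omega> * ?E \<omega> \<le> indicator {\<omega> \<in> A T. 2 * Q \<omega> < ennreal (Suc k)} \<omega> * ?E \<omega>"
        using eventually_ge_at_top[of k0]
      proof eventually_elim
        case (elim k)
        then have "b < real (Suc k)" using k0 by simp
        then have "2 * Q \<omega> < ennreal (Suc k)" using b by (simp add: ennreal_less_iff del: of_nat_Suc)
        then show ?case by (simp add: indicator_def)
      qed
      then show ?case by (rule Liminf_bounded)
    qed
  qed
  also have "\<dots> \<le> liminf (\<lambda>k. \<integral>\<^sup>+\<omega>. indicator {\<omega> \<in> A T. 2 * Q \<omega> < ennreal (Suc k)} \<omega> * ?E \<omega> \<partial>M)"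
    by (intro nn_integral_liminf) measurable
  also have "\<dots> \<le> liminf (\<lambda>k::nat. \<integral>\<^sup>+\<omega>. 2 * Q \<omega> \<partial>M)"
    by (intro Liminf_mono always_eventually allI step_c) simp
  also have "\<dots> = (\<integral>\<^sup>+\<omega>. 2 * Q \<omega> \<partial>M)" by (simp add: Liminf_const)
  also have "\<dots> = (\<integral>\<^sup>+\<omega>. 2 * (\<integral>\<^sup>+u. indicator {0..T} u * indicator (A u) \<omega> *
           ennreal ((norm (H u \<omega> - simple_process n \<sigma> \<eta> u \<omega>))\<^sup>2) \<partial>lborel) \<partial>M)"
    unfolding Q_def R_def by (intro nn_integral_cong arg_cong[where f="(*) 2"]) (auto simp: indicator_def)
  finally show ?thesis .
qed

end

subsection \<open>The Euler scheme\<close>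

text \<open>Stated for extended values because the mean square error of the Euler scheme is not
  known to be finite beforehand; finiteness is part of the conclusion.\<close>

lemma ennreal_gronwall:
  fixes \<phi> :: "nat \<Rightarrow> ennreal"
  assumes a: "0 \<le> a" "0 \<le> b"
    and \<phi>: "\<And>k. k \<le> n \<Longrightarrow> \<phi> k \<le> ennreal a + ennreal b * (\<Sum>j<k. \<phi> j)"
  shows "k \<le> n \<Longrightarrow> \<phi> k \<le> ennreal (a * (1 + b) ^ k)"
proof (induction k rule: less_induct)
  case (less k)
  \<comment> \<open>The geometric sequence solves the recursion with equality, so it serves as the
    comparison sequence.\<close>
  have geo: "a + b * (\<Sum>j<k. a * (1 + b) ^ j) = a * (1 + b) ^ k"
    by (induction k) (simp_all add: algebra_simps)
  have "\<phi> k \<le> ennreal a + ennreal b * (\<Sum>j<k. \<phi> j)" using \<phi> less by simp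
  also have "\<dots> \<le> ennreal a + ennreal b * (\<Sum>j<k. ennreal (a * (1 + b) ^ j))"
    using less by (intro add_left_mono mult_left_mono sum_mono) auto
  also have "\<dots> = ennreal (a + b * (\<Sum>j<k. a * (1 + b) ^ j))"
  proof -
    have "(\<Sum>j<k. ennreal (a * (1 + b) ^ j)) = ennreal (\<Sum>j<k. a * (1 + b) ^ j)"
      by (rule sum_ennreal) (use a in auto)
    moreover have "0 \<le> (\<Sum>j<k. a * (1 + b) ^ j)" using a by (intro sum_nonneg) auto
    ultimately show ?thesis using a by (simp only: ennreal_mult ennreal_plus mult_nonneg_nonneg)
  qed
  finally show ?case unfolding geo .
qed

lemma norm_integral_sq_le:
  fixes g :: "real \<Rightarrow> 'a::euclidean_space"
  assumes t: "0 \<le> t" and g: "set_integrable lborel {0..t} g"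
  shows "ennreal ((norm (LINT u:{0..t}|lborel. g u))\<^sup>2)
    \<le> ennreal t * (\<integral>\<^sup>+u. indicator {0..t} u * ennreal ((norm (g u))\<^sup>2) \<partial>lborel)"
proof -
  have gm [measurable]: "(\<lambda>u. indicator {0..t} u *\<^sub>R g u) \<in> borel_measurable lborel"
    using g by (auto simp: set_integrable_def)
  have "ennreal (norm (LINT u:{0..t}|lborel. g u)) \<le> (\<integral>\<^sup>+u. ennreal (norm (indicator {0..t} u *\<^sub>R g u)) \<partial>lborel)"
    unfolding set_lebesgue_integral_def using g by (intro integral_norm_bound_ennreal) (auto simp: set_integrable_def)
  also have "\<dots> = (\<integral>\<^sup>+u. ennreal (norm (indicator {0..t} u *\<^sub>R g u)) * indicator {0..t} u \<partial>lborel)"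
    by (intro nn_integral_cong) (auto simp: indicator_def)
  finally have "(ennreal (norm (LINT u:{0..t}|lborel. g u)))\<^sup>2 \<le> (\<dots>)\<^sup>2"
    by (rule power_mono) simp
  also have "\<dots> \<le> (\<integral>\<^sup>+u. (ennreal (norm (indicator {0..t} u *\<^sub>R g u)))\<^sup>2 \<partial>lborel) * (\<integral>\<^sup>+u. (indicator {0..t} u)\<^sup>2 \<partial>lborel)"
    by (rule Cauchy_Schwarz_nn_integral) measurable
  also have "(\<integral>\<^sup>+u. (indicator {0..t} u)\<^sup>2 \<partial>lborel) = (\<integral>\<^sup>+u. indicator {0..t} u \<partial>lborel)"
    by (intro nn_integral_cong) (auto simp: indicator_def)
  also have "\<dots> = ennreal t" using t by simp
  also have "(\<integral>\<^sup>+u. (ennreal (norm (indicator {0..t} u *\<^sub>R g u)))\<^sup>2 \<partial>lborel) = (\<integral>\<^sup>+u. indicator {0..t} u * ennreal ((norm (g u))\<^sup>2) \<partial>lborel)"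
    by (intro nn_integral_cong) (auto simp: indicator_def ennreal_power)
  finally show ?thesis by (simp add: ennreal_power mult.commute)
qed

primrec euler :: "(real \<Rightarrow> 'w \<Rightarrow> real^'d::finite) \<Rightarrow> (real^'d \<Rightarrow> real^'d) \<Rightarrow> (real^'d \<Rightarrow> real^'d^'d) \<Rightarrow> real \<Rightarrow>
    real^'d \<Rightarrow> nat \<Rightarrow> 'w \<Rightarrow> real^'d" where
  "euler B \<mu> \<sigma> h s 0 \<omega> = s"
| "euler B \<mu> \<sigma> h s (Suc k) \<omega> = euler B \<mu> \<sigma> h s k \<omega> + h *\<^sub>R \<mu> (euler B \<mu> \<sigma> h s k \<omega>)
     + \<sigma> (euler B \<mu> \<sigma> h s k \<omega>) *v (B (real (Suc k) * h) \<omega> - B (real k * h) \<omega>)"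

text \<open>The noise part of the Euler path is the integral of a simple process, so its distance to
  the true stochastic integral is covered by \<open>has_ito_integral_bound\<close>.\<close>

lemma euler_eq_simple_integral:
  "euler B \<mu> \<sigma> h s k \<omega> = s + (\<Sum>j<k. h *\<^sub>R \<mu> (euler B \<mu> \<sigma> h s j \<omega>))
    + simple_integral B k (\<lambda>j. real j * h) (\<lambda>j \<omega>. \<sigma> (euler B \<mu> \<sigma> h s j \<omega>)) \<omega>"
  by (induction k) (simp_all add: simple_integral_def)

text \<open>For \<open>u > 0\<close>, the index \<open>j\<close> with \<open>j * h < u \<le> (j + 1) * h\<close>.\<close>

definition step_index :: "real \<Rightarrow> real \<Rightarrow> nat" where
  "step_index h u = nat (\<lceil>u / h\<rceil> - 1)"

lemma step_index_eq:
  assumes "0 < h" "real j * h < u" "u \<le> real (Suc j) * h"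
  shows "step_index h u = j"
proof -
  have "real j < u / h" "u / h \<le> real (Suc j)" using assms by (simp_all add: field_simps)
  then have "\<lceil>u / h\<rceil> = int (Suc j)" by (intro ceiling_unique) auto
  then show ?thesis by (simp add: step_index_def)
qed

lemma step_index_bounds:
  assumes "0 < h" "0 < u"
  shows "real (step_index h u) * h < u" "u \<le> real (Suc (step_index h u)) * h"
proof -
  have "0 < u / h" using assms by simp
  then have "1 \<le> \<lceil>u / h\<rceil>" by linarith
  then have "real (step_index h u) = real_of_int \<lceil>u / h\<rceil> - 1" by (simp add: step_index_def)
  then have "real (step_index h u) < u / h" "u / h \<le> real (Suc (step_index h u))" by linarith+
  then show "real (step_index h u) * h < u" "u \<le> real (Suc (step_index h u)) * h"
    using assms by (simp_all add: field_simps)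
qed

lemma step_index_less:
  assumes "0 < h" "0 < u" "u \<le> real k * h"
  shows "step_index h u < k"
proof -
  have "real (step_index h u) * h < real k * h" using step_index_bounds(1)[OF assms(1,2)] assms(3) by simp
  then show ?thesis using assms(1) by simp
qed

lemma step_sum_eq:
  fixes c :: "nat \<Rightarrow> 'a::real_vector"
  assumes "0 < h" "0 < u" "u \<le> real k * h"
  shows "(\<Sum>j<k. indicator {real j * h<..real (Suc j) * h} u *\<^sub>R c j) = c (step_index h u)"
proof -
  have "indicator {real j * h<..real (Suc j) * h} u *\<^sub>R c j = (if j = step_index h u then c j else 0)" for j
  proof (cases "j = step_index h u")
    case True
    then show ?thesis using step_index_bounds[OF assms(1,2)] by (simp del: of_nat_Suc)
  next
    case False
    then have "u \<notin> {real j * h<..real (Suc j) * h}"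
      using step_index_eq[OF assms(1), of j u] by (auto simp del: of_nat_Suc)
    then show ?thesis using False by simp
  qed
  then show ?thesis using step_index_less[OF assms] by (simp only:) simp
qed

lemma step_index_measurable [measurable]: "step_index h \<in> measurable borel (count_space UNIV)"
  unfolding step_index_def[abs_def] by measurable

locale sde = brownian M B for M :: "'w measure" and B :: "real \<Rightarrow> 'w \<Rightarrow> real^'d::finite" +
  fixes \<mu> :: "real^'d \<Rightarrow> real^'d" and \<sigma> :: "real^'d \<Rightarrow> real^'d^'d" and K :: real
  assumes lip_\<mu>: "K-lipschitz_on UNIV \<mu>" and lip_\<sigma>: "K-lipschitz_on UNIV \<sigma>"
begin

lemma K_nonneg: "0 \<le> K"
  using lip_\<mu> by (rule lipschitz_on_nonneg)

lemma lip_norm: "norm (\<mu> x - \<mu> y) \<le> K * norm (x - y)" "norm (\<sigma> x - \<sigma> y) \<le> K * norm (x - y)"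
  using lipschitz_onD[OF lip_\<mu>, of x y] lipschitz_onD[OF lip_\<sigma>, of x y] by (auto simp: dist_norm)

lemma coeff_measurable [measurable]: "\<mu> \<in> borel_measurable borel" "\<sigma> \<in> borel_measurable borel"
  using lip_\<mu> lip_\<sigma> by (auto intro!: borel_measurable_continuous_onI lipschitz_on_continuous_on)

abbreviation E :: "real \<Rightarrow> real^'d \<Rightarrow> nat \<Rightarrow> 'w \<Rightarrow> real^'d" where
  "E \<equiv> euler B \<mu> \<sigma>"

lemma euler_adapted: "0 \<le> h \<Longrightarrow> E h s k \<in> borel_measurable (F (real k * h))"
proof (induction k)
  case 0
  then show ?case by (simp cong: measurable_cong)
next
  case (Suc k)
  have le: "real k * h \<le> real (Suc k) * h" "0 \<le> real k * h" using Suc by (auto intro: mult_right_mono)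
  have [measurable]: "E h s k \<in> borel_measurable (F (real (Suc k) * h))"
    by (rule measurable_F_mono[OF Suc.IH[OF Suc.prems] le(1)])
  have [measurable]: "B (real k * h) \<in> borel_measurable (F (real (Suc k) * h))"
     "B (real (Suc k) * h) \<in> borel_measurable (F (real (Suc k) * h))"
    using le Suc by (auto intro!: B_measurable_F)
  show ?case
    unfolding euler.simps by measurable
qed

lemma euler_measurable [measurable]: "0 \<le> h \<Longrightarrow> E h s k \<in> borel_measurable M"
  using measurable_F[OF euler_adapted] .

end

locale sde_solution = sde M B \<mu> \<sigma> K
  for M :: "'w measure" and B :: "real \<Rightarrow> 'w \<Rightarrow> real^'d::finite" and \<mu> \<sigma> K +
  fixes s :: "real^'d" and X :: "real \<Rightarrow> 'w \<Rightarrow> real^'d"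
  assumes solution: "strong_solution M B \<mu> \<sigma> s X"
begin

lemma X_adapted: "0 \<le> t \<Longrightarrow> X t \<in> borel_measurable (F t)"
  using solution by (simp add: strong_solution_def)

lemma X_measurable [measurable]: "0 \<le> t \<Longrightarrow> X t \<in> borel_measurable M"
  using measurable_F[OF X_adapted] .

lemma X_cont: "\<omega> \<in> space M \<Longrightarrow> continuous_on {0..} (\<lambda>t. X t \<omega>)"
  using solution by (simp add: strong_solution_def)

lemma X_measurable_pair [measurable]: "(\<lambda>(t, \<omega>). X (max 0 t) \<omega>) \<in> borel_measurable (borel \<Otimes>\<^sub>M M)"
proof (rule borel_measurable_pair_left_limit)
  fix t \<omega> assume t: "(0::real) < t" and \<omega>: "\<omega> \<in> space M"
  have "((\<lambda>s. X s \<omega>) \<longlongrightarrow> X t \<omega>) (at t within {0..})"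
    using X_cont[OF \<omega>] t by (auto simp: continuous_on_def)
  then have "((\<lambda>s. X s \<omega>) \<longlongrightarrow> X t \<omega>) (at t)"
    using t at_within_interior[of t "{0..}"] by simp
  then show "((\<lambda>s. X s \<omega>) \<longlongrightarrow> X t \<omega>) (at_left t)"
    by (rule filterlim_mono[OF _ order_refl at_le]) simp
qed simp

text \<open>The localising events: the solution has stayed in the ball of radius \<open>R\<close> up
  to time \<open>u\<close>. The closed condition is essential: a path that is in the ball at all
  times before \<open>u\<close> is still in it at \<open>u\<close>, which is the left closure
  required of a stopping family.\<close>

definition A :: "real \<Rightarrow> real \<Rightarrow> 'w set" where
  "A R u = {\<omega> \<in> space M. \<forall>v\<in>{0..u}. norm (X v \<omega>) \<le> R}"

text \<open>By path continuity the condition need only be tested at rational times, clamped to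
  \<open>{0..u}\<close>, which gives measurability in \<open>F u\<close>; left closure is
  preservation of a closed inequality on the closure of \<open>{0..<u}\<close>.\<close>

lemma stopping_family_A: "stopping_family (A R)"
  unfolding stopping_family_def
proof (intro conjI allI impI ballI)
  fix u :: real assume u: "0 \<le> u"
  let ?c = "\<lambda>q. max 0 (min u q)"
  have "A R u = {\<omega> \<in> space (F u). \<forall>q\<in>\<rat>. norm (X (?c q) \<omega>) \<le> R}"
  proof (intro set_eqI iffI)
    fix \<omega> assume \<omega>: "\<omega> \<in> {\<omega> \<in> space (F u). \<forall>q\<in>\<rat>. norm (X (?c q) \<omega>) \<le> R}"
    then have \<omega>': "\<omega> \<in> space M" by simp
    have cont: "continuous_on UNIV (\<lambda>q. norm (X (?c q) \<omega>))"
      by (intro continuous_on_norm continuous_on_compose2[OF X_cont[OF \<omega>']] continuous_intros) auto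
    have "norm (X (?c v) \<omega>) \<le> R" for v
      by (rule continuous_le_on_closure[of "\<rat>" "\<lambda>q. norm (X (?c q) \<omega>)"])
        (use cont \<omega> in \<open>auto simp: Rats_closure_real\<close>)
    then have "norm (X v \<omega>) \<le> R" if "v \<in> {0..u}" for v
      using that by (metis atLeastAtMost_iff max_absorb2 min_absorb2)
    then show "\<omega> \<in> A R u" using \<omega>' by (auto simp: A_def)
  qed (use u in \<open>auto simp: A_def\<close>)
  also have "\<dots> \<in> sets (F u)"
  proof (rule sets.sets_Collect_countable_All')
    fix q :: real assume "q \<in> \<rat>"
    have "X (?c q) \<in> borel_measurable (F u)"
      using measurable_F_mono[OF X_adapted, of "?c q" u] u by simp
    then show "{\<omega> \<in> space (F u). norm (X (?c q) \<omega>) \<le> R} \<in> sets (F u)"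
      by measurable
  qed (rule countable_rat)
  finally show "A R u \<in> sets (F u)" .
next
  fix u v :: real assume "0 \<le> u" "u \<le> v"
  then show "A R v \<subseteq> A R u" by (auto simp: A_def)
next
  fix u \<omega> assume u: "(0::real) < u" and \<omega>: "\<omega> \<in> space M" "\<omega> \<notin> A R u"
  show "\<exists>v. 0 \<le> v \<and> v < u \<and> \<omega> \<notin> A R v"
  proof (rule ccontr)
    assume "\<not> (\<exists>v. 0 \<le> v \<and> v < u \<and> \<omega> \<notin> A R v)"
    then have *: "norm (X v \<omega>) \<le> R" if "v \<in> {0..<u}" for v
      using that by (force simp: A_def)
    have cl: "closure {0..<u} = {0..u}" using u by simp
    have "norm (X v \<omega>) \<le> R" if "v \<in> {0..u}" for v
      by (rule continuous_le_on_closure[of "{0..<u}" "\<lambda>q. norm (X q \<omega>)"])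
        (use * that in \<open>auto simp: cl intro!: continuous_on_norm continuous_on_subset[OF X_cont[OF \<omega>(1)]]\<close>)
    then show False using \<omega> by (auto simp: A_def)
  qed
qed

lemma A_bound: "\<omega> \<in> A R u \<Longrightarrow> 0 \<le> v \<Longrightarrow> v \<le> u \<Longrightarrow> norm (X v \<omega>) \<le> R"
  by (auto simp: A_def)

lemma A_sets [measurable]: "0 \<le> u \<Longrightarrow> A R u \<in> sets M"
  using stopping_familyD(1)[OF stopping_family_A] sets_F_sub by blast

text \<open>A continuous path is bounded on \<open>{0..T}\<close>, so the events increase to the
  whole space.\<close>

lemma A_exhausts:
  assumes T: "0 \<le> T"
  shows "(\<lambda>n. prob (A (real n) T)) \<longlonglongrightarrow> 1"
proof -
  have "(\<lambda>n. prob (A (real n) T)) \<longlonglongrightarrow> prob (\<Union>n. A (real n) T)"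
  proof (rule finite_Lim_measure_incseq)
    show "range (\<lambda>n. A (real n) T) \<subseteq> events" using A_sets[OF T] by auto
    show "incseq (\<lambda>n. A (real n) T)" by (fastforce simp: incseq_def A_def intro: order_trans)
  qed
  moreover have "(\<Union>n. A (real n) T) = space M"
  proof (intro set_eqI iffI)
    fix \<omega> assume \<omega>: "\<omega> \<in> space M"
    have "compact ((\<lambda>t. X t \<omega>) ` {0..T})"
      by (intro compact_continuous_image continuous_on_subset[OF X_cont[OF \<omega>]]) auto
    then obtain b where b: "\<And>v. v \<in> {0..T} \<Longrightarrow> norm (X v \<omega>) \<le> b"
      by (force dest: compact_imp_bounded simp: bounded_iff)
    obtain n where "b \<le> real n" using real_arch_simple by blast
    then have "\<omega> \<in> A (real n) T"
      using \<omega> by (auto simp: A_def intro: order_trans[OF b])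
    then show "\<omega> \<in> (\<Union>n. A (real n) T)" by blast
  qed (auto simp: A_def)
  ultimately show ?thesis by (simp add: prob_space)
qed

end

section \<open>Error recursion between the solution and the Euler path\<close>

context sde_solution
begin

text \<open>The localisation constrains \<open>X\<close> only. The Euler path is never stopped; its
  size is controlled through the error itself.\<close>

definition sq_err :: "real \<Rightarrow> real \<Rightarrow> nat \<Rightarrow> ennreal" where
  "sq_err R h k = (\<integral>\<^sup>+\<omega>. indicator (A R (real k * h)) \<omega> *
      ennreal ((norm (X (real k * h) \<omega> - E h s k \<omega>))\<^sup>2) \<partial>M)"

definition path_osc :: "real \<Rightarrow> real \<Rightarrow> real \<Rightarrow> 'w \<Rightarrow> ennreal" where
  "path_osc R h T \<omega> = (\<integral>\<^sup>+u. indicator {0..T} u * indicator (A R (max 0 u)) \<omega> *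
      ennreal ((norm (X (max 0 u) \<omega> - X (real (step_index h u) * h) \<omega>))\<^sup>2) \<partial>lborel)"

definition path_err :: "real \<Rightarrow> real \<Rightarrow> real \<Rightarrow> 'w \<Rightarrow> ennreal" where
  "path_err R h T \<omega> = (\<integral>\<^sup>+u. indicator {0..T} u * indicator (A R (max 0 u)) \<omega> *
      ennreal ((norm (X (max 0 u) \<omega> - E h s (step_index h u) \<omega>))\<^sup>2) \<partial>lborel)"

lemma A_measurable_pair [measurable]:
  "(\<lambda>(u, \<omega>). indicator (A R (max 0 u)) \<omega> :: ennreal) \<in> borel_measurable (borel \<Otimes>\<^sub>M M)"
proof -
  have "(\<lambda>z. ennreal (indicator (A R (max 0 (fst z))) (snd z))) \<in> borel_measurable (borel \<Otimes>\<^sub>M M)"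
    using stopping_indicator_measurable_pair(1)[OF stopping_family_A] by (simp add: case_prod_beta)
  then show ?thesis by (simp add: ennreal_indicator case_prod_beta)
qed

lemma grid_measurable_pair:
  assumes h: "0 < h"
  shows X_grid_measurable: "(\<lambda>(u, \<omega>). X (real (step_index h u) * h) \<omega>) \<in> borel_measurable (borel \<Otimes>\<^sub>M M)"
    and E_grid_measurable: "(\<lambda>(u, \<omega>). E h s (step_index h u) \<omega>) \<in> borel_measurable (borel \<Otimes>\<^sub>M M)"
proof -
  have i: "(\<lambda>z. step_index h (fst z)) \<in> measurable (borel \<Otimes>\<^sub>M M) (count_space UNIV)"
    by measurable
  have "(\<lambda>z. X (real j * h) (snd z)) \<in> borel_measurable (borel \<Otimes>\<^sub>M M)" for j
    using h by (intro measurable_compose[OF measurable_snd] X_measurable) simp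
  from measurable_compose_countable[OF this i]
  show "(\<lambda>(u, \<omega>). X (real (step_index h u) * h) \<omega>) \<in> borel_measurable (borel \<Otimes>\<^sub>M M)"
    by (simp add: case_prod_beta)
  have "(\<lambda>z. E h s j (snd z)) \<in> borel_measurable (borel \<Otimes>\<^sub>M M)" for j
    using h by (intro measurable_compose[OF measurable_snd] euler_measurable) simp
  from measurable_compose_countable[OF this i]
  show "(\<lambda>(u, \<omega>). E h s (step_index h u) \<omega>) \<in> borel_measurable (borel \<Otimes>\<^sub>M M)"
    by (simp add: case_prod_beta)
qed

lemma path_integrals_measurable:
  assumes h: "0 < h"
  shows "path_osc R h T \<in> borel_measurable M" "path_err R h T \<in> borel_measurable M"
proof -
  note [measurable] = X_grid_measurable[OF h] E_grid_measurable[OF h]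
  show "path_osc R h T \<in> borel_measurable M"
    unfolding path_osc_def[abs_def] by (rule borel_measurable_nn_integral_lborel_fst) measurable
  show "path_err R h T \<in> borel_measurable M"
    unfolding path_err_def[abs_def] by (rule borel_measurable_nn_integral_lborel_fst) measurable
qed

text \<open>\<open>X u\<close> is compared with the Euler value through \<open>X\<close> at the last
  grid point before \<open>u\<close>: the first part is the oscillation of the solution, the second
  is constant on cells and sums to the errors at earlier grid points. Antitonicity of
  \<open>A\<close> passes from \<open>u\<close> back to that grid point.\<close>

lemma path_err_le:
  assumes h: "0 < h" and k: "real k * h \<le> T"
  shows "(\<integral>\<^sup>+\<omega>. path_err R h (real k * h) \<omega> \<partial>M) \<le>
     2 * (\<integral>\<^sup>+\<omega>. path_osc R h T \<omega> \<partial>M) + 2 * (ennreal h * (\<Sum>j<k. sq_err R h j))"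
proof -
  note [measurable] = X_grid_measurable[OF h] E_grid_measurable[OF h] path_integrals_measurable[OF h]
  define c where "c j \<omega> = indicator (A R (real j * h)) \<omega> * ennreal ((norm (X (real j * h) \<omega> - E h s j \<omega>))\<^sup>2)" for j \<omega>
  have c_meas [measurable]: "c j \<in> borel_measurable M" for j
  proof -
    have [measurable]: "X (real j * h) \<in> borel_measurable M" "A R (real j * h) \<in> sets M" "E h s j \<in> borel_measurable M"
      using h by auto
    show ?thesis unfolding c_def[abs_def] by measurable
  qed
  let ?a = "\<lambda>u \<omega>. indicator {0..T} u * indicator (A R (max 0 u)) \<omega> *
      ennreal ((norm (X (max 0 u) \<omega> - X (real (step_index h u) * h) \<omega>))\<^sup>2)"
  let ?b = "\<lambda>u \<omega>. \<Sum>j<k. c j \<omega> * indicator {real j * h<..real (Suc j) * h} u"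
  have pw: "path_err R h (real k * h) \<omega> \<le> 2 * path_osc R h T \<omega> + 2 * (\<Sum>j<k. c j \<omega> * ennreal h)"
    if \<omega>: "\<omega> \<in> space M" for \<omega>
  proof -
    have "path_err R h (real k * h) \<omega> \<le> (\<integral>\<^sup>+u. 2 * ?a u \<omega> + 2 * ?b u \<omega> \<partial>lborel)"
      unfolding path_err_def
    proof (rule nn_integral_mono_AE)
      show "AE u in lborel. indicator {0..real k * h} u * indicator (A R (max 0 u)) \<omega> *
          ennreal ((norm (X (max 0 u) \<omega> - E h s (step_index h u) \<omega>))\<^sup>2) \<le> 2 * ?a u \<omega> + 2 * ?b u \<omega>"
        using AE_lborel_singleton[of 0]
      proof eventually_elim
        case (elim u)
        show ?case
        proof (cases "0 < u \<and> u \<le> real k * h \<and> \<omega> \<in> A R u")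
          case True
          define j where "j = step_index h u"
          have j: "j < k" "real j * h < u" "u \<le> real (Suc j) * h"
            using step_index_bounds[OF h, of u] step_index_less[OF h, of u k] True by (auto simp: j_def)
          have Aj: "\<omega> \<in> A R (real j * h)"
            using True j h stopping_familyD(2)[OF stopping_family_A, of "real j * h" u R] by auto
          have "ennreal ((norm (X u \<omega> - E h s j \<omega>))\<^sup>2) \<le>
              ennreal (2 * (norm (X u \<omega> - X (real j * h) \<omega>))\<^sup>2 + 2 * (norm (X (real j * h) \<omega> - E h s j \<omega>))\<^sup>2)"
            by (intro ennreal_leI norm_diff_sq_le)
          also have "\<dots> = 2 * ?a u \<omega> + 2 * c j \<omega>"
            using True Aj k by (simp add: c_def j_def[symmetric] ennreal_plus ennreal_mult max_absorb2)
          also have "c j \<omega> \<le> ?b u \<omega>"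
          proof -
            have "c j \<omega> = c j \<omega> * indicator {real j * h<..real (Suc j) * h} u" using j by simp
            also have "\<dots> \<le> ?b u \<omega>" by (rule member_le_sum) (use j in auto)
            finally show ?thesis .
          qed
          finally show ?thesis
            using True by (simp add: j_def[symmetric] max_absorb2 mult_left_mono)
        qed (use elim in \<open>auto simp: indicator_def max_def\<close>)
      qed
    qed
    also have "\<dots> = 2 * path_osc R h T \<omega> + 2 * (\<integral>\<^sup>+u. ?b u \<omega> \<partial>lborel)"
    proof -
      have "(\<lambda>u. ?a u \<omega>) \<in> borel_measurable borel"
        by (rule pair_section_measurable[OF _ \<omega>]) measurable
      moreover have "(\<lambda>u. ?b u \<omega>) \<in> borel_measurable borel"
        by measurable
      moreover have "(\<integral>\<^sup>+u. 2 * f u + 2 * g u \<partial>lborel) = 2 * (\<integral>\<^sup>+u. f u \<partial>lborel) + 2 * (\<integral>\<^sup>+u. g u \<partial>lborel)"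
        if "f \<in> borel_measurable borel" "g \<in> borel_measurable borel" for f g :: "real \<Rightarrow> ennreal"
        using that by (simp add: nn_integral_add nn_integral_cmult)
      ultimately show ?thesis unfolding path_osc_def by blast
    qed
    also have "(\<integral>\<^sup>+u. ?b u \<omega> \<partial>lborel) = (\<Sum>j<k. \<integral>\<^sup>+u. c j \<omega> * indicator {real j * h<..real (Suc j) * h} u \<partial>lborel)"
      by (intro nn_integral_sum) measurable
    also have "\<dots> = (\<Sum>j<k. c j \<omega> * ennreal h)"
      using h by (intro sum.cong refl) (subst nn_integral_cmult_indicator, auto simp: algebra_simps)
    finally show ?thesis .
  qed
  have "(\<integral>\<^sup>+\<omega>. path_err R h (real k * h) \<omega> \<partial>M) \<le> (\<integral>\<^sup>+\<omega>. 2 * path_osc R h T \<omega> + 2 * (\<Sum>j<k. c j \<omega> * ennreal h) \<partial>M)"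
    by (intro nn_integral_mono pw)
  also have "\<dots> = 2 * (\<integral>\<^sup>+\<omega>. path_osc R h T \<omega> \<partial>M) + 2 * (\<Sum>j<k. (\<integral>\<^sup>+\<omega>. c j \<omega> \<partial>M) * ennreal h)"
    by (simp add: nn_integral_add nn_integral_cmult nn_integral_sum nn_integral_multc)
  also have "(\<Sum>j<k. (\<integral>\<^sup>+\<omega>. c j \<omega> \<partial>M) * ennreal h) = ennreal h * (\<Sum>j<k. sq_err R h j)"
    by (simp add: sq_err_def c_def sum_distrib_left mult.commute)
  finally show ?thesis .
qed

text \<open>The Euler drift is the integral of a step function, so the difference is one integral to
  which Cauchy-Schwarz and the Lipschitz bound apply pathwise.\<close>

lemma drift_difference_le:
  assumes h: "0 < h" and \<omega>: "\<omega> \<in> A R (real k * h)"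
  shows "ennreal ((norm ((LINT u:{0..real k * h}|lborel. \<mu> (X u \<omega>)) - (\<Sum>j<k. h *\<^sub>R \<mu> (E h s j \<omega>))))\<^sup>2)
     \<le> ennreal (real k * h * K\<^sup>2) * path_err R h (real k * h) \<omega>"
proof -
  let ?t = "real k * h"
  have \<omega>': "\<omega> \<in> space M" using \<omega> by (simp add: A_def)
  have t: "0 \<le> ?t" using h by simp
  let ?v = "\<lambda>u. \<Sum>j<k. indicator {real j * h<..real (Suc j) * h} u *\<^sub>R \<mu> (E h s j \<omega>)"
  have iX: "set_integrable lborel {0..?t} (\<lambda>u. \<mu> (X u \<omega>))"
    unfolding set_integrable_def
    by (intro borel_integrable_compact continuous_on_compose2[OF lipschitz_on_continuous_on[OF lip_\<mu>]]
        continuous_on_subset[OF X_cont[OF \<omega>']]) auto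
  have piece: "(\<lambda>u. indicator {0..?t} u *\<^sub>R (indicator {real j * h<..real (Suc j) * h} u *\<^sub>R c)) =
      (\<lambda>u. indicator {real j * h<..real (Suc j) * h} u *\<^sub>R c)" if j: "j < k" for j and c :: "real^'d"
  proof -
    have "real (Suc j) * h \<le> ?t" "0 \<le> real j * h" using j h by (auto intro!: mult_right_mono simp del: of_nat_Suc)
    then show ?thesis by (auto simp: indicator_def fun_eq_iff simp del: of_nat_Suc)
  qed
  have iv0: "(\<lambda>u. indicator {0..?t} u *\<^sub>R ?v u) = ?v"
    unfolding scaleR_sum_right by (intro ext sum.cong refl) (use fun_cong[OF piece] in auto)
  have iv: "has_bochner_integral lborel ?v (\<Sum>j<k. h *\<^sub>R \<mu> (E h s j \<omega>))"
  proof (rule has_bochner_integral_sum)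
    fix j
    have e: "emeasure lborel {real j * h<..real (Suc j) * h} = ennreal h"
      using h by (subst emeasure_lborel_Ioc) (auto simp: algebra_simps)
    then have "has_bochner_integral lborel (\<lambda>u. indicator {real j * h<..real (Suc j) * h} u *\<^sub>R \<mu> (E h s j \<omega>))
       (measure lborel {real j * h<..real (Suc j) * h} *\<^sub>R \<mu> (E h s j \<omega>))"
      by (intro has_bochner_integral_scaleR_left has_bochner_integral_real_indicator) (auto simp del: of_nat_Suc)
    moreover have "measure lborel {real j * h<..real (Suc j) * h} = h"
      using h by (simp only: measure_def e) simp
    ultimately show "has_bochner_integral lborel (\<lambda>u. indicator {real j * h<..real (Suc j) * h} u *\<^sub>R \<mu> (E h s j \<omega>)) (h *\<^sub>R \<mu> (E h s j \<omega>))"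
      by simp
  qed
  have iV: "set_integrable lborel {0..?t} ?v" and vV: "(LINT u:{0..?t}|lborel. ?v u) = (\<Sum>j<k. h *\<^sub>R \<mu> (E h s j \<omega>))"
    using iv unfolding set_integrable_def set_lebesgue_integral_def iv0 by (auto simp: has_bochner_integral_iff)
  have "ennreal ((norm ((LINT u:{0..?t}|lborel. \<mu> (X u \<omega>)) - (\<Sum>j<k. h *\<^sub>R \<mu> (E h s j \<omega>))))\<^sup>2) =
     ennreal ((norm (LINT u:{0..?t}|lborel. \<mu> (X u \<omega>) - ?v u))\<^sup>2)"
    by (simp only: set_integral_diff(2)[OF iX iV] vV)
  also have "\<dots> \<le> ennreal ?t * (\<integral>\<^sup>+u. indicator {0..?t} u * ennreal ((norm (\<mu> (X u \<omega>) - ?v u))\<^sup>2) \<partial>lborel)"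
    by (rule norm_integral_sq_le[OF t set_integral_diff(1)[OF iX iV]])
  also have "\<dots> \<le> ennreal ?t * (\<integral>\<^sup>+u. ennreal (K\<^sup>2) * (indicator {0..?t} u * indicator (A R (max 0 u)) \<omega> *
      ennreal ((norm (X (max 0 u) \<omega> - E h s (step_index h u) \<omega>))\<^sup>2)) \<partial>lborel)"
  proof (intro mult_left_mono nn_integral_mono_AE)
    show "AE u in lborel. indicator {0..?t} u * ennreal ((norm (\<mu> (X u \<omega>) - ?v u))\<^sup>2) \<le>
       ennreal (K\<^sup>2) * (indicator {0..?t} u * indicator (A R (max 0 u)) \<omega> * ennreal ((norm (X (max 0 u) \<omega> - E h s (step_index h u) \<omega>))\<^sup>2))"
      using AE_lborel_singleton[of 0]
    proof eventually_elim
      case (elim u)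
      show ?case
      proof (cases "0 < u \<and> u \<le> ?t")
        case True
        then have u: "0 < u" "u \<le> ?t" by auto
        have "\<omega> \<in> A R u" using stopping_familyD(2)[OF stopping_family_A, of u ?t R] u \<omega> by auto
        moreover have "ennreal ((norm (\<mu> (X u \<omega>) - \<mu> (E h s (step_index h u) \<omega>)))\<^sup>2) \<le>
          ennreal (K\<^sup>2) * ennreal ((norm (X u \<omega> - E h s (step_index h u) \<omega>))\<^sup>2)"
        proof -
          have "(norm (\<mu> (X u \<omega>) - \<mu> (E h s (step_index h u) \<omega>)))\<^sup>2 \<le> (K * norm (X u \<omega> - E h s (step_index h u) \<omega>))\<^sup>2"
            by (intro power_mono lip_norm) simp
          then show ?thesis by (simp add: ennreal_mult[symmetric] power_mult_distrib ennreal_leI)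
        qed
        ultimately show ?thesis
          using u by (simp add: step_sum_eq[OF h u] max_absorb2 del: of_nat_Suc)
      qed (use elim in \<open>auto simp: indicator_def\<close>)
    qed
  qed simp
  also have "\<dots> = ennreal ?t * (ennreal (K\<^sup>2) * path_err R h ?t \<omega>)"
  proof -
    note [measurable] = E_grid_measurable[OF h]
    have "(\<lambda>u. indicator {0..?t} u * indicator (A R (max 0 u)) \<omega> * ennreal ((norm (X (max 0 u) \<omega> - E h s (step_index h u) \<omega>))\<^sup>2)) \<in> borel_measurable borel"
      by (rule pair_section_measurable[OF _ \<omega>']) measurable
    then show ?thesis unfolding path_err_def by (subst nn_integral_cmult) auto
  qed
  finally show ?thesis
    by (subst ennreal_mult[OF t]) (simp_all add: mult.assoc)
qed

text \<open>Here \<eta> is the Euler diffusion process. The comparison of integrands is made off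
  \<open>u = 0\<close>, because the cells are open on the left.\<close>

lemma diffusion_difference_le:
  assumes h: "0 < h" and I: "has_ito_integral M B (real k * h) (\<lambda>u \<omega>. \<sigma> (X u \<omega>)) I"
  shows "(\<integral>\<^sup>+\<omega>. indicator (A R (real k * h)) \<omega> *
       ennreal ((norm (I \<omega> - simple_integral B k (\<lambda>j. real j * h) (\<lambda>j \<omega>. \<sigma> (E h s j \<omega>)) \<omega>))\<^sup>2) \<partial>M)
     \<le> ennreal (2 * K\<^sup>2) * (\<integral>\<^sup>+\<omega>. path_err R h (real k * h) \<omega> \<partial>M)"
proof -
  let ?t = "real k * h"
  let ?\<eta> = "\<lambda>j \<omega>. \<sigma> (E h s j \<omega>)"
  note [measurable] = E_grid_measurable[OF h] path_integrals_measurable[OF h]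
  have step: "step_data ?t k (\<lambda>j. real j * h) ?\<eta>"
    unfolding step_data_def
    using h by (auto intro!: mult_right_mono measurable_compose[OF euler_adapted coeff_measurable(2)])
  have "(\<integral>\<^sup>+\<omega>. indicator (A R ?t) \<omega> * ennreal ((norm (I \<omega> - simple_integral B k (\<lambda>j. real j * h) ?\<eta> \<omega>))\<^sup>2) \<partial>M)
     \<le> (\<integral>\<^sup>+\<omega>. 2 * (\<integral>\<^sup>+u. indicator {0..?t} u * indicator (A R u) \<omega> *
           ennreal ((norm (\<sigma> (X u \<omega>) - simple_process k (\<lambda>j. real j * h) ?\<eta> u \<omega>))\<^sup>2) \<partial>lborel) \<partial>M)"
    by (rule has_ito_integral_bound[OF _ I step stopping_family_A]) (use h in simp)
  also have "\<dots> \<le> (\<integral>\<^sup>+\<omega>. 2 * (ennreal (K\<^sup>2) * path_err R h ?t \<omega>) \<partial>M)"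
  proof (intro nn_integral_mono mult_left_mono)
    fix \<omega> assume \<omega>: "\<omega> \<in> space M"
    have m: "(\<lambda>u. indicator {0..?t} u * indicator (A R (max 0 u)) \<omega> * ennreal ((norm (X (max 0 u) \<omega> - E h s (step_index h u) \<omega>))\<^sup>2)) \<in> borel_measurable borel"
      by (rule pair_section_measurable[OF _ \<omega>]) measurable
    have "(\<integral>\<^sup>+u. indicator {0..?t} u * indicator (A R u) \<omega> *
           ennreal ((norm (\<sigma> (X u \<omega>) - simple_process k (\<lambda>j. real j * h) ?\<eta> u \<omega>))\<^sup>2) \<partial>lborel) \<le>
      (\<integral>\<^sup>+u. ennreal (K\<^sup>2) * (indicator {0..?t} u * indicator (A R (max 0 u)) \<omega> * ennreal ((norm (X (max 0 u) \<omega> - E h s (step_index h u) \<omega>))\<^sup>2)) \<partial>lborel)"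
    proof (rule nn_integral_mono_AE)
      show "AE u in lborel. indicator {0..?t} u * indicator (A R u) \<omega> *
           ennreal ((norm (\<sigma> (X u \<omega>) - simple_process k (\<lambda>j. real j * h) ?\<eta> u \<omega>))\<^sup>2)
         \<le> ennreal (K\<^sup>2) * (indicator {0..?t} u * indicator (A R (max 0 u)) \<omega> * ennreal ((norm (X (max 0 u) \<omega> - E h s (step_index h u) \<omega>))\<^sup>2))"
        using AE_lborel_singleton[of 0]
      proof eventually_elim
        case (elim u)
        show ?case
        proof (cases "0 < u \<and> u \<le> ?t")
          case True
          then have u: "0 < u" "u \<le> ?t" by auto
          have sp: "simple_process k (\<lambda>j. real j * h) ?\<eta> u \<omega> = \<sigma> (E h s (step_index h u) \<omega>)"
            unfolding simple_process_def by (rule step_sum_eq[OF h u])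
          have "(norm (\<sigma> (X u \<omega>) - \<sigma> (E h s (step_index h u) \<omega>)))\<^sup>2 \<le> (K * norm (X u \<omega> - E h s (step_index h u) \<omega>))\<^sup>2"
            by (intro power_mono lip_norm) simp
          then have "ennreal ((norm (\<sigma> (X u \<omega>) - \<sigma> (E h s (step_index h u) \<omega>)))\<^sup>2) \<le>
            ennreal (K\<^sup>2) * ennreal ((norm (X u \<omega> - E h s (step_index h u) \<omega>))\<^sup>2)"
            by (simp add: ennreal_mult[symmetric] power_mult_distrib ennreal_leI)
          then show ?thesis using u by (auto simp: sp max_absorb2 indicator_def)
        qed (use elim in \<open>auto simp: indicator_def\<close>)
      qed
    qed
    also have "\<dots> = ennreal (K\<^sup>2) * path_err R h ?t \<omega>"
      unfolding path_err_def using m by (subst nn_integral_cmult) auto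
    finally show "(\<integral>\<^sup>+u. indicator {0..?t} u * indicator (A R u) \<omega> *
           ennreal ((norm (\<sigma> (X u \<omega>) - simple_process k (\<lambda>j. real j * h) ?\<eta> u \<omega>))\<^sup>2) \<partial>lborel) \<le> ennreal (K\<^sup>2) * path_err R h ?t \<omega>" .
  qed simp
  also have "\<dots> = ennreal (2 * K\<^sup>2) * (\<integral>\<^sup>+\<omega>. path_err R h ?t \<omega> \<partial>M)"
    by (simp add: nn_integral_cmult ennreal_mult mult.assoc)
  finally show ?thesis .
qed

text \<open>The constant is \<open>2 * (T * K\<^sup>2)\<close> from the drift plus
  \<open>2 * (2 * K\<^sup>2)\<close> from the diffusion, the outer factors 2 coming from the square
  of a sum.\<close>

lemma sq_err_le_path_err:
  assumes h: "0 < h" and k: "real k * h \<le> T"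
  shows "sq_err R h k \<le> ennreal ((2 * T + 4) * K\<^sup>2) * (\<integral>\<^sup>+\<omega>. path_err R h (real k * h) \<omega> \<partial>M)"
proof -
  let ?t = "real k * h"
  have t: "0 \<le> ?t" using h by simp
  note [measurable] = path_integrals_measurable[OF h] A_sets[OF t]
  obtain I where I: "has_ito_integral M B ?t (\<lambda>u \<omega>. \<sigma> (X u \<omega>)) I"
    and eq: "AE \<omega> in M. X ?t \<omega> = s + (LINT u:{0..?t}|lborel. \<mu> (X u \<omega>)) + I \<omega>"
    using solution t unfolding strong_solution_def by blast
  let ?S = "simple_integral B k (\<lambda>j. real j * h) (\<lambda>j \<omega>. \<sigma> (E h s j \<omega>))"
  have step: "step_data ?t k (\<lambda>j. real j * h) (\<lambda>j \<omega>. \<sigma> (E h s j \<omega>))"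
    unfolding step_data_def
    using h by (auto intro!: mult_right_mono measurable_compose[OF euler_adapted coeff_measurable(2)])
  have [measurable]: "I \<in> borel_measurable M" "?S \<in> borel_measurable M"
    using I simple_integral_measurable[OF step] by (auto simp: has_ito_integral_def)
  have "sq_err R h k \<le> (\<integral>\<^sup>+\<omega>. 2 * (ennreal (?t * K\<^sup>2) * path_err R h ?t \<omega>) +
      2 * (indicator (A R ?t) \<omega> * ennreal ((norm (I \<omega> - ?S \<omega>))\<^sup>2)) \<partial>M)"
    unfolding sq_err_def
  proof (rule nn_integral_mono_AE)
    show "AE \<omega> in M. indicator (A R ?t) \<omega> * ennreal ((norm (X ?t \<omega> - E h s k \<omega>))\<^sup>2) \<le>
       2 * (ennreal (?t * K\<^sup>2) * path_err R h ?t \<omega>) + 2 * (indicator (A R ?t) \<omega> * ennreal ((norm (I \<omega> - ?S \<omega>))\<^sup>2))"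
      using eq
    proof eventually_elim
      case (elim \<omega>)
      show ?case
      proof (cases "\<omega> \<in> A R ?t")
        case True
        let ?D = "(LINT u:{0..?t}|lborel. \<mu> (X u \<omega>)) - (\<Sum>j<k. h *\<^sub>R \<mu> (E h s j \<omega>))"
        have "X ?t \<omega> - E h s k \<omega> = ?D - (?S \<omega> - I \<omega>)"
          unfolding elim euler_eq_simple_integral[of B \<mu> \<sigma> h s k \<omega>] by simp
        then have "(norm (X ?t \<omega> - E h s k \<omega>))\<^sup>2 \<le> 2 * (norm ?D)\<^sup>2 + 2 * (norm (I \<omega> - ?S \<omega>))\<^sup>2"
          using norm_diff_sq_le[of ?D "?S \<omega> - I \<omega>" 0] by (simp add: norm_minus_commute)
        then have "ennreal ((norm (X ?t \<omega> - E h s k \<omega>))\<^sup>2) \<le> 2 * ennreal ((norm ?D)\<^sup>2) + 2 * ennreal ((norm (I \<omega> - ?S \<omega>))\<^sup>2)"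
        proof -
          assume "(norm (X ?t \<omega> - E h s k \<omega>))\<^sup>2 \<le> 2 * (norm ?D)\<^sup>2 + 2 * (norm (I \<omega> - ?S \<omega>))\<^sup>2"
          from ennreal_leI[OF this] show ?thesis by (simp add: ennreal_plus ennreal_mult)
        qed
        also have "\<dots> \<le> 2 * (ennreal (?t * K\<^sup>2) * path_err R h ?t \<omega>) + 2 * ennreal ((norm (I \<omega> - ?S \<omega>))\<^sup>2)"
          by (rule add_right_mono[OF mult_left_mono[OF drift_difference_le[OF h True]]]) simp
        finally show ?thesis using True by simp
      qed simp
    qed
  qed
  also have "\<dots> = 2 * (ennreal (?t * K\<^sup>2) * (\<integral>\<^sup>+\<omega>. path_err R h ?t \<omega> \<partial>M)) +
      2 * (\<integral>\<^sup>+\<omega>. indicator (A R ?t) \<omega> * ennreal ((norm (I \<omega> - ?S \<omega>))\<^sup>2) \<partial>M)"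
    by (simp add: nn_integral_add nn_integral_cmult)
  also have "\<dots> \<le> 2 * (ennreal (T * K\<^sup>2) * (\<integral>\<^sup>+\<omega>. path_err R h ?t \<omega> \<partial>M)) +
      2 * (ennreal (2 * K\<^sup>2) * (\<integral>\<^sup>+\<omega>. path_err R h ?t \<omega> \<partial>M))"
    by (intro add_mono mult_left_mono mult_right_mono ennreal_leI k diffusion_difference_le[OF h I]) auto
  also have "\<dots> = (2 * ennreal (T * K\<^sup>2) + 2 * ennreal (2 * K\<^sup>2)) * (\<integral>\<^sup>+\<omega>. path_err R h ?t \<omega> \<partial>M)"
    by (simp add: algebra_simps)
  also have "2 * ennreal (T * K\<^sup>2) + 2 * ennreal (2 * K\<^sup>2) = ennreal (2 * (T * K\<^sup>2) + 2 * (2 * K\<^sup>2))"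
  proof -
    have "0 \<le> T" using t k by simp
    then show ?thesis by (simp add: ennreal_plus ennreal_mult)
  qed
  also have "2 * (T * K\<^sup>2) + 2 * (2 * K\<^sup>2) = (2 * T + 4) * K\<^sup>2" by (simp add: algebra_simps)
  finally show ?thesis .
qed

end

context sde_solution
begin

lemma path_osc_integrand_le:
  assumes h: "0 < h"
  shows "indicator {0..T} u * indicator (A R (max 0 u)) \<omega> *
      ennreal ((norm (X (max 0 u) \<omega> - X (real (step_index h u) * h) \<omega>))\<^sup>2) \<le> ennreal (4 * R\<^sup>2) * indicator {0..T} u"
proof (cases "u \<in> {0..T} \<and> \<omega> \<in> A R u")
  case True
  then have u: "0 \<le> u" and \<omega>: "\<omega> \<in> A R u" by auto
  have l: "real (step_index h u) * h \<le> u"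
  proof (cases "u = 0")
    case False
    then show ?thesis using step_index_bounds(1)[OF h, of u] u by simp
  qed (simp add: step_index_def)
  have "norm (X u \<omega>) \<le> R" "norm (X (real (step_index h u) * h) \<omega>) \<le> R"
    using A_bound[OF \<omega>] u l h by auto
  then have "norm (X u \<omega> - X (real (step_index h u) * h) \<omega>) \<le> 2 * R"
    using norm_triangle_ineq4[of "X u \<omega>" "X (real (step_index h u) * h) \<omega>"] by simp
  then have "(norm (X u \<omega> - X (real (step_index h u) * h) \<omega>))\<^sup>2 \<le> (2 * R)\<^sup>2"
    by (rule power_mono) simp
  then show ?thesis using True by (simp add: max_absorb2 ennreal_leI power_mult_distrib)
qed (auto simp: indicator_def max_def)

text \<open>Dominated convergence twice, first in time and then in \<omega>: paths are continuous
  and on the localising event the integrand is at most \<open>4 * R\<^sup>2\<close>. This gives no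
  rate in \<open>h\<close>, and the semigroup argument asks for none.\<close>

lemma path_osc_tendsto:
  assumes T: "0 \<le> T" and h: "\<And>n. 0 < h n" "h \<longlonglongrightarrow> 0"
  shows "(\<lambda>n. \<integral>\<^sup>+\<omega>. path_osc R (h n) T \<omega> \<partial>M) \<longlonglongrightarrow> 0"
    and "(\<integral>\<^sup>+\<omega>. path_osc R (h n) T \<omega> \<partial>M) < \<infinity>"
proof -
  note [measurable] = path_integrals_measurable[OF h(1)] X_grid_measurable[OF h(1)]
  let ?f = "\<lambda>n u \<omega>. indicator {0..T} u * indicator (A R (max 0 u)) \<omega> *
      ennreal ((norm (X (max 0 u) \<omega> - X (real (step_index (h n) u) * h n) \<omega>))\<^sup>2)"
  have int: "(\<integral>\<^sup>+u. ennreal (4 * R\<^sup>2) * indicator {0..T} u \<partial>lborel) = ennreal (4 * R\<^sup>2 * T)"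
    using T by (simp add: nn_integral_cmult_indicator ennreal_mult)
  have le: "path_osc R (h n) T \<omega> \<le> ennreal (4 * R\<^sup>2 * T)" for n \<omega>
    unfolding path_osc_def int[symmetric] by (intro nn_integral_mono path_osc_integrand_le h)
  have "(\<integral>\<^sup>+\<omega>. path_osc R (h n) T \<omega> \<partial>M) \<le> (\<integral>\<^sup>+\<omega>. ennreal (4 * R\<^sup>2 * T) \<partial>M)"
    by (intro nn_integral_mono le)
  also have "\<dots> < \<infinity>" by (simp add: emeasure_space_1)
  finally show "(\<integral>\<^sup>+\<omega>. path_osc R (h n) T \<omega> \<partial>M) < \<infinity>" .
  have "(\<lambda>n. \<integral>\<^sup>+\<omega>. path_osc R (h n) T \<omega> \<partial>M) \<longlonglongrightarrow> (\<integral>\<^sup>+\<omega>. 0 \<partial>M)"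
  proof (rule nn_integral_dominated_convergence[where w="\<lambda>_. ennreal (4 * R\<^sup>2 * T)"])
    show "AE \<omega> in M. (\<lambda>n. path_osc R (h n) T \<omega>) \<longlonglongrightarrow> 0"
    proof (rule AE_I2)
      fix \<omega> assume \<omega>: "\<omega> \<in> space M"
      have "(\<lambda>n. \<integral>\<^sup>+u. ?f n u \<omega> \<partial>lborel) \<longlonglongrightarrow> (\<integral>\<^sup>+u. 0 \<partial>(lborel :: real measure))"
      proof (rule nn_integral_dominated_convergence[where w="\<lambda>u. ennreal (4 * R\<^sup>2) * indicator {0..T} u"])
        show "(\<lambda>u. ?f n u \<omega>) \<in> borel_measurable lborel" for n
          using pair_section_measurable[of "?f n", OF _ \<omega>] by simp
        show "AE u in lborel. (\<lambda>n. ?f n u \<omega>) \<longlonglongrightarrow> 0"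
          using AE_lborel_singleton[of 0]
        proof eventually_elim
          case (elim u)
          show ?case
          proof (cases "0 < u")
            case True
            let ?l = "\<lambda>n. real (step_index (h n) u) * h n"
            have l: "u - h n \<le> ?l n" "?l n \<le> u" "0 \<le> ?l n" for n
              using step_index_bounds[OF h(1) True, of n] h(1)[of n] by (auto simp: algebra_simps)
            have "?l \<longlonglongrightarrow> u"
              by (rule tendsto_sandwich[of "\<lambda>n. u - h n" _ _ "\<lambda>_. u"])
                (use l tendsto_diff[OF tendsto_const h(2), of u] in auto)
            then have "(\<lambda>n. X (?l n) \<omega>) \<longlonglongrightarrow> X u \<omega>"
              using continuous_on_tendsto_compose[OF X_cont[OF \<omega>], of ?l u sequentially] l True by auto
            then have "(\<lambda>n. ennreal ((norm (X u \<omega> - X (?l n) \<omega>))\<^sup>2)) \<longlonglongrightarrow> ennreal ((norm (X u \<omega> - X u \<omega>))\<^sup>2)"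
              by (intro tendsto_ennrealI tendsto_intros)
            then have lim: "(\<lambda>n. ennreal ((norm (X u \<omega> - X (?l n) \<omega>))\<^sup>2)) \<longlonglongrightarrow> 0" by simp
            show ?thesis
              by (rule tendsto_sandwich[OF _ _ tendsto_const lim]) (use True in \<open>auto simp: indicator_def max_absorb2\<close>)
          qed (use elim in \<open>simp add: indicator_def\<close>)
        qed
        show "AE u in lborel. ?f n u \<omega> \<le> ennreal (4 * R\<^sup>2) * indicator {0..T} u" for n
          using path_osc_integrand_le[OF h(1)] by simp
      qed (auto simp: int)
      then show "(\<lambda>n. path_osc R (h n) T \<omega>) \<longlonglongrightarrow> 0" by (simp add: path_osc_def)
    qed
  qed (use le in \<open>auto simp: emeasure_space_1\<close>)
  then show "(\<lambda>n. \<integral>\<^sup>+\<omega>. path_osc R (h n) T \<omega> \<partial>M) \<longlonglongrightarrow> 0" by simp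
qed

text \<open>Combining the two error bounds closes the recursion; the power
  \<open>(1 + c * h) ^ N\<close> is bounded by an exponential depending only on
  \<open>T = real N * h\<close>.\<close>

lemma sq_err_gronwall:
  assumes h: "0 < h" and N: "real N * h = T" and e: "(\<integral>\<^sup>+\<omega>. path_osc R h T \<omega> \<partial>M) = ennreal e" "0 \<le> e"
  defines "c \<equiv> 2 * ((2 * T + 4) * K\<^sup>2)"
  shows "sq_err R h N \<le> ennreal (c * e * exp (c * T))"
proof -
  have T: "0 \<le> T" using N h by auto
  have c: "0 \<le> c" using T by (simp add: c_def)
  have "sq_err R h N \<le> ennreal (c * e * (1 + c * h) ^ N)"
  proof (rule ennreal_gronwall[of _ _ N])
    fix k assume "k \<le> N"
    then have k: "real k * h \<le> T" unfolding N[symmetric] using h by (intro mult_right_mono) auto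
    have "sq_err R h k \<le> ennreal ((2 * T + 4) * K\<^sup>2) * (\<integral>\<^sup>+\<omega>. path_err R h (real k * h) \<omega> \<partial>M)"
      by (rule sq_err_le_path_err[OF h k])
    also have "\<dots> \<le> ennreal ((2 * T + 4) * K\<^sup>2) * (2 * ennreal e + 2 * (ennreal h * (\<Sum>j<k. sq_err R h j)))"
      unfolding e(1)[symmetric] by (intro mult_left_mono path_err_le[OF h k]) simp
    also have "\<dots> = ennreal ((2 * T + 4) * K\<^sup>2) * 2 * ennreal e + ennreal ((2 * T + 4) * K\<^sup>2) * 2 * ennreal h * (\<Sum>j<k. sq_err R h j)"
      by (simp add: algebra_simps)
    also have "ennreal ((2 * T + 4) * K\<^sup>2) * 2 = ennreal c"
      using T by (simp add: c_def ennreal_mult mult.commute)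
    finally show "sq_err R h k \<le> ennreal (c * e) + ennreal (c * h) * (\<Sum>j<k. sq_err R h j)"
      using c e h by (simp add: ennreal_mult)
  qed (use c e h in auto)
  also have "\<dots> \<le> ennreal (c * e * exp (c * T))"
  proof (intro ennreal_leI mult_left_mono)
    have "(1 + c * h) ^ N \<le> exp (c * h) ^ N"
      using c h by (intro power_mono) auto
    also have "\<dots> = exp (c * T)"
      by (simp add: exp_of_nat_mult[symmetric] N[symmetric] mult_ac)
    finally show "(1 + c * h) ^ N \<le> exp (c * T)" .
  qed (use c e in auto)
  finally show ?thesis .
qed

lemma sq_err_tendsto:
  assumes T: "0 \<le> T" and h: "\<And>n. 0 < h n" "h \<longlonglongrightarrow> 0" and N: "\<And>n. real (N n) * h n = T"
  shows "(\<lambda>n. sq_err R (h n) (N n)) \<longlonglongrightarrow> 0"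
proof -
  define e where "e n = enn2real (\<integral>\<^sup>+\<omega>. path_osc R (h n) T \<omega> \<partial>M)" for n
  note osc = path_osc_tendsto[OF T h, of R]
  have e: "(\<integral>\<^sup>+\<omega>. path_osc R (h n) T \<omega> \<partial>M) = ennreal (e n)" "0 \<le> e n" for n
    using osc(2)[of n] by (auto simp: e_def)
  have "(\<lambda>n. enn2real (\<integral>\<^sup>+\<omega>. path_osc R (h n) T \<omega> \<partial>M)) \<longlonglongrightarrow> 0"
    by (rule tendsto_enn2real) (use osc(1) in auto)
  then have e0: "e \<longlonglongrightarrow> 0" by (simp add: e_def[abs_def])
  let ?c = "2 * ((2 * T + 4) * K\<^sup>2)"
  have "(\<lambda>n. ennreal (?c * e n * exp (?c * T))) \<longlonglongrightarrow> ennreal (?c * 0 * exp (?c * T))"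
    by (intro tendsto_ennrealI tendsto_intros e0)
  then have l: "(\<lambda>n. ennreal (?c * e n * exp (?c * T))) \<longlonglongrightarrow> 0" by simp
  show ?thesis
    by (rule tendsto_sandwich[OF _ _ tendsto_const l])
      (use sq_err_gronwall[OF h(1) N e] in auto)
qed

text \<open>The truncated distance metrises convergence in probability. First fix a radius for which
  leaving the ball is unlikely, then refine the mesh; inside the ball the mean square error controls
  the distance.\<close>

lemma euler_converges:
  assumes T: "0 \<le> T" and h: "\<And>n. 0 < h n" "h \<longlonglongrightarrow> 0" and N: "\<And>n. real (N n) * h n = T"
  shows "(\<lambda>n. expectation (\<lambda>\<omega>. min 1 (norm (X T \<omega> - E (h n) s (N n) \<omega>)))) \<longlonglongrightarrow> 0"
proof (rule LIMSEQ_I)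
  fix r :: real assume r: "0 < r"
  let ?Y = "\<lambda>n \<omega>. norm (X T \<omega> - E (h n) s (N n) \<omega>)"
  \<comment> \<open>Three contributions of \<delta> appear: the exit probability, the constant in
    \<open>Y \<le> \<delta> + Y\<^sup>2 / \<delta>\<close>, and the scaled mean square error. Their
    sum stays below \<open>r\<close>.\<close>
  define \<delta> where "\<delta> = r / 4"
  have \<delta>: "0 < \<delta>" using r by (simp add: \<delta>_def)
  obtain m where m: "1 - prob (A (real m) T) < \<delta>"
  proof -
    have "\<forall>\<^sub>F m in sequentially. 1 - \<delta> < prob (A (real m) T)"
      using A_exhausts[OF T] \<delta> by (intro order_tendstoD(1)) auto
    then have "\<exists>m. 1 - \<delta> < prob (A (real m) T)"
      by (rule eventually_happens'[OF sequentially_bot])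
    then obtain m where "1 - \<delta> < prob (A (real m) T)" by blast
    then show ?thesis by (intro that[of m]) linarith
  qed
  let ?A = "A (real m) T"
  have Am [measurable]: "?A \<in> sets M" using A_sets[OF T] .
  have Xm [measurable]: "X T \<in> borel_measurable M" using X_measurable[OF T] .
  have Em [measurable]: "E (h n) s (N n) \<in> borel_measurable M" for n
    using h(1)[of n] by (intro euler_measurable) simp
  \<comment> \<open>The level \<delta> squared compensates the later factor
    \<open>1 / \<delta>\<close>.\<close>
  have "\<forall>\<^sub>F n in sequentially. sq_err (real m) (h n) (N n) < ennreal (\<delta> * \<delta>)"
    by (intro order_tendstoD(2)[OF sq_err_tendsto[OF T h N]]) (use \<delta> in simp)
  then obtain n0 where n0: "\<And>n. n \<ge> n0 \<Longrightarrow> sq_err (real m) (h n) (N n) < ennreal (\<delta> * \<delta>)"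
    by (auto simp: eventually_sequentially)
  have "expectation (\<lambda>\<omega>. min 1 (?Y n \<omega>)) < r" if n: "n \<ge> n0" for n
  proof -
    have "ennreal (expectation (\<lambda>\<omega>. min 1 (?Y n \<omega>))) = (\<integral>\<^sup>+\<omega>. ennreal (min 1 (?Y n \<omega>)) \<partial>M)"
      by (intro nn_integral_eq_integral[symmetric] integrable_const_bound[where B=1]) auto
    also have "\<dots> \<le> (\<integral>\<^sup>+\<omega>. (indicator (space M - ?A) \<omega> + ennreal \<delta>) + ennreal (1 / \<delta>) * (indicator ?A \<omega> * ennreal ((?Y n \<omega>)\<^sup>2)) \<partial>M)"
    proof (rule nn_integral_mono)
      fix \<omega> assume \<omega>: "\<omega> \<in> space M"
      show "ennreal (min 1 (?Y n \<omega>)) \<le> (indicator (space M - ?A) \<omega> + ennreal \<delta>) + ennreal (1 / \<delta>) * (indicator ?A \<omega> * ennreal ((?Y n \<omega>)\<^sup>2))"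
      proof (cases "\<omega> \<in> ?A")
        case True
        have "?Y n \<omega> \<le> \<delta> + (?Y n \<omega>)\<^sup>2 / \<delta>"
        proof (cases "?Y n \<omega> \<le> \<delta>")
          case True
          moreover have "0 \<le> (?Y n \<omega>)\<^sup>2 / \<delta>" using \<delta> by simp
          ultimately show ?thesis by linarith
        next
          case False
          then have "?Y n \<omega> * \<delta> \<le> ?Y n \<omega> * ?Y n \<omega>" by (intro mult_left_mono) auto
          then have "?Y n \<omega> \<le> (?Y n \<omega>)\<^sup>2 / \<delta>" using \<delta> by (simp add: field_simps power2_eq_square)
          then show ?thesis using \<delta> by linarith
        qed
        then have "ennreal (min 1 (?Y n \<omega>)) \<le> ennreal (\<delta> + 1 / \<delta> * (?Y n \<omega>)\<^sup>2)"
          by (intro ennreal_leI) simp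
        also have "\<dots> = ennreal \<delta> + ennreal (1 / \<delta>) * ennreal ((?Y n \<omega>)\<^sup>2)"
          using \<delta> by (subst ennreal_plus) (auto simp: ennreal_mult[symmetric])
        finally show ?thesis using True by simp
      next
        case False
        have "ennreal (min 1 (?Y n \<omega>)) \<le> ennreal 1" by (intro ennreal_leI) simp
        also have "\<dots> \<le> 1 + ennreal \<delta>" by simp
        finally show ?thesis using False \<omega> by simp
      qed
    qed
    also have "\<dots> = (emeasure M (space M - ?A) + ennreal \<delta>) + ennreal (1 / \<delta>) * sq_err (real m) (h n) (N n)"
      by (subst nn_integral_add, simp, simp, subst nn_integral_add) (simp_all add: nn_integral_cmult sq_err_def N emeasure_space_1)
    also have "\<dots> \<le> (ennreal \<delta> + ennreal \<delta>) + ennreal (1 / \<delta>) * ennreal (\<delta> * \<delta>)"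
    proof (intro add_mono mult_left_mono)
      show "emeasure M (space M - ?A) \<le> ennreal \<delta>"
        using m prob_compl[OF Am] by (simp add: emeasure_eq_measure ennreal_leI)
      show "sq_err (real m) (h n) (N n) \<le> ennreal (\<delta> * \<delta>)" using n0[OF n] by simp
    qed simp_all
    also have "\<dots> = ennreal (3 * \<delta>)"
      using \<delta> by (simp add: ennreal_mult[symmetric] ennreal_plus[symmetric] del: ennreal_plus)
    finally have "expectation (\<lambda>\<omega>. min 1 (?Y n \<omega>)) \<le> 3 * \<delta>"
      using \<delta> by (simp add: ennreal_le_iff)
    then show ?thesis using r by (simp add: \<delta>_def)
  qed
  moreover have "0 \<le> expectation (\<lambda>\<omega>. min 1 (?Y n \<omega>))" for n
    by (intro integral_nonneg_AE) auto
  ultimately show "\<exists>n0. \<forall>n\<ge>n0. norm (expectation (\<lambda>\<omega>. min 1 (?Y n \<omega>)) - 0) < r" by auto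
qed

end

subsection \<open>The transition operator of the Euler scheme\<close>

lemma gauss_affine_second_moment:
  fixes v :: "real^'d::finite" and S :: "real^'d^'d"
  assumes h: "0 < h"
  shows "has_bochner_integral (gauss h) (\<lambda>y. (norm (v + S *v y))\<^sup>2) ((norm v)\<^sup>2 + h * (norm S)\<^sup>2)"
proof -
  have 1: "has_bochner_integral (gauss h) (\<lambda>y. \<Sum>l\<in>UNIV. (2 * (\<Sum>i\<in>UNIV. v $ i * S $ i $ l)) * y $ l)
     (\<Sum>l\<in>(UNIV::'d set). (2 * (\<Sum>i\<in>UNIV. v $ i * S $ i $ l)) * 0)"
    by (intro has_bochner_integral_sum has_bochner_integral_mult_right gauss_first_moment(1)[OF h])
  have 2: "has_bochner_integral (gauss h) (\<lambda>y. \<Sum>l\<in>UNIV. \<Sum>m\<in>UNIV. (\<Sum>i\<in>UNIV. S $ i $ l * S $ i $ m) * (y $ l * y $ m))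
     (\<Sum>l\<in>(UNIV::'d set). \<Sum>m\<in>UNIV. (\<Sum>i\<in>UNIV. S $ i $ l * S $ i $ m) * (if l = m then h else 0))"
    by (intro has_bochner_integral_sum has_bochner_integral_mult_right gauss_covariance[OF h])
  have "(\<Sum>l\<in>(UNIV::'d set). \<Sum>m\<in>UNIV. (\<Sum>i\<in>UNIV. S $ i $ l * S $ i $ m) * (if l = m then h else 0)) = h * (norm S)\<^sup>2"
    by (simp add: norm_matrix_sq sum_distrib_left mult.commute if_distrib cong: if_cong)
  then show ?thesis
    using has_bochner_integral_add[OF has_bochner_integral_add[OF gauss_const[OF h] 1] 2]
    by (simp add: norm_add_matrix_vector_sq)
qed

text \<open>The elementary inequality \<open>x \<le> c / 2 + x\<^sup>2 / (2 * c)\<close> passes from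
  the second moment to the first with the sharp constant.\<close>

lemma gauss_affine_norm_le:
  fixes v :: "real^'d::finite" and S :: "real^'d^'d"
  assumes h: "0 < h" and c: "0 < c" "(norm v)\<^sup>2 + h * (norm S)\<^sup>2 \<le> c\<^sup>2"
  shows "integrable (gauss h) (\<lambda>y. norm (v + S *v y))" "(\<integral>y. norm (v + S *v y) \<partial>gauss h) \<le> c"
proof -
  interpret G: prob_space "gauss h :: (real^'d) measure" by (rule prob_space_gauss[OF h])
  note m = gauss_affine_second_moment[OF h, of v S]
  have bound: "norm (v + S *v y) \<le> c / 2 + (norm (v + S *v y))\<^sup>2 * (1 / (2 * c))" for y
  proof -
    have "0 \<le> (norm (v + S *v y) - c)\<^sup>2" by simp
    then have "2 * (norm (v + S *v y) * c) \<le> c\<^sup>2 + (norm (v + S *v y))\<^sup>2"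
      by (simp add: power2_diff algebra_simps)
    then show ?thesis using c(1) by (simp add: field_simps power2_eq_square)
  qed
  have int: "integrable (gauss h) (\<lambda>y. c / 2 + (norm (v + S *v y))\<^sup>2 * (1 / (2 * c)))"
    using m by (intro Bochner_Integration.integrable_add integrable_mult_left) (auto simp: has_bochner_integral_iff)
  have [measurable]: "(\<lambda>y. S *v y) \<in> borel_measurable (gauss h)"
    by (rule borel_measurable_matrix_vector_mult) (auto simp: measurable_ident_sets[OF sets_gauss])
  show i: "integrable (gauss h) (\<lambda>y. norm (v + S *v y))"
    by (rule Bochner_Integration.integrable_bound[OF int]) (use order_trans[OF bound abs_ge_self] in auto)
  have "(\<integral>y. norm (v + S *v y) \<partial>gauss h) \<le> (\<integral>y. c / 2 + (norm (v + S *v y))\<^sup>2 * (1 / (2 * c)) \<partial>gauss h)"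
    by (intro integral_mono i int bound)
  also have "\<dots> = c / 2 + ((norm v)\<^sup>2 + h * (norm S)\<^sup>2) * (1 / (2 * c))"
    using m by (subst Bochner_Integration.integral_add)
      (auto simp: has_bochner_integral_iff G.prob_space[unfolded space_gauss])
  also have "\<dots> \<le> c / 2 + c\<^sup>2 * (1 / (2 * c))"
    using c by (intro add_left_mono mult_right_mono) auto
  also have "\<dots> = c" using c(1) by (simp add: power2_eq_square)
  finally show "(\<integral>y. norm (v + S *v y) \<partial>gauss h) \<le> c" .
qed

context sde
begin

text \<open>The one-step transition operator of the Euler chain with step \<open>h\<close>; its
  powers take over the role of a semigroup.\<close>

definition kern :: "real \<Rightarrow> (real^'d \<Rightarrow> real) \<Rightarrow> real^'d \<Rightarrow> real" where
  "kern h f x = (\<integral>y. f (x + h *\<^sub>R \<mu> x + \<sigma> x *v y) \<partial>gauss h)"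

lemma step_map_measurable [measurable]:
  "(\<lambda>z. fst z + h *\<^sub>R \<mu> (fst z) + \<sigma> (fst z) *v snd z) \<in> borel_measurable (borel \<Otimes>\<^sub>M borel)"
  by measurable

lemma kern_measurable:
  assumes h: "0 < h" and f [measurable]: "f \<in> borel_measurable borel"
  shows "kern h f \<in> borel_measurable borel"
proof -
  interpret G: prob_space "gauss h :: (real^'d) measure" by (rule prob_space_gauss[OF h])
  have "(\<lambda>z. f (fst z + h *\<^sub>R \<mu> (fst z) + \<sigma> (fst z) *v snd z)) \<in> borel_measurable (borel \<Otimes>\<^sub>M borel)"
    by (rule measurable_compose[OF step_map_measurable f])
  then have "(\<lambda>(x, y). f (x + h *\<^sub>R \<mu> x + \<sigma> x *v y)) \<in> borel_measurable (borel \<Otimes>\<^sub>M gauss h)"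
    by (simp add: case_prod_beta cong: measurable_cong_sets sets_pair_measure_cong add: sets_gauss)
  then show ?thesis
    unfolding kern_def[abs_def] by (rule G.borel_measurable_lebesgue_integral)
qed

lemma step_fun_measurable [measurable]:
  assumes [measurable]: "f \<in> borel_measurable borel"
  shows "(\<lambda>y. f (x + h *\<^sub>R \<mu> x + \<sigma> x *v y)) \<in> borel_measurable borel"
  by measurable

lemma kern_bound:
  assumes h: "0 < h" and f [measurable]: "f \<in> borel_measurable borel" and C: "\<And>x. \<bar>f x\<bar> \<le> C"
  shows "integrable (gauss h) (\<lambda>y. f (x + h *\<^sub>R \<mu> x + \<sigma> x *v y))" "\<bar>kern h f x\<bar> \<le> C"
proof -
  interpret G: prob_space "gauss h :: (real^'d) measure" by (rule prob_space_gauss[OF h])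
  have "(\<lambda>y. f (x + h *\<^sub>R \<mu> x + \<sigma> x *v y)) \<in> borel_measurable (gauss h)"
    using step_fun_measurable[OF f, of x h] by (simp cong: measurable_cong_sets add: sets_gauss)
  then show i: "integrable (gauss h) (\<lambda>y. f (x + h *\<^sub>R \<mu> x + \<sigma> x *v y))"
    using C by (intro G.integrable_const_bound[where B=C]) auto
  have "\<bar>kern h f x\<bar> \<le> (\<integral>y. \<bar>f (x + h *\<^sub>R \<mu> x + \<sigma> x *v y)\<bar> \<partial>gauss h)"
    unfolding kern_def by (rule integral_abs_bound)
  also have "\<dots> \<le> (\<integral>y. C \<partial>(gauss h :: (real^'d) measure))"
    using i C by (intro integral_mono integrable_abs) auto
  also have "\<dots> = C" by (simp add: G.prob_space[unfolded space_gauss])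
  finally show "\<bar>kern h f x\<bar> \<le> C" .
qed

lemma kern_funpow:
  assumes h: "0 < h" and f: "f \<in> borel_measurable borel" and C: "\<And>x. \<bar>f x\<bar> \<le> C"
  shows "(kern h ^^ n) f \<in> borel_measurable borel" "\<bar>(kern h ^^ n) f x\<bar> \<le> C"
proof -
  have "(kern h ^^ n) f \<in> borel_measurable borel \<and> (\<forall>x. \<bar>(kern h ^^ n) f x\<bar> \<le> C)"
    by (induction n) (use f C kern_measurable[OF h] kern_bound(2)[OF h] in auto)
  then show "(kern h ^^ n) f \<in> borel_measurable borel" "\<bar>(kern h ^^ n) f x\<bar> \<le> C" by auto
qed

text \<open>The current state is independent of the next increment, so Fubini integrates the
  increment out first.\<close>

lemma expectation_euler_Suc:
  assumes h: "0 < h" and f [measurable]: "f \<in> borel_measurable borel" and C: "\<And>x. \<bar>f x\<bar> \<le> C"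
  shows "expectation (\<lambda>\<omega>. f (E h s (Suc k) \<omega>)) = expectation (\<lambda>\<omega>. kern h f (E h s k \<omega>))"
proof -
  let ?D = "distr M borel (E h s k)" and ?g = "\<lambda>z. f (fst z + h *\<^sub>R \<mu> (fst z) + \<sigma> (fst z) *v snd z)"
  let ?d = "\<lambda>\<omega>. B (real (Suc k) * h) \<omega> - B (real k * h) \<omega>"
  have t: "0 \<le> real k * h" "real k * h < real (Suc k) * h" "real (Suc k) * h - real k * h = h"
    using h by (auto simp: algebra_simps)
  have Em [measurable]: "E h s k \<in> borel_measurable M" using h by (intro euler_measurable) simp
  have dm [measurable]: "?d \<in> borel_measurable M"
    using t by (intro borel_measurable_diff measurable_B) (auto intro: order_trans less_imp_le)
  interpret G: prob_space "gauss h :: (real^'d) measure" by (rule prob_space_gauss[OF h])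
  interpret D: prob_space ?D by (rule prob_space_distr[OF Em])
  interpret P: pair_prob_space ?D "gauss h :: (real^'d) measure" ..
  have gm: "?g \<in> borel_measurable (borel \<Otimes>\<^sub>M borel)" by (rule measurable_compose[OF step_map_measurable f])
  then have gm': "?g \<in> borel_measurable (?D \<Otimes>\<^sub>M gauss h)"
    by (simp cong: measurable_cong_sets sets_pair_measure_cong add: sets_gauss)
  have gi: "integrable (?D \<Otimes>\<^sub>M gauss h) ?g"
    using gm' C by (intro P.integrable_const_bound[where B=C]) auto
  have "expectation (\<lambda>\<omega>. f (E h s (Suc k) \<omega>)) = expectation (\<lambda>\<omega>. ?g (E h s k \<omega>, ?d \<omega>))"
    by simp
  also have "\<dots> = (\<integral>z. ?g z \<partial>distr M (borel \<Otimes>\<^sub>M borel) (\<lambda>\<omega>. (E h s k \<omega>, ?d \<omega>)))"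
    by (intro integral_distr[symmetric] gm) measurable
  also have "distr M (borel \<Otimes>\<^sub>M borel) (\<lambda>\<omega>. (E h s k \<omega>, ?d \<omega>)) = ?D \<Otimes>\<^sub>M gauss h"
    using distr_pair_increment[OF t(1,2) euler_adapted] h by (simp only: t(3) less_imp_le)
  also have "(\<integral>z. ?g z \<partial>(?D \<Otimes>\<^sub>M gauss h)) = (\<integral>x. (\<integral>y. ?g (x, y) \<partial>gauss h) \<partial>?D)"
    by (rule P.integral_fst'[symmetric, OF gi])
  also have "\<dots> = (\<integral>x. kern h f x \<partial>?D)"
    by (simp add: kern_def)
  also have "\<dots> = expectation (\<lambda>\<omega>. kern h f (E h s k \<omega>))"
    by (intro integral_distr kern_measurable h f) measurable
  finally show ?thesis .
qed

lemma expectation_euler_add: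
  assumes h: "0 < h" and f: "f \<in> borel_measurable borel" and C: "\<And>x. \<bar>f x\<bar> \<le> C"
  shows "expectation (\<lambda>\<omega>. f (E h s (k + n) \<omega>)) = expectation (\<lambda>\<omega>. (kern h ^^ n) f (E h s k \<omega>))"
  using f C
proof (induction n arbitrary: f)
  case (Suc n)
  have "expectation (\<lambda>\<omega>. f (E h s (k + Suc n) \<omega>)) = expectation (\<lambda>\<omega>. kern h f (E h s (k + n) \<omega>))"
    using expectation_euler_Suc[OF h Suc.prems, of s "k + n"] by simp
  also have "\<dots> = expectation (\<lambda>\<omega>. (kern h ^^ n) (kern h f) (E h s k \<omega>))"
    by (rule Suc.IH) (use kern_measurable[OF h] kern_bound(2)[OF h] Suc.prems in auto)
  finally show ?case by (simp add: funpow_swap1)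
qed simp

lemma expectation_euler:
  assumes "0 < h" "f \<in> borel_measurable borel" "\<And>x. \<bar>f x\<bar> \<le> C"
  shows "expectation (\<lambda>\<omega>. f (E h s n \<omega>)) = (kern h ^^ n) f s"
  using expectation_euler_add[OF assms, of s 0 n] by (simp add: prob_space)

text \<open>Synchronous coupling: both starting points are moved by the same Gaussian increment, and
  the mean distance after the step is bounded through its second moment.\<close>

lemma kern_lipschitz:
  assumes h: "0 < h" and f: "f \<in> borel_measurable borel" and C: "\<And>x. \<bar>f x\<bar> \<le> C"
    and L: "0 \<le> L" "\<And>x y. \<bar>f x - f y\<bar> \<le> L * norm (x - y)"
  shows "\<bar>kern h f x - kern h f y\<bar> \<le> L * (1 + h * (K + K\<^sup>2)) * norm (x - y)"
proof (cases "x = y")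
  case False
  let ?v = "(x - y) + h *\<^sub>R (\<mu> x - \<mu> y)" and ?S = "\<sigma> x - \<sigma> y"
  let ?c = "(1 + h * (K + K\<^sup>2)) * norm (x - y)"
  note K = K_nonneg
  have c: "0 < ?c" using False h K by (intro mult_pos_pos add_pos_nonneg) auto
  have "h * norm (\<mu> x - \<mu> y) \<le> h * (K * norm (x - y))"
    using h by (intro mult_left_mono lip_norm) auto
  moreover have "norm (h *\<^sub>R (\<mu> x - \<mu> y)) = h * norm (\<mu> x - \<mu> y)"
    using h by simp
  ultimately have "norm ?v \<le> norm (x - y) + h * (K * norm (x - y))"
    using norm_triangle_ineq[of "x - y" "h *\<^sub>R (\<mu> x - \<mu> y)"] by linarith
  then have "(norm ?v)\<^sup>2 \<le> ((1 + h * K) * norm (x - y))\<^sup>2"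
    by (intro power_mono) (auto simp: algebra_simps)
  moreover have "h * (norm ?S)\<^sup>2 \<le> h * (K * norm (x - y))\<^sup>2"
    using h by (intro mult_left_mono power_mono lip_norm) auto
  moreover have "((1 + h * K) * norm (x - y))\<^sup>2 + h * (K * norm (x - y))\<^sup>2 \<le> ?c\<^sup>2"
  proof -
    have "((1 + h * K) * norm (x - y))\<^sup>2 + h * (K * norm (x - y))\<^sup>2 = ((1 + h * K)\<^sup>2 + h * K\<^sup>2) * (norm (x - y))\<^sup>2"
      unfolding power_mult_distrib by (simp only: distrib_right[of _ _ "(norm (x - y))\<^sup>2"] mult.assoc)
    also have "\<dots> \<le> (1 + h * (K + K\<^sup>2))\<^sup>2 * (norm (x - y))\<^sup>2"
    proof (rule mult_right_mono)
      \<comment> \<open>This is exactly the difference of the two sides of the inequality to be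
        shown. The summand \<open>h * K\<^sup>2\<close> in the growth factor absorbs the variance of
        the coupled noise.\<close>
      have "0 \<le> h * K\<^sup>2 + 2 * (h * K) * (h * K\<^sup>2) + (h * K\<^sup>2)\<^sup>2"
        using h K by (intro add_nonneg_nonneg mult_nonneg_nonneg) auto
      then show "(1 + h * K)\<^sup>2 + h * K\<^sup>2 \<le> (1 + h * (K + K\<^sup>2))\<^sup>2"
        by (simp add: power2_sum distrib_left algebra_simps)
    qed simp
    finally show ?thesis by (simp add: power_mult_distrib)
  qed
  ultimately have cc: "(norm ?v)\<^sup>2 + h * (norm ?S)\<^sup>2 \<le> ?c\<^sup>2" by linarith
  note g = gauss_affine_norm_le[OF h c cc]
  have eq: "(x + h *\<^sub>R \<mu> x + \<sigma> x *v z) - (y + h *\<^sub>R \<mu> y + \<sigma> y *v z) = ?v + ?S *v z" for z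
    by (simp add: matrix_vector_mult_diff_rdistrib scaleR_diff_right)
  note i = kern_bound(1)[OF h f C]
  have "\<bar>kern h f x - kern h f y\<bar> = \<bar>\<integral>z. f (x + h *\<^sub>R \<mu> x + \<sigma> x *v z) - f (y + h *\<^sub>R \<mu> y + \<sigma> y *v z) \<partial>gauss h\<bar>"
    unfolding kern_def by (subst Bochner_Integration.integral_diff[OF i i]) simp
  also have "\<dots> \<le> (\<integral>z. \<bar>f (x + h *\<^sub>R \<mu> x + \<sigma> x *v z) - f (y + h *\<^sub>R \<mu> y + \<sigma> y *v z)\<bar> \<partial>gauss h)"
    by (rule integral_abs_bound)
  also have "\<dots> \<le> (\<integral>z. L * norm (?v + ?S *v z) \<partial>gauss h)"
    unfolding eq[symmetric]
    by (intro integral_mono integrable_abs Bochner_Integration.integrable_diff i integrable_mult_right L(2) g(1)[folded eq])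
  also have "\<dots> = L * (\<integral>z. norm (?v + ?S *v z) \<partial>gauss h)" by simp
  also have "\<dots> \<le> L * ?c" using L(1) g(2) by (rule mult_left_mono[rotated])
  finally show ?thesis by (simp add: mult.assoc)
qed simp

text \<open>The bound depends on \<open>n\<close> and \<open>h\<close> only through the elapsed
  time, so it survives the refinement of the mesh.\<close>

lemma kern_funpow_lipschitz:
  assumes h: "0 < h" and f: "f \<in> borel_measurable borel" and C: "\<And>x. \<bar>f x\<bar> \<le> C"
    and L: "0 \<le> L" "\<And>x y. \<bar>f x - f y\<bar> \<le> L * norm (x - y)"
  shows "\<bar>(kern h ^^ n) f x - (kern h ^^ n) f y\<bar> \<le> L * exp ((K + K\<^sup>2) * (real n * h)) * norm (x - y)"
proof -
  have c: "0 \<le> h * (K + K\<^sup>2)" using h K_nonneg by simp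
  have "\<bar>(kern h ^^ n) f x - (kern h ^^ n) f y\<bar> \<le> L * (1 + h * (K + K\<^sup>2)) ^ n * norm (x - y)" for x y
  proof (induction n arbitrary: x y)
    case (Suc n)
    have "\<bar>kern h ((kern h ^^ n) f) x - kern h ((kern h ^^ n) f) y\<bar> \<le>
       (L * (1 + h * (K + K\<^sup>2)) ^ n) * (1 + h * (K + K\<^sup>2)) * norm (x - y)"
      by (rule kern_lipschitz[OF h kern_funpow[OF h f C] _ Suc.IH]) (use L c in auto)
    then show ?case by (simp add: mult_ac)
  qed (use L in simp)
  also have "L * (1 + h * (K + K\<^sup>2)) ^ n * norm (x - y) \<le> L * exp ((K + K\<^sup>2) * (real n * h)) * norm (x - y)"
  proof (intro mult_right_mono mult_left_mono)
    have "(1 + h * (K + K\<^sup>2)) ^ n \<le> exp (h * (K + K\<^sup>2)) ^ n"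
      using c by (intro power_mono) auto
    also have "\<dots> = exp ((K + K\<^sup>2) * (real n * h))"
      by (simp add: exp_of_nat_mult[symmetric] mult_ac)
    finally show "(1 + h * (K + K\<^sup>2)) ^ n \<le> exp ((K + K\<^sup>2) * (real n * h))" .
  qed (use L in auto)
  finally show ?thesis by blast
qed

end

subsection \<open>The Markov property\<close>

text \<open>One solution is chosen for each starting point, with no joint regularity in
  \<open>s\<close>; measurability of \<open>P t f\<close> therefore has to be derived.\<close>

locale sde_flow = sde M B \<mu> \<sigma> K
  for M :: "'w measure" and B :: "real \<Rightarrow> 'w \<Rightarrow> real^'d::finite" and \<mu> \<sigma> K +
  fixes X :: "real^'d \<Rightarrow> real \<Rightarrow> 'w \<Rightarrow> real^'d"
  assumes solutions: "\<And>s. strong_solution M B \<mu> \<sigma> s (X s)"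
begin

lemma sde_solution: "sde_solution M B \<mu> \<sigma> K s (X s)"
  by unfold_locales (rule solutions)

lemmas flow_measurable = sde_solution.X_measurable[OF sde_solution]
  and flow_cont = sde_solution.X_cont[OF sde_solution]
  and flow_measurable_pair = sde_solution.X_measurable_pair[OF sde_solution]

lemma flow_0: "AE \<omega> in M. X s 0 \<omega> = s"
  using solutions by (simp add: strong_solution_def)

definition P :: "real \<Rightarrow> (real^'d \<Rightarrow> real) \<Rightarrow> real^'d \<Rightarrow> real" where
  "P t f s = expectation (\<lambda>\<omega>. f (X s t \<omega>))"

lemma flow_integrable:
  fixes f :: "real^'d \<Rightarrow> real"
  assumes "0 \<le> t" "f \<in> borel_measurable borel" "\<And>x. \<bar>f x\<bar> \<le> C"
  shows "integrable M (\<lambda>\<omega>. f (X s t \<omega>))"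
  using measurable_compose[OF flow_measurable[OF assms(1)] assms(2)] assms(3)
  by (intro integrable_const_bound[where B=C]) auto

lemma P_bound:
  assumes "0 \<le> t" "f \<in> borel_measurable borel" "\<And>x. \<bar>f x\<bar> \<le> C"
  shows "\<bar>P t f s\<bar> \<le> C"
proof -
  have "\<bar>P t f s\<bar> \<le> expectation (\<lambda>\<omega>. \<bar>f (X s t \<omega>)\<bar>)"
    unfolding P_def by (rule integral_abs_bound)
  also have "\<dots> \<le> expectation (\<lambda>\<omega>. C)"
    using flow_integrable[OF assms] assms(3) by (intro integral_mono integrable_abs) auto
  finally show ?thesis by (simp add: prob_space)
qed

lemma lipschitz_measurable:
  fixes f :: "real^'d \<Rightarrow> real"
  assumes "0 \<le> L" "\<And>x y. \<bar>f x - f y\<bar> \<le> L * norm (x - y)"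
  shows "f \<in> borel_measurable borel"
proof -
  have "L-lipschitz_on UNIV f"
    using assms by (intro lipschitz_onI) (auto simp: dist_norm)
  then show ?thesis by (intro borel_measurable_continuous_onI lipschitz_on_continuous_on)
qed

text \<open>Lipschitz continuity is used at distances up to 1, boundedness beyond; this converts the
  truncated distance of \<open>euler_converges\<close> into convergence of expectations.\<close>

lemma min_one_bound:
  assumes C: "\<And>x. \<bar>f x\<bar> \<le> C" and L: "0 \<le> L" "\<And>x y. \<bar>f x - f y\<bar> \<le> L * norm (x - y)"
  shows "\<bar>f (x :: real^'d) - f y\<bar> \<le> (2 * C + L) * min 1 (norm (x - y))"
proof (cases "norm (x - y) \<le> 1")
  case True
  have "0 \<le> C" using order_trans[OF abs_ge_zero C] .
  then have "0 \<le> 2 * C * norm (x - y)" by simp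
  then show ?thesis using L(2)[of x y] True by (simp add: min_absorb2 algebra_simps)
next
  case False
  have "\<bar>f x - f y\<bar> \<le> 2 * C" using C[of x] C[of y] by linarith
  then show ?thesis using False L by (simp add: min_absorb1)
qed

lemma expectation_diff_le:
  assumes C: "\<And>x. \<bar>f x\<bar> \<le> C" and L: "0 \<le> L" "\<And>x y. \<bar>f x - f y\<bar> \<le> L * norm (x - y)"
    and Y [measurable]: "Y \<in> borel_measurable M" and Z [measurable]: "Z \<in> borel_measurable M"
  shows "\<bar>expectation (\<lambda>\<omega>. f (Y \<omega>)) - expectation (\<lambda>\<omega>. f (Z \<omega>))\<bar>
    \<le> (2 * C + L) * expectation (\<lambda>\<omega>. min 1 (norm (Y \<omega> - Z \<omega> :: real^'d)))"
proof -
  note [measurable] = lipschitz_measurable[OF L]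
  have i: "integrable M (\<lambda>\<omega>. f (Y \<omega>))" "integrable M (\<lambda>\<omega>. f (Z \<omega>))"
    using C by (auto intro!: integrable_const_bound[where B=C])
  have m: "integrable M (\<lambda>\<omega>. min 1 (norm (Y \<omega> - Z \<omega>)))"
    by (intro integrable_const_bound[where B=1]) auto
  have "\<bar>expectation (\<lambda>\<omega>. f (Y \<omega>)) - expectation (\<lambda>\<omega>. f (Z \<omega>))\<bar> = \<bar>expectation (\<lambda>\<omega>. f (Y \<omega>) - f (Z \<omega>))\<bar>"
    using i by simp
  also have "\<dots> \<le> expectation (\<lambda>\<omega>. \<bar>f (Y \<omega>) - f (Z \<omega>)\<bar>)"
    by (rule integral_abs_bound)
  also have "\<dots> \<le> expectation (\<lambda>\<omega>. (2 * C + L) * min 1 (norm (Y \<omega> - Z \<omega>)))"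
    using i m by (intro integral_mono integrable_abs Bochner_Integration.integrable_diff integrable_mult_right min_one_bound[OF C L])
  finally show ?thesis by simp
qed

text \<open>By \<open>expectation_euler\<close> the iterated kernel is the expectation of
  \<open>f\<close> at the Euler endpoint, to which convergence in probability applies.\<close>

lemma euler_expectation_converges:
  assumes C: "\<And>x. \<bar>f x\<bar> \<le> C" and L: "0 \<le> L" "\<And>x y. \<bar>f x - f y\<bar> \<le> L * norm (x - y)"
    and T: "0 \<le> T" and h: "\<And>n. 0 < h n" "h \<longlonglongrightarrow> 0" and N: "\<And>n. real (N n) * h n = T"
  shows "(\<lambda>n. (kern (h n) ^^ N n) f s) \<longlonglongrightarrow> P T f s"
proof -
  have "(\<lambda>n. (2 * C + L) * expectation (\<lambda>\<omega>. min 1 (norm (X s T \<omega> - E (h n) s (N n) \<omega>)))) \<longlonglongrightarrow> (2 * C + L) * 0"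
    by (intro tendsto_intros sde_solution.euler_converges[OF sde_solution T h N])
  then have l: "(\<lambda>n. (2 * C + L) * expectation (\<lambda>\<omega>. min 1 (norm (X s T \<omega> - E (h n) s (N n) \<omega>)))) \<longlonglongrightarrow> 0" by simp
  have "norm (P T f s - (kern (h n) ^^ N n) f s) \<le> (2 * C + L) * expectation (\<lambda>\<omega>. min 1 (norm (X s T \<omega> - E (h n) s (N n) \<omega>)))" for n
    unfolding P_def expectation_euler[OF h(1) lipschitz_measurable[OF L] C, symmetric] real_norm_def
    using h(1)[of n] by (intro expectation_diff_le[OF C L] flow_measurable T euler_measurable) simp
  then have "(\<lambda>n. P T f s - (kern (h n) ^^ N n) f s) \<longlonglongrightarrow> 0"
    by (intro Lim_null_comparison[OF _ l] always_eventually) auto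
  from tendsto_diff[OF tendsto_const[of "P T f s"] this] show ?thesis by simp
qed

text \<open>The solutions from \<open>x\<close> and \<open>y\<close> are never compared directly:
  the estimate is inherited from the Euler kernels.\<close>

lemma P_lipschitz:
  assumes C: "\<And>x. \<bar>f x\<bar> \<le> C" and L: "0 \<le> L" "\<And>x y. \<bar>f x - f y\<bar> \<le> L * norm (x - y)" and T: "0 < T"
  shows "\<bar>P T f x - P T f y\<bar> \<le> L * exp ((K + K\<^sup>2) * T) * norm (x - y)"
proof -
  let ?h = "\<lambda>n. T / real (Suc n)"
  have h: "0 < ?h n" for n using T by simp
  have h0: "?h \<longlonglongrightarrow> 0"
    using tendsto_mult[OF tendsto_const[of T] LIMSEQ_inverse_real_of_nat] by (simp add: divide_inverse)
  have N: "real (Suc n) * ?h n = T" for n by simp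
  have "(\<lambda>n. \<bar>(kern (?h n) ^^ Suc n) f x - (kern (?h n) ^^ Suc n) f y\<bar>) \<longlonglongrightarrow> \<bar>P T f x - P T f y\<bar>"
    using T by (intro tendsto_intros euler_expectation_converges[OF C L _ h h0 N]) simp_all
  moreover have "\<bar>(kern (?h n) ^^ Suc n) f x - (kern (?h n) ^^ Suc n) f y\<bar> \<le> L * exp ((K + K\<^sup>2) * T) * norm (x - y)" for n
    using kern_funpow_lipschitz[OF h[of n] lipschitz_measurable[OF L] C L, of "Suc n" x y] by (simp only: N)
  ultimately show ?thesis
    by (intro LIMSEQ_le_const2) blast+
qed

text \<open>For the Euler chain the identity is exact as soon as one step size divides both times.
  In the limit, the Euler state at the intermediate time is first replaced by the solution,
  uniformly because the functions \<open>?G n\<close> share bound and Lipschitz constant; then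
  \<open>?G n\<close> itself converges pointwise.\<close>

lemma chapman_kolmogorov_lipschitz:
  fixes a b :: nat
  assumes C: "\<And>x. \<bar>f x\<bar> \<le> C" and L: "0 \<le> L" "\<And>x y. \<bar>f x - f y\<bar> \<le> L * norm (x - y)" and q: "0 < q"
  shows "P (real a * q) (P (real b * q) f) s = P (real (a + b) * q) f s"
proof -
  let ?h = "\<lambda>n. q / real (Suc n)" and ?M = "\<lambda>m n. m * Suc n"
  let ?G = "\<lambda>n. (kern (?h n) ^^ ?M b n) f"
  have h: "0 < ?h n" for n using q by simp
  have h0: "?h \<longlonglongrightarrow> 0"
    using tendsto_mult[OF tendsto_const[of q] LIMSEQ_inverse_real_of_nat] by (simp add: divide_inverse)
  have N: "real (?M m n) * ?h n = real m * q" for m n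
    unfolding of_nat_mult by (simp del: of_nat_Suc)
  have nn: "0 \<le> real m * q" for m using q by simp
  note fm = lipschitz_measurable[OF L]
  \<comment> \<open>This Lipschitz constant does not depend on \<open>n\<close>, which is what
    allows the test function \<open>?G n\<close> to vary while its argument converges.\<close>
  define L' where "L' = L * exp ((K + K\<^sup>2) * (real b * q))"
  have L': "0 \<le> L'" using L by (simp add: L'_def)
  have G: "\<bar>?G n x\<bar> \<le> C" "\<bar>?G n x - ?G n y\<bar> \<le> L' * norm (x - y)" for n x y
    using kern_funpow(2)[OF h fm C] kern_funpow_lipschitz[OF h fm C L, of "?M b n" n x y] unfolding N L'_def by auto
  have e: "(kern (?h n) ^^ ?M (a + b) n) f s = expectation (\<lambda>\<omega>. ?G n (E (?h n) s (?M a n) \<omega>))" for n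
    using expectation_euler_add[OF h fm C, of n s "?M a n" "?M b n"] expectation_euler[OF h fm C, of n s "?M (a + b) n"]
    by (simp only: add_mult_distrib)
  have 1: "(\<lambda>n. expectation (\<lambda>\<omega>. ?G n (E (?h n) s (?M a n) \<omega>))) \<longlonglongrightarrow> P (real (a + b) * q) f s"
    unfolding e[symmetric] by (rule euler_expectation_converges[OF C L nn h h0 N])
  have 2: "(\<lambda>n. expectation (\<lambda>\<omega>. ?G n (X s (real a * q) \<omega>)) - expectation (\<lambda>\<omega>. ?G n (E (?h n) s (?M a n) \<omega>))) \<longlonglongrightarrow> 0"
  proof (rule Lim_null_comparison)
    have "(\<lambda>n. (2 * C + L') * expectation (\<lambda>\<omega>. min 1 (norm (X s (real a * q) \<omega> - E (?h n) s (?M a n) \<omega>)))) \<longlonglongrightarrow> (2 * C + L') * 0"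
      by (intro tendsto_intros sde_solution.euler_converges[OF sde_solution nn h h0 N])
    then show "(\<lambda>n. (2 * C + L') * expectation (\<lambda>\<omega>. min 1 (norm (X s (real a * q) \<omega> - E (?h n) s (?M a n) \<omega>)))) \<longlonglongrightarrow> 0"
      by simp
    show "\<forall>\<^sub>F n in sequentially. norm (expectation (\<lambda>\<omega>. ?G n (X s (real a * q) \<omega>)) - expectation (\<lambda>\<omega>. ?G n (E (?h n) s (?M a n) \<omega>)))
       \<le> (2 * C + L') * expectation (\<lambda>\<omega>. min 1 (norm (X s (real a * q) \<omega> - E (?h n) s (?M a n) \<omega>)))"
      unfolding real_norm_def
      by (intro always_eventually allI expectation_diff_le[OF G(1) L' G(2)] flow_measurable nn euler_measurable less_imp_le[OF h])
  qed
  have 3: "(\<lambda>n. expectation (\<lambda>\<omega>. ?G n (X s (real a * q) \<omega>))) \<longlonglongrightarrow> P (real (a + b) * q) f s"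
    using tendsto_add[OF 1 2] by simp
  have 4: "(\<lambda>n. expectation (\<lambda>\<omega>. ?G n (X s (real a * q) \<omega>))) \<longlonglongrightarrow> expectation (\<lambda>\<omega>. P (real b * q) f (X s (real a * q) \<omega>))"
  proof (rule integral_dominated_convergence[where w="\<lambda>_. C"])
    have Gm: "?G n \<in> borel_measurable borel" for n by (rule kern_funpow(1)[OF h fm C])
    have lim: "(\<lambda>n. ?G n x) \<longlonglongrightarrow> P (real b * q) f x" for x
      by (rule euler_expectation_converges[OF C L nn h h0 N])
    have "P (real b * q) f \<in> borel_measurable borel"
      by (rule borel_measurable_LIMSEQ_metric[OF Gm lim])
    then show "(\<lambda>\<omega>. P (real b * q) f (X s (real a * q) \<omega>)) \<in> borel_measurable M"
      by (rule measurable_compose[OF flow_measurable[OF nn]])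
    show "(\<lambda>\<omega>. ?G n (X s (real a * q) \<omega>)) \<in> borel_measurable M" for n
      by (rule measurable_compose[OF flow_measurable[OF nn] Gm])
    show "AE \<omega> in M. (\<lambda>n. ?G n (X s (real a * q) \<omega>)) \<longlonglongrightarrow> P (real b * q) f (X s (real a * q) \<omega>)"
      by (intro AE_I2 lim)
    show "AE \<omega> in M. norm (?G n (X s (real a * q) \<omega>)) \<le> C" for n
      using G(1) by simp
  qed simp
  show ?thesis
    using LIMSEQ_unique[OF 4 3] by (simp add: P_def)
qed

section \<open>The semigroup property for continuous functions and arbitrary times\<close>

lemma P_tendsto:
  assumes t: "0 \<le> t" and f: "\<And>n. f n \<in> borel_measurable borel" and C: "\<And>n x. \<bar>f n x\<bar> \<le> C"
    and lim: "\<And>x. (\<lambda>n. f n x) \<longlonglongrightarrow> g x"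
  shows "(\<lambda>n. P t (f n) s) \<longlonglongrightarrow> P t g s"
  unfolding P_def
proof (rule integral_dominated_convergence[where w="\<lambda>_. C"])
  have "g \<in> borel_measurable borel" by (rule borel_measurable_LIMSEQ_metric[OF f lim])
  then show "(\<lambda>\<omega>. g (X s t \<omega>)) \<in> borel_measurable M"
    by (rule measurable_compose[OF flow_measurable[OF t]])
  show "(\<lambda>\<omega>. f n (X s t \<omega>)) \<in> borel_measurable M" for n
    by (rule measurable_compose[OF flow_measurable[OF t] f])
  show "AE \<omega> in M. (\<lambda>n. f n (X s t \<omega>)) \<longlonglongrightarrow> g (X s t \<omega>)" by (intro AE_I2 lim)
  show "AE \<omega> in M. norm (f n (X s t \<omega>)) \<le> C" for n using C by simp
qed simp

text \<open>The approximants are infimal convolutions of \<open>f\<close> with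
  \<open>real n * norm\<close>. Being infima of Lipschitz functions, they are Lipschitz; they
  increase to \<open>f\<close> at points of continuity and keep its bounds.\<close>

lemma lipschitz_approximation:
  fixes f :: "real^'d \<Rightarrow> real"
  assumes f: "continuous_on UNIV f" and C: "\<And>x. \<bar>f x\<bar> \<le> C"
  obtains g :: "nat \<Rightarrow> real^'d \<Rightarrow> real" where "\<And>n x. \<bar>g n x\<bar> \<le> C"
    "\<And>n x y. \<bar>g n x - g n y\<bar> \<le> real n * norm (x - y)" "\<And>x. (\<lambda>n. g n x) \<longlonglongrightarrow> f x"
proof -
  define g where "g n x = (INF y. f y + real n * norm (x - y))" for n x
  have nn: "0 \<le> real n * norm z" for n and z :: "real^'d" by simp
  have bdd: "bdd_below (range (\<lambda>y. f y + real n * norm (x - y)))" for n x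
  proof (rule bdd_belowI2)
    fix y show "- C \<le> f y + real n * norm (x - y)"
      using C[of y] nn[of n "x - y"] by linarith
  qed
  have g_le: "g n x \<le> f y + real n * norm (x - y)" for n x y
    unfolding g_def by (rule cINF_lower[OF bdd]) simp
  have g_ge: "c \<le> g n x" if "\<And>y. c \<le> f y + real n * norm (x - y)" for c n x
    unfolding g_def by (rule cINF_greatest) (use that in auto)
  have lower: "- C \<le> g n x" for n x
  proof (rule g_ge)
    fix y show "- C \<le> f y + real n * norm (x - y)"
      using C[of y] nn[of n "x - y"] by linarith
  qed
  have upper: "g n x \<le> f x" for n x using g_le[of n x x] by simp
  have lip: "g n x - real n * norm (x - y) \<le> g n y" for n x y
  proof (rule g_ge)
    fix z
    have "norm (x - z) \<le> norm (x - y) + norm (y - z)"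
      using norm_triangle_ineq[of "x - y" "y - z"] by simp
    from mult_left_mono[OF this, of "real n"] show "g n x - real n * norm (x - y) \<le> f z + real n * norm (y - z)"
      using g_le[of n x z] by (simp add: algebra_simps)
  qed
  show ?thesis
  proof (rule that)
    show "\<bar>g n x\<bar> \<le> C" for n x using lower[of n x] upper[of n x] C[of x] by linarith
    show "\<bar>g n x - g n y\<bar> \<le> real n * norm (x - y)" for n x y
      using lip[of n x y] lip[of n y x] by (simp add: norm_minus_commute abs_le_iff)
    show "(\<lambda>n. g n x) \<longlonglongrightarrow> f x" for x
    proof (rule LIMSEQ_I)
      fix r :: real assume r: "0 < r"
      have "isCont f x" using f by (simp add: continuous_on_eq_continuous_at)
      then obtain d where d: "0 < d" "\<And>y. norm (y - x) < d \<Longrightarrow> \<bar>f y - f x\<bar> < r / 2"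
        using r unfolding continuous_at_eps_delta dist_norm by (metis half_gt_zero real_norm_def)
      \<comment> \<open>Outside the ball of radius \<open>d\<close> the penalty then exceeds
        \<open>2 * C\<close>, the largest possible gain in \<open>f\<close>, so only nearby points
        compete in the infimum.\<close>
      obtain m where m: "2 * C / d < real m" using reals_Archimedean2 by blast
      have "norm (g n x - f x) < r" if n: "n \<ge> m" for n
      proof -
        have "f x - r / 2 \<le> g n x"
        proof (rule g_ge)
          fix y
          show "f x - r / 2 \<le> f y + real n * norm (x - y)"
          proof (cases "norm (y - x) < d")
            case True
            then show ?thesis using d(2)[OF True] nn[of n "x - y"] by linarith
          next
            case False
            have "2 * C < real m * d" using m d(1) by (simp add: field_simps)
            also have "\<dots> \<le> real n * norm (x - y)"
              using False n d(1) by (intro mult_mono) (auto simp: norm_minus_commute)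
            finally show ?thesis using C[of x] C[of y] r by linarith
          qed
        qed
        then show ?thesis using upper[of n x] r by simp
      qed
      then show "\<exists>n0. \<forall>n\<ge>n0. norm (g n x - f x) < r" by blast
    qed
  qed
qed

lemma P_0:
  assumes "f \<in> borel_measurable borel"
  shows "P 0 f s = f s"
proof -
  have "expectation (\<lambda>\<omega>. f (X s 0 \<omega>)) = expectation (\<lambda>\<omega>. f s)"
  proof (rule integral_cong_AE)
    show "(\<lambda>\<omega>. f (X s 0 \<omega>)) \<in> borel_measurable M"
      by (rule measurable_compose[OF flow_measurable assms]) simp
    show "AE \<omega> in M. f (X s 0 \<omega>) = f s"
      using flow_0[of s] by (rule eventually_mono) simp
  qed simp
  then show ?thesis by (simp add: P_def prob_space)
qed

text \<open>At positive times \<open>P t\<close> maps the Lipschitz approximants to Lipschitz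
  functions; time zero, where \<open>P\<close> acts as the identity, is separate.\<close>

lemma P_measurable:
  assumes f: "continuous_on UNIV f" and C: "\<And>x. \<bar>f x\<bar> \<le> C" and t: "0 \<le> t"
  shows "P t f \<in> borel_measurable borel"
proof -
  have fm: "f \<in> borel_measurable borel" using f by (rule borel_measurable_continuous_onI)
  show ?thesis
  proof (cases "t = 0")
    case True
    have "P 0 f = f" using P_0[OF fm] by (intro ext)
    then show ?thesis using fm True by simp
  next
    case False
    obtain g where g: "\<And>n x. \<bar>g n x\<bar> \<le> C" "\<And>n x y. \<bar>g n x - g n y\<bar> \<le> real n * norm (x - y)" "\<And>x. (\<lambda>n. g n x) \<longlonglongrightarrow> f x"
      by (rule lipschitz_approximation[OF f C]) (rule that)
    have gm: "g n \<in> borel_measurable borel" for n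
      by (rule lipschitz_measurable[OF _ g(2)]) simp
    have "P t (g n) \<in> borel_measurable borel" for n
    proof (rule lipschitz_measurable)
      show "\<bar>P t (g n) x - P t (g n) y\<bar> \<le> real n * exp ((K + K\<^sup>2) * t) * norm (x - y)" for x y
        by (rule P_lipschitz[OF g(1) _ g(2)]) (use t False in auto)
    qed simp
    then show ?thesis
      by (rule borel_measurable_LIMSEQ_metric) (rule P_tendsto[OF t gm g(1) g(3)])
  qed
qed

lemma P_tendsto_time:
  assumes f: "continuous_on UNIV f" and C: "\<And>x. \<bar>f x\<bar> \<le> C"
    and t: "0 \<le> t" "\<And>n. 0 \<le> u n" "u \<longlonglongrightarrow> t"
  shows "(\<lambda>n. P (u n) f s) \<longlonglongrightarrow> P t f s"
  unfolding P_def
proof (rule integral_dominated_convergence[where w="\<lambda>_. C"])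
  note fm = borel_measurable_continuous_onI[OF f]
  show "(\<lambda>\<omega>. f (X s t \<omega>)) \<in> borel_measurable M" by (rule measurable_compose[OF flow_measurable[OF t(1)] fm])
  show "(\<lambda>\<omega>. f (X s (u n) \<omega>)) \<in> borel_measurable M" for n
    by (rule measurable_compose[OF flow_measurable[OF t(2)] fm])
  show "AE \<omega> in M. (\<lambda>n. f (X s (u n) \<omega>)) \<longlonglongrightarrow> f (X s t \<omega>)"
  proof (rule AE_I2)
    fix \<omega> assume "\<omega> \<in> space M"
    then have "(\<lambda>n. X s (u n) \<omega>) \<longlonglongrightarrow> X s t \<omega>"
      using continuous_on_tendsto_compose[OF flow_cont, of \<omega> u t sequentially] t by auto
    then show "(\<lambda>n. f (X s (u n) \<omega>)) \<longlonglongrightarrow> f (X s t \<omega>)"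
      using continuous_on_tendsto_compose[OF f] by auto
  qed
  show "AE \<omega> in M. norm (f (X s (u n) \<omega>)) \<le> C" for n using C by simp
qed simp

lemma chapman_kolmogorov_grid:
  fixes a b :: nat
  assumes f: "continuous_on UNIV f" and C: "\<And>x. \<bar>f x\<bar> \<le> C" and q: "0 < q"
  shows "P (real a * q) (P (real b * q) f) s = P (real (a + b) * q) f s"
proof -
  have nn: "0 \<le> real m * q" for m using q by simp
  obtain g where g: "\<And>n x. \<bar>g n x\<bar> \<le> C" "\<And>n x y. \<bar>g n x - g n y\<bar> \<le> real n * norm (x - y)" "\<And>x. (\<lambda>n. g n x) \<longlonglongrightarrow> f x"
    by (rule lipschitz_approximation[OF f C]) (rule that)
  have gm: "g n \<in> borel_measurable borel" for n
    by (rule lipschitz_measurable[OF _ g(2)]) simp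
  have gc: "continuous_on UNIV (g n)" for n
    using g(2) by (intro lipschitz_on_continuous_on[of "real n"] lipschitz_onI) (auto simp: dist_norm)
  have "(\<lambda>n. P (real a * q) (P (real b * q) (g n)) s) \<longlonglongrightarrow> P (real a * q) (P (real b * q) f) s"
    by (intro P_tendsto[where C=C] nn P_measurable[OF gc g(1) nn] P_bound gm g P_tendsto[OF nn gm g(1) g(3)])
  moreover have "P (real a * q) (P (real b * q) (g n)) s = P (real (a + b) * q) (g n) s" for n
    by (rule chapman_kolmogorov_lipschitz[OF g(1) _ g(2) q]) simp
  moreover have "(\<lambda>n. P (real (a + b) * q) (g n) s) \<longlonglongrightarrow> P (real (a + b) * q) f s"
    by (intro P_tendsto[where C=C] nn gm g)
  ultimately show ?thesis
    using LIMSEQ_unique by simp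
qed

text \<open>The times may be incommensurable. The time \<Delta> is kept as exactly
  \<open>Suc n\<close> grid steps, and only \<open>t\<close> is rounded down to the grid, which path
  continuity makes harmless.\<close>

lemma chapman_kolmogorov:
  assumes f: "continuous_on UNIV f" and C: "\<And>x. \<bar>f x\<bar> \<le> C" and \<Delta>: "0 < \<Delta>" and t: "0 \<le> t"
  shows "P \<Delta> (P t f) s = P (\<Delta> + t) f s"
proof -
  define m where "m n = nat \<lfloor>t / \<Delta> * real (Suc n)\<rfloor>" for n
  define u where "u n = real (m n) * (\<Delta> / real (Suc n))" for n
  have u0: "0 \<le> u n" for n using \<Delta> by (simp add: u_def)
  have m: "t / \<Delta> * real (Suc n) - 1 \<le> real (m n)" "real (m n) \<le> t / \<Delta> * real (Suc n)" for n
  proof -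
    have "0 \<le> t / \<Delta> * real (Suc n)" using t \<Delta> by simp
    then show "t / \<Delta> * real (Suc n) - 1 \<le> real (m n)" "real (m n) \<le> t / \<Delta> * real (Suc n)"
      unfolding m_def by linarith+
  qed
  have ub: "t - \<Delta> * inverse (real (Suc n)) \<le> u n" "u n \<le> t" for n
  proof -
    have 0: "0 \<le> \<Delta> / real (Suc n)" using \<Delta> by simp
    have e: "t / \<Delta> * real (Suc n) * (\<Delta> / real (Suc n)) = t"
      using \<Delta> by (simp del: of_nat_Suc)
    show "t - \<Delta> * inverse (real (Suc n)) \<le> u n" "u n \<le> t"
      using mult_right_mono[OF m(1)[of n] 0] mult_right_mono[OF m(2)[of n] 0]
      unfolding left_diff_distrib e u_def[symmetric] by (simp_all add: divide_inverse)
  qed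
  have "(\<lambda>n. t - \<Delta> * inverse (real (Suc n))) \<longlonglongrightarrow> t - \<Delta> * 0"
    by (intro tendsto_intros LIMSEQ_inverse_real_of_nat)
  then have ut: "u \<longlonglongrightarrow> t"
    by (intro tendsto_sandwich[of "\<lambda>n. t - \<Delta> * inverse (real (Suc n))" u _ "\<lambda>_. t"]) (use ub in auto)
  note fm = borel_measurable_continuous_onI[OF f]
  have D0: "0 \<le> \<Delta>" using \<Delta> by simp
  have "(\<lambda>n. P \<Delta> (P (u n) f) s) \<longlonglongrightarrow> P \<Delta> (P t f) s"
    by (intro P_tendsto[where C=C] D0 P_measurable[OF f C] u0 P_bound fm C P_tendsto_time[OF f C t u0 ut])
  moreover have "P \<Delta> (P (u n) f) s = P (\<Delta> + u n) f s" for n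
  proof -
    have q: "0 < \<Delta> / real (Suc n)" using \<Delta> by simp
    have e: "real (Suc n) * (\<Delta> / real (Suc n)) = \<Delta>" by simp
    have "real (Suc n + m n) * (\<Delta> / real (Suc n)) = \<Delta> + u n"
      unfolding u_def of_nat_add distrib_right e ..
    then show ?thesis
      using chapman_kolmogorov_grid[OF f C q, of "Suc n" "m n" s] by (simp only: e u_def[symmetric])
  qed
  moreover have "(\<lambda>n. P (\<Delta> + u n) f s) \<longlonglongrightarrow> P (\<Delta> + t) f s"
    using \<Delta> t u0 by (intro P_tendsto_time[OF f C] tendsto_intros ut) (auto intro: add_nonneg_nonneg)
  ultimately show ?thesis
    using LIMSEQ_unique by simp
qed

end

subsection \<open>One Euler step and the generator\<close>

lemma C1_fun_continuous: "C1_fun f \<Longrightarrow> continuous_on UNIV f"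
  unfolding C1_fun_def
  by (auto intro!: continuous_at_imp_continuous_on differentiable_imp_continuous_within)

lemma C2_fun_continuous: "C2_fun f \<Longrightarrow> continuous_on UNIV f"
  by (simp add: C2_fun_def C1_fun_continuous)

lemma C2_fun_measurable: "C2_fun f \<Longrightarrow> f \<in> borel_measurable borel"
  by (intro borel_measurable_continuous_onI C2_fun_continuous)

lemma C1_fun_has_real_derivative_line:
  fixes f :: "real^'d::finite \<Rightarrow> real"
  assumes "C1_fun f"
  shows "((\<lambda>t. f (x + t *\<^sub>R w)) has_real_derivative (\<Sum>j\<in>UNIV. w $ j * partial_deriv j f (x + t *\<^sub>R w))) (at t)"
proof -
  let ?y = "x + t *\<^sub>R w" and ?D = "frechet_derivative f (at (x + t *\<^sub>R w))"
  have D: "(f has_derivative ?D) (at ?y)"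
    using assms frechet_derivative_works by (auto simp: C1_fun_def)
  have l: "((\<lambda>t. x + t *\<^sub>R w) has_derivative (\<lambda>t. t *\<^sub>R w)) (at t)"
    by (auto intro!: derivative_eq_intros)
  have "((\<lambda>t. f (x + t *\<^sub>R w)) has_derivative (\<lambda>t. ?D (t *\<^sub>R w))) (at t)"
    by (rule has_derivative_compose[OF l D])
  moreover have "?D (c *\<^sub>R w) = c * (\<Sum>j\<in>UNIV. w $ j * partial_deriv j f ?y)" for c
  proof -
    have lin: "linear ?D" using D by (rule has_derivative_linear)
    have "w = (\<Sum>j\<in>UNIV. w $ j *\<^sub>R axis j 1)"
      using basis_expansion[of w] by (simp add: scalar_mult_eq_scaleR)
    then have "?D w = ?D (\<Sum>j\<in>UNIV. w $ j *\<^sub>R axis j 1)" by simp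
    also have "\<dots> = (\<Sum>j\<in>UNIV. w $ j * ?D (axis j 1))"
      by (simp add: linear_sum[OF lin] linear_cmul[OF lin])
    finally show ?thesis by (simp add: linear_cmul[OF lin] partial_deriv_def)
  qed
  then have "(\<lambda>t. ?D (t *\<^sub>R w)) = (*) (\<Sum>j\<in>UNIV. w $ j * partial_deriv j f ?y)"
    by (intro ext) (simp only: mult.commute)
  ultimately show ?thesis
    by (simp only: has_field_derivative_def)
qed

text \<open>One-dimensional Taylor expansion along the segment, with Lagrange remainder. The double
  sum is rearranged to match the index order in \<open>generator\<close>.\<close>

lemma C2_fun_taylor:
  fixes f :: "real^'d::finite \<Rightarrow> real"
  assumes f: "C2_fun f"
  obtains \<theta> where "0 < \<theta>" "\<theta> < 1"
    "f (x + w) = f x + (\<Sum>j\<in>UNIV. w $ j * partial_deriv j f x)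
       + 1 / 2 * (\<Sum>i\<in>UNIV. \<Sum>j\<in>UNIV. w $ i * w $ j * partial_deriv i (partial_deriv j f) (x + \<theta> *\<^sub>R w))"
proof -
  define diff where "diff m t = (if m = 0 then f (x + t *\<^sub>R w) else if m = 1 then (\<Sum>j\<in>UNIV. w $ j * partial_deriv j f (x + t *\<^sub>R w))
     else (\<Sum>j\<in>UNIV. w $ j * (\<Sum>i\<in>UNIV. w $ i * partial_deriv i (partial_deriv j f) (x + t *\<^sub>R w))))" for m :: nat and t :: real
  have f1: "C1_fun f" and f2: "\<And>j. C1_fun (partial_deriv j f)" using f by (auto simp: C2_fun_def)
  have d0: "DERIV (diff 0) t :> diff 1 t" for t
    unfolding diff_def using C1_fun_has_real_derivative_line[OF f1] by simp
  have d1: "DERIV (diff 1) t :> diff 2 t" for t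
    unfolding diff_def by (auto intro!: DERIV_sum DERIV_cmult C1_fun_has_real_derivative_line[OF f2])
  have "\<exists>t::real. 0 < t \<and> t < 1 \<and> f (x + 1 *\<^sub>R w) = (\<Sum>m<2. (diff m 0 / fact m) * 1 ^ m) + (diff 2 t / fact 2) * 1 ^ 2"
  proof (rule Maclaurin[where f="\<lambda>t. f (x + t *\<^sub>R w)"])
    show "diff 0 = (\<lambda>t. f (x + t *\<^sub>R w))" by (intro ext) (simp add: diff_def)
    show "\<forall>m t. m < 2 \<and> 0 \<le> t \<and> t \<le> 1 \<longrightarrow> DERIV (diff m) t :> diff (Suc m) t"
    proof (intro allI impI)
      fix m :: nat and t :: real assume "m < 2 \<and> 0 \<le> t \<and> t \<le> 1"
      then have "m = 0 \<or> m = 1" by auto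
      then show "DERIV (diff m) t :> diff (Suc m) t"
        using d0[of t] d1[of t] by (auto simp: numeral_2_eq_2)
    qed
  qed auto
  then obtain t :: real where t: "0 < t" "t < 1" "f (x + w) = diff 0 0 + diff 1 0 + diff 2 t / 2"
    by (auto simp: numeral_2_eq_2)
  have "diff 2 t = (\<Sum>i\<in>UNIV. \<Sum>j\<in>UNIV. w $ i * w $ j * partial_deriv i (partial_deriv j f) (x + t *\<^sub>R w))"
    unfolding diff_def by (subst sum.swap) (simp add: sum_distrib_left mult_ac)
  then show ?thesis using t by (intro that[of t]) (auto simp: diff_def)
qed

text \<open>Uniform continuity in an integrable form: a small constant plus a quadratic penalty
  covers small and large displacements at once. Multiplied by the squared increment in Taylor's
  formula, the penalty becomes a fourth moment.\<close>

lemma compact_support_modulus: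
  fixes g :: "real^'d::finite \<Rightarrow> real"
  assumes g: "continuous_on UNIV g" and supp: "\<And>x. \<rho> < norm x \<Longrightarrow> g x = 0" and e: "0 < e"
  obtains b where "0 \<le> b" "\<And>x y. \<bar>g x - g y\<bar> \<le> e + b * (norm (x - y))\<^sup>2"
proof -
  have "compact (g ` cball 0 \<rho>)"
    by (intro compact_continuous_image continuous_on_subset[OF g]) auto
  then obtain b0 where b0: "\<And>x. x \<in> cball 0 \<rho> \<Longrightarrow> \<bar>g x\<bar> \<le> b0"
    using compact_imp_bounded[of "g ` cball 0 \<rho>"] by (force simp: bounded_iff)
  define b1 where "b1 = max b0 0"
  have b1: "0 \<le> b1" "\<bar>g x\<bar> \<le> b1" for x
    using b0[of x] supp[of x] by (cases "norm x \<le> \<rho>"; force simp: b1_def)+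
  \<comment> \<open>With \<open>d \<le> 1\<close>, either both points lie in the ball of radius
    \<open>\<rho> + 2\<close> or both lie outside the support.\<close>
  have "uniformly_continuous_on (cball 0 (\<rho> + 2)) g"
    by (intro compact_uniformly_continuous continuous_on_subset[OF g]) auto
  then obtain d0 where d0: "0 < d0" "\<And>x y. x \<in> cball 0 (\<rho> + 2) \<Longrightarrow> y \<in> cball 0 (\<rho> + 2) \<Longrightarrow> dist y x < d0 \<Longrightarrow> dist (g y) (g x) < e"
    using e unfolding uniformly_continuous_on_def by metis
  define d where "d = min d0 1"
  have d: "0 < d" "d \<le> d0" "d \<le> 1" using d0 by (auto simp: d_def)
  have close: "\<bar>g x - g y\<bar> \<le> e" if "norm (x - y) < d" for x y
  proof (cases "norm x \<le> \<rho> + 1")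
    case True
    have "norm y \<le> norm x + norm (x - y)" using norm_triangle_ineq4[of x "x - y"] by simp
    then have "norm y \<le> \<rho> + 2" using True that d by linarith
    then have "dist (g x) (g y) < e"
      using True that d by (intro d0(2)) (auto simp: dist_norm)
    then show ?thesis by (simp add: dist_real_def)
  next
    case False
    have "norm x \<le> norm y + norm (x - y)" using norm_triangle_ineq[of y "x - y"] by simp
    then have "\<rho> < norm y" "\<rho> < norm x" using False that d by linarith+
    then show ?thesis using supp e by simp
  qed
  show ?thesis
  proof (rule that)
    \<comment> \<open>At distance at least \<open>d\<close> this penalty exceeds
      \<open>2 * b1\<close>, which bounds any difference of values.\<close>
    show "0 \<le> 2 * b1 / d\<^sup>2" using b1 by simp
    show "\<bar>g x - g y\<bar> \<le> e + (2 * b1 / d\<^sup>2) * (norm (x - y))\<^sup>2" for x y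
    proof (cases "norm (x - y) < d")
      case True
      then show ?thesis using close[OF True] b1 by (intro order_trans[OF close[OF True]]) simp
    next
      case False
      then have "d\<^sup>2 \<le> (norm (x - y))\<^sup>2" using d by (intro power_mono) auto
      then have "1 \<le> (norm (x - y))\<^sup>2 / d\<^sup>2" using d by simp
      then have "2 * b1 * 1 \<le> 2 * b1 * ((norm (x - y))\<^sup>2 / d\<^sup>2)" using b1 by (intro mult_left_mono) auto
      moreover have "\<bar>g x - g y\<bar> \<le> 2 * b1" using b1(2)[of x] b1(2)[of y] by linarith
      ultimately show ?thesis using e by simp
    qed
  qed
qed

lemma partial_deriv_eq_0:
  fixes f :: "real^'d::finite \<Rightarrow> real"
  assumes "\<And>x. \<rho> < norm x \<Longrightarrow> f x = c" "\<rho> < norm x"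
  shows "partial_deriv i f x = 0"
proof -
  have op: "open {x::real^'d. \<rho> < norm x}" by (intro open_Collect_less continuous_intros)
  have "((\<lambda>_. c) has_derivative (\<lambda>_. 0)) (at x)" by simp
  then have "(f has_derivative (\<lambda>_. 0)) (at x)"
    by (rule has_derivative_transform_within_open[OF _ op]) (use assms in auto)
  then have "frechet_derivative f (at x) = (\<lambda>_. 0)"
    by (rule frechet_derivative_at[symmetric])
  then show ?thesis by (simp add: partial_deriv_def)
qed

text \<open>The square of a sum of squares costs a factor equal to the dimension, and each of the
  coordinates contributes \<open>3 * h\<^sup>2\<close>.\<close>

lemma gauss_norm4:
  assumes h: "0 < h"
  obtains q where "has_bochner_integral (gauss h :: (real^'d::finite) measure) (\<lambda>y. (norm y)^4) q"
    "q \<le> 3 * (real CARD('d))\<^sup>2 * h\<^sup>2"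
proof -
  have s: "has_bochner_integral (gauss h :: (real^'d) measure) (\<lambda>y. real CARD('d) * (\<Sum>l\<in>UNIV. (y $ l)^4))
      (real CARD('d) * (\<Sum>l\<in>(UNIV::'d set). 3 * h\<^sup>2))"
    by (intro has_bochner_integral_mult_right has_bochner_integral_sum gauss_second_moment(2)[OF h])
  have le: "(norm y)^4 \<le> real CARD('d) * (\<Sum>l\<in>UNIV. (y $ l)^4)" for y :: "real^'d"
  proof -
    have "(norm y)^4 = ((norm y)\<^sup>2)\<^sup>2" by (simp add: power_mult[symmetric])
    also have "\<dots> \<le> (\<Sum>l\<in>UNIV. ((y $ l)\<^sup>2)\<^sup>2) * card (UNIV :: 'd set)"
      unfolding norm_vec_sq by (rule sum_squared_le_sum_of_squares)
    finally show ?thesis by (simp add: power_mult[symmetric] mult.commute)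
  qed
  have nn: "0 \<le> (\<Sum>l\<in>UNIV. (y $ l)^4)" for y :: "real^'d" by (intro sum_nonneg) simp
  have i: "integrable (gauss h :: (real^'d) measure) (\<lambda>y. (norm y)^4)"
  proof (rule Bochner_Integration.integrable_bound[OF has_bochner_integral_iff[THEN iffD1, THEN conjunct1, OF s]])
    show "(\<lambda>y. (norm y)^4) \<in> borel_measurable (gauss h :: (real^'d) measure)"
      by (simp cong: measurable_cong_sets add: sets_gauss)
  qed (use le nn in \<open>auto simp: abs_of_nonneg\<close>)
  show ?thesis
  proof (rule that)
    show "has_bochner_integral (gauss h :: (real^'d) measure) (\<lambda>y. (norm y)^4) (\<integral>y. (norm y)^4 \<partial>(gauss h :: (real^'d) measure))"
      using i by (simp add: has_bochner_integral_iff)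
    have "(\<integral>y. (norm y)^4 \<partial>(gauss h :: (real^'d) measure)) \<le> (\<integral>y. real CARD('d) * (\<Sum>l\<in>UNIV. (y $ l)^4) \<partial>(gauss h :: (real^'d) measure))"
      using s i le by (intro integral_mono) (auto simp: has_bochner_integral_iff)
    also have "\<dots> = real CARD('d) * (\<Sum>l\<in>(UNIV::'d set). 3 * h\<^sup>2)"
      using s by (simp add: has_bochner_integral_iff)
    finally show "(\<integral>y. (norm y)^4 \<partial>(gauss h :: (real^'d) measure)) \<le> 3 * (real CARD('d))\<^sup>2 * h\<^sup>2"
      by (simp add: power2_eq_square mult_ac)
  qed
qed

lemma gauss_affine_moments:
  fixes m :: "real^'d::finite" and S :: "real^'d^'d"
  assumes h: "0 < h"
  shows "has_bochner_integral (gauss h) (\<lambda>y. (m + S *v y) $ i) (m $ i)"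
    and "has_bochner_integral (gauss h) (\<lambda>y. (m + S *v y) $ i * (m + S *v y) $ j)
       (m $ i * m $ j + h * (S ** transpose S) $ i $ j)"
proof -
  note c = gauss_const[OF h]
  have l: "has_bochner_integral (gauss h) (\<lambda>y. \<Sum>k\<in>UNIV. a k * y $ k) (\<Sum>k\<in>(UNIV::'d set). a k * 0)" for a
    by (intro has_bochner_integral_sum has_bochner_integral_mult_right gauss_first_moment(1)[OF h])
  have w: "(m + S *v y) $ i = m $ i + (\<Sum>k\<in>UNIV. S $ i $ k * y $ k)" for y i
    by (simp add: matrix_vector_mult_def)
  show "has_bochner_integral (gauss h) (\<lambda>y. (m + S *v y) $ i) (m $ i)"
    unfolding w using has_bochner_integral_add[OF c l] by simp
  have q: "has_bochner_integral (gauss h) (\<lambda>y. \<Sum>k\<in>UNIV. \<Sum>l\<in>UNIV. (S $ i $ k * S $ j $ l) * (y $ k * y $ l))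
     (\<Sum>k\<in>(UNIV::'d set). \<Sum>l\<in>UNIV. (S $ i $ k * S $ j $ l) * (if k = l then h else 0))"
    by (intro has_bochner_integral_sum has_bochner_integral_mult_right gauss_covariance[OF h])
  have "(m + S *v y) $ i * (m + S *v y) $ j = m $ i * m $ j + (\<Sum>k\<in>UNIV. (m $ i * S $ j $ k) * y $ k)
     + (\<Sum>k\<in>UNIV. (m $ j * S $ i $ k) * y $ k) + (\<Sum>k\<in>UNIV. \<Sum>l\<in>UNIV. (S $ i $ k * S $ j $ l) * (y $ k * y $ l))" for y
  proof -
    have "(\<Sum>k\<in>UNIV. S $ i $ k * y $ k) * (\<Sum>k\<in>UNIV. S $ j $ k * y $ k) =
       (\<Sum>k\<in>UNIV. \<Sum>l\<in>UNIV. (S $ i $ k * S $ j $ l) * (y $ k * y $ l))"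
      by (simp add: sum_product mult_ac)
    then show ?thesis
      unfolding w by (simp add: distrib_left distrib_right sum_distrib_left mult_ac)
  qed
  moreover have "(\<Sum>k\<in>(UNIV::'d set). \<Sum>l\<in>UNIV. (S $ i $ k * S $ j $ l) * (if k = l then h else 0)) = h * (S ** transpose S) $ i $ j"
    by (simp add: matrix_matrix_mult_def transpose_def sum_distrib_left mult.commute if_distrib cong: if_cong)
  ultimately show "has_bochner_integral (gauss h) (\<lambda>y. (m + S *v y) $ i * (m + S *v y) $ j)
       (m $ i * m $ j + h * (S ** transpose S) $ i $ j)"
    using has_bochner_integral_add[OF has_bochner_integral_add[OF has_bochner_integral_add[OF c[of "m $ i * m $ j"] l[of "\<lambda>k. m $ i * S $ j $ k"]] l[of "\<lambda>k. m $ j * S $ i $ k"]] q]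
    by simp
qed

lemma norm_add_pow4_le:
  fixes a b :: "'a::real_normed_vector"
  shows "norm (a + b) ^ 4 \<le> 8 * norm a ^ 4 + 8 * norm b ^ 4"
proof -
  have "(norm (a + b))\<^sup>2 \<le> 2 * (norm a)\<^sup>2 + 2 * (norm b)\<^sup>2"
    using norm_diff_sq_le[of a "- b" 0] by simp
  then have "((norm (a + b))\<^sup>2)\<^sup>2 \<le> (2 * (norm a)\<^sup>2 + 2 * (norm b)\<^sup>2)\<^sup>2"
    by (intro power_mono) auto
  also have "\<dots> \<le> 8 * ((norm a)\<^sup>2)\<^sup>2 + 8 * ((norm b)\<^sup>2)\<^sup>2"
    using sum_squares_bound[of "(norm a)\<^sup>2" "(norm b)\<^sup>2"] by (simp add: power2_sum power_mult_distrib)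
  finally show ?thesis by (simp add: power_mult[symmetric])
qed

section \<open>One-step estimates near to and far from the support\<close>

context sde
begin

abbreviation gen :: "(real^'d \<Rightarrow> real) \<Rightarrow> real^'d \<Rightarrow> real" where
  "gen \<equiv> generator \<mu> (\<lambda>x. \<sigma> x ** transpose (\<sigma> x))"

lemma linear_growth:
  obtains g where "0 < g" "\<And>x. norm (\<mu> x) \<le> g * (1 + norm x)" "\<And>x. norm (\<sigma> x) \<le> g * (1 + norm x)"
proof -
  define g where "g = norm (\<mu> 0) + norm (\<sigma> 0) + K + 1"
  have g: "norm (\<mu> 0) \<le> g" "norm (\<sigma> 0) \<le> g" "K \<le> g" "0 < g"
    using K_nonneg norm_ge_zero[of "\<mu> 0"] norm_ge_zero[of "\<sigma> 0"] unfolding g_def by linarith+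
  have "norm (\<mu> x) \<le> g * (1 + norm x)" "norm (\<sigma> x) \<le> g * (1 + norm x)" for x
  proof -
    have "norm (\<mu> x) \<le> norm (\<mu> 0) + K * norm x"
      using lip_norm(1)[of x 0] norm_triangle_sub[of "\<mu> x" "\<mu> 0"] by simp
    also have "\<dots> \<le> g + g * norm x" by (intro add_mono mult_right_mono g) auto
    finally show "norm (\<mu> x) \<le> g * (1 + norm x)" by (simp add: distrib_left)
    have "norm (\<sigma> x) \<le> norm (\<sigma> 0) + K * norm x"
      using lip_norm(2)[of x 0] norm_triangle_sub[of "\<sigma> x" "\<sigma> 0"] by simp
    also have "\<dots> \<le> g + g * norm x" by (intro add_mono mult_right_mono g) auto
    finally show "norm (\<sigma> x) \<le> g * (1 + norm x)" by (simp add: distrib_left)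
  qed
  then show ?thesis using g(4) that by blast
qed

lemma increment_pow4_le:
  assumes h: "0 < h" and m: "norm (\<mu> x) \<le> m" "norm (\<sigma> x) \<le> m"
  shows "norm (h *\<^sub>R \<mu> x + \<sigma> x *v y) ^ 4 \<le> 8 * (h * m) ^ 4 + 8 * m ^ 4 * norm y ^ 4"
proof -
  have "norm (h *\<^sub>R \<mu> x + \<sigma> x *v y) ^ 4 \<le> 8 * norm (h *\<^sub>R \<mu> x) ^ 4 + 8 * norm (\<sigma> x *v y) ^ 4"
    by (rule norm_add_pow4_le)
  also have "\<dots> \<le> 8 * (h * m) ^ 4 + 8 * (m * norm y) ^ 4"
  proof (intro add_mono mult_left_mono power_mono)
    show "norm (h *\<^sub>R \<mu> x) \<le> h * m" using h m by simp
    show "norm (\<sigma> x *v y) \<le> m * norm y"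
      by (rule order_trans[OF norm_matrix_vector_le mult_right_mono[OF m(2)]]) simp
  qed auto
  finally show ?thesis by (simp add: power_mult_distrib mult.assoc)
qed

text \<open>In Taylor's formula the second derivatives are frozen at \<open>x\<close>, after which
  the Gaussian moments reproduce the generator plus a drift term of order \<open>h\<^sup>2\<close>.
  Freezing costs a small multiple of the second moment, of order \<open>h\<close>, and a fourth
  moment, of order \<open>h\<^sup>2\<close>.\<close>

lemma kern_near:
  assumes f: "C2_fun f" and supp: "\<And>x. \<rho> < norm x \<Longrightarrow> f x = c" and C: "\<And>x. \<bar>f x\<bar> \<le> C" and e: "0 < e"
  obtains h0 where "0 < h0"
    "\<And>h x. 0 < h \<Longrightarrow> h < h0 \<Longrightarrow> norm x \<le> r \<Longrightarrow> kern h f x \<le> f x + h * (gen f x + e)"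
proof -
  obtain g where g: "0 < g" "\<And>x. norm (\<mu> x) \<le> g * (1 + norm x)" "\<And>x. norm (\<sigma> x) \<le> g * (1 + norm x)"
    using linear_growth by metis
  define m where "m = g * (1 + max 0 r)"
  have m: "0 < m" using g(1) by (simp add: m_def add_pos_nonneg)
  have bm: "norm (\<mu> x) \<le> m" "norm (\<sigma> x) \<le> m" if "norm x \<le> r" for x
  proof -
    have "g * (1 + norm x) \<le> m" unfolding m_def using that g(1) by (intro mult_left_mono) auto
    then show "norm (\<mu> x) \<le> m" "norm (\<sigma> x) \<le> m" using g(2)[of x] g(3)[of x] by linarith+
  qed
  define d where "d = real CARD('d)"
  have d: "1 \<le> d" unfolding d_def by (simp add: Suc_leI)
  define H where "H i j = partial_deriv i (partial_deriv j f)" for i j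
  have Hc: "continuous_on UNIV (H i j)" for i j
    using f by (auto simp: C2_fun_def C1_fun_def H_def)
  have H0: "H i j x = 0" if "\<rho> < norm x" for i j x
    unfolding H_def by (rule partial_deriv_eq_0[OF partial_deriv_eq_0[OF supp] that])
  \<comment> \<open>Tuned so that \<open>d\<^sup>2 * m\<^sup>2 * e'\<close>, the contribution of the
    modulus to the coefficient of \<open>h\<close>, is half of \<open>e\<close>.\<close>
  define e' where "e' = e / (2 * d\<^sup>2 * m\<^sup>2)"
  have e': "0 < e'" using e d m by (simp add: e'_def)
  have "\<exists>b\<ge>0. \<forall>x y. \<bar>H i j x - H i j y\<bar> \<le> e' + b * (norm (x - y))\<^sup>2" for i j
    by (rule compact_support_modulus[OF Hc[of i j] H0 e']) blast+
  then obtain b' where b': "\<And>i j. 0 \<le> b' i j" "\<And>i j x y. \<bar>H i j x - H i j y\<bar> \<le> e' + b' i j * (norm (x - y))\<^sup>2"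
    by metis
  define b where "b = (\<Sum>i\<in>UNIV. \<Sum>j\<in>UNIV. b' i j)"
  have b: "0 \<le> b" unfolding b_def by (intro sum_nonneg b')
  have bb: "b' i j \<le> b" for i j
    unfolding b_def
    by (rule order_trans[OF member_le_sum[of j UNIV "b' i"] member_le_sum[of i UNIV "\<lambda>i. \<Sum>j\<in>UNIV. b' i j"]])
      (auto intro: b' sum_nonneg)
  have Hb: "\<bar>H i j x - H i j y\<bar> \<le> e' + b * (norm (x - y))\<^sup>2" for i j x y
    using b'(2)[of i j x y] mult_right_mono[OF bb[of i j], of "(norm (x - y))\<^sup>2"] by simp
  \<comment> \<open>A bound for the second derivatives on the ball, read off from the modulus by
    comparing with a point at distance \<open>\<bar>\<rho>\<bar> + 1\<close> from the origin, where
    they vanish.\<close>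
  define M' where "M' = e' + b * (max 0 r + (\<bar>\<rho>\<bar> + 1))\<^sup>2"
  have M': "0 \<le> M'" using e' b by (simp add: M'_def)
  have HM: "\<bar>H i j x\<bar> \<le> M'" if "norm x \<le> r" for i j x
  proof -
    let ?y = "(\<bar>\<rho>\<bar> + 1) *\<^sub>R axis i 1 :: real^'d"
    have ny: "norm ?y = \<bar>\<rho>\<bar> + 1" by simp
    then have "H i j ?y = 0" by (intro H0) linarith
    then have "\<bar>H i j x\<bar> \<le> e' + b * (norm (x - ?y))\<^sup>2" using Hb[of i j x ?y] by simp
    also have "\<dots> \<le> M'"
      unfolding M'_def using norm_triangle_ineq4[of x ?y] ny that b
      by (intro add_left_mono mult_left_mono power_mono) auto
    finally show ?thesis .
  qed
  \<comment> \<open>All coefficients of \<open>h\<^sup>2\<close>: the squared drift, then the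
    fourth-moment terms, where 24 is 8 from \<open>norm_add_pow4_le\<close> times 3 from
    \<open>gauss_norm4\<close>. The choice of \<open>h0\<close> makes \<open>h * C2\<close> at most
    \<open>e / 2\<close>.\<close>
  define C2 where "C2 = 1 / 2 * d\<^sup>2 * m\<^sup>2 * M' + 1 / 2 * d\<^sup>2 * b * (8 * m ^ 4 + 24 * d\<^sup>2 * m ^ 4)"
  have C2: "0 \<le> C2" using M' b by (simp add: C2_def)
  define h0 where "h0 = min 1 (e / (2 * (C2 + 1)))"
  show ?thesis
  proof (rule that)
    show "0 < h0" using e C2 by (simp add: h0_def)
    fix h :: real and x :: "real^'d" assume h: "0 < h" "h < h0" and x: "norm x \<le> r"
    have h1: "h \<le> 1" using h by (simp add: h0_def)
    define w where "w y = h *\<^sub>R \<mu> x + \<sigma> x *v y" for y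
    let ?D = "\<lambda>j. partial_deriv j f x"
    let ?R = "\<lambda>y. (f x + (\<Sum>j\<in>UNIV. w y $ j * ?D j)) + 1 / 2 * (\<Sum>i\<in>UNIV. \<Sum>j\<in>UNIV. (w y $ i * w y $ j) * H i j x)
       + (1 / 2 * d\<^sup>2 * e' * (norm (w y))\<^sup>2 + (1 / 2 * d\<^sup>2 * b * (8 * (h * m) ^ 4) + 1 / 2 * d\<^sup>2 * b * (8 * m ^ 4) * norm y ^ 4))"
    have pw: "f (x + w y) \<le> ?R y" for y
    proof -
      let ?w = "w y"
      obtain \<theta> where \<theta>: "0 < \<theta>" "\<theta> < 1"
        "f (x + ?w) = f x + (\<Sum>j\<in>UNIV. ?w $ j * ?D j) + 1 / 2 * (\<Sum>i\<in>UNIV. \<Sum>j\<in>UNIV. ?w $ i * ?w $ j * H i j (x + \<theta> *\<^sub>R ?w))"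
        unfolding H_def by (rule C2_fun_taylor[OF f])
      have "(\<Sum>i\<in>UNIV. \<Sum>j\<in>UNIV. ?w $ i * ?w $ j * H i j (x + \<theta> *\<^sub>R ?w)) - (\<Sum>i\<in>UNIV. \<Sum>j\<in>UNIV. ?w $ i * ?w $ j * H i j x)
          = (\<Sum>i\<in>UNIV. \<Sum>j\<in>UNIV. ?w $ i * ?w $ j * (H i j (x + \<theta> *\<^sub>R ?w) - H i j x))"
        by (simp add: sum_subtractf right_diff_distrib)
      also have "\<dots> \<le> (\<Sum>i\<in>(UNIV::'d set). \<Sum>j\<in>(UNIV::'d set). (norm ?w)\<^sup>2 * (e' + b * (norm ?w)\<^sup>2))"
      proof (intro sum_mono)
        fix i j :: 'd
        have 1: "\<bar>?w $ i\<bar> * \<bar>?w $ j\<bar> \<le> (norm ?w)\<^sup>2"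
          unfolding power2_eq_square by (intro mult_mono component_le_norm_cart) auto
        have "norm (\<theta> *\<^sub>R ?w) \<le> norm ?w" using \<theta> by (simp add: mult_left_le_one_le)
        then have "(norm (\<theta> *\<^sub>R ?w))\<^sup>2 \<le> (norm ?w)\<^sup>2" by (intro power_mono) auto
        then have "b * (norm (\<theta> *\<^sub>R ?w))\<^sup>2 \<le> b * (norm ?w)\<^sup>2" by (rule mult_left_mono[OF _ b])
        then have 2: "\<bar>H i j (x + \<theta> *\<^sub>R ?w) - H i j x\<bar> \<le> e' + b * (norm ?w)\<^sup>2"
          using Hb[of i j "x + \<theta> *\<^sub>R ?w" x] unfolding add_diff_cancel_left' by linarith
        have "?w $ i * ?w $ j * (H i j (x + \<theta> *\<^sub>R ?w) - H i j x) \<le> (\<bar>?w $ i\<bar> * \<bar>?w $ j\<bar>) * \<bar>H i j (x + \<theta> *\<^sub>R ?w) - H i j x\<bar>"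
          by (metis abs_ge_self abs_mult)
        also have "\<dots> \<le> (norm ?w)\<^sup>2 * (e' + b * (norm ?w)\<^sup>2)"
          using 1 2 by (intro mult_mono) auto
        finally show "?w $ i * ?w $ j * (H i j (x + \<theta> *\<^sub>R ?w) - H i j x) \<le> (norm ?w)\<^sup>2 * (e' + b * (norm ?w)\<^sup>2)" .
      qed
      also have "\<dots> = d\<^sup>2 * (e' * (norm ?w)\<^sup>2 + b * norm ?w ^ 4)"
        by (simp add: d_def power2_eq_square power4_eq_xxxx algebra_simps)
      also have "\<dots> \<le> d\<^sup>2 * (e' * (norm ?w)\<^sup>2 + b * (8 * (h * m) ^ 4 + 8 * m ^ 4 * norm y ^ 4))"
        using b increment_pow4_le[OF h(1) bm[OF x], of y] unfolding w_def
        by (intro mult_left_mono add_left_mono) auto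
      finally show ?thesis using \<theta>(3) by (simp add: algebra_simps)
    qed
    obtain q where q: "has_bochner_integral (gauss h :: (real^'d) measure) (\<lambda>y. norm y ^ 4) q" "q \<le> 3 * d\<^sup>2 * h\<^sup>2"
      using gauss_norm4[OF h(1)] unfolding d_def by metis
    let ?S = "\<sigma> x ** transpose (\<sigma> x)"
    let ?V = "(f x + (\<Sum>j\<in>UNIV. (h * \<mu> x $ j) * ?D j)) + 1 / 2 * (\<Sum>i\<in>UNIV. \<Sum>j\<in>UNIV. ((h * \<mu> x $ i) * (h * \<mu> x $ j) + h * ?S $ i $ j) * H i j x)
       + (1 / 2 * d\<^sup>2 * e' * ((norm (h *\<^sub>R \<mu> x))\<^sup>2 + h * (norm (\<sigma> x))\<^sup>2) + (1 / 2 * d\<^sup>2 * b * (8 * (h * m) ^ 4) + 1 / 2 * d\<^sup>2 * b * (8 * m ^ 4) * q))"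
    have mom1: "has_bochner_integral (gauss h) (\<lambda>y. w y $ j) (h * \<mu> x $ j)" for j
      using gauss_affine_moments(1)[OF h(1), of "h *\<^sub>R \<mu> x" "\<sigma> x" j] by (simp add: w_def)
    have mom2: "has_bochner_integral (gauss h) (\<lambda>y. w y $ i * w y $ j) ((h * \<mu> x $ i) * (h * \<mu> x $ j) + h * ?S $ i $ j)" for i j
      using gauss_affine_moments(2)[OF h(1), of "h *\<^sub>R \<mu> x" "\<sigma> x" i j] by (simp add: w_def)
    have R: "has_bochner_integral (gauss h) ?R ?V"
      by (intro has_bochner_integral_add gauss_const[OF h(1)] has_bochner_integral_sum has_bochner_integral_mult_left has_bochner_integral_mult_right
          mom1 mom2 q(1) gauss_affine_second_moment[OF h(1), of "h *\<^sub>R \<mu> x" "\<sigma> x", folded w_def])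
    have "kern h f x = (\<integral>y. f (x + w y) \<partial>gauss h)"
      by (simp add: kern_def w_def add.assoc)
    also have "\<dots> \<le> (\<integral>y. ?R y \<partial>gauss h)"
      using kern_bound(1)[OF h(1) C2_fun_measurable[OF f] C, of x] R
      by (intro integral_mono pw) (auto simp: has_bochner_integral_iff w_def add.assoc)
    also have "\<dots> = ?V" using R by (simp add: has_bochner_integral_iff)
    also have "\<dots> = f x + h * gen f x
        + (1 / 2 * h\<^sup>2 * (\<Sum>i\<in>UNIV. \<Sum>j\<in>UNIV. (\<mu> x $ i * \<mu> x $ j) * H i j x)
        + 1 / 2 * d\<^sup>2 * e' * ((norm (h *\<^sub>R \<mu> x))\<^sup>2 + h * (norm (\<sigma> x))\<^sup>2) + (1 / 2 * d\<^sup>2 * b * (8 * (h * m) ^ 4) + 1 / 2 * d\<^sup>2 * b * (8 * m ^ 4) * q))"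
      by (simp add: generator_def H_def[symmetric] sum_distrib_left sum.distrib distrib_left distrib_right power2_eq_square mult_ac)
    also have "\<dots> \<le> f x + h * gen f x
        + (1 / 2 * h\<^sup>2 * (d\<^sup>2 * (m\<^sup>2 * M')) + 1 / 2 * d\<^sup>2 * e' * (h * m\<^sup>2 + h * m\<^sup>2)
          + (1 / 2 * d\<^sup>2 * b * (8 * (h\<^sup>2 * m ^ 4)) + 1 / 2 * d\<^sup>2 * b * (8 * m ^ 4) * (3 * d\<^sup>2 * h\<^sup>2)))"
    proof (intro add_left_mono add_mono)
      have "(\<Sum>i\<in>UNIV. \<Sum>j\<in>UNIV. (\<mu> x $ i * \<mu> x $ j) * H i j x) \<le> (\<Sum>i\<in>(UNIV::'d set). \<Sum>j\<in>(UNIV::'d set). m\<^sup>2 * M')"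
      proof (intro sum_mono)
        fix i j :: 'd
        have mi: "\<bar>\<mu> x $ i\<bar> \<le> m" for i using component_le_norm_cart[of "\<mu> x" i] bm(1)[OF x] by linarith
        have "(\<mu> x $ i * \<mu> x $ j) * H i j x \<le> (\<bar>\<mu> x $ i\<bar> * \<bar>\<mu> x $ j\<bar>) * \<bar>H i j x\<bar>"
          by (metis abs_ge_self abs_mult)
        also have "\<dots> \<le> (m * m) * M'"
          using m by (intro mult_mono mi HM[OF x]) auto
        finally show "(\<mu> x $ i * \<mu> x $ j) * H i j x \<le> m\<^sup>2 * M'" by (simp add: power2_eq_square)
      qed
      also have "\<dots> = d\<^sup>2 * (m\<^sup>2 * M')" by (simp add: d_def power2_eq_square)
      finally show "1 / 2 * h\<^sup>2 * (\<Sum>i\<in>UNIV. \<Sum>j\<in>UNIV. (\<mu> x $ i * \<mu> x $ j) * H i j x) \<le> 1 / 2 * h\<^sup>2 * (d\<^sup>2 * (m\<^sup>2 * M'))"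
        by (rule mult_left_mono) simp
      have n1: "(norm (h *\<^sub>R \<mu> x))\<^sup>2 \<le> h * m\<^sup>2"
      proof -
        have "(norm (h *\<^sub>R \<mu> x))\<^sup>2 = h * h * (norm (\<mu> x))\<^sup>2" by (simp add: power_mult_distrib power2_eq_square)
        also have "\<dots> \<le> h * 1 * m\<^sup>2" using h h1 bm(1)[OF x] by (intro mult_mono power_mono) auto
        finally show ?thesis by simp
      qed
      have n2: "h * (norm (\<sigma> x))\<^sup>2 \<le> h * m\<^sup>2" using h bm(2)[OF x] by (intro mult_left_mono power_mono) auto
      show "1 / 2 * d\<^sup>2 * e' * ((norm (h *\<^sub>R \<mu> x))\<^sup>2 + h * (norm (\<sigma> x))\<^sup>2) \<le> 1 / 2 * d\<^sup>2 * e' * (h * m\<^sup>2 + h * m\<^sup>2)"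
        by (rule mult_left_mono[OF add_mono[OF n1 n2]]) (use e' d in auto)
      have "(h * m) ^ 4 \<le> h\<^sup>2 * m ^ 4"
        unfolding power_mult_distrib using h(1) h1 by (intro mult_right_mono power_decreasing) auto
      then show "1 / 2 * d\<^sup>2 * b * (8 * (h * m) ^ 4) \<le> 1 / 2 * d\<^sup>2 * b * (8 * (h\<^sup>2 * m ^ 4))"
        using b by (intro mult_left_mono) auto
      show "1 / 2 * d\<^sup>2 * b * (8 * m ^ 4) * q \<le> 1 / 2 * d\<^sup>2 * b * (8 * m ^ 4) * (3 * d\<^sup>2 * h\<^sup>2)"
        using b q(2) by (intro mult_left_mono) auto
    qed
    also have "\<dots> = f x + h * (gen f x + (d\<^sup>2 * m\<^sup>2 * e' + h * C2))"
      by (simp add: C2_def algebra_simps power2_eq_square)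
    also have "\<dots> \<le> f x + h * (gen f x + (e / 2 + e / 2))"
    proof (intro add_left_mono mult_left_mono add_mono)
      show "d\<^sup>2 * m\<^sup>2 * e' \<le> e / 2" using d m by (simp add: e'_def)
      have "h * C2 \<le> h * (C2 + 1)" using h by simp
      also have "\<dots> \<le> e / (2 * (C2 + 1)) * (C2 + 1)"
        using h C2 by (intro mult_right_mono) (auto simp: h0_def)
      also have "\<dots> = e / 2" using C2 by (simp add: field_simps)
      finally show "h * C2 \<le> e / 2" .
    qed (use h in auto)
    finally show "kern h f x \<le> f x + h * (gen f x + e)" by simp
  qed
qed

text \<open>From far away \<open>f\<close> changes only if the step covers at least half the
  distance to the origin. By a fourth-moment Chebyshev bound this has probability of order
  \<open>h\<^sup>2\<close>, uniformly in \<open>x\<close>, because the linear growth of the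
  coefficients is cancelled by the fourth power of the distance. Second moments would give only
  order \<open>h\<close>, too large to be neglected.\<close>

lemma kern_far:
  assumes fm: "f \<in> borel_measurable borel" and supp: "\<And>x. \<rho> < norm x \<Longrightarrow> f x = c" and C: "\<And>x. \<bar>f x\<bar> \<le> C"
  obtains D where "0 \<le> D"
    "\<And>h x. 0 < h \<Longrightarrow> h \<le> 1 \<Longrightarrow> 2 * \<bar>\<rho>\<bar> + 1 \<le> norm x \<Longrightarrow> kern h f x \<le> f x + D * h\<^sup>2"
proof -
  obtain g where g: "0 < g" "\<And>x. norm (\<mu> x) \<le> g * (1 + norm x)" "\<And>x. norm (\<sigma> x) \<le> g * (1 + norm x)"
    using linear_growth by metis
  define d where "d = real CARD('d)"
  have C0: "0 \<le> C" using order_trans[OF abs_ge_zero C] .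
  \<comment> \<open>\<open>2 * C\<close> bounds the change of \<open>f\<close>, the first 16 comes
    from halving the distance, \<open>16 * g ^ 4\<close> from the growth bound
    \<open>m = g * (2 * n)\<close>, and the last factor from the fourth moment of the step.\<close>
  define D where "D = 2 * C * 16 * (16 * g ^ 4) * (8 + 24 * d\<^sup>2)"
  show ?thesis
  proof (rule that)
    show "0 \<le> D" using C0 by (simp add: D_def)
    fix h :: real and x :: "real^'d" assume h: "0 < h" "h \<le> 1" and x: "2 * \<bar>\<rho>\<bar> + 1 \<le> norm x"
    define n where "n = norm x"
    have n: "1 \<le> n" using x by (simp add: n_def)
    have fx: "f x = c" using x by (intro supp) linarith
    define m where "m = g * (2 * n)"
    have bm: "norm (\<mu> x) \<le> m" "norm (\<sigma> x) \<le> m"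
    proof -
      have "g * (1 + norm x) \<le> m" unfolding m_def using n g(1) by (intro mult_left_mono) (auto simp: n_def)
      then show "norm (\<mu> x) \<le> m" "norm (\<sigma> x) \<le> m" using g(2)[of x] g(3)[of x] by linarith+
    qed
    define A where "A = 2 * C * 16 / n ^ 4"
    have A: "0 \<le> A" using C0 n by (simp add: A_def)
    define w where "w y = h *\<^sub>R \<mu> x + \<sigma> x *v y" for y
    have pw: "f (x + w y) \<le> c + (A * (8 * (h * m) ^ 4) + A * (8 * m ^ 4) * norm y ^ 4)" for y
    proof -
      have "f (x + w y) \<le> c + A * norm (w y) ^ 4"
      proof (cases "\<rho> < norm (x + w y)")
        case True
        then show ?thesis using supp[OF True] A by simp
      next
        case False
        have "norm x \<le> norm (x + w y) + norm (w y)"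
          using norm_triangle_ineq4[of "x + w y" "w y"] by simp
        \<comment> \<open>The point reached lies in the ball of radius \<rho>, and
          \<open>2 * \<bar>\<rho>\<bar> + 1 \<le> n\<close> leaves at least half of \<open>n\<close>
          for the displacement.\<close>
        then have "n / 2 \<le> norm (w y)" using False x unfolding n_def by linarith
        then have "(n / 2) ^ 4 \<le> norm (w y) ^ 4" using n by (intro power_mono) auto
        then have "1 \<le> 16 * norm (w y) ^ 4 / n ^ 4" using n by (simp add: field_simps)
        then have "2 * C * 1 \<le> 2 * C * (16 * norm (w y) ^ 4 / n ^ 4)" using C0 by (intro mult_left_mono) auto
        moreover have "f (x + w y) - c \<le> 2 * C" using C[of "x + w y"] C[of x] fx by linarith
        ultimately show ?thesis by (simp add: A_def)
      qed
      also have "\<dots> \<le> c + A * (8 * (h * m) ^ 4 + 8 * m ^ 4 * norm y ^ 4)"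
        using A increment_pow4_le[OF h(1) bm, of y] unfolding w_def by (intro add_left_mono mult_left_mono) auto
      finally show ?thesis by (simp add: distrib_left mult.assoc)
    qed
    obtain q where q: "has_bochner_integral (gauss h :: (real^'d) measure) (\<lambda>y. norm y ^ 4) q" "q \<le> 3 * d\<^sup>2 * h\<^sup>2"
      using gauss_norm4[OF h(1)] unfolding d_def by metis
    have R: "has_bochner_integral (gauss h) (\<lambda>y::real^'d. c + (A * (8 * (h * m) ^ 4) + A * (8 * m ^ 4) * norm y ^ 4))
        (c + (A * (8 * (h * m) ^ 4) + A * (8 * m ^ 4) * q))"
      by (intro has_bochner_integral_add gauss_const[OF h(1)] has_bochner_integral_mult_right q(1))
    have "kern h f x = (\<integral>y. f (x + w y) \<partial>gauss h)"
      by (simp add: kern_def w_def add.assoc)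
    also have "\<dots> \<le> (\<integral>y. c + (A * (8 * (h * m) ^ 4) + A * (8 * m ^ 4) * norm y ^ 4) \<partial>(gauss h :: (real^'d) measure))"
      using kern_bound(1)[OF h(1) fm C, of x] R
      by (intro integral_mono pw) (auto simp: has_bochner_integral_iff w_def add.assoc)
    also have "\<dots> = c + (A * (8 * (h * m) ^ 4) + A * (8 * m ^ 4) * q)"
      using R by (simp add: has_bochner_integral_iff)
    also have "\<dots> \<le> c + (A * (8 * (h\<^sup>2 * m ^ 4)) + A * (8 * m ^ 4) * (3 * d\<^sup>2 * h\<^sup>2))"
    proof (intro add_left_mono add_mono mult_left_mono)
      show "(h * m) ^ 4 \<le> h\<^sup>2 * m ^ 4"
        unfolding power_mult_distrib using h by (intro mult_right_mono power_decreasing) auto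
    qed (use A q(2) in auto)
    also have "\<dots> = f x + D * h\<^sup>2"
    proof -
      have "A * m ^ 4 = 2 * C * 16 * (16 * g ^ 4)"
        using n by (simp add: A_def m_def power_mult_distrib)
      moreover have "A * (8 * (h\<^sup>2 * m ^ 4)) + A * (8 * m ^ 4) * (3 * d\<^sup>2 * h\<^sup>2) = (A * m ^ 4) * (8 + 24 * d\<^sup>2) * h\<^sup>2"
        by (simp add: algebra_simps)
      ultimately show ?thesis by (simp add: fx D_def)
    qed
    finally show "kern h f x \<le> f x + D * h\<^sup>2" .
  qed
qed

text \<open>The two regions overlap at radius \<open>2 * \<bar>\<rho>\<bar> + 1\<close>. Far out the
  excess \<open>D * h\<^sup>2\<close> is absorbed into \<open>h * (G + e)\<close>, which uses that
  \<open>G\<close> is nonnegative.\<close>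

lemma kern_one_step:
  assumes f: "C2_fun f" and supp: "\<And>x. \<rho> < norm x \<Longrightarrow> f x = c" and C: "\<And>x. \<bar>f x\<bar> \<le> C"
    and gen: "\<And>x. gen f x \<le> G" and G: "0 \<le> G" and e: "0 < e"
  obtains h0 where "0 < h0" "\<And>h x. 0 < h \<Longrightarrow> h < h0 \<Longrightarrow> kern h f x \<le> f x + h * (G + e)"
proof -
  note fm = C2_fun_measurable[OF f]
  obtain h1 where h1: "0 < h1" "\<And>h x. 0 < h \<Longrightarrow> h < h1 \<Longrightarrow> norm x \<le> 2 * \<bar>\<rho>\<bar> + 1 \<Longrightarrow>
      kern h f x \<le> f x + h * (gen f x + e)"
    by (rule kern_near[where r="2 * \<bar>\<rho>\<bar> + 1" and \<rho>=\<rho> and c=c and C=C, OF f _ C e]) (rule supp, assumption, rule that)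
  obtain D where D: "0 \<le> D" "\<And>h x. 0 < h \<Longrightarrow> h \<le> 1 \<Longrightarrow> 2 * \<bar>\<rho>\<bar> + 1 \<le> norm x \<Longrightarrow> kern h f x \<le> f x + D * h\<^sup>2"
    by (rule kern_far[where \<rho>=\<rho> and c=c and C=C, OF fm _ C]) (rule supp, assumption, rule that)
  show ?thesis
  proof (rule that)
    show "0 < min h1 (min 1 (e / (D + 1)))" using h1 e D by simp
    fix h x assume h: "0 < h" "h < min h1 (min 1 (e / (D + 1)))"
    show "kern h f x \<le> f x + h * (G + e)"
    proof (cases "norm x \<le> 2 * \<bar>\<rho>\<bar> + 1")
      case True
      have "kern h f x \<le> f x + h * (gen f x + e)"
        using h True by (intro h1(2)) auto
      also have "\<dots> \<le> f x + h * (G + e)"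
        using h gen by (intro add_left_mono mult_left_mono add_right_mono) auto
      finally show ?thesis .
    next
      case False
      have "h * D \<le> e"
      proof -
        have "h * D \<le> h * (D + 1)" using h by simp
        also have "\<dots> \<le> e / (D + 1) * (D + 1)" using h D by (intro mult_right_mono) auto
        also have "\<dots> = e" using D by simp
        finally show ?thesis .
      qed
      then have "h * (h * D) \<le> h * (G + e)" using h G by (intro mult_left_mono) auto
      moreover have "kern h f x \<le> f x + D * h\<^sup>2" using h False by (intro D(2)) auto
      ultimately show ?thesis by (simp add: power2_eq_square mult_ac)
    qed
  qed
qed

end

subsection \<open>Calculus for the generator\<close>

lemma partial_deriv_eqI:
  assumes "(f has_derivative f') (at x)"
  shows "partial_deriv i f x = f' (axis i 1)"
  using frechet_derivative_at[OF assms] by (simp add: partial_deriv_def)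

lemma C1_fun_D: "C1_fun f \<Longrightarrow> (f has_derivative frechet_derivative f (at x)) (at x)"
  by (auto simp: C1_fun_def frechet_derivative_works)

lemma C1_funI:
  assumes "\<And>x. (f has_derivative f' x) (at x)" "\<And>i. continuous_on UNIV (\<lambda>x. f' x (axis i 1))"
  shows "C1_fun f" "partial_deriv i f = (\<lambda>x. f' x (axis i 1))"
proof -
  have p: "partial_deriv i f = (\<lambda>x. f' x (axis i 1))" for i
    using partial_deriv_eqI[OF assms(1)] by (intro ext)
  then show "C1_fun f" "partial_deriv i f = (\<lambda>x. f' x (axis i 1))"
    using assms by (auto simp: C1_fun_def differentiable_def)
qed

lemma C1_fun_compose:
  assumes g: "C1_fun g" and \<phi>: "\<And>x. (\<phi> has_real_derivative \<phi>' (g x)) (at (g x))" and c: "continuous_on UNIV (\<lambda>x. \<phi>' (g x))"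
  shows "C1_fun (\<lambda>x. \<phi> (g x))" "partial_deriv i (\<lambda>x. \<phi> (g x)) = (\<lambda>x. \<phi>' (g x) * partial_deriv i g x)"
proof -
  have "((\<lambda>x. \<phi> (g x)) has_derivative (\<lambda>v. frechet_derivative g (at x) v * \<phi>' (g x))) (at x)" for x
    using has_derivative_compose[OF C1_fun_D[OF g] \<phi>[THEN has_field_derivative_imp_has_derivative]]
    by (simp add: mult.commute)
  note d = this
  have cc: "continuous_on UNIV (\<lambda>x. frechet_derivative g (at x) (axis i 1) * \<phi>' (g x))" for i
    using g c unfolding C1_fun_def partial_deriv_def by (intro continuous_on_mult) auto
  show "C1_fun (\<lambda>x. \<phi> (g x))" "partial_deriv i (\<lambda>x. \<phi> (g x)) = (\<lambda>x. \<phi>' (g x) * partial_deriv i g x)"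
    using C1_funI[OF d cc] by (auto simp: partial_deriv_def mult.commute)
qed

lemma C1_fun_mult:
  assumes u: "C1_fun u" and v: "C1_fun v"
  shows "C1_fun (\<lambda>x. u x * v x)" "partial_deriv i (\<lambda>x. u x * v x) = (\<lambda>x. u x * partial_deriv i v x + partial_deriv i u x * v x)"
proof -
  have d: "((\<lambda>x. u x * v x) has_derivative (\<lambda>h. u x * frechet_derivative v (at x) h + frechet_derivative u (at x) h * v x)) (at x)" for x
    by (rule has_derivative_mult[OF C1_fun_D[OF u] C1_fun_D[OF v]])
  have cc: "continuous_on UNIV (\<lambda>x. u x * frechet_derivative v (at x) (axis i 1) + frechet_derivative u (at x) (axis i 1) * v x)" for i
    using u v C1_fun_continuous[OF u] C1_fun_continuous[OF v]
    unfolding C1_fun_def partial_deriv_def by (intro continuous_intros) auto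
  show "C1_fun (\<lambda>x. u x * v x)" "partial_deriv i (\<lambda>x. u x * v x) = (\<lambda>x. u x * partial_deriv i v x + partial_deriv i u x * v x)"
    using C1_funI[OF d cc] by (auto simp: partial_deriv_def)
qed

lemma C1_fun_add:
  assumes u: "C1_fun u" and v: "C1_fun v"
  shows "C1_fun (\<lambda>x. u x + v x)" "partial_deriv i (\<lambda>x. u x + v x) = (\<lambda>x. partial_deriv i u x + partial_deriv i v x)"
proof -
  have d: "((\<lambda>x. u x + v x) has_derivative (\<lambda>h. frechet_derivative u (at x) h + frechet_derivative v (at x) h)) (at x)" for x
    by (rule has_derivative_add[OF C1_fun_D[OF u] C1_fun_D[OF v]])
  have cc: "continuous_on UNIV (\<lambda>x. frechet_derivative u (at x) (axis i 1) + frechet_derivative v (at x) (axis i 1))" for i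
    using u v unfolding C1_fun_def partial_deriv_def by (intro continuous_intros) auto
  show "C1_fun (\<lambda>x. u x + v x)" "partial_deriv i (\<lambda>x. u x + v x) = (\<lambda>x. partial_deriv i u x + partial_deriv i v x)"
    using C1_funI[OF d cc] by (auto simp: partial_deriv_def)
qed

lemma C1_fun_cmult:
  assumes u: "C1_fun u"
  shows "C1_fun (\<lambda>x. c * u x)" "partial_deriv i (\<lambda>x. c * u x) = (\<lambda>x. c * partial_deriv i u x)"
  using C1_fun_compose[OF u, of "\<lambda>y. c * y" "\<lambda>_. c"] by (auto intro!: derivative_eq_intros)

lemma C1_fun_inner_self:
  "C1_fun (\<lambda>x::real^'d::finite. 1 + x \<bullet> x)" "partial_deriv i (\<lambda>x::real^'d. 1 + x \<bullet> x) = (\<lambda>x. 2 * x $ i)"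
proof -
  have d: "((\<lambda>x::real^'d. 1 + x \<bullet> x) has_derivative (\<lambda>h. 2 * (x \<bullet> h))) (at x)" for x
    by (auto intro!: derivative_eq_intros simp: inner_commute)
  have cc: "continuous_on UNIV (\<lambda>x::real^'d. 2 * (x \<bullet> axis i 1))" for i
    by (intro continuous_intros)
  show "C1_fun (\<lambda>x::real^'d. 1 + x \<bullet> x)" "partial_deriv i (\<lambda>x::real^'d. 1 + x \<bullet> x) = (\<lambda>x. 2 * x $ i)"
    using C1_funI[OF d cc] by (auto simp: inner_axis)
qed

lemma C1_fun_component:
  "C1_fun (\<lambda>x::real^'d::finite. x $ j)" "partial_deriv i (\<lambda>x::real^'d. x $ j) = (\<lambda>x. if i = j then 1 else 0)"
proof -
  have d: "((\<lambda>x::real^'d. x $ j) has_derivative (\<lambda>h. h $ j)) (at x)" for x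
    by (rule bounded_linear_imp_has_derivative[OF bounded_linear_vec_nth])
  have cc: "continuous_on UNIV (\<lambda>x::real^'d. (axis i 1 :: real^'d) $ j)" for i
    by (intro continuous_intros)
  show "C1_fun (\<lambda>x::real^'d. x $ j)" "partial_deriv i (\<lambda>x::real^'d. x $ j) = (\<lambda>x. if i = j then 1 else 0)"
    using C1_funI[OF d cc] by (auto simp: axis_def)
qed

lemma C2_fun_add:
  assumes u: "C2_fun u" and v: "C2_fun v"
  shows "C2_fun (\<lambda>x. u x + v x)" "generator \<mu> S (\<lambda>x. u x + v x) x = generator \<mu> S u x + generator \<mu> S v x"
proof -
  have u': "C1_fun u" "\<And>i. C1_fun (partial_deriv i u)" and v': "C1_fun v" "\<And>i. C1_fun (partial_deriv i v)"
    using u v by (auto simp: C2_fun_def)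
  show "C2_fun (\<lambda>x. u x + v x)"
    unfolding C2_fun_def C1_fun_add(2)[OF u'(1) v'(1)] using C1_fun_add(1) u' v' by auto
  show "generator \<mu> S (\<lambda>x. u x + v x) x = generator \<mu> S u x + generator \<mu> S v x"
    unfolding generator_def C1_fun_add(2)[OF u'(1) v'(1)] C1_fun_add(2)[OF u'(2) v'(2)]
    by (simp add: distrib_left sum.distrib)
qed

lemma C2_fun_cmult:
  assumes u: "C2_fun u"
  shows "C2_fun (\<lambda>x. c * u x)" "generator \<mu> S (\<lambda>x. c * u x) x = c * generator \<mu> S u x"
proof -
  have u': "C1_fun u" "\<And>i. C1_fun (partial_deriv i u)"
    using u by (auto simp: C2_fun_def)
  show "C2_fun (\<lambda>x. c * u x)"
    unfolding C2_fun_def C1_fun_cmult(2)[OF u'(1)] using C1_fun_cmult(1) u' by auto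
  show "generator \<mu> S (\<lambda>x. c * u x) x = c * generator \<mu> S u x"
    unfolding generator_def C1_fun_cmult(2)[OF u'(1)] C1_fun_cmult(2)[OF u'(2)]
    by (simp add: distrib_left sum_distrib_left mult_ac)
qed

text \<open>The last sum is a quadratic form in the gradient, nonnegative for a Gram matrix; hence a
  concave outer function can only lower the generator beyond the factor
  \<open>\<phi>1\<close>.\<close>

lemma C2_fun_compose:
  assumes g: "C2_fun g"
    and \<phi>: "\<And>x. (\<phi> has_real_derivative \<phi>1 (g x)) (at (g x))" "\<And>x. (\<phi>1 has_real_derivative \<phi>2 (g x)) (at (g x))"
    and c: "continuous_on UNIV (\<lambda>x. \<phi>2 (g x))"
  shows "C2_fun (\<lambda>x. \<phi> (g x))"
    "generator \<mu> S (\<lambda>x. \<phi> (g x)) x = \<phi>1 (g x) * generator \<mu> S g x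
       + 1 / 2 * \<phi>2 (g x) * (\<Sum>i\<in>UNIV. \<Sum>j\<in>UNIV. S x $ i $ j * (partial_deriv i g x * partial_deriv j g x))"
proof -
  have g': "C1_fun g" "\<And>i. C1_fun (partial_deriv i g)"
    using g by (auto simp: C2_fun_def)
  note 1 = C1_fun_compose[OF g'(1) \<phi>(2) c]
  have c1: "continuous_on UNIV (\<lambda>x. \<phi>1 (g x))" by (rule C1_fun_continuous[OF 1(1)])
  note 0 = C1_fun_compose[OF g'(1) \<phi>(1) c1]
  note m = C1_fun_mult[OF 1(1) g'(2)]
  show "C2_fun (\<lambda>x. \<phi> (g x))"
    unfolding C2_fun_def 0(2) using 0(1) m(1) by auto
  show "generator \<mu> S (\<lambda>x. \<phi> (g x)) x = \<phi>1 (g x) * generator \<mu> S g x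
       + 1 / 2 * \<phi>2 (g x) * (\<Sum>i\<in>UNIV. \<Sum>j\<in>UNIV. S x $ i $ j * (partial_deriv i g x * partial_deriv j g x))"
    unfolding generator_def 0(2) m(2) 1(2)
    by (simp add: distrib_left sum_distrib_left sum.distrib mult_ac)
qed

text \<open>Needed because Euler convergence is available for bounded Lipschitz functions: the
  partial derivatives vanish outside the ball and are bounded on it.\<close>

lemma C1_compact_support_lipschitz:
  fixes f :: "real^'d::finite \<Rightarrow> real"
  assumes f: "C1_fun f" and supp: "\<And>x. \<rho> < norm x \<Longrightarrow> f x = c"
  obtains L where "0 \<le> L" "\<And>x y. \<bar>f x - f y\<bar> \<le> L * norm (x - y)"
proof -
  have "\<exists>b\<ge>0. \<forall>x. \<bar>partial_deriv j f x\<bar> \<le> b" for j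
  proof -
    have "continuous_on UNIV (partial_deriv j f)" using f by (simp add: C1_fun_def)
    then have "compact (partial_deriv j f ` cball 0 \<rho>)"
      by (intro compact_continuous_image) (auto intro: continuous_on_subset)
    then obtain b where b: "\<And>x. x \<in> cball 0 \<rho> \<Longrightarrow> \<bar>partial_deriv j f x\<bar> \<le> b"
      using compact_imp_bounded[of "partial_deriv j f ` cball 0 \<rho>"] by (force simp: bounded_iff)
    have "\<bar>partial_deriv j f x\<bar> \<le> max b 0" for x
      using b[of x] partial_deriv_eq_0[of \<rho> f c x j] supp by (cases "norm x \<le> \<rho>") force+
    then show ?thesis by (intro exI[of _ "max b 0"]) auto
  qed
  then obtain b where b: "\<And>j. 0 \<le> b j" "\<And>j x. \<bar>partial_deriv j f x\<bar> \<le> b j" by metis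
  show ?thesis
  proof (rule that)
    show "0 \<le> (\<Sum>j\<in>UNIV. b j)" by (intro sum_nonneg b)
    show "\<bar>f x - f y\<bar> \<le> (\<Sum>j\<in>UNIV. b j) * norm (x - y)" for x y
    proof -
      let ?w = "x - y"
      from MVT2[of 0 1 "\<lambda>t. f (y + t *\<^sub>R ?w)" "\<lambda>t. \<Sum>j\<in>UNIV. ?w $ j * partial_deriv j f (y + t *\<^sub>R ?w)",
          OF zero_less_one C1_fun_has_real_derivative_line[OF f]]
      obtain z where "f (y + 1 *\<^sub>R ?w) - f (y + 0 *\<^sub>R ?w) = (1 - 0) * (\<Sum>j\<in>UNIV. ?w $ j * partial_deriv j f (y + z *\<^sub>R ?w))"
        by blast
      then have "\<bar>f x - f y\<bar> = \<bar>\<Sum>j\<in>UNIV. ?w $ j * partial_deriv j f (y + z *\<^sub>R ?w)\<bar>" by simp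
      also have "\<dots> \<le> (\<Sum>j\<in>UNIV. \<bar>?w $ j * partial_deriv j f (y + z *\<^sub>R ?w)\<bar>)" by (rule sum_abs)
      also have "\<dots> \<le> (\<Sum>j\<in>UNIV. norm ?w * b j)"
        unfolding abs_mult by (intro sum_mono mult_mono component_le_norm_cart b) auto
      finally show ?thesis by (simp add: sum_distrib_right mult.commute)
    qed
  qed
qed

text \<open>A concave truncation of the identity, of class \<open>C\<^sup>2\<close>: its second derivative is minus the hat
  function supported on \<open>[0, 2]\<close>.\<close>

definition soft_min :: "real \<Rightarrow> real" where
  "soft_min z = z - 1 / 6 * ((max 0 z) ^ 3 - 2 * (max 0 (z - 1)) ^ 3 + (max 0 (z - 2)) ^ 3)"

definition soft_min' :: "real \<Rightarrow> real" where
  "soft_min' z = 1 - 1 / 2 * ((max 0 z)\<^sup>2 - 2 * (max 0 (z - 1))\<^sup>2 + (max 0 (z - 2))\<^sup>2)"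

definition soft_min'' :: "real \<Rightarrow> real" where
  "soft_min'' z = - (max 0 z - 2 * max 0 (z - 1) + max 0 (z - 2))"

text \<open>Only the kink needs thought: there the difference quotient is at most
  \<open>\<bar>y - c\<bar> ^ n\<close>, which vanishes in the limit as \<open>n > 0\<close>.\<close>

lemma DERIV_max_power:
  fixes c z :: real
  assumes n: "0 < n"
  shows "((\<lambda>z. (max 0 (z - c)) ^ Suc n) has_real_derivative real (Suc n) * (max 0 (z - c)) ^ n) (at z)"
proof (cases "z = c")
  case True
  have "((\<lambda>z. (max 0 (z - c)) ^ Suc n) has_real_derivative 0) (at c)"
    unfolding has_field_derivative_iff
  proof (rule Lim_null_comparison)
    have "((\<lambda>y. \<bar>y - c\<bar> ^ n) \<longlongrightarrow> \<bar>c - c\<bar> ^ n) (at c)" by (intro tendsto_intros)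
    moreover have "\<bar>c - c\<bar> ^ n = 0" using n by simp
    ultimately show "((\<lambda>y. \<bar>y - c\<bar> ^ n) \<longlongrightarrow> 0) (at c)" by (simp only:)
    show "\<forall>\<^sub>F y in at c. norm ((max 0 (y - c) ^ Suc n - max 0 (c - c) ^ Suc n) / (y - c)) \<le> \<bar>y - c\<bar> ^ n"
      by (rule always_eventually) (auto simp: max_def abs_mult divide_simps)
  qed
  then show ?thesis using True n by (simp add: zero_power)
next
  case False
  show ?thesis
  proof (cases "z < c")
    case True
    have d: "((\<lambda>_. 0) has_real_derivative 0) (at z)" by simp
    have ev: "\<forall>\<^sub>F y in nhds z. (max 0 (y - c)) ^ Suc n = 0"
      using eventually_nhds_in_open[of "{..<c}" z] True by (auto elim!: eventually_mono simp: max_def)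
    have "((\<lambda>z. (max 0 (z - c)) ^ Suc n) has_real_derivative 0) (at z)"
      by (rule iffD2[OF DERIV_cong_ev[OF refl ev refl] d])
    then show ?thesis using True n by (simp add: max_absorb1 zero_power)
  next
    case False
    with \<open>z \<noteq> c\<close> have z: "c < z" by simp
    have d: "((\<lambda>y. (y - c) ^ Suc n) has_real_derivative real (Suc n) * (z - c) ^ n) (at z)"
    proof -
      have "((\<lambda>y. y - c) has_real_derivative 1) (at z)" by (auto intro!: derivative_eq_intros)
      from DERIV_power_Suc[OF this, of n] show ?thesis by simp
    qed
    have ev: "\<forall>\<^sub>F y in nhds z. (max 0 (y - c)) ^ Suc n = (y - c) ^ Suc n"
      using eventually_nhds_in_open[of "{c<..}" z] z by (auto elim!: eventually_mono simp: max_def)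
    have "((\<lambda>z. (max 0 (z - c)) ^ Suc n) has_real_derivative real (Suc n) * (z - c) ^ n) (at z)"
      by (rule iffD2[OF DERIV_cong_ev[OF refl ev refl] d])
    then show ?thesis using z by (simp add: max_absorb2)
  qed
qed

lemma soft_min_deriv:
  "(soft_min has_real_derivative soft_min' z) (at z)" "(soft_min' has_real_derivative soft_min'' z) (at z)"
proof -
  have "((\<lambda>z. z - 1 / 6 * ((max 0 (z - 0)) ^ Suc 2 - 2 * (max 0 (z - 1)) ^ Suc 2 + (max 0 (z - 2)) ^ Suc 2))
     has_real_derivative 1 - 1 / 6 * (real (Suc 2) * (max 0 (z - 0)) ^ 2 - 2 * (real (Suc 2) * (max 0 (z - 1)) ^ 2) + real (Suc 2) * (max 0 (z - 2)) ^ 2)) (at z)"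
    by (intro DERIV_diff DERIV_add DERIV_cmult DERIV_ident DERIV_max_power) simp_all
  then show "(soft_min has_real_derivative soft_min' z) (at z)"
    unfolding soft_min_def[abs_def] soft_min'_def by (simp add: eval_nat_numeral(3)[symmetric] numeral_3_eq_3[symmetric] algebra_simps)
  have "((\<lambda>z. 1 - 1 / 2 * ((max 0 (z - 0)) ^ Suc 1 - 2 * (max 0 (z - 1)) ^ Suc 1 + (max 0 (z - 2)) ^ Suc 1))
     has_real_derivative 0 - 1 / 2 * (real (Suc 1) * (max 0 (z - 0)) ^ 1 - 2 * (real (Suc 1) * (max 0 (z - 1)) ^ 1) + real (Suc 1) * (max 0 (z - 2)) ^ 1)) (at z)"
    by (intro DERIV_diff DERIV_add DERIV_cmult DERIV_const DERIV_max_power) simp_all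
  then show "(soft_min' has_real_derivative soft_min'' z) (at z)"
    unfolding soft_min'_def[abs_def] soft_min''_def by (simp add: numeral_2_eq_2[symmetric] algebra_simps)
qed

lemma soft_min_simps: "z \<le> 0 \<Longrightarrow> soft_min z = z" "2 \<le> z \<Longrightarrow> soft_min z = 1"
proof -
  show "z \<le> 0 \<Longrightarrow> soft_min z = z" by (simp add: soft_min_def)
  assume "2 \<le> z"
  then show "soft_min z = 1"
    by (simp add: soft_min_def max_absorb2 power3_eq_cube algebra_simps)
qed

lemma soft_min'_bounds: "0 \<le> soft_min' z" "soft_min' z \<le> 1"
proof -
  consider "z \<le> 0" | "0 < z" "z \<le> 1" | "1 < z" "z \<le> 2" | "2 < z" by linarith
  then have "0 \<le> soft_min' z \<and> soft_min' z \<le> 1"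
  proof cases
    case 2
    then have "z\<^sup>2 \<le> 1\<^sup>2" by (intro power_mono) auto
    then show ?thesis using 2 by (simp add: soft_min'_def max_absorb1 max_absorb2)
  next
    case 3
    then have "soft_min' z = (2 - z)\<^sup>2 / 2"
      by (simp add: soft_min'_def max_absorb1 max_absorb2 power2_eq_square algebra_simps)
    moreover have "(2 - z)\<^sup>2 \<le> 1" using power_mono[of "2 - z" 1 2] 3 by simp
    ultimately show ?thesis using zero_le_power2[of "2 - z"] by linarith
  next
    case 4
    then have "soft_min' z = 0"
      by (simp add: soft_min'_def max_absorb2 power2_eq_square algebra_simps)
    then show ?thesis by simp
  qed (simp add: soft_min'_def)
  then show "0 \<le> soft_min' z" "soft_min' z \<le> 1" by auto
qed

lemma soft_min''_nonpos: "soft_min'' z \<le> 0"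
  by (simp add: soft_min''_def max_def)

lemma soft_min_mono: "y \<le> z \<Longrightarrow> soft_min y \<le> soft_min z"
  by (rule DERIV_nonneg_imp_nondecreasing[where f=soft_min]) (use soft_min_deriv(1) soft_min'_bounds in blast)+

lemma soft_min_le: "soft_min z \<le> z" "soft_min z \<le> 1"
proof -
  show "soft_min z \<le> 1"
    using soft_min_mono[of z "max z 2"] soft_min_simps(2)[of "max z 2"] by simp
  show "soft_min z \<le> z"
  proof (cases "z \<le> 0")
    case False
    have "(\<lambda>z. z - soft_min z) 0 \<le> (\<lambda>z. z - soft_min z) z"
    proof (rule DERIV_nonneg_imp_nondecreasing[where f="\<lambda>z. z - soft_min z"])
      fix x :: real
      have "((\<lambda>z. z - soft_min z) has_real_derivative 1 - soft_min' x) (at x)"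
        by (intro DERIV_diff DERIV_ident soft_min_deriv)
      then show "\<exists>y. ((\<lambda>z. z - soft_min z) has_real_derivative y) (at x) \<and> 0 \<le> y"
        using soft_min'_bounds(2)[of x] by (intro exI[of _ "1 - soft_min' x"]) auto
    qed (use False in simp)
    then show ?thesis by (simp add: soft_min_simps(1))
  qed (simp add: soft_min_simps)
qed

lemma soft_min''_continuous: "continuous_on UNIV soft_min''"
  unfolding soft_min''_def[abs_def] by (intro continuous_intros)

section \<open>A logarithmic Lyapunov function\<close>

lemma norm_matrix_matrix_transpose_component_le:
  fixes S :: "real^'d::finite^'d"
  shows "\<bar>(S ** transpose S) $ i $ j\<bar> \<le> (norm S)\<^sup>2"
proof -
  have "(S ** transpose S) $ i $ j = S $ i \<bullet> S $ j"
    by (simp add: matrix_matrix_mult_def transpose_def inner_vec_def)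
  also have "\<bar>\<dots>\<bar> \<le> norm (S $ i) * norm (S $ j)" by (rule Cauchy_Schwarz_ineq2)
  also have "\<dots> \<le> norm S * norm S"
    by (intro mult_mono Finite_Cartesian_Product.norm_nth_le) auto
  finally show ?thesis by (simp add: power2_eq_square)
qed

lemma gram_quadratic_form_nonneg:
  fixes S :: "real^'d::finite^'d"
  shows "0 \<le> (\<Sum>i\<in>UNIV. \<Sum>j\<in>UNIV. (S ** transpose S) $ i $ j * (a i * a j))"
proof -
  have e: "(S ** transpose S) $ i $ j = S $ j \<bullet> S $ i" for i j
    by (simp add: matrix_matrix_mult_def transpose_def inner_vec_def mult.commute)
  have "(\<Sum>i\<in>UNIV. \<Sum>j\<in>UNIV. (S ** transpose S) $ i $ j * (a i * a j)) =
      (\<Sum>i\<in>UNIV. a i *\<^sub>R S $ i) \<bullet> (\<Sum>j\<in>UNIV. a j *\<^sub>R S $ j)"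
    by (simp add: inner_sum_left inner_sum_right e sum_distrib_left mult_ac)
  then show ?thesis by simp
qed

lemma C2_fun_ln_inner:
  "C2_fun (\<lambda>x::real^'d::finite. ln (1 + x \<bullet> x))"
  "generator \<mu> S (\<lambda>x::real^'d. ln (1 + x \<bullet> x)) x =
     (\<Sum>i\<in>UNIV. \<mu> x $ i * (2 * x $ i / (1 + x \<bullet> x))) +
     1 / 2 * (\<Sum>i\<in>UNIV. \<Sum>j\<in>UNIV. S x $ i $ j * ((if i = j then 2 else 0) / (1 + x \<bullet> x) - 4 * x $ i * x $ j / (1 + x \<bullet> x)\<^sup>2))"
proof -
  let ?q = "\<lambda>x::real^'d. 1 + x \<bullet> x"
  have q: "0 < ?q x" for x by (simp add: add_pos_nonneg)
  have q0: "?q x \<noteq> 0" for x using q[of x] by linarith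
  have 1: "(ln has_real_derivative inverse (?q x)) (at (?q x))" for x
    using q[of x] by (rule DERIV_ln)
  have 2: "(inverse has_real_derivative - (inverse (?q x) ^ Suc (Suc 0))) (at (?q x))" for x
    by (rule DERIV_inverse[OF q0])
  have c2: "continuous_on UNIV (\<lambda>x. - (inverse (?q x) ^ Suc (Suc 0)))"
    by (intro continuous_intros) (use q0 in blast)
  have c1: "continuous_on UNIV (\<lambda>x. inverse (?q x))"
    by (intro continuous_intros) (use q0 in blast)
  have lin: "C1_fun (\<lambda>x::real^'d. 2 * x $ i)" "partial_deriv j (\<lambda>x::real^'d. 2 * x $ i) = (\<lambda>x. 2 * (if j = i then 1 else 0))" for i j
    using C1_fun_cmult[OF C1_fun_component(1)[of i], where c=2] by (auto simp: C1_fun_component(2))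
  note U = C1_fun_compose[where \<phi>'=inverse, OF C1_fun_inner_self(1) 1 c1, unfolded C1_fun_inner_self(2)]
  note V = C1_fun_compose[where \<phi>'="\<lambda>y. - (inverse y ^ Suc (Suc 0))", OF C1_fun_inner_self(1) 2 c2, unfolded C1_fun_inner_self(2)]
  note W = C1_fun_mult[OF V(1) lin(1)]
  show "C2_fun (\<lambda>x::real^'d. ln (1 + x \<bullet> x))"
    unfolding C2_fun_def U(2) using U(1) W(1) by auto
  show "generator \<mu> S (\<lambda>x::real^'d. ln (1 + x \<bullet> x)) x =
     (\<Sum>i\<in>UNIV. \<mu> x $ i * (2 * x $ i / (1 + x \<bullet> x))) +
     1 / 2 * (\<Sum>i\<in>UNIV. \<Sum>j\<in>UNIV. S x $ i $ j * ((if i = j then 2 else 0) / (1 + x \<bullet> x) - 4 * x $ i * x $ j / (1 + x \<bullet> x)\<^sup>2))"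
    unfolding generator_def U(2) W(2) V(2) lin(2)
    by (intro arg_cong2[where f="(+)"] arg_cong[where f="(*) (1 / 2)"] sum.cong refl)
      (auto simp: power2_eq_square field_simps)
qed

context sde
begin

text \<open>The logarithm grows without bound, yet its first and second derivatives decay like
  \<open>1 / norm x\<close> and its square, which balances the linear growth of \<mu> and the
  quadratic growth of the diffusion matrix.\<close>

lemma gen_ln_bounded:
  obtains \<kappa> where "0 \<le> \<kappa>" "\<And>x. gen (\<lambda>x. ln (1 + x \<bullet> x)) x \<le> \<kappa>"
proof -
  obtain g where g: "0 < g" "\<And>x. norm (\<mu> x) \<le> g * (1 + norm x)" "\<And>x. norm (\<sigma> x) \<le> g * (1 + norm x)"
    using linear_growth by metis
  define d where "d = real CARD('d)"
  show ?thesis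
  proof (rule that)
    \<comment> \<open>Each drift summand is at most \<open>4 * g\<close> and each second-order
      summand at most \<open>12 * g\<^sup>2\<close>; the latter is
      \<open>g\<^sup>2 * (2 * q)\<close> times \<open>6 / q\<close>, with 6 = 2 + 4 from the two
      parts of the Hessian.\<close>
    show "0 \<le> d * (4 * g) + 1 / 2 * (d * d * (12 * g\<^sup>2))" using g by (simp add: d_def)
    fix x :: "real^'d"
    define q where "q = 1 + x \<bullet> x"
    have q: "1 \<le> q" by (simp add: q_def)
    have n2: "(norm x)\<^sup>2 \<le> q" by (simp add: q_def power2_norm_eq_inner)
    have n1: "(1 + norm x)\<^sup>2 \<le> 2 * q"
    proof -
      have "(1 + norm x)\<^sup>2 \<le> 2 * 1\<^sup>2 + 2 * (norm x)\<^sup>2"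
        using sum_squares_bound[of 1 "norm x"] by (simp add: power2_sum)
      then show ?thesis by (simp add: q_def power2_norm_eq_inner)
    qed
    have xi: "\<bar>x $ i\<bar> \<le> norm x" for i by (rule component_le_norm_cart)
    have t1: "\<mu> x $ i * (2 * x $ i / q) \<le> 4 * g" for i
    proof -
      have "\<bar>\<mu> x $ i * (2 * x $ i)\<bar> = 2 * (\<bar>\<mu> x $ i\<bar> * \<bar>x $ i\<bar>)" by (simp add: abs_mult)
      also have "\<dots> \<le> 2 * (g * (1 + norm x) * (1 + norm x))"
        using xi[of i] order_trans[OF component_le_norm_cart g(2)[of x]] g(1)
        by (intro mult_left_mono mult_mono) (auto intro: order_trans)
      also have "\<dots> \<le> 2 * (g * (2 * q))"
        using n1 g(1) by (intro mult_left_mono) (auto simp: power2_eq_square mult.assoc)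
      finally have "\<mu> x $ i * (2 * x $ i) \<le> (4 * g) * q"
        using abs_ge_self[of "\<mu> x $ i * (2 * x $ i)"] by linarith
      then have "\<mu> x $ i * (2 * x $ i) / q \<le> 4 * g" using q by (simp add: pos_divide_le_eq)
      then show ?thesis by simp
    qed
    have t2: "(\<sigma> x ** transpose (\<sigma> x)) $ i $ j * ((if i = j then 2 else 0) / q - 4 * x $ i * x $ j / q\<^sup>2) \<le> 12 * g\<^sup>2" for i j
    proof -
      have s: "\<bar>(\<sigma> x ** transpose (\<sigma> x)) $ i $ j\<bar> \<le> g\<^sup>2 * (2 * q)"
      proof -
        have "\<bar>(\<sigma> x ** transpose (\<sigma> x)) $ i $ j\<bar> \<le> (norm (\<sigma> x))\<^sup>2" by (rule norm_matrix_matrix_transpose_component_le)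
        also have "\<dots> \<le> (g * (1 + norm x))\<^sup>2" by (intro power_mono g(3)) simp
        also have "\<dots> \<le> g\<^sup>2 * (2 * q)" unfolding power_mult_distrib using n1 by (intro mult_left_mono) auto
        finally show ?thesis .
      qed
      have "\<bar>4 * x $ i * x $ j / q\<^sup>2\<bar> = 4 * (\<bar>x $ i\<bar> * \<bar>x $ j\<bar>) / q\<^sup>2" by (simp add: abs_mult)
      also have "\<dots> \<le> 4 * (norm x * norm x) / q\<^sup>2"
        by (intro divide_right_mono mult_left_mono mult_mono xi) auto
      also have "\<dots> \<le> 4 * q / q\<^sup>2"
        using n2 by (intro divide_right_mono) (auto simp: power2_eq_square)
      also have "\<dots> = 4 / q" using q by (simp add: power2_eq_square)
      finally have a: "\<bar>4 * x $ i * x $ j / q\<^sup>2\<bar> \<le> 4 / q" .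
      have b: "\<bar>(if i = j then 2 else 0) / q\<bar> \<le> 2 / q" using q by simp
      have "4 / q + 2 / q = 6 / q" by (simp add: add_divide_distrib[symmetric])
      then have "\<bar>(if i = j then 2 else 0) / q - 4 * x $ i * x $ j / q\<^sup>2\<bar> \<le> 6 / q"
        using a b by linarith
      with s have "\<bar>(\<sigma> x ** transpose (\<sigma> x)) $ i $ j\<bar> * \<bar>(if i = j then 2 else 0) / q - 4 * x $ i * x $ j / q\<^sup>2\<bar> \<le> (g\<^sup>2 * (2 * q)) * (6 / q)"
        using q by (intro mult_mono) auto
      also have "\<dots> = 12 * g\<^sup>2" using q by simp
      finally show ?thesis unfolding abs_mult[symmetric] by (rule order_trans[OF abs_ge_self])
    qed
    have "(\<Sum>i\<in>UNIV. \<mu> x $ i * (2 * x $ i / q)) \<le> (\<Sum>i\<in>(UNIV::'d set). 4 * g)"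
      by (intro sum_mono t1)
    moreover have "(\<Sum>i\<in>UNIV. \<Sum>j\<in>UNIV. (\<sigma> x ** transpose (\<sigma> x)) $ i $ j * ((if i = j then 2 else 0) / q - 4 * x $ i * x $ j / q\<^sup>2))
        \<le> (\<Sum>i\<in>(UNIV::'d set). \<Sum>j\<in>(UNIV::'d set). 12 * g\<^sup>2)"
      by (intro sum_mono t2)
    ultimately show "gen (\<lambda>x. ln (1 + x \<bullet> x)) x \<le> d * (4 * g) + 1 / 2 * (d * d * (12 * g\<^sup>2))"
      unfolding C2_fun_ln_inner(2) q_def[symmetric] by (simp add: d_def)
  qed
qed

section \<open>From one-step bounds to bounds on the semigroup\<close>

lemma kern_le_add:
  assumes h: "0 < h" and u: "u \<in> borel_measurable borel" "\<And>x. \<bar>u x\<bar> \<le> C"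
    and v: "v \<in> borel_measurable borel" "\<And>x. \<bar>v x\<bar> \<le> D" and le: "\<And>x. u x \<le> v x + c"
  shows "kern h u x \<le> kern h v x + c"
proof -
  interpret G: prob_space "gauss h :: (real^'d) measure" by (rule prob_space_gauss[OF h])
  have "kern h u x \<le> (\<integral>y. v (x + h *\<^sub>R \<mu> x + \<sigma> x *v y) + c \<partial>gauss h)"
    unfolding kern_def using kern_bound(1)[OF h u, of x] kern_bound(1)[OF h v, of x]
    by (intro integral_mono le) auto
  also have "\<dots> = kern h v x + c"
    unfolding kern_def using kern_bound(1)[OF h v, of x]
    by (subst Bochner_Integration.integral_add) (auto simp: G.prob_space[unfolded space_gauss])
  finally show ?thesis .
qed

text \<open>The kernel is monotone and preserves constants, so a one-step bound uniform in the
  starting point simply accumulates.\<close>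

lemma kern_funpow_le:
  assumes h: "0 < h" and f: "f \<in> borel_measurable borel" "\<And>x. \<bar>f x\<bar> \<le> C"
    and step: "\<And>x. kern h f x \<le> f x + c"
  shows "(kern h ^^ n) f x \<le> f x + real n * c"
proof (induction n arbitrary: x)
  case (Suc n)
  have "kern h ((kern h ^^ n) f) x \<le> kern h f x + real n * c"
    by (rule kern_le_add[OF h kern_funpow[OF h f] f Suc.IH])
  also have "\<dots> \<le> f x + c + real n * c" using step[of x] by simp
  finally show ?case by (simp add: algebra_simps)
qed simp

end

context sde_flow
begin

text \<open>Iterating the one-step bound over \<open>Suc n\<close> steps of length
  \<open>t / real (Suc n)\<close> accumulates exactly \<open>t * (G + e)\<close>; the limit turns
  the Euler kernels into \<open>P t\<close>.\<close>

lemma P_le_compact: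
  assumes f: "C2_fun f" and supp: "\<And>x. \<rho> < norm x \<Longrightarrow> f x = c" and C: "\<And>x. \<bar>f x\<bar> \<le> C"
    and G: "\<And>x. gen f x \<le> G" "0 \<le> G" and t: "0 < t"
  shows "P t f s \<le> f s + t * G"
proof (rule field_le_epsilon)
  fix e' :: real assume e': "0 < e'"
  define e where "e = e' / t"
  have e: "0 < e" using e' t by (simp add: e_def)
  have f1: "C1_fun f" using f by (simp add: C2_fun_def)
  obtain L where L: "0 \<le> L" "\<And>x y. \<bar>f x - f y\<bar> \<le> L * norm (x - y)"
    by (rule C1_compact_support_lipschitz[OF f1, of \<rho> c]) (rule supp, assumption, rule that)
  note fm = lipschitz_measurable[OF L]
  obtain h0 where h0: "0 < h0" "\<And>h x. 0 < h \<Longrightarrow> h < h0 \<Longrightarrow> kern h f x \<le> f x + h * (G + e)"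
    by (rule kern_one_step[where \<rho>=\<rho> and c=c and C=C, OF f _ C G e]) (rule supp, assumption, rule that)
  let ?h = "\<lambda>n. t / real (Suc n)"
  have h: "0 < ?h n" for n using t by simp
  have hl: "?h \<longlonglongrightarrow> 0"
    using tendsto_mult[OF tendsto_const[of t] LIMSEQ_inverse_real_of_nat] by (simp add: divide_inverse)
  have N: "real (Suc n) * ?h n = t" for n by simp
  have lim: "(\<lambda>n. (kern (?h n) ^^ Suc n) f s) \<longlonglongrightarrow> P t f s"
    by (rule euler_expectation_converges[OF C L less_imp_le[OF t] h hl N])
  have "\<forall>\<^sub>F n in sequentially. (kern (?h n) ^^ Suc n) f s \<le> f s + t * (G + e)"
    using order_tendstoD(2)[OF hl h0(1)]
  proof eventually_elim
    case (elim n)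
    have "(kern (?h n) ^^ Suc n) f s \<le> f s + real (Suc n) * (?h n * (G + e))"
      by (rule kern_funpow_le[OF h fm C h0(2)[OF h elim]])
    then show ?case by (simp only: mult.assoc[symmetric] N)
  qed
  then have "P t f s \<le> f s + t * (G + e)"
    by (rule tendsto_upperbound[OF lim]) simp
  then show "P t f s \<le> f s + t * G + e'" using t by (simp add: e_def distrib_left)
qed

text \<open>Since \<open>r\<close> is bounded but its gradient is not, localisation by a multiplicative cutoff would
  leave uncontrolled terms. Instead \<open>r + \<epsilon> ln (1 + \<bar>x\<bar>\<^sup>2)\<close>, which is proper, is truncated by
  a concave function: concavity only decreases the generator.\<close>

lemma P_le_generator:
  assumes r: "C2_fun r" and C: "\<And>x. \<bar>r x\<bar> \<le> C" and G: "\<And>x. gen r x \<le> G" "0 \<le> G" and t: "0 \<le> t"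
  shows "P t r s \<le> r s + t * G"
proof (cases "t = 0")
  case True
  then show ?thesis using P_0[OF C2_fun_measurable[OF r]] by simp
next
  case False
  with t have t: "0 < t" by simp
  let ?U = "\<lambda>x::real^'d. ln (1 + x \<bullet> x)"
  obtain \<kappa> where \<kappa>: "0 \<le> \<kappa>" "\<And>x. gen ?U x \<le> \<kappa>"
    by (rule gen_ln_bounded) (rule that)
  have C0: "0 \<le> C" using order_trans[OF abs_ge_zero C] .
  have U0: "0 \<le> ?U x" for x by simp
  note rm = C2_fun_measurable[OF r]
  have main: "P t r s \<le> r s + \<epsilon> * ?U s + t * (G + \<epsilon> * \<kappa>)" if \<epsilon>: "0 < \<epsilon>" for \<epsilon>
  proof -
    define g where "g x = r x + \<epsilon> * ?U x" for x
    have gC2: "C2_fun g" and gg: "gen g x \<le> G + \<epsilon> * \<kappa>" for x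
    proof -
      note u = C2_fun_cmult[OF C2_fun_ln_inner(1), where c=\<epsilon>]
      show "C2_fun g" unfolding g_def[abs_def] by (rule C2_fun_add(1)[OF r u(1)])
      have "gen g x = gen r x + \<epsilon> * gen ?U x"
        unfolding g_def[abs_def] C2_fun_add(2)[OF r u(1)] u(2) ..
      also have "\<dots> \<le> G + \<epsilon> * \<kappa>" using \<epsilon> by (intro add_mono G mult_left_mono \<kappa>) auto
      finally show "gen g x \<le> G + \<epsilon> * \<kappa>" .
    qed
    \<comment> \<open>The shift by \<open>C\<close> makes \<phi> the identity on the range of
      \<open>r\<close>, so monotonicity gives \<open>r \<le> \<phi> g\<close>, while
      \<open>\<phi> y \<le> y\<close> returns to \<open>g\<close> at the starting point.\<close>
    define \<phi> where "\<phi> y = C + soft_min (y - C)" for y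
    have sh: "((\<lambda>y. y - C) has_real_derivative 1) (at y)" for y :: real
      by (auto intro!: derivative_eq_intros)
    have d1: "(\<phi> has_real_derivative soft_min' (y - C)) (at y)" for y
    proof -
      have "((\<lambda>y. soft_min (y - C)) has_real_derivative soft_min' (y - C) * 1) (at y)"
        by (rule DERIV_chain2[where f=soft_min and g="\<lambda>y. y - C", OF soft_min_deriv(1) sh])
      from DERIV_add[OF DERIV_const[of C] this] show ?thesis
        by (simp add: \<phi>_def[abs_def])
    qed
    have d2: "((\<lambda>y. soft_min' (y - C)) has_real_derivative soft_min'' (y - C)) (at y)" for y
      using DERIV_chain2[where f=soft_min' and g="\<lambda>y. y - C", OF soft_min_deriv(2) sh] by simp
    note gc = C2_fun_continuous[OF gC2]
    have c2: "continuous_on UNIV (\<lambda>x. soft_min'' (g x - C))"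
      by (intro continuous_on_compose2[OF soft_min''_continuous] continuous_intros gc) auto
    note comp = C2_fun_compose[where \<phi>=\<phi> and ?\<phi>1.0="\<lambda>y. soft_min' (y - C)" and ?\<phi>2.0="\<lambda>y. soft_min'' (y - C)", OF gC2 d1 d2 c2]
    let ?f = "\<lambda>x. \<phi> (g x)"
    \<comment> \<open>Beyond this radius the logarithmic term is at least \<open>2 * C + 2\<close>,
      so \<open>g - C\<close> is at least 2, where \<open>soft_min\<close> has reached its constant
      value.\<close>
    define \<rho> where "\<rho> = exp ((2 * C + 2) / \<epsilon>)"
    have far: "?f x = C + 1" if x: "\<rho> < norm x" for x
    proof -
      have \<rho>: "1 \<le> \<rho>" using C0 \<epsilon> by (simp add: \<rho>_def)
      have "norm x * 1 \<le> norm x * norm x" using x \<rho> by (intro mult_left_mono) auto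
      then have "\<rho> \<le> 1 + x \<bullet> x" using x by (simp add: power2_norm_eq_inner[symmetric] power2_eq_square)
      moreover have "0 < \<rho>" using \<rho> by simp
      ultimately have "ln \<rho> \<le> ?U x" by (intro ln_mono) auto
      then have "\<epsilon> * ((2 * C + 2) / \<epsilon>) \<le> \<epsilon> * ?U x"
        using \<epsilon> by (intro mult_left_mono) (auto simp: \<rho>_def)
      then have "2 * C + 2 \<le> \<epsilon> * ?U x" using \<epsilon> by simp
      moreover have "- C \<le> r x" using C[of x] by linarith
      ultimately have "2 \<le> g x - C" unfolding g_def by linarith
      then show ?thesis by (simp add: \<phi>_def soft_min_simps)
    qed
    have ge: "r x \<le> ?f x" for x
    proof -
      have "r x - C \<le> 0" using C[of x] by linarith
      then have "r x = C + soft_min (r x - C)" by (simp add: soft_min_simps)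
      also have "\<dots> \<le> ?f x"
        unfolding \<phi>_def using U0[of x] \<epsilon> by (intro add_left_mono soft_min_mono) (simp add: g_def)
      finally show ?thesis .
    qed
    have bound: "\<bar>?f x\<bar> \<le> C + 1" for x
      using ge[of x] C[of x] soft_min_le(2)[of "g x - C"] unfolding \<phi>_def by linarith
    \<comment> \<open>The concavity term is nonpositive and is dropped; the remaining factor
      \<open>soft_min'\<close> lies between 0 and 1, and the bound it multiplies is
      nonnegative.\<close>
    have gen_f: "gen ?f x \<le> G + \<epsilon> * \<kappa>" for x
    proof -
      have "gen ?f x \<le> soft_min' (g x - C) * gen g x"
        unfolding comp(2) using mult_nonpos_nonneg[OF soft_min''_nonpos[of "g x - C"] gram_quadratic_form_nonneg[of "\<sigma> x" "\<lambda>i. partial_deriv i g x"]]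
        by simp
      also have "\<dots> \<le> soft_min' (g x - C) * (G + \<epsilon> * \<kappa>)"
        by (intro mult_left_mono gg soft_min'_bounds)
      also have "\<dots> \<le> 1 * (G + \<epsilon> * \<kappa>)"
        using G(2) \<epsilon> \<kappa> by (intro mult_right_mono soft_min'_bounds) auto
      finally show ?thesis by simp
    qed
    note fm = C2_fun_measurable[OF comp(1)]
    have "P t r s \<le> P t ?f s"
      unfolding P_def using t
      by (intro integral_mono flow_integrable[OF _ rm C] flow_integrable[OF _ fm bound] ge) auto
    also have "\<dots> \<le> ?f s + t * (G + \<epsilon> * \<kappa>)"
      by (rule P_le_compact[where \<rho>=\<rho> and c="C + 1" and C="C + 1", OF comp(1) _ bound gen_f _ t])
        (use far G(2) \<epsilon> \<kappa> in auto)
    also have "?f s \<le> g s" using soft_min_le(1)[of "g s - C"] by (simp add: \<phi>_def)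
    finally show ?thesis by (simp add: g_def)
  qed
  \<comment> \<open>For fixed \<open>s\<close> and \<open>t\<close> the perturbation is linear in
    \<epsilon> and disappears as \<epsilon> decreases to 0, although the cutoff radius then tends to
    infinity.\<close>
  show ?thesis
  proof (rule tendsto_lowerbound)
    show "((\<lambda>\<epsilon>. r s + \<epsilon> * ?U s + t * (G + \<epsilon> * \<kappa>)) \<longlongrightarrow> r s + t * G) (at_right 0)"
      by (auto intro!: tendsto_eq_intros)
    show "\<forall>\<^sub>F \<epsilon> in at_right 0. P t r s \<le> r s + \<epsilon> * ?U s + t * (G + \<epsilon> * \<kappa>)"
      using eventually_at_right_less[of "0::real"] by eventually_elim (rule main)
  qed simp
qed

text \<open>The upper bound is applied to \<open>r\<close> and to \<open>-r\<close>, whose generator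
  is bounded by the same \<open>G\<close>.\<close>

lemma P_diff_le_generator:
  assumes r: "C2_fun r" and C: "\<And>x. \<bar>r x\<bar> \<le> C" and G: "\<And>x. \<bar>gen r x\<bar> \<le> G" and t: "0 \<le> t"
  shows "\<bar>P t r s - r s\<bar> \<le> t * G"
proof -
  have G0: "0 \<le> G" using order_trans[OF abs_ge_zero G] .
  have "P t r s \<le> r s + t * G"
    using G G0 by (intro P_le_generator[OF r C _ _ t]) (auto simp: abs_le_iff)
  moreover have "P t (\<lambda>x. -1 * r x) s \<le> -1 * r s + t * G"
  proof (rule P_le_generator[OF C2_fun_cmult(1)[OF r] _ _ G0 t])
    show "\<bar>- 1 * r x\<bar> \<le> C" for x using C[of x] by simp
    show "gen (\<lambda>x. - 1 * r x) x \<le> G" for x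
      unfolding C2_fun_cmult(2)[OF r] using G[of x] by linarith
  qed
  moreover have "P t (\<lambda>x. -1 * r x) s = - P t r s" by (simp add: P_def)
  ultimately show ?thesis by (simp add: abs_le_iff)
qed

end

subsection \<open>Value functions\<close>

lemma set_integrable_exp:
  assumes "0 < \<beta>"
  shows "set_integrable lborel {0..} (\<lambda>t::real. exp (- \<beta> * t))"
proof -
  have "(\<integral>\<^sup>+x. exponential_density \<beta> x \<partial>lborel) = 1"
    using prob_space.emeasure_space_1[OF prob_space_exponential_density[OF assms]]
    by (simp add: emeasure_density)
  then have "integrable lborel (\<lambda>x. exponential_density \<beta> x)"
    using assms by (intro integrableI_nonneg) (auto simp: erlang_density_nonneg)
  then have "integrable lborel (\<lambda>x. (1 / \<beta>) * exponential_density \<beta> x)"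
    by (rule integrable_mult_right)
  also have "(\<lambda>x. (1 / \<beta>) * exponential_density \<beta> x) = (\<lambda>x. indicator {0..} x *\<^sub>R exp (- \<beta> * x))"
    using assms by (intro ext) (simp add: exponential_density_def indicator_def mult.commute)
  finally show ?thesis by (simp add: set_integrable_def)
qed

text \<open>Kept general in \<open>N\<close> because it is used with the underlying probability
  space and also with a point mass on the state space.\<close>

lemma discounted_fubini:
  fixes g :: "real \<Rightarrow> 'a \<Rightarrow> real"
  assumes N: "prob_space N" and \<beta>: "0 < \<beta>"
    and g: "(\<lambda>(t, \<omega>). g t \<omega>) \<in> borel_measurable (borel \<Otimes>\<^sub>M N)" and C: "\<And>t \<omega>. \<bar>g t \<omega>\<bar> \<le> C"
  shows "(\<integral>\<omega>. (LINT t:{0..}|lborel. exp (- \<beta> * t) * g t \<omega>) \<partial>N) = (LINT t:{0..}|lborel. exp (- \<beta> * t) * (\<integral>\<omega>. g t \<omega> \<partial>N))"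
    and "(\<lambda>\<omega>. LINT t:{0..}|lborel. exp (- \<beta> * t) * g t \<omega>) \<in> borel_measurable N"
    and "\<omega> \<in> space N \<Longrightarrow> set_integrable lborel {0..} (\<lambda>t. exp (- \<beta> * t) * g t \<omega>)"
    and "\<omega> \<in> space N \<Longrightarrow> \<bar>LINT t:{0..}|lborel. exp (- \<beta> * t) * g t \<omega>\<bar> \<le> C * (LINT t:{0..}|lborel. exp (- \<beta> * t))"
proof -
  interpret N: prob_space N by fact
  interpret PS: pair_sigma_finite "lborel :: real measure" N ..
  let ?e = "\<lambda>t. indicator {0..} t * exp (- \<beta> * t) :: real"
  let ?f = "\<lambda>t \<omega>. ?e t * g t \<omega>"
  have C0: "0 \<le> C" using order_trans[OF abs_ge_zero C] .
  have e: "integrable lborel ?e"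
    using set_integrable_exp[OF \<beta>] by (simp add: set_integrable_def)
  have eC: "integrable lborel (\<lambda>t. ?e t * C)" by (intro integrable_mult_left e)
  have fm: "case_prod ?f \<in> borel_measurable (lborel \<Otimes>\<^sub>M N)"
  proof -
    have "(\<lambda>z. ?e (fst z) * g (fst z) (snd z)) \<in> borel_measurable (borel \<Otimes>\<^sub>M N)"
      using g unfolding case_prod_beta by measurable
    then show ?thesis by (simp add: case_prod_beta cong: measurable_cong_sets sets_pair_measure_cong)
  qed
  have le: "norm (?f t \<omega>) \<le> norm (?e t * C)" for t \<omega>
    using C[of t \<omega>] C0 by (simp add: abs_mult mult_left_mono)
  have sec1: "(\<lambda>t. ?f t \<omega>) \<in> borel_measurable lborel" if "\<omega> \<in> space N" for \<omega>
    using measurable_compose[OF measurable_Pair2'[OF that] fm] by simp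
  have sec2: "(\<lambda>\<omega>. g t \<omega>) \<in> borel_measurable N" for t
    using measurable_compose[OF measurable_Pair1', OF _ g, of t] by simp
  have i1: "integrable lborel (\<lambda>t. ?f t \<omega>)" if "\<omega> \<in> space N" for \<omega>
    by (rule Bochner_Integration.integrable_bound[OF eC sec1[OF that]]) (use le in auto)
  have i2: "integrable N (\<lambda>\<omega>. ?f t \<omega>)" for t
    using C sec2 by (intro integrable_mult_right N.integrable_const_bound[where B=C]) auto
  have int: "integrable (lborel \<Otimes>\<^sub>M N) (case_prod ?f)"
  proof (rule PS.Fubini_integrable[OF fm])
    show "integrable lborel (\<lambda>t. \<integral>\<omega>. norm (case (t, \<omega>) of (t, \<omega>) \<Rightarrow> ?f t \<omega>) \<partial>N)"
    proof (rule Bochner_Integration.integrable_bound[OF eC])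
      have "(\<lambda>(t, \<omega>). norm (?f t \<omega>)) \<in> borel_measurable (lborel \<Otimes>\<^sub>M N)"
        using measurable_compose[OF fm borel_measurable_norm] by (simp add: case_prod_beta)
      then have "(\<lambda>t. \<integral>\<omega>. norm (?f t \<omega>) \<partial>N) \<in> borel_measurable lborel"
        by (rule N.borel_measurable_lebesgue_integral)
      then show "(\<lambda>t. \<integral>\<omega>. norm (case (t, \<omega>) of (t, \<omega>) \<Rightarrow> ?f t \<omega>) \<partial>N) \<in> borel_measurable lborel" by simp
      show "AE t in lborel. norm (\<integral>\<omega>. norm (case (t, \<omega>) of (t, \<omega>) \<Rightarrow> ?f t \<omega>) \<partial>N) \<le> norm (?e t * C)"
      proof (rule AE_I2)
        fix t
        have "(\<integral>\<omega>. norm (?f t \<omega>) \<partial>N) \<le> (\<integral>\<omega>. norm (?e t * C) \<partial>N)"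
          using i2[of t] le by (intro integral_mono integrable_norm) auto
        moreover have "0 \<le> (\<integral>\<omega>. norm (?f t \<omega>) \<partial>N)" by (intro integral_nonneg_AE) auto
        ultimately show "norm (\<integral>\<omega>. norm (case (t, \<omega>) of (t, \<omega>) \<Rightarrow> ?f t \<omega>) \<partial>N) \<le> norm (?e t * C)"
          by (simp add: N.prob_space)
      qed
    qed
    show "AE t in lborel. integrable N (\<lambda>\<omega>. case (t, \<omega>) of (t, \<omega>) \<Rightarrow> ?f t \<omega>)"
      using i2 by simp
  qed
  have "(\<integral>\<omega>. (\<integral>t. ?f t \<omega> \<partial>lborel) \<partial>N) = (\<integral>t. (\<integral>\<omega>. ?f t \<omega> \<partial>N) \<partial>lborel)"
    by (rule PS.Fubini_integral[OF int])
  then show "(\<integral>\<omega>. (LINT t:{0..}|lborel. exp (- \<beta> * t) * g t \<omega>) \<partial>N) = (LINT t:{0..}|lborel. exp (- \<beta> * t) * (\<integral>\<omega>. g t \<omega> \<partial>N))"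
    by (simp add: set_lebesgue_integral_def mult.assoc)
  have "(\<lambda>(\<omega>, t). ?f t \<omega>) \<in> borel_measurable (N \<Otimes>\<^sub>M lborel)"
    using measurable_compose[OF measurable_pair_swap' fm] by (simp add: case_prod_beta)
  then have "(\<lambda>\<omega>. \<integral>t. ?f t \<omega> \<partial>lborel) \<in> borel_measurable N"
    by (rule lborel.borel_measurable_lebesgue_integral)
  then show "(\<lambda>\<omega>. LINT t:{0..}|lborel. exp (- \<beta> * t) * g t \<omega>) \<in> borel_measurable N"
    by (simp add: set_lebesgue_integral_def mult.assoc)
  assume \<omega>: "\<omega> \<in> space N"
  show "set_integrable lborel {0..} (\<lambda>t. exp (- \<beta> * t) * g t \<omega>)"
    using i1[OF \<omega>] by (simp add: set_integrable_def mult.assoc)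
  have "\<bar>\<integral>t. ?f t \<omega> \<partial>lborel\<bar> \<le> (\<integral>t. \<bar>?f t \<omega>\<bar> \<partial>lborel)" by (rule integral_abs_bound)
  also have "\<dots> \<le> (\<integral>t. ?e t * C \<partial>lborel)"
    using le C0 by (intro integral_mono integrable_abs i1[OF \<omega>] eC) (auto simp: abs_mult)
  also have "\<dots> = C * (LINT t:{0..}|lborel. exp (- \<beta> * t))"
    by (simp add: set_lebesgue_integral_def mult.commute)
  finally show "\<bar>LINT t:{0..}|lborel. exp (- \<beta> * t) * g t \<omega>\<bar> \<le> C * (LINT t:{0..}|lborel. exp (- \<beta> * t))"
    by (simp add: set_lebesgue_integral_def mult.assoc)
qed

context sde_flow
begin

lemma P_measurable_pair:
  assumes f: "continuous_on UNIV f" and C: "\<And>x. \<bar>f x\<bar> \<le> C"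
  shows "(\<lambda>(t, x). P (max 0 t) f x) \<in> borel_measurable (borel \<Otimes>\<^sub>M borel)"
proof (rule borel_measurable_pair_left_limit)
  show "P t f \<in> borel_measurable borel" if "0 \<le> t" for t by (rule P_measurable[OF f C that])
  fix t :: real and x assume t: "0 < t"
  show "((\<lambda>s. P s f x) \<longlongrightarrow> P t f x) (at_left t)"
  proof (rule tendsto_at_left_sequentially[of 0])
    fix S :: "nat \<Rightarrow> real" assume "\<And>n. S n < t" "\<And>n. 0 < S n" "S \<longlonglongrightarrow> t"
    then show "(\<lambda>n. P (S n) f x) \<longlonglongrightarrow> P t f x"
      using t by (intro P_tendsto_time[OF f C]) (auto intro: less_imp_le)
  qed (use t in auto)
qed

text \<open>Exchanging expectation and time integral expresses \<open>V\<close> through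
  \<open>P\<close>; the expectation of \<open>V\<close> at time \<Delta> then becomes a time shift
  by the semigroup property. The maximum with 0 only extends the integrands to negative times, for
  joint measurability.\<close>

lemma value_fun_facts:
  assumes r: "continuous_on UNIV r" and C: "\<And>x. \<bar>r x\<bar> \<le> C" and \<beta>: "0 < \<beta>"
  defines "V \<equiv> value_fun M X \<beta> r"
  shows value_fun_eq: "V s = (LINT t:{0..}|lborel. exp (- \<beta> * t) * P (max 0 t) r s)"
    and value_fun_measurable: "V \<in> borel_measurable borel"
    and value_fun_bound: "\<bar>V s\<bar> \<le> C * (LINT t:{0..}|lborel. exp (- \<beta> * t))"
    and value_fun_expectation: "0 < \<Delta> \<Longrightarrow> expectation (\<lambda>\<omega>. V (X s \<Delta> \<omega>)) = (LINT t:{0..}|lborel. exp (- \<beta> * t) * P (\<Delta> + max 0 t) r s)"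
    and value_fun_integrable: "set_integrable lborel {0..} (\<lambda>t. exp (- \<beta> * t) * P (max 0 t) r s)"
proof -
  note rm = borel_measurable_continuous_onI[OF r]
  have P': "\<bar>P (max 0 t) r x\<bar> \<le> C" for t x by (rule P_bound[OF _ rm C]) simp
  have m1: "(\<lambda>(t, \<omega>). r (X s (max 0 t) \<omega>)) \<in> borel_measurable (borel \<Otimes>\<^sub>M M)" for s
    using measurable_compose[OF flow_measurable_pair rm] by (simp add: case_prod_beta)
  have V: "V s = (LINT t:{0..}|lborel. exp (- \<beta> * t) * P (max 0 t) r s)" for s
  proof -
    have "V s = (\<integral>\<omega>. (LINT t:{0..}|lborel. exp (- \<beta> * t) * r (X s (max 0 t) \<omega>)) \<partial>M)"
      unfolding V_def value_fun_def
      by (intro Bochner_Integration.integral_cong refl set_lebesgue_integral_cong) auto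
    also have "\<dots> = (LINT t:{0..}|lborel. exp (- \<beta> * t) * (\<integral>\<omega>. r (X s (max 0 t) \<omega>) \<partial>M))"
      by (rule discounted_fubini(1)[OF prob_space_axioms \<beta> m1 C])
    finally show ?thesis by (simp add: P_def)
  qed
  then show "V s = (LINT t:{0..}|lborel. exp (- \<beta> * t) * P (max 0 t) r s)" .
  \<comment> \<open>A point mass has the Borel sigma-algebra, so \<open>discounted_fubini\<close>
    yields Borel measurability of \<open>V\<close> on the whole state space and, read at
    \<open>s\<close>, its bound and integrability.\<close>
  interpret S: prob_space "return borel s :: (real^'d) measure" by (rule prob_space_return) simp
  have m2: "(\<lambda>(t, x). P (max 0 t) r x) \<in> borel_measurable (borel \<Otimes>\<^sub>M return borel s)"
    using P_measurable_pair[OF r C] by (simp cong: measurable_cong_sets sets_pair_measure_cong)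
  note fub = discounted_fubini[OF S.prob_space_axioms \<beta> m2 P']
  show "V \<in> borel_measurable borel"
    unfolding V[abs_def] using fub(2) by simp
  show "\<bar>V s\<bar> \<le> C * (LINT t:{0..}|lborel. exp (- \<beta> * t))"
    unfolding V using fub(4)[of s] by simp
  show "set_integrable lborel {0..} (\<lambda>t. exp (- \<beta> * t) * P (max 0 t) r s)"
    using fub(3)[of s] by simp
  assume \<Delta>: "0 < \<Delta>"
  have m3: "(\<lambda>(t, \<omega>). P (max 0 t) r (X s \<Delta> \<omega>)) \<in> borel_measurable (borel \<Otimes>\<^sub>M M)"
  proof -
    have "(\<lambda>(t, \<omega>). (t, X s \<Delta> \<omega>)) \<in> measurable (borel \<Otimes>\<^sub>M M) (borel \<Otimes>\<^sub>M borel)"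
      unfolding case_prod_beta using flow_measurable[OF less_imp_le[OF \<Delta>], of s]
      by (intro measurable_Pair measurable_compose[OF measurable_snd]) auto
    from measurable_compose[OF this P_measurable_pair[OF r C]] show ?thesis
      by (simp add: case_prod_beta)
  qed
  have "expectation (\<lambda>\<omega>. V (X s \<Delta> \<omega>)) = (LINT t:{0..}|lborel. exp (- \<beta> * t) * (\<integral>\<omega>. P (max 0 t) r (X s \<Delta> \<omega>) \<partial>M))"
    unfolding V by (rule discounted_fubini(1)[OF prob_space_axioms \<beta> m3 P'])
  also have "\<dots> = (LINT t:{0..}|lborel. exp (- \<beta> * t) * P (\<Delta> + max 0 t) r s)"
    using chapman_kolmogorov[OF r C \<Delta>, of "max 0 _" s] by (simp add: P_def[of \<Delta>])
  finally show "expectation (\<lambda>\<omega>. V (X s \<Delta> \<omega>)) = (LINT t:{0..}|lborel. exp (- \<beta> * t) * P (\<Delta> + max 0 t) r s)" .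
qed

text \<open>Cut the time integral at \<Delta> and translate the tail to the origin, which produces
  the discount factor and, through Chapman-Kolmogorov, the expected value at time \<Delta>.\<close>

lemma value_fun_dynamic_programming:
  assumes r: "continuous_on UNIV r" and C: "\<And>x. \<bar>r x\<bar> \<le> C" and \<beta>: "0 < \<beta>" and \<Delta>: "0 < \<Delta>"
  shows "value_fun M X \<beta> r s = (LINT t:{0..<\<Delta>}|lborel. exp (- \<beta> * t) * P (max 0 t) r s)
     + exp (- \<beta> * \<Delta>) * expectation (\<lambda>\<omega>. value_fun M X \<beta> r (X s \<Delta> \<omega>))"
    and "set_integrable lborel {0..<\<Delta>} (\<lambda>t. exp (- \<beta> * t) * P (max 0 t) r s)"
proof -
  let ?f = "\<lambda>t. exp (- \<beta> * t) * P (max 0 t) r s"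
  note i = value_fun_integrable[OF r C \<beta>, of s]
  show i1: "set_integrable lborel {0..<\<Delta>} ?f"
    by (rule set_integrable_subset[OF i]) auto
  have i2: "set_integrable lborel {\<Delta>..} ?f"
    by (rule set_integrable_subset[OF i]) (use \<Delta> in auto)
  have "{0..} = {0..<\<Delta>} \<union> {\<Delta>..}" using \<Delta> by auto
  then have "value_fun M X \<beta> r s = (LINT t:{0..<\<Delta>}|lborel. ?f t) + (LINT t:{\<Delta>..}|lborel. ?f t)"
    unfolding value_fun_eq[OF r C \<beta>] using i1 i2 by (simp only:) (intro set_integral_Un, auto)
  also have "(LINT t:{\<Delta>..}|lborel. ?f t) = (\<integral>t. indicator {\<Delta>..} t * ?f t \<partial>lborel)"
    by (simp add: set_lebesgue_integral_def)
  also have "\<dots> = (\<integral>t. indicator {\<Delta>..} (\<Delta> + 1 * t) * ?f (\<Delta> + 1 * t) \<partial>lborel)"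
    by (subst lborel_integral_real_affine[of 1 _ \<Delta>]) auto
  also have "\<dots> = (\<integral>t. exp (- \<beta> * \<Delta>) * (indicator {0..} t * (exp (- \<beta> * t) * P (\<Delta> + max 0 t) r s)) \<partial>lborel)"
    using \<Delta> by (intro Bochner_Integration.integral_cong refl) (auto simp: indicator_def exp_add[symmetric] algebra_simps max_def)
  also have "\<dots> = exp (- \<beta> * \<Delta>) * (LINT t:{0..}|lborel. exp (- \<beta> * t) * P (\<Delta> + max 0 t) r s)"
    by (simp add: set_lebesgue_integral_def)
  finally show "value_fun M X \<beta> r s = (LINT t:{0..<\<Delta>}|lborel. ?f t)
     + exp (- \<beta> * \<Delta>) * expectation (\<lambda>\<omega>. value_fun M X \<beta> r (X s \<Delta> \<omega>))"
    unfolding value_fun_expectation[OF r C \<beta> \<Delta>] .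
qed

text \<open>At time \<open>t\<close> the integrand deviates from \<open>r s\<close> by at most
  \<open>(G + \<beta> * C) * t\<close>: the state has moved, costing \<open>G * t\<close>, and the
  reward is discounted, costing \<open>\<beta> * C * t\<close>. Integrating \<open>t\<close>
  produces the factor 1/2.\<close>

lemma one_step_error:
  assumes r: "C2_fun r" and C: "\<And>x. \<bar>r x\<bar> \<le> C" and G: "\<And>x. \<bar>gen r x\<bar> \<le> G" and \<beta>: "0 < \<beta>" and \<Delta>: "0 < \<Delta>"
  shows "\<bar>(LINT t:{0..<\<Delta>}|lborel. exp (- \<beta> * t) * P (max 0 t) r s) - r s * \<Delta>\<bar> \<le> 1 / 2 * (G + \<beta> * C) * \<Delta>\<^sup>2"
proof -
  note rc = C2_fun_continuous[OF r]
  have C0: "0 \<le> C" and G0: "0 \<le> G" using order_trans[OF abs_ge_zero C] order_trans[OF abs_ge_zero G] .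
  let ?f = "\<lambda>t. exp (- \<beta> * t) * P (max 0 t) r s"
  note i1 = value_fun_dynamic_programming(2)[OF rc C \<beta> \<Delta>, of s]
  have i2: "set_integrable lborel {0..<\<Delta>} (\<lambda>t. r s)"
    unfolding set_integrable_def using \<Delta> by simp
  have "(LINT t:{0..<\<Delta>}|lborel. r s) = r s * \<Delta>"
    using \<Delta> by (simp add: set_lebesgue_integral_def)
  then have "(LINT t:{0..<\<Delta>}|lborel. ?f t) - r s * \<Delta> = (LINT t:{0..<\<Delta>}|lborel. ?f t - r s)"
    using set_integral_diff(2)[OF i1 i2] by simp
  also have "\<bar>\<dots>\<bar> \<le> (\<integral>t. \<bar>indicator {0..<\<Delta>} t *\<^sub>R (?f t - r s)\<bar> \<partial>lborel)"
    unfolding set_lebesgue_integral_def by (rule integral_abs_bound)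
  also have "\<dots> \<le> (\<integral>t. (G + \<beta> * C) * (t ^ 1 * indicator {0..\<Delta>} t) \<partial>lborel)"
  proof (rule integral_mono)
    show "integrable lborel (\<lambda>t. \<bar>indicator {0..<\<Delta>} t *\<^sub>R (?f t - r s)\<bar>)"
      using set_integral_diff(1)[OF i1 i2] by (simp add: set_integrable_def)
    show "integrable lborel (\<lambda>t. (G + \<beta> * C) * (t ^ 1 * indicator {0..\<Delta>} t))"
      by (intro integrable_mult_right borel_integrable_atLeastAtMost[of 0 \<Delta> "\<lambda>t. t ^ 1", unfolded indicator_def[abs_def, symmetric]]) simp
    fix t :: real
    show "\<bar>indicator {0..<\<Delta>} t *\<^sub>R (?f t - r s)\<bar> \<le> (G + \<beta> * C) * (t ^ 1 * indicator {0..\<Delta>} t)"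
    proof (cases "t \<in> {0..<\<Delta>}")
      case True
      then have t: "0 \<le> t" by simp
      have e: "exp (- \<beta> * t) \<le> 1" "1 - exp (- \<beta> * t) \<le> \<beta> * t"
        using \<beta> t exp_ge_add_one_self[of "- \<beta> * t"] by auto
      have "?f t - r s = exp (- \<beta> * t) * (P t r s - r s) - (1 - exp (- \<beta> * t)) * r s"
        using t by (simp add: algebra_simps max_absorb2)
      also have "\<bar>\<dots>\<bar> \<le> \<bar>exp (- \<beta> * t) * (P t r s - r s)\<bar> + \<bar>(1 - exp (- \<beta> * t)) * r s\<bar>"
        by (rule abs_triangle_ineq4)
      also have "\<dots> = exp (- \<beta> * t) * \<bar>P t r s - r s\<bar> + (1 - exp (- \<beta> * t)) * \<bar>r s\<bar>"
        using e by (simp add: abs_mult)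
      also have "\<dots> \<le> 1 * (t * G) + (\<beta> * t) * C"
        using e C P_diff_le_generator[OF r C G t, of s] \<beta> t G0 by (intro add_mono mult_mono) auto
      finally show ?thesis using True by (simp add: algebra_simps)
    qed (use C0 G0 \<beta> in \<open>auto simp: indicator_def\<close>)
  qed
  also have "\<dots> = (G + \<beta> * C) * (\<Delta>\<^sup>2 / 2)"
    using integral_power[of 0 \<Delta> 1] \<Delta> by (simp add: numeral_2_eq_2)
  finally show ?thesis by (simp add: mult.commute)
qed

text \<open>\<open>V\<close> and \<open>W\<close> satisfy the same equation up to the one-step
  error, so their distance \<open>N\<close> obeys \<open>N \<le> ?d + ?q * N\<close>. Both functions
  are bounded, hence \<open>N\<close> is finite and the inequality can be solved for it.\<close>

lemma value_fun_bellman_error: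
  assumes r: "C2_fun r" and C: "\<And>x. \<bar>r x\<bar> \<le> C" and G: "\<And>x. \<bar>gen r x\<bar> \<le> G" and \<beta>: "0 < \<beta>" and \<Delta>: "0 < \<Delta>"
    and W: "bellman_solution M X \<beta> r \<Delta> W"
  shows "\<bar>value_fun M X \<beta> r s - W s\<bar> \<le> 1 / 2 * (G + \<beta> * C) * \<Delta>\<^sup>2 / (1 - exp (- \<beta> * \<Delta>))"
proof -
  let ?V = "value_fun M X \<beta> r" and ?q = "exp (- \<beta> * \<Delta>)" and ?d = "1 / 2 * (G + \<beta> * C) * \<Delta>\<^sup>2"
  note rc = C2_fun_continuous[OF r]
  have q: "0 < ?q" "?q < 1" using \<beta> \<Delta> by auto
  have Wm: "W \<in> borel_measurable borel" and Wb: "bounded (range W)"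
    and Weq: "\<And>s. W s = r s * \<Delta> + ?q * expectation (\<lambda>\<omega>. W (X s \<Delta> \<omega>))"
    using W unfolding bellman_solution_def by blast+
  obtain w where "\<forall>y\<in>range W. norm y \<le> w" using Wb unfolding bounded_iff by blast
  then have w: "\<bar>W x\<bar> \<le> w" for x by simp
  define v where "v = C * (LINT t:{0..}|lborel. exp (- \<beta> * t))"
  have v: "\<bar>?V x\<bar> \<le> v" for x unfolding v_def by (rule value_fun_bound[OF rc C \<beta>])
  have Vm: "?V \<in> borel_measurable borel" by (rule value_fun_measurable[OF rc C \<beta>])
  have D0: "0 \<le> \<Delta>" using \<Delta> by simp
  define D where "D x = \<bar>?V x - W x\<bar>" for x
  have "bdd_above (range D)"
  proof (rule bdd_aboveI2)
    show "D x \<le> v + w" for x unfolding D_def using v[of x] w[of x] by linarith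
  qed
  define N where "N = (SUP x. D x)"
  have DN: "D x \<le> N" for x unfolding N_def by (rule cSUP_upper) (use \<open>bdd_above (range D)\<close> in auto)
  have step: "D x \<le> ?d + ?q * N" for x
  proof -
    note iV = flow_integrable[OF D0 Vm v, of x] and iW = flow_integrable[OF D0 Wm w, of x]
    let ?I = "LINT t:{0..<\<Delta>}|lborel. exp (- \<beta> * t) * P (max 0 t) r x"
    have "?V x - W x = (?I - r x * \<Delta>) + ?q * (expectation (\<lambda>\<omega>. ?V (X x \<Delta> \<omega>)) - expectation (\<lambda>\<omega>. W (X x \<Delta> \<omega>)))"
      unfolding value_fun_dynamic_programming(1)[OF rc C \<beta> \<Delta>, of x] Weq[of x] by (simp add: right_diff_distrib)
    also have "expectation (\<lambda>\<omega>. ?V (X x \<Delta> \<omega>)) - expectation (\<lambda>\<omega>. W (X x \<Delta> \<omega>)) = expectation (\<lambda>\<omega>. ?V (X x \<Delta> \<omega>) - W (X x \<Delta> \<omega>))"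
      using iV iW by simp
    finally have eq: "?V x - W x = (?I - r x * \<Delta>) + ?q * expectation (\<lambda>\<omega>. ?V (X x \<Delta> \<omega>) - W (X x \<Delta> \<omega>))" .
    have "\<bar>expectation (\<lambda>\<omega>. ?V (X x \<Delta> \<omega>) - W (X x \<Delta> \<omega>))\<bar> \<le> expectation (\<lambda>\<omega>. \<bar>?V (X x \<Delta> \<omega>) - W (X x \<Delta> \<omega>)\<bar>)"
      by (rule integral_abs_bound)
    also have "\<dots> \<le> expectation (\<lambda>\<omega>. N)"
      using iV iW DN unfolding D_def by (intro integral_mono integrable_abs Bochner_Integration.integrable_diff) auto
    finally have "\<bar>expectation (\<lambda>\<omega>. ?V (X x \<Delta> \<omega>) - W (X x \<Delta> \<omega>))\<bar> \<le> N" by (simp add: prob_space)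
    then have "\<bar>?q * expectation (\<lambda>\<omega>. ?V (X x \<Delta> \<omega>) - W (X x \<Delta> \<omega>))\<bar> \<le> ?q * N"
      by (simp add: abs_mult)
    then show ?thesis
      unfolding D_def eq using one_step_error[OF r C G \<beta> \<Delta>, of x] by linarith
  qed
  have "N \<le> ?d + ?q * N" unfolding N_def[symmetric] by (subst (1) N_def, rule cSUP_least) (use step in auto)
  moreover have "N * (1 - ?q) = N - ?q * N" by (simp add: right_diff_distrib mult.commute)
  ultimately have "N * (1 - ?q) \<le> ?d" by linarith
  then have "N \<le> ?d / (1 - ?q)" using q(2) by (intro iffD2[OF pos_le_divide_eq]) linarith+
  then show ?thesis using DN[of s] unfolding D_def by linarith
qed

end

text \<open>Divided by \<open>d\<close>, the first term is \<open>c\<close> over the difference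
  quotient of \<open>1 - exp (- \<beta> * d)\<close>, which tends to \<beta> by the derivative of
  the exponential at 0.\<close>

lemma discount_remainder_smallo:
  assumes "0 < \<beta>"
  shows "(\<lambda>d. c * d\<^sup>2 / (1 - exp (- \<beta> * d)) - c / \<beta> * d) \<in> o[at_right 0](\<lambda>d::real. d)"
proof (rule smalloI_tendsto)
  show "\<forall>\<^sub>F d in at_right 0. (d::real) \<noteq> 0"
    using eventually_at_right_less[of "0::real"] by eventually_elim simp
  let ?g = "\<lambda>d. (exp (- \<beta> * d) - exp (- \<beta> * 0)) / (d - 0)"
  have "((\<lambda>d. exp (- \<beta> * d)) has_real_derivative (- \<beta>)) (at 0)"
    by (auto intro!: derivative_eq_intros)
  then have "(?g \<longlongrightarrow> - \<beta>) (at 0)"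
    unfolding has_field_derivative_iff by simp
  then have "(?g \<longlongrightarrow> - \<beta>) (at_right 0)"
    by (rule filterlim_mono[OF _ order_refl at_le]) simp
  then have "((\<lambda>d. - c / ?g d - c / \<beta>) \<longlongrightarrow> - c / (- \<beta>) - c / \<beta>) (at_right 0)"
    using assms by (intro tendsto_intros) auto
  then have lim: "((\<lambda>d. - c / ?g d - c / \<beta>) \<longlongrightarrow> 0) (at_right 0)" by simp
  show "((\<lambda>d. (c * d\<^sup>2 / (1 - exp (- \<beta> * d)) - c / \<beta> * d) / d) \<longlongrightarrow> 0) (at_right 0)"
  proof (rule Lim_transform_eventually[OF lim])
    show "\<forall>\<^sub>F d in at_right 0. - c / ?g d - c / \<beta> = (c * d\<^sup>2 / (1 - exp (- \<beta> * d)) - c / \<beta> * d) / d"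
      using eventually_at_right_less[of "0::real"]
    proof eventually_elim
      case (elim d)
      define e where "e = 1 - exp (- \<beta> * d)"
      have e: "0 < e" using assms elim by (simp add: e_def)
      have "?g d = - e / d" by (simp add: e_def)
      then have A: "- c / ?g d = c * d / e" by simp
      have B: "(c * d\<^sup>2 / e - c / \<beta> * d) / d = c * d / e - c / \<beta>"
        using elim by (simp add: diff_divide_distrib power2_eq_square)
      show ?case by (simp only: A e_def[symmetric] B)
    qed
  qed
qed

lemma Linf_norm_finite:
  assumes "Linf_norm f < \<infinity>"
  obtains C where "Linf_norm f = ereal C" "\<And>x. \<bar>f x\<bar> \<le> C"
proof -
  have le: "ereal \<bar>f x\<bar> \<le> Linf_norm f" for x
    unfolding Linf_norm_def by (rule SUP_upper) simp
  have "0 \<le> Linf_norm f" using order_trans[OF _ le[of undefined], of 0] by simp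
  with assms obtain C where C: "Linf_norm f = ereal C" by (cases "Linf_norm f") auto
  then show ?thesis using le that by auto
qed

theorem theorem3p1:
  fixes M :: "'w measure"
    and B :: "real \<Rightarrow> 'w \<Rightarrow> real^'d::finite"
    and \<mu> :: "real^'d \<Rightarrow> real^'d"
    and \<sigma> :: "real^'d \<Rightarrow> real^'d^'d"
    and r :: "real^'d \<Rightarrow> real"
    and X :: "real^'d \<Rightarrow> real \<Rightarrow> 'w \<Rightarrow> real^'d"
    and V\<^sub>\<Delta> :: "real \<Rightarrow> real^'d \<Rightarrow> real"
    and \<beta> :: real
  defines "\<Sigma> \<equiv> \<lambda>x. \<sigma> x ** transpose (\<sigma> x)"
  assumes "\<beta> > 0"
    and "\<exists>K. K-lipschitz_on UNIV \<mu>"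
    and "\<exists>K. K-lipschitz_on UNIV \<sigma>"
    and "brownian_motion M B"
    and "\<And>s. strong_solution M B \<mu> \<sigma> s (X s)"
    and "C2_fun r"
    and "Linf_norm r < \<infinity>"
    and "Linf_norm (generator \<mu> \<Sigma> r) < \<infinity>"
    and "\<And>\<Delta>t. \<Delta>t > 0 \<Longrightarrow> bellman_solution M X \<beta> r \<Delta>t (V\<^sub>\<Delta> \<Delta>t)"
  shows "\<exists>R. R \<in> o[at_right 0](\<lambda>\<Delta>t. \<Delta>t) \<and>
           (\<forall>\<^sub>F \<Delta>t in at_right 0.
              Linf_norm (\<lambda>s. value_fun M X \<beta> r s - V\<^sub>\<Delta> \<Delta>t s)
                \<le> ereal (1 / 2) * (Linf_norm (generator \<mu> \<Sigma> r) + ereal \<beta> * Linf_norm r) / ereal \<beta>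
                    * ereal \<Delta>t + ereal (R \<Delta>t))"
proof -
  obtain K1 K2 where K: "K1-lipschitz_on UNIV \<mu>" "K2-lipschitz_on UNIV \<sigma>" using assms by blast
  \<comment> \<open>A single Lipschitz constant for both coefficients, as the locale
    expects.\<close>
  define K where "K = max K1 K2"
  have lip: "K-lipschitz_on UNIV \<mu>" "K-lipschitz_on UNIV \<sigma>"
    using K by (auto intro: lipschitz_on_le simp: K_def)
  interpret sde_flow M B \<mu> \<sigma> K X
    using assms lip by unfold_locales auto
  obtain C where C: "Linf_norm r = ereal C" "\<And>x. \<bar>r x\<bar> \<le> C"
    by (rule Linf_norm_finite[OF assms(8)]) (rule that)
  obtain G where G: "Linf_norm (generator \<mu> \<Sigma> r) = ereal G" "\<And>x. \<bar>generator \<mu> \<Sigma> r x\<bar> \<le> G"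
    by (rule Linf_norm_finite[OF assms(9)]) (rule that)
  define c where "c = 1 / 2 * (G + \<beta> * C)"
  \<comment> \<open>The whole non-asymptotic bound minus its leading term. The inequality therefore
    holds for every positive step, and only the size of \<open>R\<close> is asymptotic.\<close>
  define R where "R d = c * d\<^sup>2 / (1 - exp (- \<beta> * d)) - c / \<beta> * d" for d
  have "Linf_norm (\<lambda>s. value_fun M X \<beta> r s - V\<^sub>\<Delta> d s)
      \<le> ereal (1 / 2) * (Linf_norm (generator \<mu> \<Sigma> r) + ereal \<beta> * Linf_norm r) / ereal \<beta> * ereal d + ereal (R d)"
    if d: "0 < d" for d
  proof -
    have "\<bar>value_fun M X \<beta> r s - V\<^sub>\<Delta> d s\<bar> \<le> c / \<beta> * d + R d" for s
      using value_fun_bellman_error[OF assms(7) C(2) _ assms(2) d assms(10)[OF d], of G s] G(2)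
      by (simp add: R_def c_def \<Sigma>_def)
    then have "Linf_norm (\<lambda>s. value_fun M X \<beta> r s - V\<^sub>\<Delta> d s) \<le> ereal (c / \<beta> * d + R d)"
      unfolding Linf_norm_def by (intro SUP_least) simp
    also have "ereal (c / \<beta> * d + R d) = ereal (1 / 2) * (Linf_norm (generator \<mu> \<Sigma> r) + ereal \<beta> * Linf_norm r) / ereal \<beta> * ereal d + ereal (R d)"
      using assms(2) by (simp add: C(1) G(1) c_def)
    finally show ?thesis .
  qed
  moreover have "R \<in> o[at_right 0](\<lambda>d. d)"
    unfolding R_def[abs_def] using discount_remainder_smallo[OF assms(2)] .
  ultimately show ?thesis
    using eventually_at_right_less[of "0::real"] by (intro exI[of _ R] conjI) (auto elim: eventually_mono)
qed

end
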